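(* There exist an absolute constant $c''>0$ and a function $n\mapsto k(n)$ (with values integers $\ge 2$) satisfying $\log k(n)\asymp\sqrt{\log\log n}$, such that for all sufficiently large $n$, $$M_{k(n)}(n)\ll \exp\Big(-\frac{c''(\log\log n)^{1/4}}{\log\log\log n}\Big)\log n,$$ with an absolute implied constant.
   Context: For integers $n\ge 1$ and $k\ge 2$, a set of distinct positive integers has property $D_k(n)$ if the product of any two distinct elements plus $n$ is the $k$-th power of an integer; $M_k(n)$ is the supremum of the sizes of sets of positive integers with property $D_k(n)$. *)

theory Defs
  imports
    Complex_Main
    "HOL-Library.Landau_Symbols"
    "HOL-Library.Extended_Real"
    "HOL-Computational_Algebra.Nth_Powers"
begin

definition has_property_D :: "nat \<Rightarrow> nat \<Rightarrow> nat set \<Rightarrow> bool" where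
  "has_property_D k n A \<longleftrightarrow>
     (\<forall>a\<in>A. 0 < a) \<and>
     (\<forall>a\<in>A. \<forall>b\<in>A. a \<noteq> b \<longrightarrow> is_nth_power k (int a * int b + int n))"

(* card is 0 on infinite sets, so these are given size infinity explicitly. *)
definition set_size :: "'a set \<Rightarrow> enat" where
  "set_size A = (if finite A then enat (card A) else \<infinity>)"

definition M :: "nat \<Rightarrow> nat \<Rightarrow> enat" where
  "M k n = (SUP A \<in> {A. has_property_D k n A}. set_size A)"

end

theory Submission
  imports
    Defs
    "HOL-Number_Theory.Number_Theory"
    "HOL-Computational_Algebra.Computational_Algebra"
    "HOL-Complex_Analysis.Complex_Analysis"
    "HOL-Probability.Probability"
    "HOL-Real_Asymp.Real_Asymp"
begin

text \<open>
  Put \<open>x = ln (ln n)\<close> and let \<open>k\<close> be a product of about \<open>sqrt x / ln x\<close> primes between \<open>x powr (1 / 4)\<close>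
  and \<open>sqrt x\<close>. By Stepanov's method a set with property \<open>D_k(n)\<close> occupies at most
  \<open>6 sqrt (p / gcd (p - 1, k))\<close> residue classes modulo a prime \<open>p\<close> not dividing \<open>n\<close>, and Gallagher's larger
  sieve turns this into a bound for the number of elements below \<open>n\<close>. The gain over \<open>ln n\<close> comes
  from \<open>sqrt (gcd (p - 1, k))\<close> being large on average: summing over the products \<open>d\<close> of \<open>J\<close> prime factors
  of \<open>k\<close>, with \<open>J\<close> about \<open>x powr (1 / 4) / ln x\<close>, the primes \<open>p = 1 mod d\<close> up to \<open>exp l\<close>, \<open>l\<close> about \<open>2 x\<close>,
  contribute a factor \<open>exp J\<close>. These \<open>d\<close> are as large as \<open>exp (l powr (1 / 4))\<close>. In this range primes are
  equidistributed unless an L-function has a zero very close to the line \<open>Re s = 1\<close>; two such zeros repel each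
  other, so that all bad moduli have a common prime factor, which \<open>k\<close> is chosen to avoid.
  Any four elements \<open>a < b < c < d\<close> that are at least \<open>n\<close> satisfy \<open>d \<ge> b ^ 20\<close>, and for two such gaps the
  \<open>k\<close>-th powers \<open>a C + n\<close>, \<open>b C + n\<close>, \<open>a c + n\<close>, \<open>b c + n\<close> give a rational approximation to a \<open>k\<close>-th root
  that Pade approximation rules out; so at most five elements are that large.
\<close>

section \<open>Dirichlet characters\<close>

text \<open>The exponent 1/4 comes from a balance. With \<open>ln k\<close> of order
  \<open>sqrt x\<close>, the exponent has room for \<open>N\<close>, about
  \<open>sqrt x / ln x\<close>, primes up to \<open>Y = sqrt x\<close>. The average over sets of
  \<open>J\<close> of them gains the factor \<open>(N / (2 J sqrt Y)) ^ J\<close>, which is at least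
  \<open>exp J\<close> only while \<open>J\<close> stays below a multiple of
  \<open>N / sqrt Y\<close>, that is, of \<open>x powr (1 / 4) / ln x\<close>. Every loss in the
  count of primes must stay below this gain, but a loss such as \<open>exp ((ln l) ^ 3)\<close> is
  harmless. Hence Chebyshev's lower bound serves for the principal character, and zeta occurs only
  as a sum of positive terms to the right of 1. The sums over the other characters carry a Gaussian
  weight, whose Mellin integral comes from probability theory. The only input on zeros is their
  repulsion, at arbitrary and possibly different heights. It needs a nonprincipal quotient of two
  characters, and this is why one prime of the conductor of a bad character is enough to separate it
  from all moduli free of that prime.\<close>

lemmas nat_cong_def = unique_euclidean_semiring_class.cong_def

lemma cong_coprime_nat: "[m = n] (mod r) \<Longrightarrow> coprime n r \<Longrightarrow> coprime m (r::nat)"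
  using cong_imp_coprime cong_sym by blast

lemma cong_1_coprime_nat: "[n = 1] (mod r) \<Longrightarrow> coprime n (r::nat)"
  by (erule cong_coprime_nat) simp

lemma coprime_add_self_nat: "coprime (n + r) r \<longleftrightarrow> coprime n (r::nat)"
  unfolding coprime_iff_gcd_eq_1 by (rule arg_cong[where f = "\<lambda>x. x = 1"]) (rule gcd_add1)

text \<open>All characters to the modulus \<open>r\<close>, imprimitive ones included. The value at
  \<open>0\<close> is \<open>1\<close> for \<open>r = 1\<close> and \<open>0\<close> for every other
  modulus.\<close>

definition dchar :: "nat \<Rightarrow> (nat \<Rightarrow> complex) \<Rightarrow> bool" where
  "dchar r \<theta> \<longleftrightarrow> r > 0 \<and> (\<forall>m n. \<theta> (m * n) = \<theta> m * \<theta> n) \<and> (\<forall>n. \<theta> (n + r) = \<theta> n) \<and> \<theta> 1 = 1 \<and>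
     (\<forall>n. norm (\<theta> n) \<le> 1) \<and> (\<forall>n. \<not> coprime n r \<longrightarrow> \<theta> n = 0)"

definition nonprincipal :: "nat \<Rightarrow> (nat \<Rightarrow> complex) \<Rightarrow> bool" where
  "nonprincipal r \<theta> \<longleftrightarrow> (\<exists>n. coprime n r \<and> \<theta> n \<noteq> 1)"

lemma dcharD:
  assumes "dchar r \<theta>"
  shows "r > 0" "\<theta> (m * n) = \<theta> m * \<theta> n" "\<theta> (n + r) = \<theta> n" "\<theta> (Suc 0) = 1" "norm (\<theta> n) \<le> 1"
    "\<not> coprime n r \<Longrightarrow> \<theta> n = 0"
  using assms unfolding dchar_def by auto

lemma dchar_add_mult: "dchar r \<theta> \<Longrightarrow> \<theta> (n + r * i) = \<theta> n"
proof (induction i)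
  case (Suc i)
  then show ?case using dcharD(3)[of r \<theta> "n + r * i"] by (simp add: algebra_simps)
qed simp

lemma dchar_mod: "dchar r \<theta> \<Longrightarrow> \<theta> (n mod r) = \<theta> n"
  using dchar_add_mult[of r \<theta> "n mod r" "n div r"] by simp

lemma dchar_cong: "dchar r \<theta> \<Longrightarrow> [m = n] (mod r) \<Longrightarrow> \<theta> m = \<theta> n"
  by (metis dchar_mod nat_cong_def)

lemma dchar_nonzero:
  assumes "dchar r \<theta>" "coprime n r"
  shows "\<theta> n \<noteq> 0"
proof -
  have pw: "\<theta> (n ^ i) = \<theta> n ^ i" for i
    using dcharD[OF assms(1)] by (induction i) auto
  have "[n ^ totient r = 1] (mod r)" using assms(2) by (rule euler_theorem)
  then have "\<theta> n ^ totient r = 1" using dchar_cong[OF assms(1)] pw[of "totient r"] dcharD(4)[OF assms(1)] by auto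
  moreover have "totient r > 0" using dcharD(1)[OF assms(1)] by simp
  ultimately show ?thesis by (auto simp: power_0_left)
qed

lemma dchar_mult:
  assumes "dchar r \<theta>" "dchar s \<psi>"
  shows "dchar (r * s) (\<lambda>n. \<theta> n * \<psi> n)"
proof -
  have "\<theta> (n + r * s) = \<theta> n" "\<psi> (n + r * s) = \<psi> n" for n
    using dchar_add_mult[OF assms(1), of n s] dchar_add_mult[OF assms(2), of n r] by (auto simp: mult.commute)
  then show ?thesis using dcharD[OF assms(1)] dcharD[OF assms(2)]
    unfolding dchar_def by (auto simp: norm_mult mult_le_one coprime_mult_right_iff)
qed

lemma dchar_cnj: "dchar r \<theta> \<Longrightarrow> dchar r (\<lambda>n. cnj (\<theta> n))"
  unfolding dchar_def by auto

lemma dchar_one: "dchar (Suc 0) (\<lambda>_. 1)"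
  unfolding dchar_def by auto

lemma dchar_sum_period:
  assumes \<theta>: "dchar r \<theta>" and np: "nonprincipal r \<theta>"
  shows "(\<Sum>n<r. \<theta> n) = 0"
proof -
  obtain a where a: "coprime a r" "\<theta> a \<noteq> 1" using np by (auto simp: nonprincipal_def)
  have r: "r > 0" using dcharD(1)[OF \<theta>] .
  have inj: "inj_on (\<lambda>n. a * n mod r) {..<r}"
  proof (rule inj_onI)
    fix x y assume xy: "x \<in> {..<r}" "y \<in> {..<r}" "a * x mod r = a * y mod r"
    then have "[a * x = a * y] (mod r)" by (simp add: nat_cong_def)
    then have "[x = y] (mod r)" using a(1) by (simp add: cong_mult_lcancel_nat)
    then show "x = y" using xy by (simp add: nat_cong_def)
  qed
  have "bij_betw (\<lambda>n. a * n mod r) {..<r} {..<r}"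
    using inj r by (intro bij_betw_imageI endo_inj_surj) auto
  then have "(\<Sum>n<r. \<theta> n) = (\<Sum>n<r. \<theta> (a * n mod r))"
    by (intro sum.reindex_bij_betw[symmetric])
  also have "\<dots> = \<theta> a * (\<Sum>n<r. \<theta> n)"
    using dchar_mod[OF \<theta>] dcharD(2)[OF \<theta>] by (simp add: sum_distrib_left)
  finally have "(1 - \<theta> a) * (\<Sum>n<r. \<theta> n) = 0" by (simp add: algebra_simps)
  then show ?thesis using a by simp
qed

text \<open>Complete periods cancel and one incomplete period remains. The size of this bound
  matters later only through its logarithm.\<close>

lemma dchar_partial_sum_bound:
  assumes \<theta>: "dchar r \<theta>" and np: "nonprincipal r \<theta>"
  shows "norm (\<Sum>n<N. \<theta> n) \<le> real r"
proof (induction N rule: less_induct)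
  case (less N)
  show ?case
  proof (cases "N < r")
    case True
    have "norm (\<Sum>n<N. \<theta> n) \<le> (\<Sum>n<N. 1)" using dcharD(5)[OF \<theta>] by (intro sum_norm_le) auto
    then show ?thesis using True by simp
  next
    case False
    then obtain K where K: "N = r + K" using le_Suc_ex not_less by blast
    have "(\<Sum>n<N. \<theta> n) = (\<Sum>n<r. \<theta> n) + (\<Sum>n<K. \<theta> (n + r))"
      unfolding K by (induction K) (auto simp: add_ac)
    also have "\<dots> = (\<Sum>n<K. \<theta> n)" using dchar_sum_period[OF assms] dcharD(3)[OF \<theta>] by simp
    finally show ?thesis using less[of K] K dcharD(1)[OF \<theta>] by simp
  qed
qed

section \<open>Characters to squarefree moduli\<close>

text \<open>The discrete logarithm \<open>ind\<close> to a primitive root turns roots of unity of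
  order dividing \<open>q - 1\<close> into characters. A list together with its length, rather than
  a set and its cardinality, lets the next lemma multiply characters for different primes without
  showing that the products are distinct.\<close>

lemma prime_modulus_characters:
  fixes q :: nat
  assumes q: "prime q"
  obtains xs where "\<forall>\<theta>\<in>set xs. dchar q \<theta>" "length xs \<le> q" "(\<lambda>n. if coprime n q then 1 else 0) \<in> set xs"
    "\<And>n. (\<Sum>\<theta>\<leftarrow>xs. \<theta> n) = (if [n = 1] (mod q) then of_nat (length xs) else 0)"
proof -
  define M where "M = q - 1"
  have q2: "q \<ge> 2" using q by (simp add: prime_ge_2_nat)
  then have M: "M \<ge> 1" by (simp add: M_def)
  obtain g where g: "residue_primroot q g" using prime_primitive_root_exists[OF _ q] q2 by auto
  have og: "ord q g = M" and cg: "coprime q g"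
    using g q by (auto simp: residue_primroot_def totient_prime M_def)
  have bij: "bij_betw (\<lambda>i. g ^ i mod q) {..<M} (totatives q)"
    using residue_primroot_is_generator[of q g] g q q2 by (simp add: totient_prime M_def)
  have ex: "\<exists>i<M. [g ^ i = n] (mod q)" if "coprime n q" for n
  proof -
    have "coprime (n mod q) q" using that q2 by (subst coprime_mod_left_iff) auto
    moreover from this have "n mod q > 0" using q2 by (cases "n mod q = 0") auto
    ultimately have "n mod q \<in> totatives q" using q2 by (auto simp: totatives_def intro: less_imp_le)
    then obtain i where "i < M" "g ^ i mod q = n mod q" using bij unfolding bij_betw_def by force
    then show ?thesis by (auto simp: nat_cong_def)
  qed
  define ind where "ind n = (SOME i. i < M \<and> [g ^ i = n] (mod q))" for n
  have ind: "ind n < M" "[g ^ ind n = n] (mod q)" if "coprime n q" for n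
    using someI_ex[OF ex[OF that]] unfolding ind_def by auto
  have pcong: "[g ^ i = g ^ j] (mod q) \<longleftrightarrow> [i = j] (mod M)" for i j
    using order_divides_expdiff[OF cg, of i j] og by simp
  define E where "E i = exp (2 * of_real pi * \<i> * of_nat i / of_nat M)" for i
  have E_eq: "E i = E j \<longleftrightarrow> [i = j] (mod M)" for i j
    unfolding E_def using complex_root_unity_eq[OF M, of i j] by (simp add: nat_cong_def)
  have E_add: "E (i + j) = E i * E j" for i j
    unfolding E_def by (simp add: exp_add[symmetric] add_divide_distrib algebra_simps)
  have E_mult: "E (i * j) = E i ^ j" for i j
    unfolding E_def by (simp add: exp_of_nat_mult[symmetric] algebra_simps)
  have E0: "E 0 = 1" by (simp add: E_def)
  have E_norm: "norm (E i) = 1" for i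
    unfolding E_def by (simp add: norm_exp_eq_Re)
  define X where "X j n = (if coprime n q then E (j * ind n) else 0)" for j n
  have ind_add: "[ind (m * n) = ind m + ind n] (mod M)" if "coprime m q" "coprime n q" for m n
  proof -
    have "[g ^ (ind m + ind n) = m * n] (mod q)"
      unfolding power_add using ind that by (intro cong_mult)
    moreover have "[g ^ ind (m * n) = m * n] (mod q)" using that by (intro ind) simp
    ultimately show ?thesis using pcong cong_sym cong_trans by blast
  qed
  have ind_cong: "ind m = ind n" if "[m = n] (mod q)" for m n
    
  proof -
    have "[g ^ i = m] (mod q) \<longleftrightarrow> [g ^ i = n] (mod q)" for i
      using that cong_sym cong_trans by blast
    then show ?thesis unfolding ind_def by simp
  qed
  have ind1: "ind 1 = 0"
  proof -
    have "[g ^ ind 1 = g ^ 0] (mod q)" using ind(2)[of 1] by simp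
    then have "[ind 1 = 0] (mod M)" using pcong by blast
    then show ?thesis using ind(1)[of 1] by (simp add: nat_cong_def)
  qed
  have dch: "dchar q (X j)" for j
    unfolding dchar_def
  proof (intro conjI allI impI)
    fix m n
    show "X j (m * n) = X j m * X j n"
    proof (cases "coprime m q \<and> coprime n q")
      case True
      then have "[j * ind (m * n) = j * (ind m + ind n)] (mod M)" by (intro cong_mult cong_refl ind_add) auto
      then show ?thesis using True by (simp add: X_def E_eq[symmetric] E_add[symmetric] distrib_left)
    qed (auto simp: X_def)
    show "X j (n + q) = X j n"
      using ind_cong[of "n + q" n] by (simp add: X_def nat_cong_def coprime_add_self_nat)
    show "X j 1 = 1" using ind1 by (simp add: X_def E0)
    show "norm (X j n) \<le> 1" by (simp add: X_def E_norm)
  qed (use q2 in \<open>auto simp: X_def\<close>)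
  define xs where "xs = map X [0..<M]"
  have len: "length xs = M" by (simp add: xs_def)
  show ?thesis
  proof (rule that[of xs])
    show "\<forall>\<theta>\<in>set xs. dchar q \<theta>" using dch by (auto simp: xs_def)
    show "length xs \<le> q" by (simp add: len M_def)
    have "X 0 = (\<lambda>n. if coprime n q then 1 else 0)" by (auto simp: X_def E0)
    then show "(\<lambda>n. if coprime n q then 1 else 0) \<in> set xs" using M unfolding xs_def by (auto intro!: rev_image_eqI[of 0])
    fix n
    have e: "(\<Sum>\<theta>\<leftarrow>xs. \<theta> n) = (\<Sum>j<M. X j n)"
      by (simp add: xs_def o_def interv_sum_list_conv_sum_set_nat atLeast0LessThan)
    show "(\<Sum>\<theta>\<leftarrow>xs. \<theta> n) = (if [n = 1] (mod q) then of_nat (length xs) else 0)"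
    proof (cases "coprime n q")
      case False
      have "\<not> [n = 1] (mod q)" using False using cong_1_coprime_nat by blast
      then show ?thesis unfolding e using False by (simp add: X_def)
    next
      case True
      have "(\<Sum>j<M. X j n) = (\<Sum>j<M. E (ind n) ^ j)"
        using True by (simp add: X_def E_mult[symmetric] mult.commute)
      also have "\<dots> = (if [n = 1] (mod q) then of_nat M else 0)"
      proof (cases "[n = 1] (mod q)")
        case True
        then have "ind n = 0" using ind_cong ind1 by simp
        then show ?thesis using True by (simp add: E0)
      next
        case False
        have "ind n \<noteq> 0" 
        proof
          assume "ind n = 0"
          then show False using ind(2)[OF True] False cong_sym by fastforce
        qed
        then have "\<not> [ind n = 0] (mod M)" using ind(1)[OF True] by (simp add: nat_cong_def)
        then have "E (ind n) \<noteq> 1" using E_eq[of "ind n" 0] E0 by simp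
        moreover have "E (ind n) ^ M = 1"
          using E_eq[of "ind n * M" 0] by (simp add: E_mult[symmetric] E0 nat_cong_def)
        ultimately show ?thesis using False by (simp add: geometric_sum)
      qed
      finally show ?thesis unfolding e len .
    qed
  qed
qed

lemma dchar_list_exists:
  fixes P :: "nat set"
  assumes "finite P" "\<And>p. p \<in> P \<Longrightarrow> prime p"
  shows "\<exists>xs. (\<forall>\<theta>\<in>set xs. dchar (\<Prod>P) \<theta>) \<and> length xs \<le> \<Prod>P \<and>
     (\<lambda>n. if coprime n (\<Prod>P) then 1 else 0) \<in> set xs \<and>
     (\<forall>n. (\<Sum>\<theta>\<leftarrow>xs. \<theta> n) = (if [n = 1] (mod \<Prod>P) then of_nat (length xs) else 0))"
  using assms
proof (induction P rule: finite_induct)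
  case empty
  show ?case by (rule exI[of _ "[\<lambda>_. 1]"]) (auto simp: dchar_one)
next
  case (insert q P)
  then obtain xs where xs: "\<forall>\<theta>\<in>set xs. dchar (\<Prod>P) \<theta>" "length xs \<le> \<Prod>P"
     "(\<lambda>n. if coprime n (\<Prod>P) then 1 else 0) \<in> set xs"
     "\<And>n. (\<Sum>\<theta>\<leftarrow>xs. \<theta> n) = (if [n = 1] (mod \<Prod>P) then of_nat (length xs) else 0)"
    by blast
  obtain ys where ys: "\<forall>\<theta>\<in>set ys. dchar q \<theta>" "length ys \<le> q"
     "(\<lambda>n. if coprime n q then 1 else 0) \<in> set ys"
     "\<And>n. (\<Sum>\<theta>\<leftarrow>ys. \<theta> n) = (if [n = 1] (mod q) then of_nat (length ys) else 0)"
    using prime_modulus_characters[of q] insert.prems by auto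
  have pq: "\<Prod>(insert q P) = q * \<Prod>P" using insert by simp
  have cop: "coprime q (\<Prod>P)"
    using insert by (intro prod_coprime_right) (auto intro: primes_coprime)
  define zs where "zs = concat (map (\<lambda>\<psi>. map (\<lambda>\<theta> n. \<psi> n * \<theta> n) xs) ys)"
  have len: "length zs = length ys * length xs"
    by (simp add: zs_def length_concat o_def sum_list_triv)
  show ?case
  proof (intro exI[of _ zs] conjI allI)
    show "\<forall>\<theta>\<in>set zs. dchar (\<Prod>(insert q P)) \<theta>"
      using xs(1) ys(1) unfolding pq by (auto simp: zs_def intro!: dchar_mult)
    show "length zs \<le> \<Prod>(insert q P)" unfolding len pq using xs(2) ys(2) by (rule mult_le_mono[rotated])
    have "(\<lambda>n. if coprime n (\<Prod>(insert q P)) then 1 else 0 :: complex)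
       = (\<lambda>n. (if coprime n q then 1 else 0) * (if coprime n (\<Prod>P) then 1 else 0))"
      unfolding pq by auto
    then show "(\<lambda>n. if coprime n (\<Prod>(insert q P)) then 1 else 0) \<in> set zs"
      using xs(3) ys(3) unfolding zs_def by auto
    fix n
    have "(\<Sum>\<theta>\<leftarrow>zs. \<theta> n) = (\<Sum>\<psi>\<leftarrow>ys. \<psi> n) * (\<Sum>\<theta>\<leftarrow>xs. \<theta> n)"
      unfolding zs_def by (induction ys) (auto simp: o_def sum_list_const_mult distrib_right)
    also have "\<dots> = (if [n = 1] (mod \<Prod>(insert q P)) then of_nat (length zs) else 0)"
    proof -
      have "[n = 1] (mod q * \<Prod>P) \<longleftrightarrow> [n = 1] (mod q) \<and> [n = 1] (mod \<Prod>P)"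
        using cop cong_modulus_mult_nat[of n 1 q "\<Prod>P"] cong_modulus_mult_nat[of n 1 "\<Prod>P" q]
          coprime_cong_mult_nat[of n 1 q "\<Prod>P"] by (auto simp: mult.commute)
      then show ?thesis unfolding xs(4) ys(4) pq len by simp
    qed
    finally show "(\<Sum>\<theta>\<leftarrow>zs. \<theta> n) = (if [n = 1] (mod \<Prod>(insert q P)) then of_nat (length zs) else 0)" .
  qed
qed

text \<open>By the Chinese remainder theorem a character to a squarefree modulus is a product of
  characters to prime moduli, and one of these is nontrivial. The element \<open>a\<close> detects
  that component. The proof goes through the conductor, so the factorization itself is never
  constructed.\<close>

lemma dchar_component_exists:
  fixes P :: "nat set"
  assumes P: "finite P" "\<And>p. p \<in> P \<Longrightarrow> prime p"
    and \<theta>: "dchar (\<Prod>P) \<theta>" and np: "nonprincipal (\<Prod>P) \<theta>"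
  shows "\<exists>q\<in>P. \<exists>a. coprime a (\<Prod>P) \<and> [a = 1] (mod \<Prod>(P - {q})) \<and> \<theta> a \<noteq> 1"
proof -
  \<comment> \<open>\<open>Z D\<close> says that \<open>\<theta>\<close> is induced from the modulus
    \<open>\<Prod>D\<close>. The smallest such \<open>D\<close> consists of the primes of the
    conductor, and any of them can serve as \<open>q\<close>.\<close>
  define Z where "Z D \<longleftrightarrow> D \<subseteq> P \<and> (\<forall>a. coprime a (\<Prod>P) \<longrightarrow> [a = 1] (mod \<Prod>D) \<longrightarrow> \<theta> a = 1)" for D
  have "Z P" unfolding Z_def using dchar_cong[OF \<theta>, of _ 1] dcharD(4)[OF \<theta>] by auto
  then obtain D where D: "Z D" and min: "\<And>D'. Z D' \<Longrightarrow> card D \<le> card D'"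
    using ex_has_least_nat[of Z P card] by auto
  have Dsub: "D \<subseteq> P" and finD: "finite D" using D P(1) finite_subset unfolding Z_def by auto
  have "\<not> Z {}" using np unfolding Z_def nonprincipal_def by auto
  then have "D \<noteq> {}" using D by metis
  then obtain q where q: "q \<in> D" by blast
  have "\<not> Z (D - {q})" using min[of "D - {q}"] card_Diff1_less[OF finD q] by auto
  then obtain a where a: "coprime a (\<Prod>P)" "[a = 1] (mod \<Prod>(D - {q}))" "\<theta> a \<noteq> 1"
    using Dsub unfolding Z_def by auto
  have qP: "q \<in> P" using q Dsub by auto
  \<comment> \<open>The witness found for \<open>D - {q}\<close> is moved to an \<open>n\<close>
    that is \<open>1\<close> modulo all of \<open>P - {q}\<close>. Both agree modulo
    \<open>\<Prod>D\<close>, and this determines the value of \<open>\<theta>\<close>.\<close>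
  have cop: "coprime q (\<Prod>(P - {q}))"
    using P qP by (intro prod_coprime_right) (auto intro: primes_coprime)
  then obtain n where n: "[n = a] (mod q)" "[n = 1] (mod \<Prod>(P - {q}))"
    using binary_chinese_remainder_nat by blast
  have PP: "\<Prod>P = q * \<Prod>(P - {q})" using P(1) qP by (rule prod.remove)
  have DD: "\<Prod>D = q * \<Prod>(D - {q})" using finD q by (rule prod.remove)
  have dv: "\<Prod>(D - {q}) dvd \<Prod>(P - {q})" using P Dsub by (intro prod_dvd_prod_subset) auto
  have "coprime a q" using a(1) unfolding PP by simp
  then have "coprime n q" using n(1) using cong_coprime_nat cong_sym by blast
  moreover have "coprime n (\<Prod>(P - {q}))" using n(2) using cong_1_coprime_nat by blast
  ultimately have cn: "coprime n (\<Prod>P)" unfolding PP by simp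
  have "[n = 1] (mod \<Prod>(D - {q}))" using n(2) dv by (rule cong_dvd_modulus_nat)
  then have "[n = a] (mod \<Prod>(D - {q}))" using a(2) cong_sym cong_trans by blast
  moreover have "coprime q (\<Prod>(D - {q}))" using dv cop by (rule coprime_divisors[OF dvd_refl])
  ultimately have na: "[n = a] (mod \<Prod>D)" unfolding DD using n(1) by (intro coprime_cong_mult_nat)
  have "coprime a (\<Prod>P)" by fact
  then obtain b where b: "[a * b = 1] (mod \<Prod>P)" using cong_solve_coprime_nat[of a "\<Prod>P"] by auto
  have DP: "\<Prod>D dvd \<Prod>P" using P Dsub by (intro prod_dvd_prod_subset) auto
  have cb: "coprime b (\<Prod>P)" using b using cong_1_coprime_nat coprime_mult_left_iff by blast
  have "[n * b = a * b] (mod \<Prod>D)" using na by (intro cong_mult cong_refl)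
  then have "[n * b = 1] (mod \<Prod>D)" using b DP cong_dvd_modulus_nat cong_trans by blast
  then have "\<theta> (n * b) = 1" using D cn cb unfolding Z_def by auto
  moreover have "\<theta> (a * b) = 1" using dchar_cong[OF \<theta> b] dcharD(4)[OF \<theta>] by simp
  ultimately have "\<theta> n * \<theta> b = \<theta> a * \<theta> b" using dcharD(2)[OF \<theta>] by simp
  then have "\<theta> n = \<theta> a" using dchar_nonzero[OF \<theta> cb] by simp
  then show ?thesis using qP cn n(2) a(3) by (intro bexI[of _ q] exI[of _ n] conjI) auto
qed

text \<open>A residue that equals \<open>a\<close> modulo \<open>q\<close> and \<open>1\<close>
  modulo all other primes is seen by \<open>\<theta>\<close> but not by \<open>\<psi>\<close>. This
  supplies the hypothesis on the quotient in \<open>zero_repulsion\<close>.\<close>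

lemma nonprincipal_quotient:
  fixes P P' :: "nat set"
  assumes P: "finite P" "\<And>p. p \<in> P \<Longrightarrow> prime p" and P': "finite P'" "\<And>p. p \<in> P' \<Longrightarrow> prime p"
    and \<theta>: "dchar (\<Prod>P) \<theta>" and \<psi>: "dchar (\<Prod>P') \<psi>"
    and q: "q \<in> P" "q \<notin> P'" and a: "coprime a (\<Prod>P)" "[a = 1] (mod \<Prod>(P - {q}))" "\<theta> a \<noteq> 1"
  shows "nonprincipal (\<Prod>P * \<Prod>P') (\<lambda>n. \<theta> n * cnj (\<psi> n))"
proof -
  let ?R = "P \<union> P' - {q}"
  have cop: "coprime q (\<Prod>?R)"
    using P P' q by (intro prod_coprime_right) (auto intro: primes_coprime)
  then obtain n where n: "[n = a] (mod q)" "[n = 1] (mod \<Prod>?R)"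
    using binary_chinese_remainder_nat by blast
  have PP: "\<Prod>P = q * \<Prod>(P - {q})" using P(1) q(1) by (rule prod.remove)
  have d1: "\<Prod>(P - {q}) dvd \<Prod>?R" using P P' by (intro prod_dvd_prod_subset) auto
  have d2: "\<Prod>P' dvd \<Prod>?R" using P P' q by (intro prod_dvd_prod_subset) auto
  have "[n = 1] (mod \<Prod>(P - {q}))" using n(2) d1 by (rule cong_dvd_modulus_nat)
  then have "[n = a] (mod \<Prod>(P - {q}))" using a(2) cong_sym cong_trans by blast
  moreover have "coprime q (\<Prod>(P - {q}))" using d1 cop by (rule coprime_divisors[OF dvd_refl])
  ultimately have na: "[n = a] (mod \<Prod>P)" unfolding PP using n(1) by (intro coprime_cong_mult_nat)
  have n1: "[n = 1] (mod \<Prod>P')" using n(2) d2 by (rule cong_dvd_modulus_nat)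
  have "coprime n (\<Prod>P)" using na a(1) using cong_coprime_nat cong_sym by blast
  moreover have "coprime n (\<Prod>P')" using n1 using cong_1_coprime_nat by blast
  moreover have "\<theta> n = \<theta> a" by (rule dchar_cong[OF \<theta> na])
  moreover have "\<psi> n = 1" using dchar_cong[OF \<psi> n1] dcharD(4)[OF \<psi>] by simp
  ultimately show ?thesis unfolding nonprincipal_def using a(3) by (intro exI[of _ n]) auto
qed

section \<open>L-functions\<close>

text \<open>The factor \<open>n\<close> to the power \<open>- s\<close>, written with the real
  logarithm so that it is visibly entire in \<open>s\<close>.\<close>

definition dz :: "nat \<Rightarrow> complex \<Rightarrow> complex" where
  "dz n s = exp (- (s * of_real (ln (real n))))"

lemma norm_dz: "n > 0 \<Longrightarrow> norm (dz n s) = real n powr (- Re s)"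
  by (simp add: dz_def norm_exp_eq_Re powr_def)

lemma dz_mult: "m > 0 \<Longrightarrow> n > 0 \<Longrightarrow> dz (m * n) s = dz m s * dz n s"
  by (simp add: dz_def ln_mult exp_add[symmetric] algebra_simps)

lemma dz_has_field_derivative:
  "((\<lambda>s. dz n s) has_field_derivative (- (of_real (ln (real n)) * dz n s))) (at s)"
  unfolding dz_def by (auto intro!: derivative_eq_intros)

text \<open>Mean value inequality in the variable \<open>n\<close>: the derivative of
  \<open>z\<close> to the power \<open>- s\<close> is bounded along the segment from
  \<open>n\<close> to \<open>n + 1\<close>.\<close>

lemma norm_dz_diff_le:
  assumes "n > 0" "Re s > 0"
  shows "norm (dz n s - dz (Suc n) s) \<le> norm s * real n powr (- Re s - 1)"
proof -
  define f where "f z = exp (- (s * Ln z))" for z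
  define S where "S = closed_segment (of_nat n) (of_nat (Suc n) :: complex)"
  have S: "\<exists>x. z = of_real x \<and> real n \<le> x" if z: "z \<in> S" for z
  proof -
    obtain u where u: "0 \<le> u" "u \<le> 1" "z = (1 - u) *\<^sub>R of_nat n + u *\<^sub>R of_nat (Suc n)"
      using z unfolding S_def in_segment by blast
    have "z = of_real (real n + u)" unfolding u by (simp add: complex_eq_iff algebra_simps)
    then show ?thesis using u by (intro exI[of _ "real n + u"]) auto
  qed
  have "norm (f (of_nat n) - f (of_nat (Suc n))) \<le> norm s * real n powr (- Re s - 1) * norm (of_nat n - of_nat (Suc n) :: complex)"
  proof (rule field_differentiable_bound[where S = S and f' = "\<lambda>z. - (s / z) * f z"])
    show "convex S" by (simp add: S_def)
    show "of_nat n \<in> S" "of_nat (Suc n) \<in> S" by (auto simp: S_def)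
    fix z assume "z \<in> S"
    then obtain x where x: "z = of_real x" "real n \<le> x" using S by blast
    then have xp: "x > 0" using assms by linarith
    then have "z \<notin> \<real>\<^sub>\<le>\<^sub>0" by (simp add: x)
    then show "(f has_field_derivative - (s / z) * f z) (at z within S)"
      unfolding f_def by (auto intro!: derivative_eq_intros simp: field_simps)
    have "norm (- (s / z) * f z) = norm s / x * x powr (- Re s)"
      using xp by (simp add: x f_def norm_mult norm_divide norm_exp_eq_Re Ln_of_real powr_def)
    also have "\<dots> = norm s * x powr (- Re s - 1)"
      using xp by (simp add: powr_diff)
    also have "\<dots> \<le> norm s * real n powr (- Re s - 1)"
      using assms x by (intro mult_left_mono powr_mono2') auto
    finally show "norm (- (s / z) * f z) \<le> norm s * real n powr (- Re s - 1)" .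
  qed
  moreover have "f (of_nat m) = dz m s" if "m > 0" for m
    using that Ln_of_real[of "real m"] unfolding f_def dz_def by simp
  ultimately show ?thesis using assms by (simp flip: of_nat_Suc del: of_nat_Suc) (simp add: norm_minus_commute)
qed

text \<open>For \<open>a > 1\<close> the value of the Riemann zeta function at
  \<open>a\<close>.\<close>

definition zsum :: "real \<Rightarrow> real" where
  "zsum a = (\<Sum>n. real (Suc n) powr (- a))"

lemma zsum_summable: "a > 1 \<Longrightarrow> summable (\<lambda>n. real (Suc n) powr (- a))"
  using summable_real_powr_iff[of "- a"] by (subst summable_Suc_iff) simp

definition csum :: "(nat \<Rightarrow> complex) \<Rightarrow> nat \<Rightarrow> complex" where
  "csum f N = (\<Sum>n<Suc N. f n)"

text \<open>Abel summation: for nonprincipal characters the series of the \<open>Lterm\<close> converges for \<open>Re s > 0\<close>.\<close>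

definition Lterm :: "(nat \<Rightarrow> complex) \<Rightarrow> nat \<Rightarrow> complex \<Rightarrow> complex" where
  "Lterm f n s = csum f (Suc n) * (dz (Suc n) s - dz (Suc (Suc n)) s)"

definition Lfun :: "(nat \<Rightarrow> complex) \<Rightarrow> complex \<Rightarrow> complex" where
  "Lfun f s = (\<Sum>n. Lterm f n s)"

lemma norm_Lterm_le:
  assumes "dchar r \<theta>" "nonprincipal r \<theta>" "Re s > 0"
  shows "norm (Lterm \<theta> n s) \<le> real r * norm s * real (Suc n) powr (- (Re s + 1))"
proof -
  have "norm (Lterm \<theta> n s) \<le> real r * (norm s * real (Suc n) powr (- Re s - 1))"
    unfolding Lterm_def norm_mult csum_def using assms
    by (intro mult_mono norm_dz_diff_le dchar_partial_sum_bound) auto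
  then show ?thesis by (simp add: mult.assoc)
qed

lemma Lfun_summable:
  assumes "dchar r \<theta>" "nonprincipal r \<theta>" "Re s > 0"
  shows "summable (\<lambda>n. Lterm \<theta> n s)"
  by (rule summable_comparison_test'[OF summable_mult[OF zsum_summable[of "Re s + 1"]] norm_Lterm_le[OF assms]])
     (use assms in auto)

text \<open>The terms decay like \<open>n powr (- (Re s + 1))\<close> after Abel summation. A bound
  polynomial in \<open>r\<close> and \<open>norm s\<close> is what the logarithmic estimates of
  Borel-Caratheodory type call for.\<close>

lemma norm_Lfun_le:
  assumes "dchar r \<theta>" "nonprincipal r \<theta>" "Re s \<ge> 1 / 2"
  shows "norm (Lfun \<theta> s) \<le> real r * norm s * zsum (3 / 2)"
proof -
  have sm: "summable (\<lambda>n. real (Suc n) powr (- (3 / 2)))" by (rule zsum_summable) simp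
  have "norm (Lterm \<theta> n s) \<le> real r * norm s * real (Suc n) powr (- (3 / 2))" for n
  proof -
    have "norm (Lterm \<theta> n s) \<le> real r * norm s * real (Suc n) powr (- (Re s + 1))"
      by (rule norm_Lterm_le) (use assms in auto)
    also have "\<dots> \<le> real r * norm s * real (Suc n) powr (- (3 / 2))"
      using assms by (intro mult_left_mono powr_mono) auto
    finally show ?thesis .
  qed
  then have "norm (Lfun \<theta> s) \<le> (\<Sum>n. real r * norm s * real (Suc n) powr (- (3 / 2)))"
    unfolding Lfun_def by (rule norm_suminf_le) (rule summable_mult[OF sm])
  also have "\<dots> = real r * norm s * zsum (3 / 2)"
    unfolding zsum_def by (rule suminf_mult[OF sm])
  finally show ?thesis .
qed

lemma Lfun_holomorphic:
  assumes "dchar r \<theta>" "nonprincipal r \<theta>"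
  shows "Lfun \<theta> holomorphic_on {s. Re s > 0}"
proof -
  have op: "open {s. Re s > 0}" by (rule open_halfspace_Re_gt)
  obtain g where g: "\<forall>x \<in> {s. Re s > 0}. ((\<lambda>n. Lterm \<theta> n x) sums g x) \<and> g field_differentiable (at x)"
  proof (rule series_differentiable_comparison_complex[OF op, of "Lterm \<theta>"])
    show "Lterm \<theta> n field_differentiable at x" for n x

    proof -
      have "((\<lambda>s. csum \<theta> (Suc n) * (dz (Suc n) s - dz (Suc (Suc n)) s)) has_field_derivative
        csum \<theta> (Suc n) * (- (of_real (ln (real (Suc n))) * dz (Suc n) x) - - (of_real (ln (real (Suc (Suc n)))) * dz (Suc (Suc n)) x))) (at x)"
        by (intro DERIV_cmult DERIV_diff dz_has_field_derivative)
      then show ?thesis unfolding Lterm_def field_differentiable_def by blast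
    qed
  next
    fix x assume x: "x \<in> {s. Re s > 0}"
    \<comment> \<open>On the ball of radius \<open>Re x / 2\<close> the real part stays at least
      \<open>d\<close>, which yields one summable majorant \<open>h\<close> for the whole
      ball.\<close>
    define d where "d = Re x / 2"
    define h where "h n = complex_of_real (real r * (norm x + d) * real (Suc n) powr (- (d + 1)))" for n
    have d: "d > 0" using x by (simp add: d_def)
    have "norm (Lterm \<theta> n y) \<le> norm (h n)" if y: "y \<in> ball x d \<inter> {s. Re s > 0}" for n y
    proof -
      have "norm (x - y) < d" using y by (simp add: dist_norm)
      then have "norm y \<le> norm x + d" using norm_triangle_ineq2[of y x] by (simp add: norm_minus_commute)
      moreover have "Re y \<ge> d" using \<open>norm (x - y) < d\<close> abs_Re_le_cmod[of "x - y"] unfolding d_def by simp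
      ultimately have "real r * norm y * real (Suc n) powr (- (Re y + 1))
          \<le> real r * (norm x + d) * real (Suc n) powr (- (d + 1))"
        using d by (intro mult_mono powr_mono mult_nonneg_nonneg add_nonneg_nonneg) auto
      moreover have "norm (Lterm \<theta> n y) \<le> real r * norm y * real (Suc n) powr (- (Re y + 1))"
        by (rule norm_Lterm_le[OF assms]) (use y in auto)
      moreover have "norm (h n) = real r * (norm x + d) * real (Suc n) powr (- (d + 1))"
        using d unfolding h_def norm_of_real by (intro abs_of_nonneg mult_nonneg_nonneg add_nonneg_nonneg) auto
      ultimately show ?thesis by linarith
    qed
    moreover have "summable h" unfolding h_def summable_complex_of_real
      using d by (intro summable_mult zsum_summable) auto
    moreover have "range h \<subseteq> \<real>\<^sub>\<ge>\<^sub>0" using d unfolding h_def by (auto simp: nonneg_Reals_of_real_iff)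
    ultimately show "\<exists>d h. 0 < d \<and> summable h \<and> range h \<subseteq> \<real>\<^sub>\<ge>\<^sub>0 \<and>
       (\<forall>\<^sub>F n in sequentially. \<forall>y\<in>ball x d \<inter> {s. 0 < Re s}. cmod (Lterm \<theta> n y) \<le> cmod (h n))"
      using d by (intro exI[of _ d] exI[of _ h]) auto
  qed blast
  have "g holomorphic_on {s. Re s > 0}"
    using g op by (auto simp: holomorphic_on_open field_differentiable_def)
  moreover have "g x = Lfun \<theta> x" if "x \<in> {s. Re s > 0}" for x
    using g that sums_unique unfolding Lfun_def by blast
  ultimately show ?thesis by (rule holomorphic_transform)
qed

section \<open>Dirichlet series to the right of the line Re s = 1\<close>

text \<open>A Dirichlet series; the coefficient at \<open>0\<close> is always \<open>0\<close> below since \<open>dz 0 s = 1\<close>.\<close>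

definition dser :: "(nat \<Rightarrow> complex) \<Rightarrow> complex \<Rightarrow> complex" where
  "dser a s = (\<Sum>n. a n * dz n s)"

lemma summable_ln_powr:
  fixes x :: real
  assumes "x > 1"
  shows "summable (\<lambda>n. ln (real n) * real n powr (- x))"
proof (rule summable_comparison_test')
  define e where "e = (x - 1) / 2"
  have e: "e > 0" using assms by (simp add: e_def)
  have "- x + e < - 1" using assms by (simp add: e_def field_simps)
  then show "summable (\<lambda>n. 1 / e * (real n powr (- x + e)))"
    using summable_real_powr_iff by (intro summable_mult) blast
  fix n :: nat assume n: "n \<ge> 1"
  have "norm (ln (real n) * real n powr (- x)) = ln (real n) * real n powr (- x)" using n by simp
  also have "\<dots> \<le> real n powr e / e * real n powr (- x)"
    using n e by (intro mult_right_mono ln_powr_bound) auto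
  also have "\<dots> = 1 / e * (real n powr (- x + e))" by (simp add: powr_diff powr_minus divide_inverse)
  finally show "norm (ln (real n) * real n powr (- x)) \<le> 1 / e * (real n powr (- x + e))" .
qed

lemma dser_norm_summable:
  assumes a: "a 0 = 0" "\<And>n. n > 0 \<Longrightarrow> norm (a n) \<le> 1 + ln (real n)" and s: "Re s > 1"
  shows "summable (\<lambda>n. norm (a n * dz n s))"
proof (rule summable_comparison_test')
  show "summable (\<lambda>n. real n powr (- Re s) + ln (real n) * real n powr (- Re s))"
    using s summable_real_powr_iff[of "- Re s"] by (intro summable_add summable_ln_powr) auto
  fix n :: nat assume n: "n \<ge> 1"
  have "norm (norm (a n * dz n s)) = norm (a n) * real n powr (- Re s)" using n by (simp add: norm_mult norm_dz)
  also have "\<dots> \<le> (1 + ln (real n)) * real n powr (- Re s)" using a(2)[of n] n by (intro mult_right_mono) auto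
  finally show "norm (norm (a n * dz n s)) \<le> real n powr (- Re s) + ln (real n) * real n powr (- Re s)"
    by (simp add: algebra_simps)
qed

text \<open>Absolute convergence allows the double series to be regrouped by the product of the two
  indices. Over positive integers this is a bijection between pairs \<open>(x, y)\<close> and pairs
  of a number and one of its divisors.\<close>

lemma dirichlet_product_sums:
  fixes F G :: "nat \<Rightarrow> 'a::{real_normed_field,banach}"
  assumes F: "F 0 = 0" "summable (\<lambda>n. norm (F n))" and G: "G 0 = 0" "summable (\<lambda>n. norm (G n))"
  shows "(\<lambda>n. \<Sum>d | d dvd n. F d * G (n div d)) sums ((\<Sum>n. F n) * (\<Sum>n. G n))"
proof -
  let ?A = "{1::nat..}"
  have hF0: "(F has_sum (\<Sum>n. F n)) UNIV" by (rule norm_summable_imp_has_sum[OF F(2) summable_sums[OF summable_norm_cancel[OF F(2)]]])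
  have hF: "(F has_sum (\<Sum>n. F n)) ?A"
    by (rule has_sum_cong_neutral[THEN iffD1, OF _ _ _ hF0]) (use F(1) in \<open>auto simp: not_less_eq_eq\<close>)
  have hG0: "(G has_sum (\<Sum>n. G n)) UNIV" by (rule norm_summable_imp_has_sum[OF G(2) summable_sums[OF summable_norm_cancel[OF G(2)]]])
  have hG: "(G has_sum (\<Sum>n. G n)) ?A"
    by (rule has_sum_cong_neutral[THEN iffD1, OF _ _ _ hG0]) (use G(1) in \<open>auto simp: not_less_eq_eq\<close>)
  have nF: "(\<lambda>n. norm (F n)) summable_on ?A"
    using norm_summable_imp_summable_on[of "\<lambda>n. norm (F n)"] F(2) by (auto intro: summable_on_subset_banach)
  have nG: "(\<lambda>n. norm (G n)) summable_on ?A"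
    using norm_summable_imp_summable_on[of "\<lambda>n. norm (G n)"] G(2) by (auto intro: summable_on_subset_banach)
  define h where "h p = F (fst p) * G (snd p)" for p
  have "(\<lambda>p. norm (h p)) summable_on Sigma ?A (\<lambda>_. ?A)"
  proof (subst Infinite_Sum.abs_summable_on_Sigma_iff, intro conjI ballI)
    fix x
    show "(\<lambda>y. norm (h (x, y))) summable_on ?A"
      using nG by (simp add: h_def norm_mult summable_on_cmult_right)
    have "(\<lambda>x. norm (F x) * infsum (\<lambda>y. norm (G y)) ?A) summable_on ?A"
      using nF by (rule summable_on_cmult_left)
    then have "(\<lambda>x. norm (norm (F x) * infsum (\<lambda>y. norm (G y)) ?A)) summable_on ?A"
      by (simp add: infsum_nonneg abs_mult)
    then show "(\<lambda>x. norm (infsum (\<lambda>y. norm (h (x, y))) ?A)) summable_on ?A"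
      using nG by (simp add: h_def norm_mult infsum_cmult_right)
  qed
  then have "h summable_on Sigma ?A (\<lambda>_. ?A)" by (rule Infinite_Sum.abs_summable_summable)
  moreover have "h = (\<lambda>(x, y). F x * G y)" by (auto simp: h_def)
  ultimately have sm: "(\<lambda>(x, y). F x * G y) summable_on Sigma ?A (\<lambda>_. ?A)" by simp
  have "((\<lambda>(x, y). F x * G y) has_sum ((\<Sum>n. F n) * (\<Sum>n. G n))) (Sigma ?A (\<lambda>_. ?A))"
  proof (rule has_sum_SigmaI[OF _ _ sm])
    show "((\<lambda>y. case (x, y) of (x, y) \<Rightarrow> F x * G y) has_sum (F x * (\<Sum>n. G n))) ?A" for x
      using has_sum_cmult_right[OF hG] by simp
    show "((\<lambda>x. F x * (\<Sum>n. G n)) has_sum ((\<Sum>n. F n) * (\<Sum>n. G n))) ?A"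
      using hF by (rule has_sum_cmult_left)
  qed
  also have "?this \<longleftrightarrow> ((\<lambda>(n, d). F d * G (n div d)) has_sum ((\<Sum>n. F n) * (\<Sum>n. G n))) (Sigma ?A (\<lambda>n. {d. d dvd n}))"
    by (rule has_sum_reindex_bij_witness[where i = "\<lambda>(n, d). (d, n div d)" and j = "\<lambda>(x, y). (x * y, x)"])
       (auto simp: Suc_le_eq elim!: dvdE)
  finally have "((\<lambda>n. \<Sum>d | d dvd n. F d * G (n div d)) has_sum ((\<Sum>n. F n) * (\<Sum>n. G n))) ?A"
  proof (rule has_sum_SigmaD)
    fix n :: nat assume "n \<in> ?A"
    then show "((\<lambda>y. case (n, y) of (n, d) \<Rightarrow> F d * G (n div d)) has_sum (\<Sum>d | d dvd n. F d * G (n div d))) {d. d dvd n}"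
      by (intro has_sum_finiteI) auto
  qed
  \<comment> \<open>At \<open>n = 0\<close> the divisors form an infinite set, over which
    \<open>sum\<close> is \<open>0\<close> by convention, so this index may be added.\<close>
  then have "((\<lambda>n. \<Sum>d | d dvd n. F d * G (n div d)) has_sum ((\<Sum>n. F n) * (\<Sum>n. G n))) UNIV"
    by (rule has_sum_cong_neutral[THEN iffD1, rotated -1]) (auto simp: not_less_eq_eq)
  then show ?thesis by (rule has_sum_imp_sums)
qed

text \<open>The divisor sum of the von Mangoldt function is the logarithm, and a completely
  multiplicative \<open>a\<close> passes through the convolution.\<close>

lemma dser_mangoldt_mult:
  assumes a: "a 0 = 0" "\<And>m n. a (m * n) = a m * a n" "\<And>n. norm (a n) \<le> 1" and s: "Re s > 1"
  shows "dser (\<lambda>n. mangoldt n * a n) s * dser a s = dser (\<lambda>n. of_real (ln (real n)) * a n) s"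
proof -
  have b1: "norm (a n) \<le> 1 + ln (real n)" if "n > 0" for n using a(3)[of n] that by (smt (verit) ln_ge_zero of_nat_1 of_nat_le_iff Suc_leI One_nat_def)
  have b2: "norm (mangoldt n * a n) \<le> 1 + ln (real n)" if "n > 0" for n
  proof -
    have "norm (mangoldt n * a n) \<le> ln (real n) * 1"
      unfolding norm_mult using mangoldt_le[OF that] a(3)[of n] mangoldt_nonneg[of n] that by (intro mult_mono) auto
    then show ?thesis by simp
  qed
  have "(\<lambda>n. \<Sum>d | d dvd n. (mangoldt d * a d * dz d s) * (a (n div d) * dz (n div d) s)) sums
      ((\<Sum>n. mangoldt n * a n * dz n s) * (\<Sum>n. a n * dz n s))"
    by (rule dirichlet_product_sums) (use a(1) dser_norm_summable[OF _ b1 s] dser_norm_summable[OF _ b2 s] in auto)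
  moreover have "(\<Sum>d | d dvd n. (mangoldt d * a d * dz d s) * (a (n div d) * dz (n div d) s))
      = of_real (ln (real n)) * a n * dz n s" for n
  proof (cases "n = 0")
    case False
    have "(\<Sum>d | d dvd n. (mangoldt d * a d * dz d s) * (a (n div d) * dz (n div d) s))
        = (\<Sum>d | d dvd n. mangoldt d * (a n * dz n s))"
    proof (intro sum.cong refl)
      fix d assume "d \<in> {d. d dvd n}"
      then obtain e where e: "n = d * e" by (auto elim: dvdE)
      then have "d > 0" "e > 0" "n div d = e" using False by auto
      then show "(mangoldt d * a d * dz d s) * (a (n div d) * dz (n div d) s) = mangoldt d * (a n * dz n s)"
        unfolding e using a(2) by (simp add: dz_mult)
    qed
    also have "\<dots> = of_real (ln (real n)) * (a n * dz n s)"
      using mangoldt_sum[OF False, where ?'a = complex] by (simp flip: sum_distrib_right)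
    finally show ?thesis by (simp add: mult.assoc)
  qed (use a(1) in simp)
  ultimately show ?thesis unfolding dser_def by (simp add: sums_unique[symmetric])
qed

lemma dser_has_field_derivative:
  assumes a: "a 0 = 0" "\<And>n. norm (a n) \<le> 1" and s: "Re s > 1"
  shows "(dser a has_field_derivative (- dser (\<lambda>n. of_real (ln (real n)) * a n) s)) (at s)"
proof -
  define S where "S = {s. Re s > 1}"
  have op: "open S" unfolding S_def by (rule open_halfspace_Re_gt)
  have "\<exists>g g'. \<forall>x\<in>S. ((\<lambda>n. a n * dz n x) sums g x) \<and>
     ((\<lambda>n. a n * (- (of_real (ln (real n)) * dz n x))) sums g' x) \<and> (g has_field_derivative g' x) (at x)"
  proof (rule series_and_derivative_comparison_complex[OF op])
    show "((\<lambda>x. a n * dz n x) has_field_derivative a n * (- (of_real (ln (real n)) * dz n x))) (at x)" for n x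
      by (intro DERIV_cmult dz_has_field_derivative)
    fix x assume x: "x \<in> S"
    define d where "d = (Re x - 1) / 2"
    define h where "h n = complex_of_real (real n powr (- (1 + d)))" for n
    have d: "d > 0" using x by (simp add: d_def S_def)
    have "norm (a n * dz n y) \<le> norm (h n)" if y: "y \<in> ball x d \<inter> S" for n y
    proof (cases "n = 0")
      case False
      have "norm (x - y) < d" using y by (simp add: dist_norm)
      then have "Re y \<ge> 1 + d" using abs_Re_le_cmod[of "x - y"] unfolding d_def by (simp add: field_simps)
      then have "norm (a n) * real n powr (- Re y) \<le> 1 * real n powr (- (1 + d))"
        using a False by (intro mult_mono powr_mono) auto
      then show ?thesis using False by (simp add: norm_mult norm_dz h_def)
    qed (use a in simp)
    moreover have "summable h" unfolding h_def summable_complex_of_real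
      using d summable_real_powr_iff[of "- (1 + d)"] by simp
    moreover have "range h \<subseteq> \<real>\<^sub>\<ge>\<^sub>0" unfolding h_def by (auto simp: nonneg_Reals_of_real_iff)
    ultimately show "\<exists>d h. 0 < d \<and> summable h \<and> range h \<subseteq> \<real>\<^sub>\<ge>\<^sub>0 \<and>
       (\<forall>\<^sub>F n in sequentially. \<forall>y\<in>ball x d \<inter> S. cmod (a n * dz n y) \<le> cmod (h n))"
      using d by (intro exI[of _ d] exI[of _ h]) auto
  qed
  then obtain g g' where g: "\<And>x. x \<in> S \<Longrightarrow> (\<lambda>n. a n * dz n x) sums g x"
    "\<And>x. x \<in> S \<Longrightarrow> (\<lambda>n. a n * (- (of_real (ln (real n)) * dz n x))) sums g' x"
    "\<And>x. x \<in> S \<Longrightarrow> (g has_field_derivative g' x) (at x)" by blast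
  have sS: "s \<in> S" using s by (simp add: S_def)
  have eq: "g x = dser a x" if "x \<in> S" for x using sums_unique[OF g(1)[OF that]] by (simp add: dser_def)
  have "(\<lambda>n. - (a n * (- (of_real (ln (real n)) * dz n s)))) sums - g' s" by (intro sums_minus g sS)
  then have "- g' s = (\<Sum>n. - (a n * (- (of_real (ln (real n)) * dz n s))))" by (rule sums_unique)
  also have "\<dots> = dser (\<lambda>n. of_real (ln (real n)) * a n) s"
    unfolding dser_def by (intro suminf_cong) simp
  finally have "- g' s = dser (\<lambda>n. of_real (ln (real n)) * a n) s" .
  then have "g' s = - dser (\<lambda>n. of_real (ln (real n)) * a n) s" by (metis minus_minus)
  moreover have "(dser a has_field_derivative g' s) (at s)"
    by (rule has_field_derivative_transform_within_open[OF g(3)[OF sS] op sS eq])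
  ultimately show ?thesis by simp
qed

lemma nonprincipal_zero:
  assumes "dchar r \<theta>" "nonprincipal r \<theta>"
  shows "\<theta> 0 = 0"
proof -
  have "r \<noteq> 1"
  proof
    assume r: "r = 1"
    have "\<theta> n = 1" for n using dchar_cong[OF assms(1), of n 1] dcharD(4)[OF assms(1)] r by simp
    then show False using assms(2) by (auto simp: nonprincipal_def)
  qed
  then show ?thesis using assms(1) by (intro dcharD(6)[OF assms(1)]) auto
qed

text \<open>Undoes the Abel summation: the boundary term is at most \<open>r\<close> times
  \<open>(N + 1) powr (- Re s)\<close> and tends to \<open>0\<close>.\<close>

lemma Lfun_eq_dser:
  assumes \<theta>: "dchar r \<theta>" "nonprincipal r \<theta>" and s: "Re s > 1"
  shows "Lfun \<theta> s = dser \<theta> s"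
proof -
  have z: "\<theta> 0 = 0" using nonprincipal_zero[OF \<theta>] .
  have part: "(\<Sum>n<N. Lterm \<theta> n s) = (\<Sum>n<Suc N. \<theta> n * dz n s) - csum \<theta> N * dz (Suc N) s" for N
    by (induction N) (simp_all add: Lterm_def csum_def z algebra_simps)
  have "norm (csum \<theta> N * dz (Suc N) s) \<le> real r * real (Suc N) powr (- Re s)" for N
    unfolding norm_mult csum_def by (intro mult_mono dchar_partial_sum_bound[OF \<theta>]) (auto simp: norm_dz)
  moreover have "(\<lambda>N. real r * real (Suc N) powr (- Re s)) \<longlonglongrightarrow> 0"
    using summable_LIMSEQ_zero[OF summable_mult[OF zsum_summable[OF s]]] .
  ultimately have lim: "(\<lambda>N. csum \<theta> N * dz (Suc N) s) \<longlonglongrightarrow> 0"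
    by (rule Lim_null_comparison[OF always_eventually[OF allI]])
  have b1: "norm (\<theta> n) \<le> 1 + ln (real n)" if "n > 0" for n
    using dcharD(5)[OF \<theta>(1), of n] that by (smt (verit) ln_ge_zero of_nat_1 of_nat_le_iff Suc_leI One_nat_def)
  have "summable (\<lambda>n. \<theta> n * dz n s)" using dser_norm_summable[OF z b1 s] by (rule summable_norm_cancel)
  then have "(\<lambda>N. \<Sum>n<N. \<theta> n * dz n s) \<longlonglongrightarrow> dser \<theta> s" unfolding dser_def by (rule summable_LIMSEQ)
  then have "(\<lambda>N. \<Sum>n<Suc N. \<theta> n * dz n s) \<longlonglongrightarrow> dser \<theta> s" by (rule LIMSEQ_Suc)
  from tendsto_diff[OF this lim] have "(\<lambda>N. \<Sum>n<N. Lterm \<theta> n s) \<longlonglongrightarrow> dser \<theta> s" unfolding part by simp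
  moreover have "(\<lambda>N. \<Sum>n<N. Lterm \<theta> n s) \<longlonglongrightarrow> Lfun \<theta> s"
    unfolding Lfun_def using Lfun_summable[OF \<theta>] s by (intro summable_LIMSEQ) auto
  ultimately show ?thesis by (rule LIMSEQ_unique[symmetric])
qed

text \<open>The negative of the logarithmic derivative of the L-function, as a Dirichlet series; the
  link is \<open>Lfun_has_derivative\<close>.\<close>

definition Ldser :: "(nat \<Rightarrow> complex) \<Rightarrow> complex \<Rightarrow> complex" where
  "Ldser \<theta> s = dser (\<lambda>n. mangoldt n * \<theta> n) s"

lemma Lfun_has_derivative:
  assumes \<theta>: "dchar r \<theta>" "nonprincipal r \<theta>" and s: "Re s > 1"
  shows "(Lfun \<theta> has_field_derivative - (Ldser \<theta> s * Lfun \<theta> s)) (at s)"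
proof -
  have z: "\<theta> 0 = 0" using nonprincipal_zero[OF \<theta>] .
  have "(dser \<theta> has_field_derivative - (Ldser \<theta> s * dser \<theta> s)) (at s)"
    using dser_has_field_derivative[of \<theta>, OF z dcharD(5)[OF \<theta>(1)] s]
      dser_mangoldt_mult[of \<theta>, OF z dcharD(2)[OF \<theta>(1)] dcharD(5)[OF \<theta>(1)] s] unfolding Ldser_def by simp
  then have "(Lfun \<theta> has_field_derivative - (Ldser \<theta> s * dser \<theta> s)) (at s)"
    by (rule has_field_derivative_transform_within_open[OF _ open_halfspace_Re_gt[of 1]])
       (use s Lfun_eq_dser[OF \<theta>] in auto)
  then show ?thesis using Lfun_eq_dser[OF assms] by simp
qed

section \<open>The logarithmic derivative of zeta on the real axis\<close>

text \<open>This is \<open>- zeta' / zeta\<close> at the real point \<open>x > 1\<close>. It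
  majorizes the series \<open>Ldser\<close> of every character.\<close>

definition Zr :: "real \<Rightarrow> real" where
  "Zr x = (\<Sum>n. mangoldt n * real n powr (- x))"

lemma Zr_summable: "x > 1 \<Longrightarrow> summable (\<lambda>n. mangoldt n * real n powr (- x))"
proof (rule summable_comparison_test'[OF summable_ln_powr])
  fix n :: nat assume "n \<ge> 1"
  then show "norm (mangoldt n * real n powr (- x)) \<le> ln (real n) * real n powr (- x)"
    using mangoldt_le[of n] mangoldt_nonneg[of n] by (simp add: abs_mult mult_right_mono)
qed

lemma Zr_nonneg: "x > 1 \<Longrightarrow> Zr x \<ge> 0"
  unfolding Zr_def by (intro suminf_nonneg Zr_summable) (auto simp: mangoldt_nonneg)

lemma Ldser_summable:
  assumes "\<And>n. norm (\<theta> n) \<le> 1" "Re s > 1"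
  shows "summable (\<lambda>n. norm (mangoldt n * \<theta> n * dz n s))"
proof (rule summable_comparison_test'[OF Zr_summable[OF assms(2)]])
  fix n :: nat assume "n \<ge> 1"
  then show "norm (norm (mangoldt n * \<theta> n * dz n s)) \<le> mangoldt n * real n powr (- Re s)"
    using mult_right_mono[OF mult_left_mono[OF assms(1)[of n] mangoldt_nonneg[of n]], of "real n powr (- Re s)"]
    by (simp add: norm_mult norm_dz abs_mult)
qed

lemma norm_Ldser_le:
  assumes "\<And>n. norm (\<theta> n) \<le> 1" "Re s > 1"
  shows "norm (Ldser \<theta> s) \<le> Zr (Re s)"
  unfolding Ldser_def dser_def Zr_def
proof (rule norm_suminf_le[OF _ Zr_summable[OF assms(2)]])
  fix n :: nat
  show "norm (mangoldt n * \<theta> n * dz n s) \<le> mangoldt n * real n powr (- Re s)"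
    using mult_right_mono[OF mult_left_mono[OF assms(1)[of n] mangoldt_nonneg[of n]], of "real n powr (- Re s)"]
    by (cases "n = 0") (simp_all add: norm_mult norm_dz)
qed

text \<open>\<open>G\<close> is a primitive of \<open>ln x * x powr (- (1 + u))\<close>, which
  decreases from \<open>exp 1\<close> on; hence \<open>n \<ge> 3\<close>.\<close>

lemma ln_powr_mean_value:
  fixes u :: real and n :: nat
  assumes u: "u > 0" and n: "n \<ge> 3"
  defines "G \<equiv> \<lambda>x. - ((ln x / u + 1 / u\<^sup>2) * x powr (- u))"
  shows "ln (real (Suc n)) * real (Suc n) powr (- (1 + u)) \<le> G (real (Suc n)) - G (real n)"
proof -
  have der: "(G has_real_derivative ln x * x powr (- (1 + u))) (at x)" if "x > 0" for x
  proof -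
    have d1: "(ln has_real_derivative 1 / x) (at x)" using that by (rule DERIV_ln_divide)
    have d2: "((\<lambda>x. x powr (- u)) has_real_derivative (- u) * x powr (- u - 1)) (at x)"
      using that by (rule has_real_derivative_powr)
    have e1: "x powr (- u - 1) = x powr (- u) / x"
      using that powr_diff[of x "- u" 1] by simp
    have "- (1 + u) = - u - 1" by simp
    with e1 have e2: "x powr (- (1 + u)) = x powr (- u) / x" by (simp only:)
    note e = e1 e2
    show ?thesis unfolding G_def
      by (rule DERIV_cong[OF DERIV_minus[OF DERIV_mult[OF DERIV_add[OF DERIV_cdivide[OF d1] DERIV_const] d2]]])
         (use that u in \<open>simp only: e, simp add: field_simps power2_eq_square\<close>)
  qed
  have der2: "((\<lambda>x. ln x * x powr (- (1 + u))) has_real_derivative (1 - (1 + u) * ln x) * x powr (- (2 + u))) (at x)" if "x > 0" for x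
  proof -
    have d1: "(ln has_real_derivative 1 / x) (at x)" using that by (rule DERIV_ln_divide)
    have d2: "((\<lambda>x. x powr (- (1 + u))) has_real_derivative (- (1 + u)) * x powr (- (1 + u) - 1)) (at x)"
      using that by (rule has_real_derivative_powr)
    have e1: "x powr (- (1 + u) - 1) = x powr (- (1 + u)) / x"
      using that powr_diff[of x "- (1 + u)" 1] by simp
    have "- (2 + u) = - (1 + u) - 1" by simp
    with e1 have e2: "x powr (- (2 + u)) = x powr (- (1 + u)) / x" by (simp only:)
    note e = e1 e2
    show ?thesis
      by (rule DERIV_cong[OF DERIV_mult[OF d1 d2]])
         (use that u in \<open>simp only: e, simp add: field_simps\<close>)
  qed
  obtain z where z: "real n < z" "z < real (Suc n)" "G (real (Suc n)) - G (real n) = (real (Suc n) - real n) * (ln z * z powr (- (1 + u)))"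
    using MVT2[of "real n" "real (Suc n)" G "\<lambda>x. ln x * x powr (- (1 + u))"] der n by auto
  have "ln (real (Suc n)) * real (Suc n) powr (- (1 + u)) \<le> ln z * z powr (- (1 + u))"
  proof (rule DERIV_nonpos_imp_nonincreasing[of z "real (Suc n)"])
    fix x assume x: "z \<le> x" "x \<le> real (Suc n)"
    have x3: "x \<ge> 3" using x z n by linarith
    then have "exp 1 \<le> x" using e_less_272 by linarith
    then have "ln x \<ge> 1" using x3 by (subst ln_ge_iff) auto
    then have "1 \<le> (1 + u) * ln x" using mult_mono[of 1 "1 + u" 1 "ln x"] u by simp
    then have "(1 - (1 + u) * ln x) * x powr (- (2 + u)) \<le> 0" by (intro mult_nonpos_nonneg) auto
    then show "\<exists>y. ((\<lambda>x. ln x * x powr (- (1 + u))) has_real_derivative y) (at x) \<and> y \<le> 0"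
      using der2[of x] x3 by auto
  qed (use z in auto)
  then show ?thesis using z(3) by simp
qed

text \<open>The product of \<open>Zr x\<close> with zeta is the series of
  \<open>ln n * n powr (- x)\<close>. Comparison with integrals bounds this series by
  \<open>3 + 1 / u\<^sup>2\<close> and zeta from below by \<open>1 / u\<close>. The coefficient
  \<open>1\<close> of the pole has to be sharp, since \<open>zero_repulsion\<close> weighs poles
  against zeros.\<close>

lemma Zr_le:
  assumes x: "1 < x" "x \<le> 2"
  shows "Zr x \<le> 1 / (x - 1) + 3 * (x - 1)"
proof -
  define u where "u = x - 1"
  have u: "0 < u" "x = 1 + u" using x by (auto simp: u_def)
  define z where "z = (\<Sum>n. real n powr (- x))"
  have sz: "summable (\<lambda>n. real n powr (- x))" using x summable_real_powr_iff[of "- x"] by simp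
  have "(\<lambda>n. \<Sum>d | d dvd n. (mangoldt d * real d powr (- x)) * (real (n div d) powr (- x))) sums (Zr x * z)"
    unfolding Zr_def z_def using Zr_summable[OF x(1)] sz
    by (intro dirichlet_product_sums) (auto simp: abs_mult mangoldt_nonneg)
  moreover have "(\<Sum>d | d dvd n. (mangoldt d * real d powr (- x)) * (real (n div d) powr (- x))) = ln (real n) * real n powr (- x)" for n
  proof (cases "n = 0")
    case False
    have "(\<Sum>d | d dvd n. (mangoldt d * real d powr (- x)) * (real (n div d) powr (- x)))
        = (\<Sum>d | d dvd n. mangoldt d * real n powr (- x))"
    proof (intro sum.cong refl)
      fix d assume "d \<in> {d. d dvd n}"
      then obtain e where e: "n = d * e" by (auto elim: dvdE)
      then have "d > 0" "e > 0" "n div d = e" using False by auto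
      then show "(mangoldt d * real d powr (- x)) * (real (n div d) powr (- x)) = mangoldt d * real n powr (- x)"
        unfolding e by (simp add: powr_mult)
    qed
    then show ?thesis using mangoldt_sum[OF False, where ?'a = real] by (simp flip: sum_distrib_right)
  qed simp
  ultimately have prod: "(\<lambda>n. ln (real n) * real n powr (- x)) sums (Zr x * z)" by simp
  have zlow: "1 / u \<le> z"
  proof (rule LIMSEQ_le_const)
    define H where "H y = - (y powr (- u) / u)" for y :: real
    have "(\<lambda>N. (\<Sum>n<Suc N. real n powr (- x))) \<longlonglongrightarrow> z"
      unfolding z_def by (rule LIMSEQ_Suc[OF summable_LIMSEQ[OF sz]])
    moreover have "(\<lambda>N. H (real (Suc N))) \<longlonglongrightarrow> - (0 / u)"
      unfolding H_def using u
      by (intro tendsto_intros tendsto_neg_powr filterlim_compose[OF filterlim_real_sequentially filterlim_Suc]) auto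
    ultimately show "(\<lambda>N. (\<Sum>n<Suc N. real n powr (- x)) - H (real (Suc N))) \<longlonglongrightarrow> z" 
      using tendsto_diff by fastforce
    have step: "H (real (Suc n)) - H (real n) \<le> real n powr (- x)" if n0: "n > 0" for n
    proof -
      have der: "(H has_real_derivative y powr (- x)) (at y)" if "y > 0" for y
      proof -
        have d2: "((\<lambda>x. x powr (- u)) has_real_derivative (- u) * y powr (- u - 1)) (at y)"
          using that by (rule has_real_derivative_powr)
        have "- u - 1 = - x" using u by simp
        with d2 have d3: "((\<lambda>x. x powr (- u)) has_real_derivative (- u) * y powr (- x)) (at y)"
          by (simp only:)
        show ?thesis unfolding H_def
          by (rule DERIV_cong[OF DERIV_minus[OF DERIV_cdivide[OF d3]]]) (use u in simp)
      qed
      have dd: "(H has_real_derivative y powr (- x)) (at y)" if "real n \<le> y" for y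
        using der[of y] that n0 by simp
      obtain y where y: "real n < y" "y < real (Suc n)" "H (real (Suc n)) - H (real n) = (real (Suc n) - real n) * (y powr (- x))"
        using MVT2[of "real n" "real (Suc n)" H "\<lambda>y. y powr (- x)"] dd by auto
      have "y powr (- x) \<le> real n powr (- x)" using y x n0 by (intro powr_mono2') auto
      then show ?thesis using y by simp
    qed
    have H1: "H 1 = - (1 / u)" by (simp add: H_def)
    have "H (real (Suc N)) - H 1 \<le> (\<Sum>n<Suc N. real n powr (- x))" for N
    proof (induction N)
      case (Suc N)
      then show ?case using step[of "Suc N"] by simp
    qed simp
    then have "1 / u \<le> (\<Sum>n<Suc N. real n powr (- x)) - H (real (Suc N))" for N
      unfolding H1 by (simp add: algebra_simps)
    then show "\<exists>N. \<forall>n\<ge>N. 1 / u \<le> (\<Sum>n<Suc n. real n powr (- x)) - H (real (Suc n))" by blast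
  qed
  have up: "Zr x * z \<le> 3 + 1 / u\<^sup>2"
  proof (rule LIMSEQ_le_const2)
    define G where "G y = - ((ln y / u + 1 / u\<^sup>2) * y powr (- u))" for y :: real
    show "(\<lambda>N. \<Sum>n<N + 4. ln (real n) * real n powr (- x)) \<longlonglongrightarrow> Zr x * z"
      using prod unfolding sums_def by (rule LIMSEQ_ignore_initial_segment)
    \<comment> \<open>The terms for \<open>n = 1, 2, 3\<close> lie before the range of monotonicity.
      Each is at most \<open>1\<close>, which accounts for the \<open>3\<close>.\<close>
    have b: "(\<Sum>n<N + 4. ln (real n) * real n powr (- x)) \<le> 3 + G (real (N + 3)) - G 3" for N
    proof (induction N)
      case 0
      have "ln (real n) * real n powr (- x) \<le> 1" if "n > 0" for n
      proof -
        have "ln (real n) * real n powr (- x) \<le> real n powr 1 * real n powr (- x)"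
          using that ln_bound[of "real n"] by (intro mult_right_mono) auto
        also have "\<dots> = real n powr (1 - x)" by (simp only: powr_add[symmetric] diff_conv_add_uminus)
        also have "\<dots> \<le> 1" using powr_mono[of "1 - x" 0 "real n"] that x by simp
        finally show ?thesis .
      qed
      from this[of 1] this[of 2] this[of 3] show ?case by (simp add: eval_nat_numeral)
    next
      case (Suc N)
      have "ln (real (Suc (N + 3))) * real (Suc (N + 3)) powr (- (1 + u)) \<le> G (real (Suc (N + 3))) - G (real (N + 3))"
        unfolding G_def by (rule ln_powr_mean_value) (use u in auto)
      then show ?case using Suc u(2) by (simp add: add_ac eval_nat_numeral)
    qed
    have g0: "G (real (N + 3)) \<le> 0" for N using u unfolding G_def by (auto intro!: mult_nonneg_nonneg add_nonneg_nonneg)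
    \<comment> \<open>This is \<open>(1 + y) * exp (- y) \<le> 1\<close> at
      \<open>y = u * ln 3\<close>.\<close>
    have "- G 3 \<le> 1 / u\<^sup>2"
    proof -
      have "1 + u * ln 3 \<le> exp (u * ln 3)" by (rule exp_ge_add_one_self)
      then have "(1 + u * ln 3) * (3 powr (- u)) \<le> exp (u * ln 3) * 3 powr (- u)" by (intro mult_right_mono) auto
      also have "\<dots> = 1" by (simp add: powr_def exp_add[symmetric])
      finally have "(1 + u * ln 3) * (3 powr (- u)) / u\<^sup>2 \<le> 1 / u\<^sup>2" by (intro divide_right_mono) auto
      moreover have "- G 3 = (1 + u * ln 3) * (3 powr (- u)) / u\<^sup>2"
        using u unfolding G_def by (simp add: field_simps power2_eq_square)
      ultimately show ?thesis by simp
    qed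
    then show "\<exists>N. \<forall>n\<ge>N. (\<Sum>n<n + 4. ln (real n) * real n powr (- x)) \<le> 3 + 1 / u\<^sup>2"
    proof (intro exI[of _ 0] allI impI)
      fix N :: nat
      show "(\<Sum>n<N + 4. ln (real n) * real n powr (- x)) \<le> 3 + 1 / u\<^sup>2"
        using b[of N] g0[of N] \<open>- G 3 \<le> 1 / u\<^sup>2\<close> by linarith
    qed
  qed
  have "Zr x * (1 / u) \<le> Zr x * z" using zlow Zr_nonneg[OF x(1)] by (rule mult_left_mono)
  also note up
  finally have "Zr x \<le> (3 + 1 / u\<^sup>2) * u" using u by (simp add: field_simps)
  also have "\<dots> = 1 / u + 3 * u" using u by (simp add: field_simps power2_eq_square)
  finally show ?thesis unfolding u_def .
qed

section \<open>Zeros of L-functions\<close>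

text \<open>The Borel-Caratheodory argument: \<open>\<phi>\<close> is \<open>g\<close> followed by
  the Moebius map that takes the half plane \<open>Re z < M\<close> to the unit disc and fixes
  \<open>0\<close>, so the Schwarz lemma applies.\<close>

lemma schwarz_half_plane:
  fixes M :: real
  assumes g: "g holomorphic_on ball 0 1" "g 0 = 0" and M: "M > 0" "\<And>w. norm w < 1 \<Longrightarrow> Re (g w) < M"
  shows "norm (deriv g 0) \<le> 2 * M" "norm w \<le> 1 / 2 \<Longrightarrow> norm (g w) \<le> 2 * M"
proof -
  define \<phi> where "\<phi> w = g w / (2 * of_real M - g w)" for w
  have nz: "2 * of_real M - g w \<noteq> 0" if "norm w < 1" for w
  proof
    assume "2 * of_real M - g w = 0"
    then have "g w = of_real (2 * M)" by simp
    then have "Re (g w) = 2 * M" by simp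
    then show False using M(1) M(2)[OF that] by simp
  qed
  have hol: "\<phi> holomorphic_on ball 0 1"
    unfolding \<phi>_def using nz by (intro holomorphic_intros g) (auto simp: dist_norm)
  have \<phi>0: "\<phi> 0 = 0" by (simp add: \<phi>_def g)
  have lt: "norm (\<phi> w) < 1" if w: "norm w < 1" for w
  proof -
    have "(norm (g w))\<^sup>2 < (norm (2 * of_real M - g w))\<^sup>2"
    proof -
      have "(norm (2 * of_real M - g w))\<^sup>2 = (norm (g w))\<^sup>2 + 4 * M * (M - Re (g w))"
        unfolding cmod_power2 by (simp add: power2_eq_square algebra_simps)
      moreover have "4 * M * (M - Re (g w)) > 0" using M(1) M(2)[OF w] by simp
      ultimately show ?thesis by simp
    qed
    then have "norm (g w) < norm (2 * of_real M - g w)" by (rule power_less_imp_less_base) simp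
    then show ?thesis using nz[OF w] unfolding \<phi>_def norm_divide by (subst divide_less_eq_1_pos) auto
  qed
  have "norm (deriv \<phi> 0) \<le> 1" using Schwarz_Lemma(2)[OF hol \<phi>0 lt, of 0] by simp
  moreover have "deriv \<phi> 0 = deriv g 0 / (2 * of_real M)"
  proof -
    have dg: "(g has_field_derivative deriv g 0) (at 0)" by (rule holomorphic_derivI[OF g(1)]) auto
    have "(\<phi> has_field_derivative (deriv g 0 * (2 * of_real M - g 0) - g 0 * (0 - deriv g 0)) / ((2 * of_real M - g 0) * (2 * of_real M - g 0))) (at 0)"
      unfolding \<phi>_def using nz[of 0] by (intro DERIV_divide dg DERIV_diff DERIV_const) auto
    then have "deriv \<phi> 0 = (deriv g 0 * (2 * of_real M - g 0) - g 0 * (0 - deriv g 0)) / ((2 * of_real M - g 0) * (2 * of_real M - g 0))"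
      by (rule DERIV_imp_deriv)
    then show ?thesis using M by (simp add: g)
  qed
  ultimately show "norm (deriv g 0) \<le> 2 * M" using M by (simp add: norm_divide field_simps)
  assume w: "norm w \<le> 1 / 2"
  then have w1: "norm w < 1" by simp
  have "norm (\<phi> w) \<le> 1 / 2" using Schwarz_Lemma(1)[OF hol \<phi>0 lt w1] w by simp
  moreover have "g w * (1 + \<phi> w) = 2 * of_real M * \<phi> w"
    using nz[OF w1] unfolding \<phi>_def by (simp add: field_simps)
  then have e: "norm (g w) * norm (1 + \<phi> w) = 2 * M * norm (\<phi> w)"
    using M by (metis abs_of_pos norm_mult norm_numeral norm_of_real)
  have "norm (1 + \<phi> w) \<ge> 1 - norm (\<phi> w)"
    using norm_triangle_ineq2[of 1 "- \<phi> w"] by simp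
  ultimately have "norm (1 + \<phi> w) \<ge> 1 / 2" by simp
  then have "norm (g w) * (1 / 2) \<le> 2 * M * norm (\<phi> w)" unfolding e[symmetric] by (intro mult_left_mono) auto
  also have "\<dots> \<le> 2 * M * (1 / 2)" using M \<open>norm (\<phi> w) \<le> 1 / 2\<close> by (intro mult_left_mono) auto
  finally show "norm (g w) \<le> 2 * M" by simp
qed

text \<open>Apply the half-plane lemma to a logarithm of \<open>h (a + \<rho> w) / h a\<close>. The
  derivative at the centre gives the first bound; the second keeps \<open>h\<close> away from
  \<open>0\<close> on the half disc.\<close>

lemma zero_free_bounds:
  assumes h: "h holomorphic_on ball a \<rho>" "\<And>z. z \<in> ball a \<rho> \<Longrightarrow> h z \<noteq> 0"
    and B: "\<And>z. z \<in> ball a \<rho> \<Longrightarrow> norm (h z) \<le> B" and \<rho>: "\<rho> > 0"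
  shows "norm (deriv h a / h a) \<le> 2 / \<rho> * ln (B / norm (h a))"
    and "norm (z - a) \<le> \<rho> / 2 \<Longrightarrow> ln (norm (h a) / norm (h z)) \<le> 2 * ln (B / norm (h a))"
proof -
  define M where "M = ln (B / norm (h a))"
  have ha: "h a \<noteq> 0" using h(2)[of a] \<rho> by simp
  have Bge: "B \<ge> norm (h a)" using B[of a] \<rho> by simp
  have M0: "M \<ge> 0" unfolding M_def using ha Bge by (intro ln_ge_zero) (simp add: field_simps)
  obtain l where l: "l holomorphic_on ball a \<rho>" "\<And>x. x \<in> ball a \<rho> \<Longrightarrow> exp (l x) = h x"
    using holomorphic_logarithm_exists[of "ball a \<rho>" h a] h \<rho> by auto
  define g where "g w = l (a + of_real \<rho> * w) - l a" for w
  have inb: "a + of_real \<rho> * w \<in> ball a \<rho>" if "norm w < 1" for w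
    using that \<rho> by (simp add: dist_norm norm_mult)
  have ghol: "g holomorphic_on ball 0 1"
    unfolding g_def
    by (intro holomorphic_intros holomorphic_on_compose_gen[OF _ l(1), unfolded o_def])
       (use inb in \<open>auto simp: dist_norm\<close>)
  have g0: "g 0 = 0" by (simp add: g_def)
  have Reg: "Re (g w) = ln (norm (h (a + of_real \<rho> * w)) / norm (h a))" if "norm w < 1" for w
  proof -
    have "norm (h (a + of_real \<rho> * w)) = exp (Re (l (a + of_real \<rho> * w)))" "norm (h a) = exp (Re (l a))"
      using l(2)[OF inb[OF that]] l(2)[of a] \<rho> by (metis norm_exp_eq_Re centre_in_ball)+
    then show ?thesis by (simp add: g_def exp_diff[symmetric])
  qed
  \<comment> \<open>The half-plane lemma asks for a strict inequality and a positive bound, while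
    \<open>M\<close> may be attained or be \<open>0\<close>. So \<open>M + e\<close> is used and
    \<open>e\<close> tends to \<open>0\<close>.\<close>
  have Reg_le: "Re (g w) < M + e" if "norm w < 1" "e > 0" for w e
  proof -
    have "Re (g w) \<le> M" unfolding Reg[OF that(1)] M_def
      using B[OF inb[OF that(1)]] h(2)[OF inb[OF that(1)]] ha by (intro ln_mono divide_right_mono) auto
    then show ?thesis using that by simp
  qed
  have S: "norm (deriv g 0) \<le> 2 * (M + e)" "norm w \<le> 1 / 2 \<Longrightarrow> norm (g w) \<le> 2 * (M + e)" if "e > 0" for e w
    using schwarz_half_plane[OF ghol g0, of "M + e"] M0 that Reg_le by auto
  have "norm (deriv g 0) \<le> 2 * M"
  proof (rule field_le_epsilon)
    fix e :: real assume "e > 0"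
    then show "norm (deriv g 0) \<le> 2 * M + e" using S(1)[of "e / 2"] by simp
  qed
  moreover have "deriv g 0 = of_real \<rho> * (deriv h a / h a)"
  proof -
    have dl: "(l has_field_derivative deriv l a) (at a)" by (rule holomorphic_derivI[OF l(1)]) (use \<rho> in auto)
    have "((\<lambda>w. a + of_real \<rho> * w) has_field_derivative of_real \<rho>) (at 0)"
      by (auto intro!: derivative_eq_intros)
    then have "((\<lambda>w. l (a + of_real \<rho> * w)) has_field_derivative deriv l a * of_real \<rho>) (at 0)"
      using dl by (intro DERIV_chain2[of l]) auto
    then have "(g has_field_derivative deriv l a * of_real \<rho>) (at 0)" unfolding g_def
      by (auto intro!: derivative_eq_intros)
    then have 1: "deriv g 0 = deriv l a * of_real \<rho>" by (rule DERIV_imp_deriv)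
    have "((\<lambda>x. exp (l x)) has_field_derivative exp (l a) * deriv l a) (at a)"
      using dl by (auto intro!: derivative_eq_intros)
    then have "(h has_field_derivative exp (l a) * deriv l a) (at a)"
      by (rule has_field_derivative_transform_within_open[of _ _ _ "ball a \<rho>"]) (use \<rho> l in auto)
    then have "deriv h a = h a * deriv l a" using l(2)[of a] \<rho> by (simp add: DERIV_imp_deriv)
    then show ?thesis using 1 ha by simp
  qed
  ultimately have "\<rho> * norm (deriv h a / h a) \<le> 2 * M" using \<rho> by (simp add: norm_mult norm_divide)
  then show "norm (deriv h a / h a) \<le> 2 / \<rho> * ln (B / norm (h a))"
    unfolding M_def[symmetric] using \<rho> by (simp add: field_simps)
  assume z: "norm (z - a) \<le> \<rho> / 2"
  define w where "w = (z - a) / of_real \<rho>"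
  have zw: "z = a + of_real \<rho> * w" using \<rho> by (simp add: w_def)
  have w: "norm w \<le> 1 / 2" using z \<rho> by (simp add: w_def norm_divide field_simps)
  have "norm (g w) \<le> 2 * M"
  proof (rule field_le_epsilon)
    fix e :: real assume "e > 0"
    then show "norm (g w) \<le> 2 * M + e" using S(2)[of "e / 2" w] w by simp
  qed
  then have "- Re (g w) \<le> 2 * M" using abs_Re_le_cmod[of "g w"] by linarith
  moreover have "Re (g w) = ln (norm (h z) / norm (h a))" using Reg[of w] w zw by simp
  moreover have "z \<in> ball a \<rho>" unfolding zw using w by (intro inb) simp
  then have "h z \<noteq> 0" by (rule h(2))
  ultimately show "ln (norm (h a) / norm (h z)) \<le> 2 * ln (B / norm (h a))"
    using ha unfolding M_def by (simp add: ln_div)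
qed

text \<open>Recentring at \<open>z\<close> with radius \<open>\<rho> / 2\<close> costs a factor 2 in
  the radius, and comparing \<open>h z\<close> with \<open>h a\<close> costs a factor 3 in the
  logarithm, so \<open>2\<close> becomes \<open>12\<close>.\<close>

lemma log_deriv_bound_zero_free:
  assumes h: "h holomorphic_on ball a \<rho>" "\<And>z. z \<in> ball a \<rho> \<Longrightarrow> h z \<noteq> 0"
    and B: "\<And>z. z \<in> ball a \<rho> \<Longrightarrow> norm (h z) \<le> B" and \<rho>: "\<rho> > 0" and z: "norm (z - a) \<le> \<rho> / 2"
  shows "norm (deriv h z / h z) \<le> 12 / \<rho> * ln (B / norm (h a))"
proof -
  have sub: "ball z (\<rho> / 2) \<subseteq> ball a \<rho>"
  proof
    fix y assume "y \<in> ball z (\<rho> / 2)"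
    then show "y \<in> ball a \<rho>" using z dist_triangle[of a y z] by (simp add: dist_norm norm_minus_commute)
  qed
  have zin: "z \<in> ball a \<rho>" using z \<rho> by (simp add: dist_norm norm_minus_commute)
  have hz: "h z \<noteq> 0" "h a \<noteq> 0" using h(2) zin \<rho> by auto
  have B0: "B > 0" using B[OF zin] hz by (meson less_le_trans zero_less_norm_iff)
  have "norm (deriv h z / h z) \<le> 2 / (\<rho> / 2) * ln (B / norm (h z))"
    by (rule zero_free_bounds(1)) (use h B sub \<rho> in \<open>auto intro: holomorphic_on_subset\<close>)
  moreover have "ln (B / norm (h z)) \<le> 3 * ln (B / norm (h a))"
    using zero_free_bounds(2)[OF h B \<rho> z] hz B0 by (simp add: ln_div)
  then have "2 / (\<rho> / 2) * ln (B / norm (h z)) \<le> 2 / (\<rho> / 2) * (3 * ln (B / norm (h a)))"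
    using \<rho> by (intro mult_left_mono) auto
  ultimately show ?thesis by simp
qed

text \<open>On the circle \<open>norm (z - \<rho>)\<close> is at least \<open>2 R / 3\<close>, while
  \<open>norm \<rho>\<close> is at most half of that. So dividing by \<open>z - \<rho>\<close>
  halves the ratio of the boundary bound to the value at \<open>0\<close>, which is what the
  induction below runs on.\<close>

lemma strip_zero:
  assumes f: "f holomorphic_on ball 0 R'" "0 < R" "R < R'" "f 0 \<noteq> 0"
    and B: "\<And>z. norm z = R \<Longrightarrow> norm (f z) \<le> B" "B > 0"
    and \<rho>: "norm \<rho> \<le> R / 3" "f \<rho> = 0"
  obtains g where "g holomorphic_on ball 0 R'" "g 0 \<noteq> 0" "\<And>z. norm z = R \<Longrightarrow> norm (g z) \<le> B / (2 * R / 3)"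
    "(B / (2 * R / 3)) / norm (g 0) \<le> (B / norm (f 0)) / 2" "\<And>z. f z = (z - \<rho>) * g z"
    "deriv f 0 / f 0 = deriv g 0 / g 0 - 1 / \<rho>"
proof -
  define g where "g z = (if z = \<rho> then deriv f \<rho> else f z / (z - \<rho>))" for z
  have \<rho>0: "\<rho> \<noteq> 0" using f(4) \<rho>(2) by auto
  have ghol: "g holomorphic_on ball 0 R'"
    using pole_lemma_open[OF f(1) open_ball, of \<rho>] unfolding g_def \<rho>(2) diff_zero by simp
  have fg: "f z = (z - \<rho>) * g z" for z using \<rho>(2) by (simp add: g_def)
  have g0: "g 0 = - (f 0 / \<rho>)" using \<rho>0 by (simp add: g_def)
  have gb: "norm (g z) \<le> B / (2 * R / 3)" if "norm z = R" for z
  proof -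
    have d: "norm (z - \<rho>) \<ge> 2 * R / 3" using norm_triangle_ineq2[of z \<rho>] that \<rho>(1) by simp
    then have "z \<noteq> \<rho>" using f(2) by auto
    then have "norm (g z) = norm (f z) / norm (z - \<rho>)" by (simp add: g_def norm_divide)
    also have "\<dots> \<le> B / (2 * R / 3)" using d B(1)[OF that] B(2) f(2) by (intro frac_le) auto
    finally show ?thesis .
  qed
  have "(B / (2 * R / 3)) / norm (g 0) = B / norm (f 0) * (norm \<rho> / (2 * R / 3))"
    using f(2) \<rho>0 f(4) unfolding g0 by (simp add: norm_divide field_simps)
  also have "\<dots> \<le> B / norm (f 0) * (1 / 2)"
    using \<rho>(1) f(2) B(2) by (intro mult_left_mono) (auto simp: field_simps)
  finally have r: "(B / (2 * R / 3)) / norm (g 0) \<le> (B / norm (f 0)) / 2" by simp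
  have dg: "(g has_field_derivative deriv g 0) (at 0)"
    by (rule holomorphic_derivI[OF ghol]) (use f in auto)
  have "((\<lambda>z. (z - \<rho>) * g z) has_field_derivative 1 * g 0 + deriv g 0 * (0 - \<rho>)) (at 0)"
    by (rule DERIV_mult[OF _ dg]) (auto intro!: derivative_eq_intros)
  moreover have "f = (\<lambda>z. (z - \<rho>) * g z)" using fg by blast
  ultimately have "(f has_field_derivative 1 * g 0 + deriv g 0 * (0 - \<rho>)) (at 0)" by simp
  then have "deriv f 0 = g 0 - \<rho> * deriv g 0" by (simp add: DERIV_imp_deriv)
  moreover have "f 0 = - \<rho> * g 0" using fg[of 0] by simp
  moreover have gn: "g 0 \<noteq> 0" using g0 f(4) \<rho>0 by simp
  ultimately have "deriv f 0 / f 0 = deriv g 0 / g 0 - 1 / \<rho>" using \<rho>0 by (simp add: field_simps)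
  with ghol gn gb r fg show ?thesis using that by blast
qed

text \<open>Landau's local method. Each zero stripped contributes \<open>- 1 / \<rho>\<close> to the
  logarithmic derivative at \<open>0\<close>, with nonnegative real part because
  \<open>Re \<rho> \<le> 0\<close>. What remains has no zero in the disc of radius
  \<open>R / 3\<close>, whence \<open>6 / R = 2 / (R / 3)\<close>.\<close>

lemma landau_log_deriv_lower:
  assumes "f holomorphic_on ball 0 R'" "0 < R" "R < R'" "f 0 \<noteq> 0"
    and "\<And>z. norm z = R \<Longrightarrow> norm (f z) \<le> B"
    and "\<And>z. norm z \<le> R / 3 \<Longrightarrow> f z = 0 \<Longrightarrow> Re z \<le> 0"
  shows "Re (deriv f 0 / f 0) \<ge> - (6 / R * ln (B / norm (f 0)))"
proof -
  have max: "norm (h z) \<le> C" if h: "h holomorphic_on ball 0 R'" "\<And>z. norm z = R \<Longrightarrow> norm (h z) \<le> C" "norm z \<le> R" for h C z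
  proof (rule maximum_modulus_frontier[where S = "cball 0 R" and f = h and \<xi> = z])
    show "h holomorphic_on interior (cball 0 R)" using h(1) assms(3) by (auto intro: holomorphic_on_subset)
    have "cball 0 R \<subseteq> ball (0::complex) R'" using assms(3) by auto
    then show "continuous_on (closure (cball 0 R)) h" using h(1)
      by (simp add: holomorphic_on_imp_continuous_on holomorphic_on_subset)
  qed (use h assms in \<open>auto simp: dist_norm\<close>)
  obtain N :: nat where "B / norm (f 0) < 2 ^ N"
    using real_arch_pow[of 2 "B / norm (f 0)"] by auto
  then show ?thesis using assms(1,4-)
  proof (induction N arbitrary: f B)
    \<comment> \<open>The maximum principle makes the ratio at least \<open>1\<close>, so this case
      is contradictory.\<close>
    case 0
    have "norm (f 0) \<le> B" by (rule max[OF "0.prems"(2) "0.prems"(4)]) (use assms in auto)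
    then show ?case using 0 by (simp add: field_simps)
  next
    case (Suc N)
    have f0: "norm (f 0) \<le> B" by (rule max[OF Suc.prems(2) Suc.prems(4)]) (use assms in auto)
    then have B: "B > 0" using Suc.prems(3) by (meson less_le_trans zero_less_norm_iff)
    show ?case
    proof (cases "\<exists>\<rho>. norm \<rho> \<le> R / 3 \<and> f \<rho> = 0")
      case False
      have "norm (deriv f 0 / f 0) \<le> 2 / (R / 3) * ln (B / norm (f 0))"
      proof (rule zero_free_bounds(1))
        show "f holomorphic_on ball 0 (R / 3)" using Suc.prems(2) assms(2,3) by (rule_tac holomorphic_on_subset) auto
        show "norm (f z) \<le> B" if "z \<in> ball 0 (R / 3)" for z
          by (rule max[OF Suc.prems(2) Suc.prems(4)]) (use that assms(2) in auto)
      qed (use False assms(2) in \<open>auto simp: dist_norm\<close>)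
      then show ?thesis using abs_Re_le_cmod[of "deriv f 0 / f 0"] by simp
    next
      case True
      then obtain \<rho> where \<rho>: "norm \<rho> \<le> R / 3" "f \<rho> = 0" by blast
      obtain g where g: "g holomorphic_on ball 0 R'" "g 0 \<noteq> 0" "\<And>z. norm z = R \<Longrightarrow> norm (g z) \<le> B / (2 * R / 3)"
        "(B / (2 * R / 3)) / norm (g 0) \<le> (B / norm (f 0)) / 2" "\<And>z. f z = (z - \<rho>) * g z"
        "deriv f 0 / f 0 = deriv g 0 / g 0 - 1 / \<rho>"
        using strip_zero[OF Suc.prems(2) assms(2,3) Suc.prems(3,4) B \<rho>] by blast
      have lt: "(B / (2 * R / 3)) / norm (g 0) < 2 ^ N" using g(4) Suc.prems(1) by simp
      have "Re (deriv g 0 / g 0) \<ge> - (6 / R * ln ((B / (2 * R / 3)) / norm (g 0)))"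
        by (rule Suc.IH[OF lt g(1,2,3)]) (use Suc.prems(5) g(5) in auto)
      moreover have "ln ((B / (2 * R / 3)) / norm (g 0)) \<le> ln (B / norm (f 0))"
      proof (rule ln_mono)
        show "0 < (B / (2 * R / 3)) / norm (g 0)" using B assms(2) g(2) by simp
        have "B / norm (f 0) > 0" using B Suc.prems(3) by simp
        then show "(B / (2 * R / 3)) / norm (g 0) \<le> B / norm (f 0)" by (intro order_trans[OF g(4)]) simp
      qed
      then have "6 / R * ln ((B / (2 * R / 3)) / norm (g 0)) \<le> 6 / R * ln (B / norm (f 0))"
        using assms(2) by (intro mult_left_mono) auto
      moreover have "Re (1 / \<rho>) \<le> 0"
        using Suc.prems(5)[OF \<rho>] by (simp add: Re_divide divide_nonpos_nonneg)
      ultimately show ?thesis unfolding g(6) by simp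
    qed
  qed
qed

text \<open>The zero at distance \<open>\<delta>\<close> on the negative real axis is stripped first
  and retains its full contribution \<open>1 / \<delta>\<close>.\<close>

lemma landau_log_deriv_lower_zero:
  assumes "f holomorphic_on ball 0 R'" "0 < R" "R < R'" "f 0 \<noteq> 0"
    and "\<And>z. norm z = R \<Longrightarrow> norm (f z) \<le> B" "B > 0"
    and "\<And>z. norm z \<le> R / 3 \<Longrightarrow> f z = 0 \<Longrightarrow> Re z \<le> 0"
    and \<delta>: "0 < \<delta>" "\<delta> \<le> R / 3" "f (- of_real \<delta>) = 0"
  shows "Re (deriv f 0 / f 0) \<ge> 1 / \<delta> - 6 / R * ln (B / norm (f 0))"
proof -
  have n: "norm (- of_real \<delta> :: complex) \<le> R / 3" using \<delta> by simp
  obtain g where g: "g holomorphic_on ball 0 R'" "g 0 \<noteq> 0" "\<And>z. norm z = R \<Longrightarrow> norm (g z) \<le> B / (2 * R / 3)"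
    "(B / (2 * R / 3)) / norm (g 0) \<le> (B / norm (f 0)) / 2" "\<And>z. f z = (z - - of_real \<delta>) * g z"
    "deriv f 0 / f 0 = deriv g 0 / g 0 - 1 / (- of_real \<delta>)"
    using strip_zero[OF assms(1-6) n \<delta>(3)] by blast
  have "Re (deriv g 0 / g 0) \<ge> - (6 / R * ln ((B / (2 * R / 3)) / norm (g 0)))"
    by (rule landau_log_deriv_lower[OF g(1) assms(2,3) g(2,3)]) (use assms(7) g(5) in auto)
  moreover have "ln ((B / (2 * R / 3)) / norm (g 0)) \<le> ln (B / norm (f 0))"
  proof (rule ln_mono)
    show "0 < (B / (2 * R / 3)) / norm (g 0)" using assms g(2) by simp
    have "B / norm (f 0) > 0" using assms by simp
    then show "(B / (2 * R / 3)) / norm (g 0) \<le> B / norm (f 0)" by (intro order_trans[OF g(4)]) simp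
  qed
  then have "6 / R * ln ((B / (2 * R / 3)) / norm (g 0)) \<le> 6 / R * ln (B / norm (f 0))"
    using assms(2) by (intro mult_left_mono) auto
  moreover have "Re (1 / (- of_real \<delta>)) = - (1 / \<delta>)" by (simp add: Re_divide_of_real)
  ultimately show ?thesis unfolding g(6) by simp
qed

section \<open>Lower bounds for L-functions to the right of the line Re s = 1\<close>

text \<open>Telescoping with \<open>1 / m\<^sup>2 \<le> 1 / (m - 1 / 2) - 1 / (m + 1 / 2)\<close> at
  \<open>m = n + 2\<close>.\<close>

lemma sum_inverse_squares_from_2: "(\<Sum>n<N. 1 / (real n + 2)\<^sup>2) \<le> 2 / 3 - 1 / (real N + 3 / 2)"
proof (induction N)
  case (Suc N)
  have "1 / (real N + 2)\<^sup>2 \<le> 1 / (real N + 3 / 2) - 1 / (real N + 5 / 2)"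
    by (simp add: divide_simps power2_eq_square) (simp add: algebra_simps)
  then show ?case using Suc by (simp add: add_ac)
qed simp

text \<open>The first term of the series is \<open>1\<close> and all others together have norm at
  most \<open>2 / 3\<close>.\<close>

lemma norm_Lfun_at_2_ge:
  assumes \<theta>: "dchar r \<theta>" "nonprincipal r \<theta>" and s: "Re s = 2"
  shows "norm (Lfun \<theta> s) \<ge> 1 / 3"
proof -
  have z: "\<theta> 0 = 0" using nonprincipal_zero[OF \<theta>] .
  have b1: "norm (\<theta> n) \<le> 1 + ln (real n)" if "n > 0" for n
  proof -
    have "ln (real n) \<ge> 0" using that by simp
    then show ?thesis using dcharD(5)[OF \<theta>(1), of n] by linarith
  qed
  have sm: "summable (\<lambda>n. norm (\<theta> n * dz n s))" by (rule dser_norm_summable[OF z b1]) (use s in auto)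
  have "dser \<theta> s = (\<Sum>n. \<theta> (n + 2) * dz (n + 2) s) + (\<Sum>n<2. \<theta> n * dz n s)"
    unfolding dser_def by (rule suminf_split_initial_segment[OF summable_norm_cancel[OF sm]])
  also have "(\<Sum>n<2. \<theta> n * dz n s) = 1"
    using dcharD(4)[OF \<theta>(1)] z by (simp add: numeral_2_eq_2 dz_def)
  finally have e: "Lfun \<theta> s = (\<Sum>n. \<theta> (n + 2) * dz (n + 2) s) + 1" using Lfun_eq_dser[OF \<theta>, of s] s by simp
  have sm2: "summable (\<lambda>n. norm (\<theta> (n + 2) * dz (n + 2) s))" using sm by (subst summable_iff_shift)
  have "norm (\<Sum>n. \<theta> (n + 2) * dz (n + 2) s) \<le> (\<Sum>n. norm (\<theta> (n + 2) * dz (n + 2) s))"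
    by (rule summable_norm[OF sm2])
  also have "\<dots> \<le> 2 / 3"
  proof (rule suminf_le_const[OF sm2])
    fix N
    have "(\<Sum>n<N. norm (\<theta> (n + 2) * dz (n + 2) s)) \<le> (\<Sum>n<N. 1 / (real n + 2)\<^sup>2)"
    proof (intro sum_mono)
      fix n
      have "norm (\<theta> (n + 2) * dz (n + 2) s) \<le> 1 * real (n + 2) powr (- 2)"
        unfolding norm_mult using dcharD(5)[OF \<theta>(1)] s by (intro mult_mono) (auto simp: norm_dz)
      also have "\<dots> = 1 / (real n + 2)\<^sup>2" by (simp add: powr_minus divide_inverse)
      finally show "norm (\<theta> (n + 2) * dz (n + 2) s) \<le> 1 / (real n + 2)\<^sup>2" .
    qed
    also have "\<dots> \<le> 2 / 3 - 1 / (real N + 3 / 2)" by (rule sum_inverse_squares_from_2)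
    also have "\<dots> \<le> 2 / 3" by simp
    finally show "(\<Sum>n<N. norm (\<theta> (n + 2) * dz (n + 2) s)) \<le> 2 / 3" .
  qed
  finally have "norm (\<Sum>n. \<theta> (n + 2) * dz (n + 2) s) \<le> 2 / 3" .
  then show ?thesis unfolding e
    using norm_triangle_ineq2[of 1 "- (\<Sum>n. \<theta> (n + 2) * dz (n + 2) s)"] by (simp add: add.commute)
qed

text \<open>
  Since \<open>L' = - D L\<close> with \<open>norm D \<le> 1 / (x - 1) + 3\<close>, the function
  \<open>norm (L (x + i t))^2 (x - 1)^(-2) exp (- 6 x)\<close> decreases in \<open>x\<close>; compare with \<open>x = 2\<close>.
\<close>
lemma norm_Lfun_ge:
  assumes \<theta>: "dchar r \<theta>" "nonprincipal r \<theta>" and s: "1 < Re s" "Re s \<le> 2"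
  shows "norm (Lfun \<theta> s) \<ge> (Re s - 1) * exp (- 3) / 3"
proof -
  define t where "t = Im s"
  define z where "z x = Lfun \<theta> (Complex x t)" for x
  define D where "D x = Ldser \<theta> (Complex x t)" for x
  define h where "h x = (Re (z x))\<^sup>2 + (Im (z x))\<^sup>2" for x
  define g where "g x = h x * (1 / (x - 1)\<^sup>2) * exp (- 6 * x)" for x
  have dz: "(z has_vector_derivative - (D x * z x)) (at x)" if "x > 1" for x
  proof -
    have 1: "((\<lambda>x. Complex x t) has_vector_derivative 1) (at x)"
      unfolding Complex_eq by (auto intro!: derivative_eq_intros)
    have "((Lfun \<theta> \<circ> (\<lambda>x. Complex x t)) has_vector_derivative 1 * - (D x * z x)) (at x)"
      unfolding D_def z_def by (rule field_vector_diff_chain_at[OF 1 Lfun_has_derivative[OF \<theta>]]) (use that in simp)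
    moreover have "Lfun \<theta> \<circ> (\<lambda>x. Complex x t) = z" by (auto simp: z_def)
    ultimately show ?thesis by simp
  qed
  have dh: "(h has_real_derivative - 2 * Re (D x) * h x) (at x)" if "x > 1" for x
  proof -
    have dR: "((\<lambda>x. Re (z x)) has_real_derivative Re (- (D x * z x))) (at x)"
      using bounded_linear.has_vector_derivative[OF bounded_linear_Re dz[OF that]] by (simp only: has_real_derivative_iff_has_vector_derivative)
    have dI: "((\<lambda>x. Im (z x)) has_real_derivative Im (- (D x * z x))) (at x)"
      using bounded_linear.has_vector_derivative[OF bounded_linear_Im dz[OF that]] by (simp only: has_real_derivative_iff_has_vector_derivative)
    show ?thesis unfolding h_def
      by (rule DERIV_cong[OF DERIV_add[OF DERIV_power[OF dR] DERIV_power[OF dI]]])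
         (simp add: algebra_simps power2_eq_square)
  qed
  have "g 2 \<le> g (Re s)"
  proof (rule DERIV_nonpos_imp_nonincreasing[OF s(2)])
    fix x assume x: "Re s \<le> x" "x \<le> 2"
    then have x1: "x > 1" using s by simp
    have d1: "((\<lambda>x. 1 / (x - 1)\<^sup>2) has_real_derivative - 2 / (x - 1) * (1 / (x - 1)\<^sup>2)) (at x)"
    proof -
      define y where "y = x - 1"
      have y: "y > 0" using x1 by (simp add: y_def)
      have eq: "(0 * y\<^sup>2 - 1 * (of_nat 2 * ((1 - 0) * y ^ (2 - Suc 0)))) / (y\<^sup>2 * y\<^sup>2) = - 2 / y * (1 / y\<^sup>2)"
        using y by (simp add: field_simps power2_eq_square)
      show ?thesis
        by (rule DERIV_cong[OF DERIV_divide[OF DERIV_const DERIV_power[OF DERIV_diff[OF DERIV_ident DERIV_const]]]])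
           (use y eq in \<open>auto simp: y_def\<close>)
    qed
    have d2: "((\<lambda>x. exp (- 6 * x)) has_real_derivative - 6 * exp (- 6 * x)) (at x)"
      by (auto intro!: derivative_eq_intros)
    have alg: "(- 2 * R * H * P + q * P * H) * E + - 6 * E * (H * P) = (- 2 * R + q - 6) * (H * (P * E))"
      for R H P q E :: real by (simp add: algebra_simps)
    let ?P = "(1 / (x - 1)\<^sup>2) * exp (- 6 * x)"
    have dg: "(g has_real_derivative (- 2 * Re (D x) + - 2 / (x - 1) - 6) * (h x * ?P)) (at x)"
      unfolding g_def
      by (rule DERIV_cong[OF DERIV_mult[OF DERIV_mult[OF dh[OF x1] d1] d2]]) (rule alg)
    have "- Re (D x) \<le> norm (D x)" using abs_Re_le_cmod[of "D x"] by linarith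
    also have "\<dots> \<le> Zr x" unfolding D_def using norm_Ldser_le[of \<theta> "Complex x t"] dcharD(5)[OF \<theta>(1)] x1 by simp
    also have "\<dots> \<le> 1 / (x - 1) + 3 * (x - 1)" using x1 x by (intro Zr_le) auto
    also have "\<dots> \<le> 1 / (x - 1) + 3" using x by simp
    finally have "- 2 * Re (D x) + - 2 / (x - 1) - 6 \<le> 0" by simp
    then have "(- 2 * Re (D x) + - 2 / (x - 1) - 6) * (h x * ?P) \<le> 0"
      unfolding h_def by (intro mult_nonpos_nonneg mult_nonneg_nonneg) auto
    then show "\<exists>y. (g has_real_derivative y) (at x) \<and> y \<le> 0" using dg by blast
  qed
  moreover have hn: "h x = (norm (z x))\<^sup>2" for x unfolding h_def cmod_power2 ..
  have "norm (z 2) \<ge> 1 / 3" unfolding z_def by (rule norm_Lfun_at_2_ge[OF \<theta>]) simp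
  then have "(norm (z 2))\<^sup>2 \<ge> (1 / 3)\<^sup>2" by (intro power_mono) auto
  then have "g 2 \<ge> (1 / 3)\<^sup>2 * exp (- 12)" unfolding g_def hn by simp
  ultimately have "(1 / 3)\<^sup>2 * exp (- 12) \<le> g (Re s)" by linarith
  then have le: "(1 / 3)\<^sup>2 * exp (- 12) \<le> (norm (Lfun \<theta> s))\<^sup>2 * (1 / (Re s - 1)\<^sup>2) * exp (- 6 * Re s)"
    unfolding g_def hn z_def t_def complex_surj .
  have "(1 / 3)\<^sup>2 * exp (- 12) * exp (6 * Re s) \<le> (norm (Lfun \<theta> s))\<^sup>2 * (1 / (Re s - 1)\<^sup>2) * exp (- 6 * Re s) * exp (6 * Re s)"
    using le by (intro mult_right_mono) auto
  also have "\<dots> = (norm (Lfun \<theta> s))\<^sup>2 / (Re s - 1)\<^sup>2"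
    by (simp add: mult.assoc exp_add[symmetric])
  finally have "(1 / 3)\<^sup>2 * exp (6 * Re s - 12) \<le> (norm (Lfun \<theta> s))\<^sup>2 / (Re s - 1)\<^sup>2"
    by (simp add: exp_diff exp_minus field_simps)
  moreover have "exp (- 6) \<le> exp (6 * Re s - 12)" using s by simp
  then have "(1 / 3)\<^sup>2 * exp (- 6) \<le> (1 / 3)\<^sup>2 * exp (6 * Re s - 12)" by (rule mult_left_mono) simp
  ultimately have "(1 / 3)\<^sup>2 * exp (- 6) \<le> (norm (Lfun \<theta> s))\<^sup>2 / (Re s - 1)\<^sup>2" by linarith
  moreover have "(1 / 3)\<^sup>2 * exp (- 6) = (exp (- 3) / 3 :: real)\<^sup>2"
    by (simp add: power2_eq_square exp_add[symmetric])
  moreover have "(norm (Lfun \<theta> s))\<^sup>2 / (Re s - 1)\<^sup>2 = (norm (Lfun \<theta> s) / (Re s - 1))\<^sup>2" by (simp add: power_divide)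
  ultimately have "(exp (- 3) / 3)\<^sup>2 \<le> (norm (Lfun \<theta> s) / (Re s - 1))\<^sup>2" by simp
  then have "exp (- 3) / 3 \<le> norm (Lfun \<theta> s) / (Re s - 1)"
    by (rule power2_le_imp_le) (use s in simp)
  then show ?thesis using s by (simp add: field_simps)
qed

lemma Lfun_nonzero:
  assumes "dchar r \<theta>" "nonprincipal r \<theta>" "1 < Re s" "Re s \<le> 2"
  shows "Lfun \<theta> s \<noteq> 0"
  using norm_Lfun_ge[OF assms] assms(3) by (auto simp: field_simps)

lemma Ldser_eq_log_deriv:
  assumes "dchar r \<theta>" "nonprincipal r \<theta>" "1 < Re s" "Re s \<le> 2"
  shows "Ldser \<theta> s = - (deriv (Lfun \<theta>) s / Lfun \<theta> s)"
  using DERIV_imp_deriv[OF Lfun_has_derivative[OF assms(1,2,3)]] Lfun_nonzero[OF assms] by simp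

section \<open>Repulsion of zeros\<close>

text \<open>\<open>T\<close> is large enough for \<open>ln_ratio_bound\<close>. The argument of
  \<open>ln\<close> is the upper bound \<open>3 * zsum (3 / 2) * T ^ 3\<close> for the L-function
  divided by its lower bound at distance \<open>1 / (28000 * ln T)\<close> to the right of the line
  \<open>Re s = 1\<close>.\<close>

definition Tok :: "real \<Rightarrow> bool" where
  "Tok T \<longleftrightarrow> T \<ge> 3 \<and> ln (3 * zsum (3 / 2) * T ^ 3 * (3 * exp 3 * 28000 * ln T)) \<le> 5 * ln T"

lemma zsum_pos: "a > 1 \<Longrightarrow> zsum a > 0"
  unfolding zsum_def by (rule suminf_pos[OF zsum_summable]) auto

lemma eventually_Tok: "eventually Tok at_top"
proof -
  define c where "c = ln (3 * zsum (3 / 2) * (3 * exp 3 * 28000))"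
  have "eventually (\<lambda>T::real. T \<ge> 3 \<and> c + 3 * ln T + ln (ln T) \<le> 5 * ln T) at_top"
    by (intro eventually_conj eventually_ge_at_top) real_asymp
  then show ?thesis
  proof eventually_elim
    case (elim T)
    have l: "ln T > 0" using elim by simp
    have z: "zsum (3 / 2) > 0" by (rule zsum_pos) simp
    have "3 * zsum (3 / 2) * T ^ 3 * (3 * exp 3 * 28000 * ln T) = (3 * zsum (3 / 2) * (3 * exp 3 * 28000)) * (T ^ 3 * ln T)"
      by simp
    also have "ln \<dots> = c + (3 * ln T + ln (ln T))"
      unfolding c_def using z l elim by (subst ln_mult) (auto simp: ln_mult ln_realpow)
    finally show ?case using elim unfolding Tok_def by simp
  qed
qed

lemma TokD:
  assumes "Tok T"
  shows "T \<ge> 3" "ln T \<ge> 1"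
proof -
  show T: "T \<ge> 3" using assms by (simp add: Tok_def)
  then have "exp 1 \<le> T" using e_less_272 by linarith
  then show "ln T \<ge> 1" using T by (subst ln_ge_iff) auto
qed

lemma ln_ratio_bound:
  assumes T: "Tok T" and \<theta>: "dchar r \<theta>" "nonprincipal r \<theta>" and s: "1 + 1 / (28000 * ln T) \<le> Re s" "Re s \<le> 2"
  shows "ln (3 * zsum (3 / 2) * T ^ 3 / norm (Lfun \<theta> s)) \<le> 5 * ln T"
proof -
  have T3: "T \<ge> 3" "ln T \<ge> 1" using TokD[OF T] .
  have z: "zsum (3 / 2) > 0" by (rule zsum_pos) simp
  have s1: "1 < Re s" using s(1) T3 by (smt (verit) divide_pos_pos mult_pos_pos)
  have "1 / (28000 * ln T) * exp (- 3) / 3 \<le> (Re s - 1) * exp (- 3) / 3"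
    using s(1) by (intro divide_right_mono mult_right_mono) auto
  also have "\<dots> \<le> norm (Lfun \<theta> s)" by (rule norm_Lfun_ge[OF \<theta> s1 s(2)])
  finally have low: "1 / (28000 * ln T) * exp (- 3) / 3 \<le> norm (Lfun \<theta> s)" .
  have p: "1 / (28000 * ln T) * exp (- 3) / 3 > 0" using T3 by simp
  have np: "norm (Lfun \<theta> s) > 0" by (rule order.strict_trans2[OF p low])
  have "3 * zsum (3 / 2) * T ^ 3 / norm (Lfun \<theta> s) \<le> 3 * zsum (3 / 2) * T ^ 3 / (1 / (28000 * ln T) * exp (- 3) / 3)"
    using z T3 by (intro divide_left_mono[OF low] mult_pos_pos np p) auto
  also have "\<dots> = 3 * zsum (3 / 2) * T ^ 3 * (3 * exp 3 * 28000 * ln T)"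
    by (simp add: exp_minus field_simps)
  finally have "ln (3 * zsum (3 / 2) * T ^ 3 / norm (Lfun \<theta> s)) \<le> ln (3 * zsum (3 / 2) * T ^ 3 * (3 * exp 3 * 28000 * ln T))"
    using z T3 np by (intro ln_mono divide_pos_pos mult_pos_pos) auto
  then show ?thesis using T unfolding Tok_def by linarith
qed

lemma norm_Lfun_le_T:
  assumes T: "Tok T" and \<theta>: "dchar r \<theta>" "nonprincipal r \<theta>" "real r \<le> T\<^sup>2"
    and s: "Re s \<ge> 1 / 2" "norm s \<le> 3 * T"
  shows "norm (Lfun \<theta> s) \<le> 3 * zsum (3 / 2) * T ^ 3"
proof -
  have z: "zsum (3 / 2) > 0" by (rule zsum_pos) simp
  have "norm (Lfun \<theta> s) \<le> real r * norm s * zsum (3 / 2)" by (rule norm_Lfun_le[OF \<theta>(1,2) s(1)])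
  also have "\<dots> \<le> T\<^sup>2 * (3 * T) * zsum (3 / 2)" using \<theta>(3) s(2) z by (intro mult_right_mono mult_mono) auto
  also have "\<dots> = 3 * zsum (3 / 2) * T ^ 3" by (simp add: power2_eq_square power3_eq_cube)
  finally show ?thesis .
qed

text \<open>Landau's method in the disc of radius \<open>1 / 2\<close> around \<open>s\<close> gives
  \<open>6 / (1 / 2) * 5 = 60\<close>. A zero at the height of \<open>s\<close> is at distance at
  most \<open>1 / 1000 + 1 / 7000 = 8 / 7000\<close> in units of \<open>1 / ln T\<close> and
  therefore contributes at least \<open>875 * ln T\<close>.\<close>

lemma Re_Ldser_le:
  assumes T: "Tok T" and \<theta>: "dchar r \<theta>" "nonprincipal r \<theta>" "real r \<le> T\<^sup>2"
    and s: "Re s = 1 + 1 / (1000 * ln T)" "\<bar>Im s\<bar> \<le> 2 * T"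
  shows "Re (Ldser \<theta> s) \<le> 60 * ln T"
    and "Lfun \<theta> (Complex \<beta> (Im s)) = 0 \<Longrightarrow> \<beta> \<ge> 1 - 1 / (7000 * ln T) \<Longrightarrow> \<beta> \<le> 1 \<Longrightarrow>
      Re (Ldser \<theta> s) \<le> 60 * ln T - 875 * ln T"
proof -
  have T3: "T \<ge> 3" "ln T \<ge> 1" using TokD[OF T] .
  have q: "1 / (1000 * ln T) \<le> 1 / 1000" "1 / (1000 * ln T) > 0" "1 / (28000 * ln T) \<le> 1 / (1000 * ln T)"
    using T3 by (auto simp: field_simps)
  have s12: "1 < Re s" "Re s \<le> 2" "1 + 1 / (28000 * ln T) \<le> Re s" using s(1) q by linarith+
  define f where "f z = Lfun \<theta> (s + z)" for z
  define B where "B = 3 * zsum (3 / 2) * T ^ 3"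
  have B: "B > 0" unfolding B_def using zsum_pos[of "3/2"] T3 by simp
  have fhol: "f holomorphic_on ball 0 1"
  proof -
    have "(Lfun \<theta> \<circ> (\<lambda>z. s + z)) holomorphic_on ball 0 1"
    proof (rule holomorphic_on_compose_gen[OF _ Lfun_holomorphic[OF \<theta>(1,2)]])
      show "(\<lambda>z. s + z) ` ball 0 1 \<subseteq> {s. 0 < Re s}"
      proof safe
        fix z :: complex assume "z \<in> ball 0 1"
        then have "norm z < 1" by simp
        then show "0 < Re (s + z)" using abs_Re_le_cmod[of z] s12(1) by simp
      qed
    qed (intro holomorphic_intros)
    moreover have "Lfun \<theta> \<circ> (\<lambda>z. s + z) = f" by (auto simp: f_def)
    ultimately show ?thesis by simp
  qed
  have f0: "f 0 \<noteq> 0" using Lfun_nonzero[OF \<theta>(1,2) s12(1,2)] by (simp add: f_def)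
  have fB: "norm (f z) \<le> B" if z: "norm z = 1 / 2" for z
    unfolding f_def B_def
  proof (rule norm_Lfun_le_T[OF T \<theta>])
    show "Re (s + z) \<ge> 1 / 2" using abs_Re_le_cmod[of z] z s12(1) by simp
    have "norm (s + z) \<le> \<bar>Re s\<bar> + \<bar>Im s\<bar> + norm z"
      using norm_triangle_ineq[of s z] cmod_le[of s] by linarith
    also have "\<dots> \<le> 3 * T" using s12 s(2) z T3 by simp
    finally show "norm (s + z) \<le> 3 * T" .
  qed
  have fz: "Re z \<le> 0" if z: "norm z \<le> 1 / 2 / 3" "f z = 0" for z
  proof (rule ccontr)
    assume "\<not> Re z \<le> 0"
    then have "1 < Re (s + z)" using s12 by simp
    moreover have "Re (s + z) \<le> 2" using abs_Re_le_cmod[of z] z(1) s(1) q unfolding plus_complex.sel by linarith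
    ultimately show False using Lfun_nonzero[OF \<theta>(1,2)] z(2) by (simp add: f_def)
  qed
  have lr: "ln (B / norm (f 0)) \<le> 5 * ln T"
    unfolding B_def f_def using ln_ratio_bound[OF T \<theta>(1,2) s12(3,2)] by simp
  have df: "deriv f 0 / f 0 = deriv (Lfun \<theta>) s / Lfun \<theta> s"
  proof -
    have "(Lfun \<theta> has_field_derivative deriv (Lfun \<theta>) s) (at (s + 0))"
      using holomorphic_derivI[OF Lfun_holomorphic[OF \<theta>(1,2)] open_halfspace_Re_gt, of s] s12 by simp
    then have "(f has_field_derivative deriv (Lfun \<theta>) s * 1) (at 0)"
      unfolding f_def by (intro DERIV_chain2[of "Lfun \<theta>"]) (auto intro!: derivative_eq_intros)
    then show ?thesis by (simp add: DERIV_imp_deriv f_def)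
  qed
  have D: "Re (Ldser \<theta> s) = - Re (deriv f 0 / f 0)"
    unfolding df Ldser_eq_log_deriv[OF \<theta>(1,2) s12(1,2)] by simp
  have "Re (deriv f 0 / f 0) \<ge> - (6 / (1 / 2) * ln (B / norm (f 0)))"
    by (rule landau_log_deriv_lower[OF fhol _ _ f0 fB fz]) auto
  then show "Re (Ldser \<theta> s) \<le> 60 * ln T" unfolding D using lr by simp
  assume \<beta>: "Lfun \<theta> (Complex \<beta> (Im s)) = 0" "\<beta> \<ge> 1 - 1 / (7000 * ln T)" "\<beta> \<le> 1"
  define \<delta> where "\<delta> = Re s - \<beta>"
  have \<delta>: "0 < \<delta>" unfolding \<delta>_def using s12 \<beta>(3) by simp
  have dle: "\<delta> \<le> 8 / (7000 * ln T)" unfolding \<delta>_def s(1) using \<beta>(2) by (simp add: field_simps)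
  have "8 / (7000 * ln T) \<le> 1 / 2 / 3" using T3 by (simp add: field_simps)
  then have \<delta>6: "\<delta> \<le> 1 / 2 / 3" using dle by linarith
  have "s + - of_real \<delta> = Complex \<beta> (Im s)" unfolding \<delta>_def by (simp add: complex_eq_iff)
  then have fd: "f (- of_real \<delta>) = 0" using \<beta>(1) by (simp add: f_def)
  have "Re (deriv f 0 / f 0) \<ge> 1 / \<delta> - 6 / (1 / 2) * ln (B / norm (f 0))"
    by (rule landau_log_deriv_lower_zero[OF fhol _ _ f0 fB B fz \<delta> \<delta>6 fd]) auto
  moreover have "1 / \<delta> \<ge> 875 * ln T"
  proof -
    have "1 / (8 / (7000 * ln T)) \<le> 1 / \<delta>" using \<delta> dle T3 by (intro divide_left_mono) auto
    then show ?thesis by simp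
  qed
  ultimately show "Re (Ldser \<theta> s) \<le> 60 * ln T - 875 * ln T" unfolding D using lr by simp
qed


text \<open>The box ends at \<open>Re s = 1\<close>, since beyond that line
  \<open>Lfun_nonzero\<close> takes over.\<close>

definition good_char :: "real \<Rightarrow> (nat \<Rightarrow> complex) \<Rightarrow> bool" where
  "good_char T \<theta> \<longleftrightarrow> (\<forall>s. 1 - 1 / (7000 * ln T) \<le> Re s \<and> Re s \<le> 1 \<and> \<bar>Im s\<bar> \<le> T \<longrightarrow> Lfun \<theta> s \<noteq> 0)"

lemma Zr_eq_Re_terms:
  assumes "x > 1"
  shows "(\<lambda>n. mangoldt n * real n powr (- x)) sums Zr x"
  unfolding Zr_def by (rule summable_sums[OF Zr_summable[OF assms]])

lemma Ldser_sums:
  assumes "\<And>n. norm (\<theta> n) \<le> 1" "Re s > 1"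
  shows "(\<lambda>n. mangoldt n * \<theta> n * dz n s) sums Ldser \<theta> s"
  unfolding Ldser_def dser_def
  by (rule summable_sums[OF summable_norm_cancel[OF Ldser_summable[OF assms]]])

text \<open>
  The positivity of \<open>norm (1 + a + b)^2\<close> with \<open>a = \<theta> n n^(-i t)\<close> and \<open>b = \<psi> n n^(-i u)\<close>: zeros of
  both L-functions close to the line \<open>Re s = 1\<close> would contribute \<open>-4\<close> against the \<open>3\<close> poles.
\<close>
lemma log_deriv_positivity:
  assumes \<theta>: "\<And>n. norm (\<theta> n) \<le> 1" and \<psi>: "\<And>n. norm (\<psi> n) \<le> 1" and x: "x > 1"
  shows "0 \<le> 3 * Zr x + 2 * Re (Ldser \<theta> (Complex x t)) + 2 * Re (Ldser \<psi> (Complex x u))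
     + 2 * Re (Ldser (\<lambda>n. \<theta> n * cnj (\<psi> n)) (Complex x (t - u)))"
proof (rule sums_le[of "\<lambda>_. 0"])
  have \<theta>\<psi>: "norm (\<theta> n * cnj (\<psi> n)) \<le> 1" for n
    unfolding norm_mult complex_mod_cnj using \<theta>[of n] \<psi>[of n] by (intro mult_le_one) auto
  let ?f = "\<lambda>n. 3 * (mangoldt n * real n powr (- x)) + 2 * Re (mangoldt n * \<theta> n * dz n (Complex x t))
    + 2 * Re (mangoldt n * \<psi> n * dz n (Complex x u)) + 2 * Re (mangoldt n * (\<theta> n * cnj (\<psi> n)) * dz n (Complex x (t - u)))"
  show "?f sums (3 * Zr x + 2 * Re (Ldser \<theta> (Complex x t)) + 2 * Re (Ldser \<psi> (Complex x u))
     + 2 * Re (Ldser (\<lambda>n. \<theta> n * cnj (\<psi> n)) (Complex x (t - u))))"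
    using x \<theta> \<psi> \<theta>\<psi> by (intro sums_add sums_mult sums_Re Zr_eq_Re_terms Ldser_sums) auto
  show "(\<lambda>_. 0 :: real) sums 0" by simp
  fix n
  show "0 \<le> ?f n"
  proof (cases "n = 0")
    case False
    define w where "w v = cis (- (v * ln (real n)))" for v
    define a b where "a = \<theta> n * w t" and "b = \<psi> n * w u"
    have dzw: "dz n (Complex x v) = of_real (real n powr (- x)) * w v" for v
      unfolding dz_def w_def using False
      by (simp add: Complex_eq exp_diff exp_minus powr_def cis_conv_exp exp_of_real[symmetric] algebra_simps)
         (simp add: exp_add[symmetric] exp_minus[symmetric] divide_inverse mult_ac)
    have w: "w (t - u) = w t * cnj (w u)" unfolding w_def by (simp add: cis_cnj cis_mult algebra_simps)
    have na: "norm a \<le> 1" "norm b \<le> 1" using \<theta>[of n] \<psi>[of n] by (auto simp: a_def b_def w_def norm_mult)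
    have "(norm (1 + a + b))\<^sup>2 = 1 + (norm a)\<^sup>2 + (norm b)\<^sup>2 + 2 * Re a + 2 * Re b + 2 * Re (a * cnj b)"
      unfolding cmod_power2 by (simp add: power2_eq_square algebra_simps)
    moreover have "(norm a)\<^sup>2 \<le> 1" "(norm b)\<^sup>2 \<le> 1" using na by (auto simp: power_le_one)
    ultimately have "0 \<le> 3 + 2 * Re a + 2 * Re b + 2 * Re (a * cnj b)"
      by (smt (verit) zero_le_power2)
    then have "0 \<le> (mangoldt n * real n powr (- x)) * (3 + 2 * Re a + 2 * Re b + 2 * Re (a * cnj b))"
      by (intro mult_nonneg_nonneg) (auto simp: mangoldt_nonneg)
    also have "\<dots> = ?f n"
    proof -
      define m where "m = (mangoldt n :: real)"
      have m: "mangoldt n = complex_of_real m" by (simp add: m_def)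
      have 1: "Re (complex_of_real m * c * (of_real y * d)) = m * y * Re (c * d)" for c d y
        by (simp add: algebra_simps)
      have 2: "a * cnj b = \<theta> n * cnj (\<psi> n) * w (t - u)" unfolding a_def b_def w by simp
      show ?thesis unfolding dzw m 1 2 m_def[symmetric] unfolding a_def b_def by (simp add: algebra_simps)
    qed
    finally show ?thesis .
  qed simp
qed

text \<open>At \<open>x = 1 + 1 / (1000 * ln T)\<close> the coefficients of \<open>ln T\<close> in
  \<open>log_deriv_positivity\<close> add up to
  \<open>3 * 1000 + 4 * (60 - 875) + 2 * 60 = - 140\<close>, and \<open>3 * 3 = 9\<close> is left
  over; this is negative. The hypothesis \<open>np\<close> ensures that the mixed term has no
  pole.\<close>

lemma zero_repulsion:
  assumes T: "Tok T" and \<theta>: "dchar r \<theta>" "nonprincipal r \<theta>" "real r \<le> T"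
    and \<psi>: "dchar q \<psi>" "nonprincipal q \<psi>" "real q \<le> T"
    and np: "nonprincipal (r * q) (\<lambda>n. \<theta> n * cnj (\<psi> n))"
  shows "good_char T \<theta> \<or> good_char T \<psi>"
proof (rule ccontr)
  assume "\<not> ?thesis"
  then obtain s1 s2 where s1: "1 - 1 / (7000 * ln T) \<le> Re s1" "Re s1 \<le> 1" "\<bar>Im s1\<bar> \<le> T" "Lfun \<theta> s1 = 0"
    and s2: "1 - 1 / (7000 * ln T) \<le> Re s2" "Re s2 \<le> 1" "\<bar>Im s2\<bar> \<le> T" "Lfun \<psi> s2 = 0"
    unfolding good_char_def by blast
  have T3: "T \<ge> 3" "ln T \<ge> 1" using TokD[OF T] .
  define x where "x = 1 + 1 / (1000 * ln T)"
  have x: "x > 1" "x \<le> 2" "x - 1 \<le> 1" using T3 by (auto simp: x_def field_simps)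
  have TT: "T \<le> T\<^sup>2" using T3 by (simp add: power2_eq_square)
  have dcc: "dchar (r * q) (\<lambda>n. \<theta> n * cnj (\<psi> n))" using dchar_mult[OF \<theta>(1) dchar_cnj[OF \<psi>(1)]] .
  have rq: "real (r * q) \<le> T\<^sup>2" using \<theta>(3) \<psi>(3) by (simp add: power2_eq_square mult_mono)
  have "Re (Ldser \<theta> (Complex x (Im s1))) \<le> 60 * ln T - 875 * ln T"
    by (rule Re_Ldser_le(2)[OF T \<theta>(1,2), where \<beta> = "Re s1"]) (use \<theta>(3) TT s1 T3 in \<open>auto simp: x_def\<close>)
  moreover have "Re (Ldser \<psi> (Complex x (Im s2))) \<le> 60 * ln T - 875 * ln T"
    by (rule Re_Ldser_le(2)[OF T \<psi>(1,2), where \<beta> = "Re s2"]) (use \<psi>(3) TT s2 T3 in \<open>auto simp: x_def\<close>)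
  moreover have "Re (Ldser (\<lambda>n. \<theta> n * cnj (\<psi> n)) (Complex x (Im s1 - Im s2))) \<le> 60 * ln T"
    by (rule Re_Ldser_le(1)[OF T dcc np rq]) (use s1 s2 in \<open>auto simp: x_def\<close>)
  moreover have "Zr x \<le> 1000 * ln T + 3" using Zr_le[OF x(1,2)] x(3) by (simp add: x_def)
  moreover have "0 \<le> 3 * Zr x + 2 * Re (Ldser \<theta> (Complex x (Im s1))) + 2 * Re (Ldser \<psi> (Complex x (Im s2)))
     + 2 * Re (Ldser (\<lambda>n. \<theta> n * cnj (\<psi> n)) (Complex x (Im s1 - Im s2)))"
    by (rule log_deriv_positivity) (use dcharD(5)[OF \<theta>(1)] dcharD(5)[OF \<psi>(1)] x in auto)
  ultimately show False using T3 by linarith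
qed

text \<open>With \<open>e = 1 / (28000 * ln T)\<close>, the disc of radius \<open>5 * e\<close>
  around \<open>a\<close> reaches to the left exactly as far as the box of \<open>good_char\<close>,
  because \<open>1 / (7000 * ln T) = 4 * e\<close>. The points \<open>s\<close> considered lie
  within \<open>2 * e\<close> of the centre, hence in the half disc.\<close>

lemma good_char_log_deriv_bound:
  assumes T: "Tok T" and \<theta>: "dchar r \<theta>" "nonprincipal r \<theta>" "real r \<le> T" and good: "good_char T \<theta>"
    and s: "1 - 1 / (28000 * ln T) \<le> Re s" "Re s \<le> 1 + 1 / (28000 * ln T)" "\<bar>Im s\<bar> \<le> T - 1"
  shows "Lfun \<theta> s \<noteq> 0" "norm (deriv (Lfun \<theta>) s / Lfun \<theta> s) \<le> 1344000 * (ln T)\<^sup>2"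
proof -
  have T3: "T \<ge> 3" "ln T \<ge> 1" using TokD[OF T] .
  define e where "e = 1 / (28000 * ln T)"
  have e: "e > 0" "e \<le> 1 / 28000" using T3 by (auto simp: e_def field_simps)
  have e4: "1 / (7000 * ln T) = 4 * e" by (simp add: e_def)
  define a where "a = Complex (1 + e) (Im s)"
  define \<rho> where "\<rho> = 5 * e"
  define B where "B = 3 * zsum (3 / 2) * T ^ 3"
  have TT: "T \<le> T\<^sup>2" using T3 by (simp add: power2_eq_square)
  have ball: "1 - 4 * e \<le> Re z \<and> Re z \<le> 1 + 6 * e \<and> \<bar>Im z\<bar> \<le> T" if "z \<in> ball a \<rho>" for z
  proof -
    have "norm (z - a) < 5 * e" using that by (simp add: dist_norm norm_minus_commute \<rho>_def)
    then have "\<bar>Re z - (1 + e)\<bar> < 5 * e" "\<bar>Im z - Im s\<bar> < 5 * e"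
      using abs_Re_le_cmod[of "z - a"] abs_Im_le_cmod[of "z - a"] by (auto simp: a_def)
    then show ?thesis using s(3) e by linarith
  qed
  have nz: "Lfun \<theta> z \<noteq> 0" if z: "z \<in> ball a \<rho>" for z
  proof (cases "Re z \<le> 1")
    case True
    then show ?thesis using good ball[OF z] unfolding good_char_def e4 by blast
  next
    case False
    then show ?thesis using Lfun_nonzero[OF \<theta>(1,2), of z] ball[OF z] e by simp
  qed
  have zs: "norm (s - a) \<le> \<rho> / 2"
  proof -
    have "norm (s - a) \<le> \<bar>Re (s - a)\<bar> + \<bar>Im (s - a)\<bar>" by (rule cmod_le)
    then show ?thesis using s e unfolding a_def \<rho>_def e_def[symmetric] by simp
  qed
  have hol: "Lfun \<theta> holomorphic_on ball a \<rho>"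
  proof (rule holomorphic_on_subset[OF Lfun_holomorphic[OF \<theta>(1,2)]], safe)
    fix z assume "z \<in> ball a \<rho>"
    then show "0 < Re z" using ball[of z] e by linarith
  qed
  have bd: "norm (Lfun \<theta> z) \<le> B" if z: "z \<in> ball a \<rho>" for z
    unfolding B_def
  proof (rule norm_Lfun_le_T[OF T \<theta>(1,2)])
    show "Re z \<ge> 1 / 2" using ball[OF z] e by linarith
    have "norm z \<le> \<bar>Re z\<bar> + \<bar>Im z\<bar>" by (rule cmod_le)
    then show "norm z \<le> 3 * T" using ball[OF z] e T3 by linarith
  qed (use \<theta>(3) TT in linarith)
  have \<rho>0: "\<rho> > 0" using e by (simp add: \<rho>_def)
  have sin: "s \<in> ball a \<rho>" using zs \<rho>0 by (simp add: dist_norm norm_minus_commute)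
  show "Lfun \<theta> s \<noteq> 0" using nz[OF sin] .
  have "norm (deriv (Lfun \<theta>) s / Lfun \<theta> s) \<le> 12 / \<rho> * ln (B / norm (Lfun \<theta> a))"
    by (rule log_deriv_bound_zero_free[OF hol nz bd \<rho>0 zs])
  also have "ln (B / norm (Lfun \<theta> a)) \<le> 5 * ln T"
    unfolding B_def by (rule ln_ratio_bound[OF T \<theta>(1,2)]) (use e in \<open>auto simp: a_def e_def\<close>)
  then have "12 / \<rho> * ln (B / norm (Lfun \<theta> a)) \<le> 12 / \<rho> * (5 * ln T)" using \<rho>0 by (intro mult_left_mono) auto
  also have "\<dots> = 336000 * (ln T)\<^sup>2" using T3 unfolding \<rho>_def e_def by (simp add: field_simps power2_eq_square)
  also have "\<dots> \<le> 1344000 * (ln T)\<^sup>2" by simp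
  finally show "norm (deriv (Lfun \<theta>) s / Lfun \<theta> s) \<le> 1344000 * (ln T)\<^sup>2" .
qed

section \<open>Primes in arithmetic progressions\<close>

text \<open>The average of \<open>(Q / n)\<close> to the power \<open>c + i t\<close> when
  \<open>t\<close> has the standard normal distribution.\<close>

definition wt :: "real \<Rightarrow> real \<Rightarrow> nat \<Rightarrow> real" where
  "wt Q c n = (Q / real n) powr c * exp (- (ln (Q / real n))\<^sup>2 / 2)"

lemma wt_nonneg: "wt Q c n \<ge> 0"
  by (simp add: wt_def)

text \<open>Integrating the series termwise leaves the characteristic function of the standard
  normal distribution at \<open>ln (Q / n)\<close>, which is the Gaussian factor of the weight. The
  terms are bounded uniformly in \<open>t\<close>, so the interchange is immediate for a probability
  measure.\<close>

lemma gaussian_mellin: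
  fixes \<theta> :: "nat \<Rightarrow> complex"
  assumes \<theta>: "\<And>n. norm (\<theta> n) \<le> 1" and c: "c > 1" and Q: "Q > 0"
  defines "h \<equiv> \<lambda>t. std_normal_density t *\<^sub>R (Ldser \<theta> (Complex c t) * exp (Complex c t * of_real (ln Q)))"
  shows "integrable lborel h"
    and "(\<lambda>n. mangoldt n * \<theta> n * of_real (wt Q c n)) sums (\<integral>t. h t \<partial>lborel)"
proof -
  define M where "M = std_normal_distribution"
  interpret M: real_distribution M unfolding M_def by (rule real_dist_normal_dist)
  define E where "E t = Ldser \<theta> (Complex c t) * exp (Complex c t * of_real (ln Q))" for t
  define f where "f n t = mangoldt n * \<theta> n * dz n (Complex c t) * exp (Complex c t * of_real (ln Q))" for n t
  have f_eq: "f n t = mangoldt n * \<theta> n * of_real ((Q / real n) powr c) * iexp (ln (Q / real n) * t)" for n t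
  proof (cases "n = 0")
    case False
    have "dz n (Complex c t) * exp (Complex c t * of_real (ln Q)) = exp (Complex c t * of_real (ln (Q / real n)))"
      using False Q by (simp add: dz_def exp_add[symmetric] ln_div algebra_simps)
    also have "Complex c t * of_real (ln (Q / real n)) = of_real (c * ln (Q / real n)) + \<i> * of_real (ln (Q / real n) * t)"
      by (simp add: complex_eq_iff algebra_simps)
    also have "exp \<dots> = of_real ((Q / real n) powr c) * iexp (ln (Q / real n) * t)"
      using False Q by (simp add: exp_add powr_def exp_of_real[symmetric])
    finally show ?thesis unfolding f_def by (simp add: mult.assoc)
  qed (simp add: f_def)
  have f_norm: "norm (f n t) \<le> mangoldt n * real n powr (- c) * Q powr c" for n t
  proof (cases "n = 0")
    case False
    have "norm (f n t) = mangoldt n * norm (\<theta> n) * (Q / real n) powr c"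
      unfolding f_eq by (simp add: norm_mult)
    also have "\<dots> \<le> mangoldt n * 1 * (Q / real n) powr c"
      using \<theta>[of n] by (intro mult_right_mono mult_left_mono) (auto simp: mangoldt_nonneg)
    also have "\<dots> = mangoldt n * real n powr (- c) * Q powr c"
    proof -
      have "(Q / real n) powr c = Q powr c / real n powr c" using Q by (simp add: powr_divide)
      then show ?thesis by (simp add: powr_minus divide_inverse)
    qed
    finally show ?thesis .
  qed (simp add: f_def)
  have sm: "summable (\<lambda>n. mangoldt n * real n powr (- c) * Q powr c)"
    by (rule summable_mult2[OF Zr_summable[OF c]])
  have meas: "f n \<in> borel_measurable M" for n
    unfolding f_eq M_def by simp
  have int: "integrable M (f n)" for n
    using meas f_norm[of n] by (intro M.integrable_const_bound[of _ "mangoldt n * real n powr (- c) * Q powr c"]) auto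
  have s1: "AE t in M. summable (\<lambda>n. norm (f n t))"
  proof (rule AE_I2)
    fix t
    show "summable (\<lambda>n. norm (f n t))"
      by (rule summable_comparison_test'[OF sm]) (use f_norm in auto)
  qed
  have s2: "summable (\<lambda>n. \<integral>t. norm (f n t) \<partial>M)"
  proof (rule summable_comparison_test'[OF sm])
    fix n :: nat
    have "(\<integral>t. norm (f n t) \<partial>M) \<le> (\<integral>t. mangoldt n * real n powr (- c) * Q powr c \<partial>M)"
      using f_norm int by (intro integral_mono) auto
    then show "norm (\<integral>t. norm (f n t) \<partial>M) \<le> mangoldt n * real n powr (- c) * Q powr c"
      using M.prob_space by simp
  qed
  have E_eq: "(\<lambda>t. \<Sum>n. f n t) = E"
  proof
    fix t
    have "(\<lambda>n. mangoldt n * \<theta> n * dz n (Complex c t)) sums Ldser \<theta> (Complex c t)"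
      by (rule Ldser_sums) (use \<theta> c in auto)
    then have "(\<lambda>n. f n t) sums E t" unfolding f_def E_def by (rule sums_mult2)
    then show "(\<Sum>n. f n t) = E t" by (rule sums_unique[symmetric])
  qed
  have E_int: "integrable M E" using integrable_suminf[OF int s1 s2] unfolding E_eq .
  have E_sums: "(\<lambda>n. integral\<^sup>L M (f n)) sums (\<integral>t. E t \<partial>M)" using sums_integral[OF int s1 s2] unfolding E_eq .
  have fi: "integral\<^sup>L M (f n) = mangoldt n * \<theta> n * of_real (wt Q c n)" for n
  proof -
    have "integral\<^sup>L M (f n) = mangoldt n * \<theta> n * of_real ((Q / real n) powr c) * char M (ln (Q / real n))"
      unfolding f_eq char_def by simp
    then show ?thesis unfolding M_def char_std_normal_distribution wt_def by simp
  qed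
  have Em: "E \<in> borel_measurable lborel" using E_int unfolding M_def by (auto dest: borel_measurable_integrable)
  have hE: "h = (\<lambda>t. std_normal_density t *\<^sub>R E t)" by (simp add: h_def E_def)
  show "integrable lborel h"
    using E_int unfolding hE M_def by (subst (asm) integrable_density) (use Em in auto)
  have "(\<integral>t. E t \<partial>M) = (\<integral>t. h t \<partial>lborel)"
    unfolding hE M_def by (rule integral_density) (use Em in auto)
  then show "(\<lambda>n. mangoldt n * \<theta> n * of_real (wt Q c n)) sums (\<integral>t. h t \<partial>lborel)"
    using E_sums unfolding fi by simp
qed

text \<open>\<open>c = 1 + 1 / ln Q\<close> makes \<open>Q powr c\<close> equal to
  \<open>exp 1 * Q\<close>. The part with \<open>\<bar>t\<bar> > a\<close> is cut off, and the rest
  is moved to the line \<open>Re s = b\<close> inside the zero-free box, where a factor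
  \<open>exp (- ln Q / (28000 * ln T))\<close> is saved.\<close>

lemma good_char_smoothed_sum_bound:
  assumes T: "Tok T" and \<theta>: "dchar r \<theta>" "nonprincipal r \<theta>" "real r \<le> T" and good: "good_char T \<theta>"
    and Q: "ln Q \<ge> 28000 * ln T" and Q0: "Q > 0"
  defines "c \<equiv> 1 + 1 / ln Q" and "a \<equiv> T - 1" and "K \<equiv> 1344000 * (ln T)\<^sup>2"
  shows "norm (\<Sum>n. mangoldt n * \<theta> n * of_real (wt Q c n))
     \<le> 45 * (ln Q + 3) * Q / a ^ 6 + 6 * T * K * Q powr (1 - 1 / (28000 * ln T)) + 900 * K * Q / a ^ 6"
proof -
  have T3: "T \<ge> 3" "ln T \<ge> 1" using TokD[OF T] .
  have lQ: "ln Q > 0" "ln Q \<ge> 28000" using Q T3 by linarith+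
  have c: "c > 1" "c \<le> 2" "c \<le> 1 + 1 / (28000 * ln T)" using lQ Q T3 unfolding c_def by (auto simp: field_simps)
  have a2: "a \<ge> 2" using T3 by (simp add: a_def)
  define b where "b = 1 - 1 / (28000 * ln T)"
  have b: "b < 1" "b \<ge> 1 / 2" using T3 unfolding b_def by (auto simp: field_simps)
  have cb: "c - b \<le> 1"
  proof -
    have "1 / (28000 * ln T) \<le> 1 / 2" using T3 by (simp add: field_simps)
    then show ?thesis using c(3) unfolding b_def by linarith
  qed
  have K0: "K \<ge> 0" by (simp add: K_def)
  define h where "h t = std_normal_density t *\<^sub>R (Ldser \<theta> (Complex c t) * exp (Complex c t * of_real (ln Q)))" for t
  have hi: "integrable lborel h" and hs: "(\<lambda>n. mangoldt n * \<theta> n * of_real (wt Q c n)) sums (\<integral>t. h t \<partial>lborel)"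
    unfolding h_def using gaussian_mellin[of \<theta>, OF dcharD(5)[OF \<theta>(1)] c(1) Q0] by auto
  have Qc: "Q powr c = exp 1 * Q"
    using lQ Q0 unfolding c_def powr_def by (simp add: exp_add algebra_simps)
  have ZQ: "Zr c \<le> ln Q + 3"
  proof -
    have "Zr c \<le> 1 / (c - 1) + 3 * (c - 1)" by (rule Zr_le[OF c(1,2)])
    also have "\<dots> \<le> ln Q + 3" using c(2) by (simp add: c_def)
    finally show ?thesis .
  qed
  have e3: "exp (1::real) \<le> 3" by (rule exp_le)
  have split: "(\<integral>t. h t \<partial>lborel) = (\<integral>t. indicator {- a .. a} t *\<^sub>R h t \<partial>lborel) + (\<integral>t. indicator (- {- a .. a}) t *\<^sub>R h t \<partial>lborel)"
  proof -
    have "(\<integral>t. h t \<partial>lborel) = (\<integral>t. indicator {- a .. a} t *\<^sub>R h t + indicator (- {- a .. a}) t *\<^sub>R h t \<partial>lborel)"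
      by (intro Bochner_Integration.integral_cong) (auto simp: indicator_def)
    also have "\<dots> = (\<integral>t. indicator {- a .. a} t *\<^sub>R h t \<partial>lborel) + (\<integral>t. indicator (- {- a .. a}) t *\<^sub>R h t \<partial>lborel)"
      using hi by (intro Bochner_Integration.integral_add integrable_mult_indicator) auto
    finally show ?thesis .
  qed
  have tail: "norm (\<integral>t. indicator (- {- a .. a}) t *\<^sub>R h t \<partial>lborel) \<le> 45 * (ln Q + 3) * Q / a ^ 6"
  proof -
    \<comment> \<open>The sixth moment of the standard normal distribution is \<open>15\<close>, and
      \<open>t ^ 6 / a ^ 6 \<ge> 1\<close> on the tail. A power of \<open>a\<close> is enough here
      since the modulus that multiplies this error later is at most \<open>T\<close>.\<close>
    have m: "has_bochner_integral lborel (\<lambda>x. std_normal_density x * x ^ (2 * 3)) (fact (2 * 3) / (2 ^ 3 * fact 3))"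
      by (rule std_normal_moment_even)
    have fa: "fact (2 * 3) / (2 ^ 3 * fact 3) = (15::real)" by (simp add: fact_numeral)
    let ?C = "Zr c * Q powr c / a ^ 6"
    have bint: "has_bochner_integral lborel (\<lambda>x. std_normal_density x * x ^ (2 * 3) * ?C) (15 * ?C)"
      using has_bochner_integral_mult_left[OF m, of ?C] unfolding fa by simp
    have "norm (\<integral>t. indicator (- {- a .. a}) t *\<^sub>R h t \<partial>lborel) \<le> (\<integral>t. std_normal_density t * t ^ (2 * 3) * ?C \<partial>lborel)"
    proof (rule order_trans[OF integral_norm_bound integral_mono])
      show "integrable lborel (\<lambda>t. norm (indicator (- {- a .. a}) t *\<^sub>R h t))" using hi by (intro integrable_norm integrable_mult_indicator) auto
      show "integrable lborel (\<lambda>t. std_normal_density t * t ^ (2 * 3) * ?C)" using bint by (rule integrable.intros)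
      fix t :: real
      show "norm (indicator (- {- a .. a}) t *\<^sub>R h t) \<le> std_normal_density t * t ^ (2 * 3) * ?C"
      proof (cases "t \<in> {- a .. a}")
        case True
        then show ?thesis using Zr_nonneg[OF c(1)] a2 by (auto intro!: mult_nonneg_nonneg divide_nonneg_nonneg)
      next
        case False
        then have "\<bar>t\<bar> \<ge> a" by auto
        then have "a ^ 6 \<le> \<bar>t\<bar> ^ 6" using a2 by (intro power_mono) auto
        then have at: "a ^ 6 \<le> t ^ 6" by (simp add: power_even_abs)
        have "norm (h t) = std_normal_density t * (norm (Ldser \<theta> (Complex c t)) * Q powr c)"
          using Q0 unfolding h_def by (simp add: norm_mult norm_exp_eq_Re powr_def)
        also have "\<dots> \<le> std_normal_density t * (Zr c * Q powr c)"
          using norm_Ldser_le[of \<theta> "Complex c t", OF dcharD(5)[OF \<theta>(1)]] c(1)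
          by (intro mult_left_mono mult_right_mono) auto
        also have "\<dots> = std_normal_density t * a ^ 6 * ?C" using a2 by simp
        also have "\<dots> \<le> std_normal_density t * t ^ 6 * ?C"
          using at Zr_nonneg[OF c(1)] a2 by (intro mult_right_mono mult_left_mono) auto
        finally show ?thesis using False by simp
      qed
    qed
    also have "\<dots> = 15 * ?C" using bint by (rule has_bochner_integral_integral_eq)
    also have "\<dots> \<le> 15 * ((ln Q + 3) * (3 * Q) / a ^ 6)"
      unfolding Qc using ZQ Zr_nonneg[OF c(1)] e3 Q0 lQ a2
      by (intro mult_left_mono divide_right_mono mult_mono) auto
    also have "\<dots> = 45 * (ln Q + 3) * Q / a ^ 6" by simp
    finally show ?thesis .
  qed
  \<comment> \<open>The last factor continues the normal density analytically: for
    \<open>Re s = c\<close> it equals \<open>exp (- t\<^sup>2 / 2)\<close>.\<close>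
  define F where "F s = - (deriv (Lfun \<theta>) s / Lfun \<theta> s) * exp (s * of_real (ln Q)) * exp ((s - of_real c)\<^sup>2 / 2)" for s
  define S where "S = {s. 1 - 1 / (7000 * ln T) < Re s} \<inter> {s. Re s < 2} \<inter> {s. - T < Im s} \<inter> {s. Im s < T}"
  have opS: "open S" unfolding S_def
    by (intro open_Int open_halfspace_Re_gt open_halfspace_Re_lt open_halfspace_Im_gt open_halfspace_Im_lt)
  have cvS: "convex S" unfolding S_def
    by (intro convex_Int convex_halfspace_Re_gt convex_halfspace_Re_lt convex_halfspace_Im_gt convex_halfspace_Im_lt)
  have nz: "Lfun \<theta> s \<noteq> 0" if "s \<in> S" for s
  proof (cases "Re s \<le> 1")
    case True
    then show ?thesis using that good unfolding good_char_def S_def by auto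
  next
    case False
    then show ?thesis using Lfun_nonzero[OF \<theta>(1,2), of s] that unfolding S_def by auto
  qed
  have LS: "Lfun \<theta> holomorphic_on S"
  proof (rule holomorphic_on_subset[OF Lfun_holomorphic[OF \<theta>(1,2)]], safe)
    fix s assume "s \<in> S"
    moreover have "1 / (7000 * ln T) \<le> 1" using T3 by (simp add: field_simps)
    ultimately show "0 < Re s" unfolding S_def by simp
  qed
  \<comment> \<open>On the convex box \<open>S\<close> the function \<open>F\<close> has a primitive
    \<open>g\<close>, so shifting the line means comparing \<open>g\<close> at the four corners of a
    rectangle.\<close>
  have "F holomorphic_on S" unfolding F_def
    by (intro holomorphic_intros holomorphic_deriv LS opS) (use nz in auto)
  then obtain g where g: "\<And>s. s \<in> S \<Longrightarrow> (g has_field_derivative F s) (at s within S)"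
    using holomorphic_convex_primitive'[OF cvS opS] by blast
  have Sin: "Complex x t \<in> S" if "b \<le> x" "x \<le> c" "\<bar>t\<bar> \<le> a" for x t
  proof -
    have "1 - 1 / (7000 * ln T) < b" unfolding b_def using T3 by (simp add: field_simps)
    moreover have "c < 2" unfolding c_def using lQ by (simp add: field_simps)
    ultimately show ?thesis using that unfolding S_def a_def by auto
  qed
  have Fb: "norm (F (Complex x t)) \<le> K * Q powr x * (3 * exp (- t\<^sup>2 / 2))" if "b \<le> x" "x \<le> c" "\<bar>t\<bar> \<le> a" for x t
  proof -
    let ?s = "Complex x t"
    have 1: "norm (deriv (Lfun \<theta>) ?s / Lfun \<theta> ?s) \<le> K" unfolding K_def
      by (rule good_char_log_deriv_bound(2)[OF T \<theta> good]) (use that c b in \<open>auto simp: b_def a_def\<close>)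
    have 2: "norm (exp (?s * of_real (ln Q))) = Q powr x" using Q0 by (simp add: norm_exp_eq_Re powr_def)
    have "Re ((?s - of_real c)\<^sup>2 / 2) = ((x - c)\<^sup>2 - t\<^sup>2) / 2" by (simp add: power2_eq_square)
    moreover have "(x - c)\<^sup>2 \<le> 2"
    proof -
      have "\<bar>x - c\<bar> \<le> 1" using that cb by linarith
      then have "(x - c)\<^sup>2 \<le> 1" by (simp add: abs_square_le_1)
      then show ?thesis by simp
    qed
    ultimately have "Re ((?s - of_real c)\<^sup>2 / 2) \<le> 1 + - t\<^sup>2 / 2" by simp
    then have "norm (exp ((?s - of_real c)\<^sup>2 / 2)) \<le> exp (1 + - t\<^sup>2 / 2)" unfolding norm_exp_eq_Re by simp
    also have "\<dots> = exp 1 * exp (- t\<^sup>2 / 2)" by (rule exp_add)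
    also have "\<dots> \<le> 3 * exp (- t\<^sup>2 / 2)" using e3 by (intro mult_right_mono) auto
    finally have 3: "norm (exp ((?s - of_real c)\<^sup>2 / 2)) \<le> 3 * exp (- t\<^sup>2 / 2)" .
    have "norm (F ?s) = norm (deriv (Lfun \<theta>) ?s / Lfun \<theta> ?s) * Q powr x * norm (exp ((?s - of_real c)\<^sup>2 / 2))"
      unfolding F_def norm_mult norm_minus_cancel 2 ..
    also have "\<dots> \<le> K * Q powr x * (3 * exp (- t\<^sup>2 / 2))"
      using 1 3 K0 by (intro mult_mono) auto
    finally show ?thesis .
  qed
  have Q1: "Q \<ge> 1" using lQ Q0 by (meson ln_gt_zero_imp_gt_one less_imp_le)
  have seg: "closed_segment (Complex x1 t1) (Complex x2 t2) \<subseteq> {Complex x t | x t. min x1 x2 \<le> x \<and> x \<le> max x1 x2 \<and> min t1 t2 \<le> t \<and> t \<le> max t1 t2}" for x1 t1 x2 t2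
  proof
    fix z assume "z \<in> closed_segment (Complex x1 t1) (Complex x2 t2)"
    then obtain u where u: "0 \<le> u" "u \<le> 1" "z = (1 - u) *\<^sub>R Complex x1 t1 + u *\<^sub>R Complex x2 t2"
      unfolding in_segment by blast
    have "Re z \<in> closed_segment x1 x2" "Im z \<in> closed_segment t1 t2"
      using u unfolding in_segment by auto
    then have "min x1 x2 \<le> Re z" "Re z \<le> max x1 x2" "min t1 t2 \<le> Im z" "Im z \<le> max t1 t2"
      by (auto simp: closed_segment_eq_real_ivl split: if_splits)
    then show "z \<in> {Complex x t | x t. min x1 x2 \<le> x \<and> x \<le> max x1 x2 \<and> min t1 t2 \<le> t \<and> t \<le> max t1 t2}"
      by (intro CollectI exI[of _ "Re z"] exI[of _ "Im z"]) simp
  qed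
  have hor: "norm (g (Complex b t) - g (Complex c t)) \<le> K * (3 * Q) * (3 * (48 / a ^ 6)) * 1" if t: "\<bar>t\<bar> = a" for t
  proof -
    have bc: "b \<le> c" using b c by linarith
    have ex: "exp (- t\<^sup>2 / 2) \<le> 48 / a ^ 6"
    proof -
      have tt: "t\<^sup>2 = a\<^sup>2" using t by (metis power2_abs)
      define x where "x = a\<^sup>2 / 2"
      have x: "x \<ge> 0" by (simp add: x_def)
      \<comment> \<open>The cubic term of the exponential series gives the horizontal sides the same
        decay \<open>a ^ 6\<close> as the tail; the \<open>48\<close> is
        \<open>6 * 2 ^ 3\<close>.\<close>
      have "x ^ 3 / fact 3 \<le> exp x" 
      proof -
        have "(\<Sum>n\<in>{3}. x ^ n / fact n) \<le> exp x" using x exp_converges[of x]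
          by (intro sum_le_suminf[of "\<lambda>n. x ^ n / fact n" "{3}", THEN order_trans]) (auto simp: exp_def sums_iff divide_inverse mult.commute intro!: summable_exp)
        then show ?thesis by simp
      qed
      then have "exp (- x) \<le> 6 / x ^ 3" using x a2 by (simp add: exp_minus field_simps fact_numeral x_def)
      also have "\<dots> = 48 / a ^ 6" by (simp add: x_def power_divide flip: power_mult)
      finally show ?thesis unfolding tt x_def by simp
    qed
    have "norm (g (Complex b t) - g (Complex c t)) \<le> K * (3 * Q) * (3 * (48 / a ^ 6)) * norm (Complex b t - Complex c t)"
    proof (rule field_differentiable_bound[where S = "closed_segment (Complex b t) (Complex c t)" and f' = F])
      fix z assume "z \<in> closed_segment (Complex b t) (Complex c t)"
      then obtain x where x: "z = Complex x t" "b \<le> x" "x \<le> c" using seg[of b t c t] bc by auto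
      have zS: "z \<in> S" unfolding x(1) by (rule Sin) (use x t in auto)
      have "(g has_field_derivative F z) (at z)" using g[OF zS] at_within_open[OF zS opS] by simp
      then show "(g has_field_derivative F z) (at z within closed_segment (Complex b t) (Complex c t))"
        by (rule has_field_derivative_at_within)
      have "norm (F z) \<le> K * Q powr x * (3 * exp (- t\<^sup>2 / 2))" unfolding x(1) by (rule Fb) (use x t in auto)
      also have "\<dots> \<le> K * (3 * Q) * (3 * (48 / a ^ 6))"
      proof (intro mult_mono mult_left_mono)
        have "Q powr x \<le> Q powr c" using x Q1 by (intro powr_mono) auto
        also have "\<dots> \<le> 3 * Q" unfolding Qc using e3 Q0 by simp
        finally show "Q powr x \<le> 3 * Q" .
      qed (use K0 ex Q0 in auto)
      finally show "norm (F z) \<le> K * (3 * Q) * (3 * (48 / a ^ 6))" .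
    qed auto
    moreover have "norm (Complex b t - Complex c t) \<le> 1"
    proof -
      have "norm (Complex b t - Complex c t) = \<bar>b - c\<bar>" by (simp add: cmod_def)
      then show ?thesis using bc cb by linarith
    qed
    moreover have "0 \<le> K * (3 * Q) * (3 * (48 / a ^ 6))" using K0 Q0 a2 by simp
    ultimately show ?thesis by (meson mult_left_mono order_trans)
  qed
  have ver: "norm (g (Complex b a) - g (Complex b (- a))) \<le> K * Q powr b * 3 * (2 * a)"
  proof -
    have bc: "b \<le> c" using b c by linarith
    have "norm (g (Complex b a) - g (Complex b (- a))) \<le> K * Q powr b * 3 * norm (Complex b a - Complex b (- a))"
    proof (rule field_differentiable_bound[where S = "closed_segment (Complex b (- a)) (Complex b a)" and f' = F])
      fix z assume "z \<in> closed_segment (Complex b (- a)) (Complex b a)"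
      then obtain x t where "z = Complex x t" "min b b \<le> x" "x \<le> max b b" "min (- a) a \<le> t" "t \<le> max (- a) a"
        using seg[of b "- a" b a] by blast
      then have t: "z = Complex b t" "\<bar>t\<bar> \<le> a" using a2 by auto
      have zS: "z \<in> S" unfolding t(1) by (rule Sin) (use t bc in auto)
      have "(g has_field_derivative F z) (at z)" using g[OF zS] at_within_open[OF zS opS] by simp
      then show "(g has_field_derivative F z) (at z within closed_segment (Complex b (- a)) (Complex b a))"
        by (rule has_field_derivative_at_within)
      have "norm (F z) \<le> K * Q powr b * (3 * exp (- t\<^sup>2 / 2))" unfolding t(1) by (rule Fb) (use t bc in auto)
      also have "\<dots> \<le> K * Q powr b * (3 * 1)" using K0 by (intro mult_left_mono) auto
      finally show "norm (F z) \<le> K * Q powr b * 3" by simp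
    qed auto
    also have "norm (Complex b a - Complex b (- a)) = 2 * a" using a2 by (simp add: cmod_def real_sqrt_mult)
    finally show ?thesis .
  qed
  have main: "norm (\<integral>t. indicator {- a .. a} t *\<^sub>R h t \<partial>lborel) \<le> norm (g (Complex c a) - g (Complex c (- a)))"
  proof -
    let ?G = "\<lambda>t. (1 / sqrt (2 * pi)) *\<^sub>R (- \<i> * g (Complex c t))"
    have hF: "h t = (1 / sqrt (2 * pi)) *\<^sub>R F (Complex c t)" for t
    proof -
      have "(Complex c t - of_real c)\<^sup>2 / 2 = of_real (- t\<^sup>2 / 2)" by (simp add: complex_eq_iff power2_eq_square)
      then have "exp ((Complex c t - of_real c)\<^sup>2 / 2) = of_real (exp (- t\<^sup>2 / 2))" by (simp only: exp_of_real)
      moreover have "Ldser \<theta> (Complex c t) = - (deriv (Lfun \<theta>) (Complex c t) / Lfun \<theta> (Complex c t))"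
        by (rule Ldser_eq_log_deriv[OF \<theta>(1,2)]) (use c in auto)
      ultimately show ?thesis unfolding h_def F_def std_normal_density_def by (simp add: scaleR_conv_of_real mult_ac)
    qed
    have "(\<integral>t. indicator {- a .. a} t *\<^sub>R h t \<partial>lborel) = ?G a - ?G (- a)"
    proof (rule integral_FTC_atLeastAtMost)
      show "- a \<le> a" using a2 by simp
      have der: "(?G has_vector_derivative h t) (at t)" if "- a \<le> t" "t \<le> a" for t
      proof -
        have zS: "Complex c t \<in> S" by (rule Sin) (use that b c in auto)
        have gd: "(g has_field_derivative F (Complex c t)) (at (Complex c t))" using g[OF zS] at_within_open[OF zS opS] by simp
        have 1: "((\<lambda>t. Complex c t) has_vector_derivative \<i>) (at t)"
          unfolding Complex_eq by (auto intro!: derivative_eq_intros)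
        have 2: "((g \<circ> (\<lambda>t. Complex c t)) has_vector_derivative \<i> * F (Complex c t)) (at t)"
          by (rule field_vector_diff_chain_at[OF 1 gd])
        then have "((\<lambda>t. - \<i> * (g \<circ> (\<lambda>t. Complex c t)) t) has_vector_derivative - \<i> * (\<i> * F (Complex c t))) (at t)"
          by (rule has_vector_derivative_mult_right)
        then have "((\<lambda>t. - \<i> * g (Complex c t)) has_vector_derivative F (Complex c t)) (at t)" by simp
        then show ?thesis unfolding hF by (rule bounded_linear.has_vector_derivative[OF bounded_linear_scaleR_right])
      qed
      then show "(?G has_vector_derivative h t) (at t within {- a .. a})" if "- a \<le> t" "t \<le> a" for t
        using that by (blast intro: has_vector_derivative_at_within)
      have "continuous_on {- a .. a} (\<lambda>t. F (Complex c t))"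
      proof (rule continuous_on_compose2[OF holomorphic_on_imp_continuous_on[OF \<open>F holomorphic_on S\<close>]])
        show "continuous_on {- a .. a} (Complex c)" unfolding Complex_eq by (intro continuous_intros)
        show "Complex c ` {- a .. a} \<subseteq> S" using Sin[of c] b c by auto
      qed
      then show "continuous_on {- a .. a} h" unfolding hF by (intro continuous_intros)
    qed
    also have "\<dots> = (1 / sqrt (2 * pi)) *\<^sub>R (- \<i> * (g (Complex c a) - g (Complex c (- a))))"
      by (simp only: right_diff_distrib scaleR_diff_right)
    also have "norm \<dots> = 1 / sqrt (2 * pi) * norm (g (Complex c a) - g (Complex c (- a)))"
      by (simp add: norm_mult)
    also have "\<dots> \<le> 1 * norm (g (Complex c a) - g (Complex c (- a)))"
      using pi_ge_two by (intro mult_right_mono) (auto simp: divide_le_eq_1_pos real_le_rsqrt)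
    finally show ?thesis by simp
  qed
  have "norm (g (Complex c a) - g (Complex c (- a)))
     \<le> norm (g (Complex b a) - g (Complex c a)) + norm (g (Complex b a) - g (Complex b (- a))) + norm (g (Complex b (- a)) - g (Complex c (- a)))"
  proof -
    have "g (Complex c a) - g (Complex c (- a)) = - (g (Complex b a) - g (Complex c a)) + (g (Complex b a) - g (Complex b (- a)))
       + (g (Complex b (- a)) - g (Complex c (- a)))" by simp
    then show ?thesis
      using norm_triangle_ineq[of "- (g (Complex b a) - g (Complex c a)) + (g (Complex b a) - g (Complex b (- a)))" "g (Complex b (- a)) - g (Complex c (- a))"]
        norm_triangle_ineq[of "- (g (Complex b a) - g (Complex c a))" "g (Complex b a) - g (Complex b (- a))"]
      by (simp only: norm_minus_cancel)
  qed
  also have "\<dots> \<le> K * (3 * Q) * (3 * (48 / a ^ 6)) * 1 + K * Q powr b * 3 * (2 * a) + K * (3 * Q) * (3 * (48 / a ^ 6)) * 1"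
    using hor[of a] hor[of "- a"] ver a2 by (intro add_mono) auto
  also have "\<dots> = 6 * a * K * Q powr b + 864 * K * Q / a ^ 6" by (simp add: field_simps)
  also have "\<dots> \<le> 6 * T * K * Q powr b + 900 * K * Q / a ^ 6"
    using K0 Q0 a2 by (intro add_mono mult_right_mono divide_right_mono) (auto simp: a_def)
  finally have "norm (\<integral>t. indicator {- a .. a} t *\<^sub>R h t \<partial>lborel) \<le> 6 * T * K * Q powr b + 900 * K * Q / a ^ 6"
    using main by linarith
  then have "norm (\<integral>t. h t \<partial>lborel) \<le> 45 * (ln Q + 3) * Q / a ^ 6 + (6 * T * K * Q powr b + 900 * K * Q / a ^ 6)"
    unfolding split using tail by (intro order_trans[OF norm_triangle_ineq]) linarith
  then show ?thesis using sums_unique[OF hs] unfolding b_def by (simp add: add_ac)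
qed

text \<open>Fix one bad character and a prime \<open>q\<close> at which it is nontrivial. A second
  bad one, to a modulus without \<open>q\<close>, would have a nonprincipal quotient with the first
  and contradict the repulsion. If there is no bad character, any prime serves, for instance
  \<open>2\<close>.\<close>

lemma exceptional_prime:
  assumes T: "Tok T"
  obtains q where "prime q"
    "\<And>P \<theta>. finite P \<Longrightarrow> (\<And>p. p \<in> P \<Longrightarrow> prime p) \<Longrightarrow> q \<notin> P \<Longrightarrow> real (\<Prod>P) \<le> T \<Longrightarrow>
      dchar (\<Prod>P) \<theta> \<Longrightarrow> nonprincipal (\<Prod>P) \<theta> \<Longrightarrow> good_char T \<theta>"
proof (cases "\<exists>P \<theta>. finite P \<and> (\<forall>p\<in>P. prime p) \<and> real (\<Prod>P) \<le> T \<and> dchar (\<Prod>P) \<theta> \<and>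
    nonprincipal (\<Prod>P) \<theta> \<and> \<not> good_char T \<theta>")
  case False
  show ?thesis by (rule that[of 2]) (use False in auto)
next
  case True
  then obtain P \<theta> where P: "finite P" "\<And>p. p \<in> P \<Longrightarrow> prime p" "real (\<Prod>P) \<le> T" "dchar (\<Prod>P) \<theta>"
    "nonprincipal (\<Prod>P) \<theta>" "\<not> good_char T \<theta>" by blast
  obtain q a where q: "q \<in> P" "coprime a (\<Prod>P)" "[a = 1] (mod \<Prod>(P - {q}))" "\<theta> a \<noteq> 1"
    using dchar_component_exists[OF P(1,2,4,5)] by blast
  show ?thesis
  proof (rule that[of q])
    show "prime q" using P(2) q(1) .
    fix P' \<psi> assume P': "finite P'" "\<And>p. p \<in> P' \<Longrightarrow> prime p" "q \<notin> P'" "real (\<Prod>P') \<le> T"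
      "dchar (\<Prod>P') \<psi>" "nonprincipal (\<Prod>P') \<psi>"
    have "nonprincipal (\<Prod>P * \<Prod>P') (\<lambda>n. \<theta> n * cnj (\<psi> n))"
      by (rule nonprincipal_quotient[OF P(1,2) P'(1,2) P(4) P'(5) q(1) P'(3) q(2,3,4)])
    then have "good_char T \<theta> \<or> good_char T \<psi>"
      by (rule zero_repulsion[OF T P(4,5,3) P'(5,6,4)])
    then show "good_char T \<psi>" using P(6) by blast
  qed
qed

section \<open>Chebyshev bounds and prime powers\<close>

lemma card_multiples_nat: "d > 0 \<Longrightarrow> card {m \<in> {1..n}. d dvd m} = n div (d::nat)"
proof -
  assume d: "d > 0"
  have "{m \<in> {1..n}. d dvd m} = (\<lambda>k. d * k) ` {1..n div d}"
  proof safe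
    fix m assume m: "m \<in> {1..n}" "d dvd m"
    then obtain k where k: "m = d * k" by (auto elim: dvdE)
    then have "k \<in> {1..n div d}" using m d by (auto simp: less_eq_div_iff_mult_less_eq mult.commute Suc_le_eq)
    then show "m \<in> (\<lambda>k. d * k) ` {1..n div d}" using k by blast
  next
    fix k assume k: "k \<in> {1..n div d}"
    then show "d * k \<in> {1..n}" using d by (auto simp: less_eq_div_iff_mult_less_eq mult.commute Suc_le_eq)
  qed auto
  also have "card \<dots> = n div d" using d by (subst card_image) (auto simp: inj_on_def)
  finally show ?thesis .
qed

lemma ln_fact_eq_mangoldt_sum:
  assumes "n \<le> N"
  shows "ln (fact n) = (\<Sum>d\<in>{1..N}. mangoldt d * real (n div d))"
proof -
  have "ln (fact n) = (\<Sum>m\<in>{1..n}. ln (real m))"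
    by (induction n) (simp_all add: ln_mult)
  also have "\<dots> = (\<Sum>m\<in>{1..n}. \<Sum>d\<in>{1..N}. if d dvd m then mangoldt d else 0)"
  proof (intro sum.cong refl)
    fix m assume m: "m \<in> {1..n}"
    have "ln (real m) = (\<Sum>d | d dvd m. mangoldt d)" using mangoldt_sum[of m, where ?'a = real] m by simp
    also have "\<dots> = (\<Sum>d\<in>{d\<in>{1..N}. d dvd m}. mangoldt d)"
      using m assms by (intro sum.cong) (auto dest: dvd_imp_le simp: Suc_le_eq intro: Nat.gr0I)
    also have "\<dots> = (\<Sum>d\<in>{1..N}. if d dvd m then mangoldt d else 0)" by (intro sum.inter_filter) simp
    finally show "ln (real m) = (\<Sum>d\<in>{1..N}. if d dvd m then mangoldt d else 0)" .
  qed
  also have "\<dots> = (\<Sum>d\<in>{1..N}. \<Sum>m\<in>{1..n}. if d dvd m then mangoldt d else 0)" by (rule sum.swap)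
  also have "\<dots> = (\<Sum>d\<in>{1..N}. mangoldt d * real (n div d))"
  proof (intro sum.cong refl)
    fix d assume d: "d \<in> {1..N}"
    have "(\<Sum>m\<in>{1..n}. if d dvd m then mangoldt d else 0) = (\<Sum>m\<in>{m\<in>{1..n}. d dvd m}. mangoldt d)"
      by (intro sum.inter_filter[symmetric]) simp
    also have "\<dots> = mangoldt d * real (n div d)" using card_multiples_nat[of d n] d by simp
    finally show "(\<Sum>m\<in>{1..n}. if d dvd m then mangoldt d else 0) = mangoldt d * real (n div d)" .
  qed
  finally show ?thesis .
qed

text \<open>Chebyshev's argument: by Legendre's formula the logarithm of the central binomial
  coefficient is a sum of \<open>mangoldt d\<close> with factors
  \<open>\<lfloor>2 N / d\<rfloor> - 2 \<lfloor>N / d\<rfloor>\<close>, each at most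
  \<open>1\<close>.\<close>

lemma psi_lower_bound:
  assumes "N > 0"
  shows "(\<Sum>d\<in>{1..2 * N}. mangoldt d) \<ge> real N * ln 4 - ln (2 * real N)"
proof -
  have "4 ^ N / (2 * real N) \<le> real ((2 * N) choose N)" using central_binomial_lower_bound[OF assms] .
  then have "ln (4 ^ N / (2 * real N)) \<le> ln (real ((2 * N) choose N))" using assms by (intro ln_mono) auto
  also have "real ((2 * N) choose N) = fact (2 * N) / (fact N * fact N)"
    by (subst binomial_fact) auto
  also have "ln \<dots> = ln (fact (2 * N)) - 2 * ln (fact N)" by (simp add: ln_div ln_mult)
  also have "\<dots> = (\<Sum>d\<in>{1..2 * N}. mangoldt d * (real (2 * N div d) - 2 * real (N div d)))"
    using ln_fact_eq_mangoldt_sum[of "2 * N" "2 * N"] ln_fact_eq_mangoldt_sum[of N "2 * N"]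
    by (simp add: sum_subtractf sum_distrib_left algebra_simps)
  also have "\<dots> \<le> (\<Sum>d\<in>{1..2 * N}. mangoldt d * 1)"
  proof (intro sum_mono mult_left_mono)
    fix d assume d: "d \<in> {1..2 * N}"
    have "2 * N div d \<le> 2 * (N div d) + 1"
    proof -
      have "N < d * (N div d + 1)" using d by (metis One_nat_def Suc_le_eq add.commute atLeastAtMost_iff dividend_less_times_div mult_Suc_right plus_1_eq_Suc)
      then have "2 * N < d * (2 * (N div d) + 2)" by (simp add: algebra_simps)
      then have "2 * N div d < 2 * (N div d) + 2" using d by (simp add: div_less_iff_less_mult mult.commute)
      then show ?thesis by simp
    qed
    then show "real (2 * N div d) - 2 * real (N div d) \<le> 1" by linarith
  qed (simp add: mangoldt_nonneg)
  finally show ?thesis using assms by (simp add: ln_div ln_realpow)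
qed

lemma sum_list_lower_bound:
  fixes f :: "'a \<Rightarrow> real"
  assumes "x \<in> set xs" "\<And>y. y \<in> set xs \<Longrightarrow> f y \<ge> - e" "e \<ge> 0"
  shows "(\<Sum>y\<leftarrow>xs. f y) \<ge> f x - real (length xs) * e"
proof -
  obtain ys zs where xs: "xs = ys @ x # zs" using assms(1) by (meson split_list)
  have "(\<Sum>y\<leftarrow>ws. f y) \<ge> - (real (length ws) * e)" if "set ws \<subseteq> set xs" for ws
    using that
  proof (induction ws)
    case (Cons w ws)
    then show ?case using assms(2)[of w] by (simp add: algebra_simps)
  qed simp
  moreover have "set ys \<subseteq> set xs" "set zs \<subseteq> set xs" using xs by auto
  ultimately have "(\<Sum>y\<leftarrow>ys. f y) \<ge> - (real (length ys) * e)" "(\<Sum>y\<leftarrow>zs. f y) \<ge> - (real (length zs) * e)"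
    by blast+
  then show ?thesis using assms(3) unfolding xs by (simp add: algebra_simps)
qed

lemma card_le_prod_primes:
  assumes "finite P" "\<And>p. p \<in> P \<Longrightarrow> prime p"
  shows "card P \<le> \<Prod>P" "\<Prod>P > 0"
proof -
  show pos: "\<Prod>P > (0::nat)" using assms by (intro prod_pos) (auto intro: prime_gt_0_nat)
  have "P \<subseteq> {1..\<Prod>P}"
  proof
    fix p assume p: "p \<in> P"
    then have "p dvd \<Prod>P" using assms(1) by (rule_tac dvd_prodI) auto
    then show "p \<in> {1..\<Prod>P}" using pos assms(2)[OF p] by (auto dest: dvd_imp_le simp: prime_ge_1_nat)
  qed
  then show "card P \<le> \<Prod>P" using card_mono[of "{1..\<Prod>P}" P] by simp
qed

text \<open>Completing the square: \<open>c * u - u\<^sup>2 / 2 \<le> c\<^sup>2 / 2\<close> for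
  \<open>u = ln (Q / n)\<close>.\<close>

lemma wt_le_exp2:
  assumes "n > 0" "Q > 0" "1 \<le> c" "c \<le> 2"
  shows "wt Q c n \<le> exp 2"
proof -
  define u where "u = ln (Q / real n)"
  have "(Q / real n) powr c = exp (c * u)" using assms by (simp add: powr_def u_def)
  then have "wt Q c n = exp (c * u - u\<^sup>2 / 2)" unfolding wt_def u_def[symmetric] by (simp flip: exp_add)
  also have "c * u - u\<^sup>2 / 2 = c\<^sup>2 / 2 - (u - c)\<^sup>2 / 2" by (simp add: power2_eq_square field_simps)
  also have "\<dots> \<le> c\<^sup>2 / 2" by simp
  also have "\<dots> \<le> 2" using assms power_mono[of c 2 2] by simp
  finally show ?thesis by simp
qed

lemma wt_summable:
  assumes "c > 1" "Q > 0"
  shows "summable (\<lambda>n. mangoldt n * wt Q c n)" "summable (\<lambda>n. mangoldt n * (Q / real n) powr c)"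
    "(\<Sum>n. mangoldt n * (Q / real n) powr c) = Zr c * Q powr c"
proof -
  have e: "mangoldt n * (Q / real n) powr c = mangoldt n * real n powr (- c) * Q powr c" for n
  proof -
    have "(Q / real n) powr c = Q powr c / real n powr c" using assms by (simp add: powr_divide)
    then show ?thesis by (simp add: powr_minus divide_inverse)
  qed
  show 1: "summable (\<lambda>n. mangoldt n * (Q / real n) powr c)"
    unfolding e by (rule summable_mult2[OF Zr_summable[OF assms(1)]])
  show "(\<Sum>n. mangoldt n * (Q / real n) powr c) = Zr c * Q powr c"
    unfolding e Zr_def by (rule suminf_mult2[OF Zr_summable[OF assms(1)], symmetric])
  show "summable (\<lambda>n. mangoldt n * wt Q c n)"
  proof (rule summable_comparison_test'[OF 1])
    fix n :: nat
    have "wt Q c n \<le> (Q / real n) powr c * 1" unfolding wt_def by (intro mult_left_mono) auto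
    then show "norm (mangoldt n * wt Q c n) \<le> mangoldt n * (Q / real n) powr c"
      using wt_nonneg[of Q c n] mangoldt_nonneg[of n] by (simp add: abs_mult mult_left_mono)
  qed
qed


lemma exponent_bound:
  fixes b k N :: nat
  assumes "b \<ge> 2" "b ^ k \<le> N"
  shows "real k \<le> 2 * ln (real N)"
proof -
  have "2 ^ k \<le> N" using power_mono[of 2 b k] assms by linarith
  then have "real 2 ^ k \<le> real N" by (metis of_nat_le_iff of_nat_power)
  then have "ln (2 ^ k) \<le> ln (real N)" by (intro ln_mono) auto
  then have "real k * ln 2 \<le> ln (real N)" by (simp add: ln_realpow)
  moreover have "real k * (1 / 2) \<le> real k * ln 2" using ln2_ge_two_thirds by (intro mult_left_mono) auto
  ultimately show ?thesis by simp
qed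

lemma card_powers_le:
  fixes B :: "nat set" and N :: nat
  assumes B: "finite B" "\<And>b. b \<in> B \<Longrightarrow> b \<ge> 2" and N: "N \<ge> 1"
  shows "real (card {n \<in> {1..N}. \<exists>b\<in>B. \<exists>k. n = b ^ k}) \<le> real (card B) * (2 * ln (real N) + 1)"
proof -
  define K where "K = nat \<lfloor>2 * ln (real N)\<rfloor>"
  have lN: "ln (real N) \<ge> 0" using N by simp
  have "{n \<in> {1..N}. \<exists>b\<in>B. \<exists>k. n = b ^ k} \<subseteq> (\<lambda>(b, k). b ^ k) ` (B \<times> {..K})"
  proof safe
    fix b k assume b: "b \<in> B" and bk: "b ^ k \<in> {1..N}"
    have "real k \<le> 2 * ln (real N)" by (rule exponent_bound[of b]) (use B(2)[OF b] bk in auto)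
    then have "k \<le> K" unfolding K_def by linarith
    then show "b ^ k \<in> (\<lambda>(b, k). b ^ k) ` (B \<times> {..K})" using b by force
  qed
  then have "card {n \<in> {1..N}. \<exists>b\<in>B. \<exists>k. n = b ^ k} \<le> card (B \<times> {..K})"
    using B(1) by (intro surj_card_le) auto
  also have "\<dots> = card B * (K + 1)" by (simp add: card_cartesian_product)
  finally have "real (card {n \<in> {1..N}. \<exists>b\<in>B. \<exists>k. n = b ^ k}) \<le> real (card B * (K + 1))" by (simp only: of_nat_le_iff)
  also have "\<dots> = real (card B) * (real K + 1)" by (simp add: distrib_left)
  also have "\<dots> \<le> real (card B) * (2 * ln (real N) + 1)"
    unfolding K_def using lN by (intro mult_left_mono) auto
  finally show ?thesis .
qed

lemma sum_mangoldt_le_card: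
  assumes "S \<subseteq> {1..N}" "N \<ge> 1"
  shows "(\<Sum>n\<in>S. mangoldt n) \<le> real (card S) * ln (real N)"
proof -
  have "mangoldt n \<le> ln (real N)" if "n \<in> S" for n
  proof -
    have n: "n \<ge> 1" "n \<le> N" using that assms by auto
    have "mangoldt n \<le> ln (real n)" by (rule mangoldt_le) (use n in auto)
    also have "\<dots> \<le> ln (real N)" using n by simp
    finally show ?thesis .
  qed
  then show ?thesis using sum_bounded_above[of S mangoldt "ln (real N)"] by simp
qed

text \<open>Only \<open>Q / w < n \<le> Q\<close> is kept, where the weight is at least
  \<open>exp (- (ln w)\<^sup>2 / 2)\<close>. Chebyshev's bound is reduced by the trivial estimate
  for \<open>n \<le> Q / w\<close> and by the powers of the primes in \<open>P\<close>. This is the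
  main term, that of the principal character.\<close>

lemma mangoldt_coprime_mass_lower:
  assumes P: "finite P" "\<And>p. p \<in> P \<Longrightarrow> prime p" and c: "1 < c" and Q: "Q \<ge> 4" and w: "w \<ge> 1"
  shows "(\<Sum>n. mangoldt n * (if coprime n (\<Prod>P) then 1 else 0) * wt Q c n)
    \<ge> exp (- (ln w)\<^sup>2 / 2) * ((Q / 2 - 1) * ln 4 - ln Q - Q / w * ln Q - real (\<Prod>P) * (2 * ln Q + 1) * ln Q)"
proof -
  define d where "d = \<Prod>P"
  define N where "N = nat \<lfloor>Q / 2\<rfloor>"
  have N1: "N \<ge> 1" using Q unfolding N_def by linarith
  have N2: "real (2 * N) \<le> Q" using Q unfolding N_def by linarith
  have N3: "real N \<ge> Q / 2 - 1" using Q unfolding N_def by linarith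
  define A where "A = {n \<in> {1..2 * N}. real n > Q / w \<and> coprime n d}"
  define B1 where "B1 = {n \<in> {1..2 * N}. real n \<le> Q / w}"
  define B2 where "B2 = {n \<in> {1..2 * N}. \<exists>b\<in>P. \<exists>k. n = b ^ k}"
  have lQ: "ln Q \<ge> 0" using Q by simp
  have ln2N: "ln (real (2 * N)) \<le> ln Q" using N1 N2 by (intro ln_mono) auto
  have "real N * ln 4 - ln (2 * real N) \<le> (\<Sum>n\<in>{1..2 * N}. mangoldt n)" by (rule psi_lower_bound) (use N1 in auto)
  also have "\<dots> = (\<Sum>n\<in>A \<union> (B1 \<union> B2). mangoldt n)"
  proof (rule sum.mono_neutral_right)
    show "A \<union> (B1 \<union> B2) \<subseteq> {1..2 * N}" by (auto simp: A_def B1_def B2_def)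
    show "\<forall>n\<in>{1..2 * N} - (A \<union> (B1 \<union> B2)). mangoldt n = (0::real)"
    proof (rule ballI)
      fix n assume "n \<in> {1..2 * N} - (A \<union> (B1 \<union> B2))"
      then have n: "n \<in> {1..2 * N}" "n \<notin> A" "n \<notin> B1" "n \<notin> B2" by auto
      show "mangoldt n = (0::real)"
      proof (rule ccontr)
        assume "mangoldt n \<noteq> (0::real)"
        then have "primepow n" by (auto simp: mangoldt_def split: if_splits)
        then obtain q k where qk: "prime q" "k > 0" "n = q ^ k" by (auto simp: primepow_def)
        have "\<not> coprime n d" using n by (auto simp: A_def B1_def)
        then have "\<not> coprime q d" using qk(3) by auto
        then have "q dvd d" using qk(1) prime_imp_coprime by blast
        then obtain p where p: "p \<in> P" "q dvd p" unfolding d_def using P(1) qk(1) by (auto simp: prime_dvd_prod_iff)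
        then have "p = q" using P(2)[OF p(1)] qk(1) p(2) primes_dvd_imp_eq by blast
        then have "n \<in> B2" using n(1) p(1) qk(3) by (auto simp: B2_def)
        then show False using n(4) by simp
      qed
    qed
  qed simp
  also have "\<dots> \<le> (\<Sum>n\<in>A. mangoldt n) + ((\<Sum>n\<in>B1. mangoldt n) + (\<Sum>n\<in>B2. mangoldt n))"
  proof -
    have fin: "finite A" "finite B1" "finite B2" by (auto simp: A_def B1_def B2_def)
    have nn: "(\<Sum>n\<in>S. mangoldt n :: real) \<ge> 0" for S by (intro sum_nonneg) (simp add: mangoldt_nonneg)
    show ?thesis
      using sum_Un[of A "B1 \<union> B2" "mangoldt :: nat \<Rightarrow> real"] sum_Un[of B1 B2 "mangoldt :: nat \<Rightarrow> real"] fin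
        nn[of "A \<inter> (B1 \<union> B2)"] nn[of "B1 \<inter> B2"] by simp
  qed
  also have "(\<Sum>n\<in>B1. mangoldt n) \<le> Q / w * ln Q"
  proof -
    have "B1 \<subseteq> {1..nat \<lfloor>Q / w\<rfloor>}" by (auto simp: B1_def le_nat_floor)
    then have "card B1 \<le> nat \<lfloor>Q / w\<rfloor>" using card_mono[of "{1..nat \<lfloor>Q / w\<rfloor>}" B1] by simp
    moreover have "real (nat \<lfloor>Q / w\<rfloor>) \<le> Q / w" using Q w by (intro of_nat_floor) auto
    ultimately have cB: "real (card B1) \<le> Q / w" by linarith
    have "(\<Sum>n\<in>B1. mangoldt n) \<le> real (card B1) * ln (real (2 * N))"
      by (rule sum_mangoldt_le_card) (use N1 in \<open>auto simp: B1_def\<close>)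
    also have "\<dots> \<le> Q / w * ln Q" using cB ln2N N1 Q w by (intro mult_mono) auto
    finally show ?thesis .
  qed
  also have "(\<Sum>n\<in>B2. mangoldt n) \<le> real d * (2 * ln Q + 1) * ln Q"
  proof -
    have "real (card B2) \<le> real (card P) * (2 * ln (real (2 * N)) + 1)"
      unfolding B2_def by (rule card_powers_le) (use P N1 prime_ge_2_nat in auto)
    also have "\<dots> \<le> real d * (2 * ln Q + 1)"
    proof -
      have "real (card P) \<le> real d" using card_le_prod_primes(1)[OF P] unfolding d_def by (simp only: of_nat_le_iff)
      then show ?thesis using ln2N N1 by (intro mult_mono) auto
    qed
    finally have cB: "real (card B2) \<le> real d * (2 * ln Q + 1)" .
    have "(\<Sum>n\<in>B2. mangoldt n) \<le> real (card B2) * ln (real (2 * N))"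
      by (rule sum_mangoldt_le_card) (use N1 in \<open>auto simp: B2_def\<close>)
    also have "\<dots> \<le> real d * (2 * ln Q + 1) * ln Q" using cB ln2N N1 lQ by (intro mult_mono) auto
    finally show ?thesis .
  qed
  finally have "real N * ln 4 - ln (2 * real N) \<le> (\<Sum>n\<in>A. mangoldt n) + (Q / w * ln Q + real d * (2 * ln Q + 1) * ln Q)"
    by linarith
  moreover have "(Q / 2 - 1) * ln 4 \<le> real N * ln 4" using N3 by (intro mult_right_mono) auto
  moreover have "ln (2 * real N) \<le> ln Q" using ln2N by simp
  ultimately have Alow: "(Q / 2 - 1) * ln 4 - ln Q - Q / w * ln Q - real d * (2 * ln Q + 1) * ln Q \<le> (\<Sum>n\<in>A. mangoldt n)"
    by linarith
  have sm: "summable (\<lambda>n. mangoldt n * (if coprime n d then 1 else 0) * wt Q c n)"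
  proof (rule summable_comparison_test'[OF wt_summable(1)[of c Q]])
    fix n :: nat
    show "norm (mangoldt n * (if coprime n d then 1 else 0) * wt Q c n) \<le> mangoldt n * wt Q c n"
      using wt_nonneg[of Q c n] mangoldt_nonneg[of n] by (auto simp: abs_mult)
  qed (use c Q in auto)
  have "exp (- (ln w)\<^sup>2 / 2) * (\<Sum>n\<in>A. mangoldt n) \<le> (\<Sum>n\<in>A. mangoldt n * (if coprime n d then 1 else 0) * wt Q c n)"
    unfolding sum_distrib_left
  proof (intro sum_mono)
    fix n assume n: "n \<in> A"
    then have n0: "real n > 0" "real n \<le> Q" "Q / w < real n" "coprime n d" using N2 by (auto simp: A_def)
    have r: "1 \<le> Q / real n" "Q / real n \<le> w" using n0 w by (auto simp: field_simps)
    then have "0 \<le> ln (Q / real n)" "ln (Q / real n) \<le> ln w" by (auto intro: ln_mono)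
    then have "(ln (Q / real n))\<^sup>2 \<le> (ln w)\<^sup>2" by (intro power_mono) auto
    then have "exp (- (ln w)\<^sup>2 / 2) \<le> exp (- (ln (Q / real n))\<^sup>2 / 2)" by simp
    moreover have "1 \<le> (Q / real n) powr c" using r c by (intro ge_one_powr_ge_zero) auto
    ultimately have "1 * exp (- (ln w)\<^sup>2 / 2) \<le> wt Q c n" unfolding wt_def by (intro mult_mono) auto
    then show "exp (- (ln w)\<^sup>2 / 2) * mangoldt n \<le> mangoldt n * (if coprime n d then 1 else 0) * wt Q c n"
    proof -
      assume "1 * exp (- (ln w)\<^sup>2 / 2) \<le> wt Q c n"
      then have "mangoldt n * (1 * exp (- (ln w)\<^sup>2 / 2)) \<le> mangoldt n * wt Q c n"
        by (rule mult_left_mono) (rule mangoldt_nonneg)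
      then show ?thesis using n0(4) by (simp add: mult.commute)
    qed
  qed
  also have "\<dots> \<le> (\<Sum>n. mangoldt n * (if coprime n d then 1 else 0) * wt Q c n)"
    by (rule sum_le_suminf[OF sm]) (auto simp: A_def mangoldt_nonneg wt_nonneg)
  finally have "exp (- (ln w)\<^sup>2 / 2) * (\<Sum>n\<in>A. mangoldt n) \<le> (\<Sum>n. mangoldt n * (if coprime n d then 1 else 0) * wt Q c n)" .
  then show ?thesis using mult_left_mono[OF Alow less_imp_le[OF exp_gt_zero[of "- (ln w)\<^sup>2 / 2"]]]
    unfolding d_def by (rule order_trans[rotated])
qed

lemma sums_sum_list:
  fixes f :: "'b \<Rightarrow> nat \<Rightarrow> 'a::real_normed_vector"
  assumes "\<And>x. x \<in> set xs \<Longrightarrow> f x sums g x"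
  shows "(\<lambda>n. \<Sum>x\<leftarrow>xs. f x n) sums (\<Sum>x\<leftarrow>xs. g x)"
  using assms by (induction xs) (auto intro!: sums_add)

lemma Re_sum_list: "Re (\<Sum>x\<leftarrow>xs. f x) = (\<Sum>x\<leftarrow>xs. Re (f x))"
  by (induction xs) auto

text \<open>A proper prime power up to \<open>N\<close> has its base below \<open>sqrt N\<close>, so
  everything but the primes is absorbed in the second summand.\<close>

lemma sum_mangoldt_residue_le:
  fixes d N :: nat
  assumes N: "N \<ge> 1"
  shows "(\<Sum>n\<in>{n \<in> {1..N}. [n = 1] (mod d)}. mangoldt n)
    \<le> (real (card {p. prime p \<and> p \<le> N \<and> [p = 1] (mod d)}) + sqrt (real N) * (2 * ln (real N) + 1)) * ln (real N)"
proof -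
  define S where "S = {n \<in> {1..N}. [n = 1] (mod d) \<and> primepow n}"
  define B where "B = {2..nat \<lfloor>sqrt (real N)\<rfloor>}"
  define S1 where "S1 = {p. prime p \<and> p \<le> N \<and> [p = 1] (mod d)}"
  define S2 where "S2 = {n \<in> {1..N}. \<exists>b\<in>B. \<exists>k. n = b ^ k}"
  have fS1: "finite S1" by (rule finite_subset[of _ "{..N}"]) (auto simp: S1_def)
  have "S \<subseteq> S1 \<union> S2"
  proof
    fix n assume n: "n \<in> S"
    then obtain q k where qk: "prime q" "k > 0" "n = q ^ k" by (auto simp: S_def primepow_def)
    show "n \<in> S1 \<union> S2"
    proof (cases "k = 1")
      case True
      then show ?thesis using n qk by (auto simp: S1_def S_def)
    next
      case False
      then have "q ^ 2 \<le> q ^ k" using qk prime_ge_1_nat[of q] by (intro power_increasing) auto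
      then have "q ^ 2 \<le> N" using n qk(3) by (auto simp: S_def)
      then have "(real q)\<^sup>2 \<le> real N" by (metis of_nat_le_iff of_nat_power)
      then have "real q \<le> sqrt (real N)" by (rule real_le_rsqrt)
      then have "q \<in> B" using prime_ge_2_nat[OF qk(1)] by (simp add: B_def le_nat_floor)
      then show ?thesis using n qk(3) by (auto simp: S2_def S_def)
    qed
  qed
  then have "card S \<le> card (S1 \<union> S2)" using fS1 by (intro card_mono) (auto simp: S2_def)
  also have "\<dots> \<le> card S1 + card S2" by (rule card_Un_le)
  finally have "real (card S) \<le> real (card S1) + real (card S2)" by linarith
  also have "real (card S2) \<le> real (card B) * (2 * ln (real N) + 1)"
    unfolding S2_def by (rule card_powers_le) (use N in \<open>auto simp: B_def\<close>)
  also have "\<dots> \<le> sqrt (real N) * (2 * ln (real N) + 1)"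
  proof (rule mult_right_mono)
    have "card B \<le> nat \<lfloor>sqrt (real N)\<rfloor>" by (simp add: B_def)
    moreover have "real (nat \<lfloor>sqrt (real N)\<rfloor>) \<le> sqrt (real N)" by (intro of_nat_floor) auto
    ultimately show "real (card B) \<le> sqrt (real N)" by linarith
  qed (use N in simp)
  finally have cS: "real (card S) \<le> real (card S1) + sqrt (real N) * (2 * ln (real N) + 1)" by simp
  have "(\<Sum>n\<in>{n \<in> {1..N}. [n = 1] (mod d)}. mangoldt n) = (\<Sum>n\<in>S. mangoldt n :: real)"
    by (rule sum.mono_neutral_right) (auto simp: S_def mangoldt_def)
  also have "\<dots> \<le> real (card S) * ln (real N)" by (rule sum_mangoldt_le_card) (use N in \<open>auto simp: S_def\<close>)
  also have "\<dots> \<le> (real (card S1) + sqrt (real N) * (2 * ln (real N) + 1)) * ln (real N)"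
    using cS N by (intro mult_right_mono) auto
  finally show ?thesis unfolding S1_def .
qed

text \<open>Up to \<open>Q * X\<close> the weight is at most \<open>exp 2\<close>. Beyond, its
  Gaussian factor is at most \<open>exp (- (ln X)\<^sup>2 / 2)\<close>, and the remaining factor
  \<open>(Q / n) powr c\<close> sums to \<open>Zr c * Q powr c\<close>.\<close>

lemma mangoldt_residue_mass_upper:
  fixes d :: nat
  assumes c: "1 < c" "c \<le> 2" and Q: "Q \<ge> 1" and X: "X \<ge> 1"
  shows "(\<Sum>n. mangoldt n * (if [n = 1] (mod d) then 1 else 0) * wt Q c n)
    \<le> exp 2 * ((real (card {p. prime p \<and> real p \<le> Q * X \<and> [p = 1] (mod d)}) + sqrt (Q * X) * (2 * ln (Q * X) + 1)) * ln (Q * X))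
      + Zr c * Q powr c * exp (- (ln X)\<^sup>2 / 2)"
proof -
  define N where "N = nat \<lfloor>Q * X\<rfloor>"
  have QX: "Q * X \<ge> 1" using Q X by (metis mult_mono mult_1 zero_le_one order_trans)
  have N1: "N \<ge> 1" using QX unfolding N_def by linarith
  have N2: "real N \<le> Q * X" using QX unfolding N_def by simp
  have leN: "n \<le> N \<longleftrightarrow> real n \<le> Q * X" for n unfolding N_def using QX by (simp add: le_nat_iff le_floor_iff)
  define D where "D = {n \<in> {1..N}. [n = 1] (mod d)}"
  define f :: "nat \<Rightarrow> real" where "f n = (if n \<in> D then mangoldt n * exp 2 else 0)" for n
  have finD: "finite D" by (simp add: D_def)
  have fs: "f sums (\<Sum>n\<in>D. mangoldt n * exp 2)"
    unfolding f_def by (rule sums_If_finite_set[OF finD])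
  define e where "e = exp (- (ln X)\<^sup>2 / 2)"
  have gs: "(\<lambda>n. mangoldt n * (Q / real n) powr c * e) sums (Zr c * Q powr c * e)"
    using wt_summable(2,3)[of c Q] c Q by (intro sums_mult2) (auto simp: sums_iff)
  have le: "mangoldt n * (if [n = 1] (mod d) then 1 else 0) * wt Q c n \<le> f n + mangoldt n * (Q / real n) powr c * e" for n
  proof (cases "n = 0 \<or> \<not> [n = 1] (mod d)")
    case True
    have "0 \<le> f n + mangoldt n * (Q / real n) powr c * e" by (auto simp: f_def mangoldt_nonneg e_def)
    then show ?thesis using True by auto
  next
    case False
    show ?thesis
    proof (cases "n \<le> N")
      case True
      then have "n \<in> D" using False by (auto simp: D_def)
      moreover have "mangoldt n * wt Q c n \<le> mangoldt n * exp 2"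
        using False c Q by (intro mult_left_mono wt_le_exp2) (auto simp: mangoldt_nonneg)
      moreover have "0 \<le> mangoldt n * (Q / real n) powr c * e" by (simp add: mangoldt_nonneg e_def)
      ultimately show ?thesis using False by (simp add: f_def)
    next
      case nN: False
      then have n: "real n > Q * X" using leN[of n] by simp
      have n0: "real n > 0" using n QX by linarith
      have "X * (Q / real n) \<le> 1" using n n0 by (simp add: field_simps)
      then have "ln (X * (Q / real n)) \<le> 0" using X Q n0 by (intro ln_le_zero_iff[THEN iffD2]) auto
      then have "ln (Q / real n) \<le> - ln X" using X Q n0 by (subst (asm) ln_mult) auto
      then have "ln X \<le> - ln (Q / real n)" "0 \<le> ln X" using X by auto
      then have "(ln X)\<^sup>2 \<le> (- ln (Q / real n))\<^sup>2" by (intro power_mono) auto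
      then have "exp (- (ln (Q / real n))\<^sup>2 / 2) \<le> e" unfolding e_def by simp
      then have "wt Q c n \<le> (Q / real n) powr c * e" unfolding wt_def by (intro mult_left_mono) auto
      then have "mangoldt n * wt Q c n \<le> mangoldt n * ((Q / real n) powr c * e)" by (intro mult_left_mono) (auto simp: mangoldt_nonneg)
      moreover have "f n \<ge> 0" by (auto simp: f_def mangoldt_nonneg)
      ultimately show ?thesis using False by (simp add: mult.assoc)
    qed
  qed
  have sm: "summable (\<lambda>n. mangoldt n * (if [n = 1] (mod d) then 1 else 0) * wt Q c n)"
  proof (rule summable_comparison_test'[OF wt_summable(1)[of c Q]])
    fix n :: nat
    show "norm (mangoldt n * (if [n = 1] (mod d) then 1 else 0) * wt Q c n) \<le> mangoldt n * wt Q c n"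
      using wt_nonneg[of Q c n] mangoldt_nonneg[of n] by (auto simp: abs_mult)
  qed (use c Q in auto)
  have "(\<Sum>n. mangoldt n * (if [n = 1] (mod d) then 1 else 0) * wt Q c n) \<le> (\<Sum>n\<in>D. mangoldt n * exp 2) + Zr c * Q powr c * e"
    by (rule sums_le[OF le summable_sums[OF sm] sums_add[OF fs gs]])
  also have "(\<Sum>n\<in>D. mangoldt n * exp (2::real)) = exp 2 * (\<Sum>n\<in>D. mangoldt n)" by (simp add: sum_distrib_right[symmetric] mult.commute)
  also have "(\<Sum>n\<in>D. mangoldt n :: real) \<le> (real (card {p. prime p \<and> p \<le> N \<and> [p = 1] (mod d)}) + sqrt (real N) * (2 * ln (real N) + 1)) * ln (real N)"
    unfolding D_def by (rule sum_mangoldt_residue_le[OF N1])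
  also have "\<dots> \<le> (real (card {p. prime p \<and> p \<le> N \<and> [p = 1] (mod d)}) + sqrt (Q * X) * (2 * ln (Q * X) + 1)) * ln (Q * X)"
    using N1 N2 by (intro mult_mono add_mono) auto
  finally show ?thesis unfolding e_def leN by (simp add: mult_left_mono)
qed

section \<open>Counting primes congruent to 1\<close>

text \<open>By orthogonality the smoothed sums over all characters add up to
  \<open>length xs\<close> times the sum over \<open>n\<close> congruent to \<open>1\<close>. One
  principal character gives the main term, and every other entry is at least \<open>- Err\<close>.
  Since the main term is nonnegative, \<open>length xs\<close> may be replaced by the modulus in its
  denominator.\<close>

lemma prime_count_residue_class_ge:
  assumes T: "Tok T" and P: "finite P" "\<And>p. p \<in> P \<Longrightarrow> prime p" and PT: "real (\<Prod>P) \<le> T"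
    and good: "\<And>\<theta>. dchar (\<Prod>P) \<theta> \<Longrightarrow> nonprincipal (\<Prod>P) \<theta> \<Longrightarrow> good_char T \<theta>"
    and Q: "ln Q \<ge> 28000 * ln T" "Q \<ge> 4" and X: "X \<ge> 1" and w: "w \<ge> 1"
  defines "K \<equiv> 1344000 * (ln T)\<^sup>2"
  defines "Err \<equiv> 45 * (ln Q + 3) * Q / (T - 1) ^ 6 + 6 * T * K * Q powr (1 - 1 / (28000 * ln T)) + 900 * K * Q / (T - 1) ^ 6"
  shows "exp (- (ln w)\<^sup>2 / 2) * ((Q / 2 - 1) * ln 4 - ln Q - Q / w * ln Q - real (\<Prod>P) * (2 * ln Q + 1) * ln Q) / real (\<Prod>P) - Err
    \<le> exp 2 * ((real (card {p. prime p \<and> real p \<le> Q * X \<and> [p = 1] (mod \<Prod>P)}) + sqrt (Q * X) * (2 * ln (Q * X) + 1)) * ln (Q * X))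
      + (ln Q + 3) * (3 * Q) * exp (- (ln X)\<^sup>2 / 2)"
proof -
  define d where "d = \<Prod>P"
  define c where "c = 1 + 1 / ln Q"
  have T3: "T \<ge> 3" "ln T \<ge> 1" using TokD[OF T] .
  have lQ: "ln Q \<ge> 28000" using Q T3 by linarith
  have c: "1 < c" "c \<le> 2" using lQ unfolding c_def by (auto simp: field_simps)
  have Q0: "Q > 0" using Q by simp
  have Err0: "Err \<ge> 0" unfolding Err_def K_def using T3 lQ Q0 by (intro add_nonneg_nonneg) auto
  obtain xs where xs: "\<forall>\<theta>\<in>set xs. dchar d \<theta>" "length xs \<le> d" "(\<lambda>n. if coprime n d then 1 else 0) \<in> set xs"
     "\<And>n. (\<Sum>\<theta>\<leftarrow>xs. \<theta> n) = (if [n = 1] (mod d) then of_nat (length xs) else 0)"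
    using dchar_list_exists[OF P] unfolding d_def by blast
  have len: "length xs > 0" using xs(3) by (cases xs) auto
  define S where "S \<theta> = (\<Sum>n. mangoldt n * \<theta> n * of_real (wt Q c n))" for \<theta> :: "nat \<Rightarrow> complex"
  have Ss: "(\<lambda>n. mangoldt n * \<theta> n * of_real (wt Q c n)) sums S \<theta>" if "\<theta> \<in> set xs" for \<theta>
  proof -
    have "norm (\<theta> n) \<le> 1" for n using xs(1) that dcharD(5) by blast
    then show ?thesis using gaussian_mellin(2)[of \<theta> c Q] c Q0 unfolding S_def by (auto simp: sums_iff)
  qed
  define Mn where "Mn = (\<Sum>n. mangoldt n * (if coprime n d then 1 else 0) * wt Q c n)"
  have Mn_sums: "(\<lambda>n. mangoldt n * (if coprime n d then 1 else 0) * wt Q c n) sums Mn"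
  proof -
    have "summable (\<lambda>n. mangoldt n * (if coprime n d then 1 else 0) * wt Q c n)"
    proof (rule summable_comparison_test'[OF wt_summable(1)[of c Q]])
      fix n :: nat
      show "norm (mangoldt n * (if coprime n d then 1 else 0) * wt Q c n) \<le> mangoldt n * wt Q c n"
        using wt_nonneg[of Q c n] mangoldt_nonneg[of n] by (auto simp: abs_mult)
    qed (use c Q0 in auto)
    then show ?thesis unfolding Mn_def by (rule summable_sums)
  qed
  have Mn0: "Mn \<ge> 0" by (rule sums_le[OF _ sums_zero Mn_sums]) (auto simp: mangoldt_nonneg wt_nonneg)
  have Sp: "Re (S (\<lambda>n. if coprime n d then 1 else 0)) = Mn"
  proof -
    have "(\<lambda>n. Re (mangoldt n * (if coprime n d then 1 else 0) * of_real (wt Q c n))) sums Re (S (\<lambda>n. if coprime n d then 1 else 0))"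
      by (rule sums_Re[OF Ss[OF xs(3)]])
    moreover have "(\<lambda>n. Re (mangoldt n * (if coprime n d then 1 else 0) * of_real (wt Q c n))) = (\<lambda>n. mangoldt n * (if coprime n d then 1 else 0) * wt Q c n)"
      by (rule ext) simp
    ultimately show ?thesis using sums_unique2[OF _ Mn_sums] by metis
  qed
  have Sge: "Re (S \<theta>) \<ge> - Err" if \<theta>: "\<theta> \<in> set xs" for \<theta>
  proof (cases "nonprincipal d \<theta>")
    case True
    have dc: "dchar d \<theta>" using xs(1) \<theta> by blast
    have "norm (S \<theta>) \<le> Err" unfolding S_def Err_def K_def c_def
      by (rule good_char_smoothed_sum_bound[OF T dc True _ _ Q(1) Q0]) (use PT good dc True in \<open>auto simp: d_def\<close>)
    then show ?thesis using abs_Re_le_cmod[of "S \<theta>"] by linarith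
  next
    \<comment> \<open>Such an entry is the principal character again, whose contribution is
      nonnegative; the list may repeat it.\<close>
    case False
    have dc: "dchar d \<theta>" using xs(1) \<theta> by blast
    have "\<theta> n = (if coprime n d then 1 else 0)" for n
      using False dcharD(6)[OF dc, of n] unfolding nonprincipal_def by auto
    then have "\<theta> = (\<lambda>n. if coprime n d then 1 else 0)" by blast
    then show ?thesis using Sp Mn0 Err0 by simp
  qed
  define A where "A = (\<Sum>n. mangoldt n * (if [n = 1] (mod d) then 1 else 0) * wt Q c n)"
  have A_sums: "(\<lambda>n. mangoldt n * (if [n = 1] (mod d) then 1 else 0) * wt Q c n) sums A"
  proof -
    have "summable (\<lambda>n. mangoldt n * (if [n = 1] (mod d) then 1 else 0) * wt Q c n)"
    proof (rule summable_comparison_test'[OF wt_summable(1)[of c Q]])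
      fix n :: nat
      show "norm (mangoldt n * (if [n = 1] (mod d) then 1 else 0) * wt Q c n) \<le> mangoldt n * wt Q c n"
        using wt_nonneg[of Q c n] mangoldt_nonneg[of n] by (auto simp: abs_mult)
    qed (use c Q0 in auto)
    then show ?thesis unfolding A_def by (rule summable_sums)
  qed
  have "(\<Sum>\<theta>\<leftarrow>xs. Re (S \<theta>)) = real (length xs) * A"
  proof -
    have 1: "(\<lambda>n. \<Sum>\<theta>\<leftarrow>xs. mangoldt n * \<theta> n * of_real (wt Q c n)) sums (\<Sum>\<theta>\<leftarrow>xs. S \<theta>)"
      by (rule sums_sum_list) (rule Ss)
    have 2: "Re (\<Sum>\<theta>\<leftarrow>xs. mangoldt n * \<theta> n * of_real (wt Q c n)) = real (length xs) * (mangoldt n * (if [n = 1] (mod d) then 1 else 0) * wt Q c n)" for n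
    proof -
      have "(\<Sum>\<theta>\<leftarrow>xs. mangoldt n * \<theta> n * of_real (wt Q c n)) = mangoldt n * (\<Sum>\<theta>\<leftarrow>xs. \<theta> n) * of_real (wt Q c n)"
        by (simp add: sum_list_const_mult sum_list_mult_const)
      then show ?thesis unfolding xs(4) by simp
    qed
    have "(\<lambda>n. real (length xs) * (mangoldt n * (if [n = 1] (mod d) then 1 else 0) * wt Q c n)) sums Re (\<Sum>\<theta>\<leftarrow>xs. S \<theta>)"
      using sums_Re[OF 1] unfolding 2 .
    then have "Re (\<Sum>\<theta>\<leftarrow>xs. S \<theta>) = real (length xs) * A" using sums_unique2 sums_mult[OF A_sums] by blast
    then show ?thesis by (simp add: Re_sum_list)
  qed
  moreover have "(\<Sum>\<theta>\<leftarrow>xs. Re (S \<theta>)) \<ge> Re (S (\<lambda>n. if coprime n d then 1 else 0)) - real (length xs) * Err"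
    by (rule sum_list_lower_bound[OF xs(3) Sge Err0])
  ultimately have "Mn - real (length xs) * Err \<le> real (length xs) * A" unfolding Sp by simp
  then have "Mn / real (length xs) - Err \<le> A" using len by (simp add: field_simps)
  moreover have "Mn / real d \<le> Mn / real (length xs)" using Mn0 len xs(2) order.strict_trans2[OF len xs(2)] by (intro divide_left_mono mult_pos_pos) auto
  ultimately have low: "Mn / real d - Err \<le> A" by linarith
  have "exp (- (ln w)\<^sup>2 / 2) * ((Q / 2 - 1) * ln 4 - ln Q - Q / w * ln Q - real d * (2 * ln Q + 1) * ln Q) \<le> Mn"
    unfolding Mn_def d_def by (rule mangoldt_coprime_mass_lower[OF P c(1) Q(2) w])
  then have "exp (- (ln w)\<^sup>2 / 2) * ((Q / 2 - 1) * ln 4 - ln Q - Q / w * ln Q - real d * (2 * ln Q + 1) * ln Q) / real d \<le> Mn / real d"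
    by (rule divide_right_mono) simp
  moreover have "A \<le> exp 2 * ((real (card {p. prime p \<and> real p \<le> Q * X \<and> [p = 1] (mod d)}) + sqrt (Q * X) * (2 * ln (Q * X) + 1)) * ln (Q * X))
      + Zr c * Q powr c * exp (- (ln X)\<^sup>2 / 2)"
    unfolding A_def by (rule mangoldt_residue_mass_upper) (use c Q X in auto)
  moreover have "Zr c * Q powr c * exp (- (ln X)\<^sup>2 / 2) \<le> (ln Q + 3) * (3 * Q) * exp (- (ln X)\<^sup>2 / 2)"
  proof (intro mult_right_mono mult_mono)
    have "Zr c \<le> 1 / (c - 1) + 3 * (c - 1)" by (rule Zr_le[OF c])
    then show "Zr c \<le> ln Q + 3" using c(2) by (simp add: c_def)
    have "Q powr c = exp 1 * Q" 
    proof -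
      have "c * ln Q = ln Q + 1" using lQ unfolding c_def by (simp add: distrib_right)
      then show ?thesis using Q0 unfolding powr_def by (simp add: exp_add)
    qed
    then show "Q powr c \<le> 3 * Q" using exp_le Q0 by simp
  qed (use lQ in auto)
  ultimately show ?thesis using low unfolding d_def by linarith
qed

text \<open>The parameters are \<open>Q = exp l\<close>, \<open>T = exp (l powr (1/4))\<close>,
  \<open>w = 16 * l\<close> and \<open>X = exp (l powr (1/6))\<close>. The exponent of
  \<open>X\<close> lies between 1/8 and 1/4: \<open>exp (- (ln X)\<^sup>2 / 2)\<close> must beat a
  modulus as large as \<open>T\<close>, while the longer range must cost less than the later gain.
  The choice of \<open>w\<close> turns the trivial part \<open>Q / w * ln Q\<close> into
  \<open>Q / 16\<close>, and the weight \<open>exp (- (ln w)\<^sup>2 / 2)\<close> is lost, which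
  \<open>(ln l) ^ 3\<close> absorbs.\<close>

lemma eventually_many_primes:
  "eventually (\<lambda>l::real. \<exists>q. prime q \<and> (\<forall>P. finite P \<longrightarrow> (\<forall>p\<in>P. prime p) \<longrightarrow> q \<notin> P \<longrightarrow>
      real (\<Prod>P) \<le> exp (l powr (1/4)) \<longrightarrow>
      exp (l - (ln l) ^ 3) / real (\<Prod>P)
        \<le> real (card {p. prime p \<and> real p \<le> exp (l + l powr (1/6)) \<and> [p = 1] (mod \<Prod>P)}))) at_top"
proof -
  have fl: "filterlim (\<lambda>l::real. exp (l powr (1/4))) at_top at_top" by real_asymp
  have E0: "eventually (\<lambda>l::real. Tok (exp (l powr (1/4)))) at_top"
    using eventually_compose_filterlim[OF eventually_Tok fl] .
  have E1: "eventually (\<lambda>l::real. exp l / 4 \<le> (exp l / 2 - 1) - l - exp l / 16 - exp (l powr (1/4)) * (2 * l + 1) * l) at_top"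
    by real_asymp
  have E2: "eventually (\<lambda>l::real. exp (l powr (1/4)) * (45 * (l + 3) * exp l / (exp (l powr (1/4)) - 1) ^ 6)
      \<le> exp l * exp (- (ln (16 * l))\<^sup>2 / 2) / 64) at_top"
    by real_asymp
  have E3: "eventually (\<lambda>l::real. exp (l powr (1/4)) * (6 * exp (l powr (1/4)) * (1344000 * (l powr (1/4))\<^sup>2) * exp (l * (1 - 1 / (28000 * l powr (1/4)))))
      \<le> exp l * exp (- (ln (16 * l))\<^sup>2 / 2) / 64) at_top"
    by real_asymp
  have E4: "eventually (\<lambda>l::real. exp (l powr (1/4)) * (900 * (1344000 * (l powr (1/4))\<^sup>2) * exp l / (exp (l powr (1/4)) - 1) ^ 6)
      \<le> exp l * exp (- (ln (16 * l))\<^sup>2 / 2) / 64) at_top"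
    by real_asymp
  have E5: "eventually (\<lambda>l::real. exp (l powr (1/4)) * (exp 2 * (exp ((l + l powr (1/6)) / 2) * (2 * (l + l powr (1/6)) + 1) * (l + l powr (1/6))))
      \<le> exp l * exp (- (ln (16 * l))\<^sup>2 / 2) / 64) at_top"
    by real_asymp
  have E6: "eventually (\<lambda>l::real. exp (l powr (1/4)) * ((l + 3) * (3 * exp l) * exp (- (l powr (1/6))\<^sup>2 / 2))
      \<le> exp l * exp (- (ln (16 * l))\<^sup>2 / 2) / 64) at_top"
    by real_asymp
  have E7: "eventually (\<lambda>l::real. exp (l - (ln l) ^ 3) * (exp 2 * (l + l powr (1/6))) \<le> exp l * exp (- (ln (16 * l))\<^sup>2 / 2) / 8) at_top"
    by real_asymp
  have E8: "eventually (\<lambda>l::real. l \<ge> 28000 * l powr (1/4)) at_top" by real_asymp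
  show ?thesis
    using E0 E1 E2 E3 E4 E5 E6 E7 E8 eventually_ge_at_top[of 4]
  proof eventually_elim
    case (elim l)
    define T where "T = exp (l powr (1/4))"
    define v where "v = l powr (1/6)"
    define E where "E = exp (- (ln (16 * l))\<^sup>2 / 2)"
    have T: "Tok T" using elim(1) by (simp add: T_def)
    have lnT: "ln T = l powr (1/4)" by (simp add: T_def)
    obtain q where q: "prime q" "\<And>P \<theta>. finite P \<Longrightarrow> (\<And>p. p \<in> P \<Longrightarrow> prime p) \<Longrightarrow> q \<notin> P \<Longrightarrow> real (\<Prod>P) \<le> T \<Longrightarrow>
      dchar (\<Prod>P) \<theta> \<Longrightarrow> nonprincipal (\<Prod>P) \<theta> \<Longrightarrow> good_char T \<theta>"
      using exceptional_prime[OF T] by blast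
    show ?case
    proof (intro exI[of _ q] conjI allI impI q(1))
      fix P :: "nat set"
      assume P: "finite P" "\<forall>p\<in>P. prime p" "q \<notin> P" "real (\<Prod>P) \<le> exp (l powr (1/4))"
      define d where "d = real (\<Prod>P)"
      have d1: "d \<ge> 1" using card_le_prod_primes(2)[of P] P unfolding d_def by (metis One_nat_def Suc_leI of_nat_1 of_nat_le_iff)
      have dT: "d \<le> T" using P(4) by (simp add: d_def T_def)
      define C where "C = real (card {p. prime p \<and> real p \<le> exp l * exp v \<and> [p = 1] (mod \<Prod>P)})"
      define K where "K = 1344000 * (ln T)\<^sup>2"
      define Err where "Err = 45 * (l + 3) * exp l / (T - 1) ^ 6 + 6 * T * K * exp l powr (1 - 1 / (28000 * ln T)) + 900 * K * exp l / (T - 1) ^ 6"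
      have l4: "exp l \<ge> 4" using elim(10) exp_ge_add_one_self[of l] by linarith
      have lv: "ln (exp l * exp v) = l + v" by (simp add: exp_add[symmetric])
      have sq: "sqrt (exp l * exp v) = exp ((l + v) / 2)"
        by (rule real_sqrt_unique) (auto simp: power2_eq_square exp_add[symmetric] field_simps)
      have main: "exp (- (ln (16 * l))\<^sup>2 / 2) * ((exp l / 2 - 1) * ln 4 - ln (exp l) - exp l / (16 * l) * ln (exp l) - real (\<Prod>P) * (2 * ln (exp l) + 1) * ln (exp l)) / real (\<Prod>P)
          - (45 * (ln (exp l) + 3) * exp l / (T - 1) ^ 6 + 6 * T * (1344000 * (ln T)\<^sup>2) * exp l powr (1 - 1 / (28000 * ln T)) + 900 * (1344000 * (ln T)\<^sup>2) * exp l / (T - 1) ^ 6)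
        \<le> exp 2 * ((C + sqrt (exp l * exp v) * (2 * ln (exp l * exp v) + 1)) * ln (exp l * exp v))
          + (ln (exp l) + 3) * (3 * exp l) * exp (- (ln (exp v))\<^sup>2 / 2)"
        unfolding C_def
      proof (rule prime_count_residue_class_ge[OF T P(1)])
        show "real (\<Prod>P) \<le> T" using dT by (simp only: d_def)
        show "good_char T \<theta>" if "dchar (\<Prod>P) \<theta>" "nonprincipal (\<Prod>P) \<theta>" for \<theta>
          by (rule q(2)[of P]) (use P that dT in \<open>auto simp: T_def\<close>)
        show "28000 * ln T \<le> ln (exp l)" using elim(9) by (simp add: lnT)
        show "exp v \<ge> 1" by (simp add: v_def)
      qed (use P(2) l4 elim(10) in auto)
      define m where "m = E * ((exp l / 2 - 1) * ln 4 - l - exp l / 16 - d * (2 * l + 1) * l)"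
      define R where "R = exp ((l + v) / 2) * (2 * (l + v) + 1) * (l + v)"
      define t where "t = (l + 3) * (3 * exp l) * exp (- v\<^sup>2 / 2)"
      have m1: "m / d - Err \<le> exp 2 * (C * (l + v)) + exp 2 * R + t"
        using main elim(10) unfolding lv sq m_def R_def t_def E_def Err_def K_def d_def[symmetric] ln_exp
        by (simp add: algebra_simps)
      have Epos: "E > 0" by (simp add: E_def)
      have mlow: "m \<ge> exp l * E / 4"
      proof -
        have gen: "c \<le> b - x - y - D" if "D \<le> D'" "a * 1 \<le> b" "c \<le> a - x - y - D'" for a b c x y D D' :: real
          using that by linarith
        have D: "d * (2 * l + 1) * l \<le> T * (2 * l + 1) * l" using dT elim(10) by (intro mult_right_mono) auto
        have A: "(exp l / 2 - 1) * 1 \<le> (exp l / 2 - 1) * ln 4"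
        proof (rule mult_left_mono)
          have "exp (1::real) \<le> 4" using exp_le by linarith
          then show "1 \<le> ln (4::real)" by (subst ln_ge_iff) auto
        qed (use l4 in simp)
        have "exp l / 4 \<le> (exp l / 2 - 1) * ln 4 - l - exp l / 16 - d * (2 * l + 1) * l"
          by (rule gen[OF D A]) (use elim(2) in \<open>simp add: T_def\<close>)
        then have "E * (exp l / 4) \<le> m" unfolding m_def using Epos by (intro mult_left_mono) auto
        then show ?thesis by (simp add: mult.commute)
      qed
      have powr_eq: "exp l powr (1 - 1 / (28000 * ln T)) = exp (l * (1 - 1 / (28000 * l powr (1/4))))"
        by (simp add: powr_def lnT mult.commute)
      \<comment> \<open>Five error terms of at most \<open>exp l * E / 64\<close> each stay below
        \<open>exp l * E / 8\<close>, so at least half of the main term \<open>exp l * E / 4\<close>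
        survives.\<close>
      have "T * (Err + exp 2 * R + t) \<le> 5 * (exp l * E / 64)"
      proof -
        have gen: "T * (a1 + a2 + a3 + a4 + a5) \<le> 5 * S"
          if "T * a1 \<le> S" "T * a2 \<le> S" "T * a3 \<le> S" "T * a4 \<le> S" "T * a5 \<le> S" for a1 a2 a3 a4 a5 S
          using that unfolding distrib_left by linarith
        show ?thesis unfolding Err_def K_def R_def t_def lnT powr_eq[unfolded lnT]
          by (rule gen[OF elim(3,4,5,6,7)[folded T_def v_def E_def]])
      qed
      moreover have "0 \<le> Err + exp 2 * R + t"
      proof -
        have "v \<ge> 0" by (simp add: v_def)
        moreover have "T - 1 \<ge> 0" using TokD(1)[OF T] by simp
        ultimately show ?thesis using elim(10) TokD(1)[OF T] unfolding Err_def K_def R_def t_def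
          by (intro add_nonneg_nonneg mult_nonneg_nonneg divide_nonneg_nonneg zero_le_power) auto
      qed
      then have "d * (Err + exp 2 * R + t) \<le> T * (Err + exp 2 * R + t)" using dT by (rule mult_right_mono[rotated])
      ultimately have small: "d * (Err + exp 2 * R + t) \<le> 5 * (exp l * E / 64)" by linarith
      have "m \<le> d * (exp 2 * (C * (l + v)) + exp 2 * R + t + Err)"
        using m1 d1 by (simp add: field_simps)
      then have "exp l * E / 8 \<le> d * (exp 2 * (C * (l + v)))"
      proof -
        assume a: "m \<le> d * (exp 2 * (C * (l + v)) + exp 2 * R + t + Err)"
        have b: "exp l * E \<ge> 0" using Epos by simp
        have "d * (exp 2 * (C * (l + v)) + exp 2 * R + t + Err) = d * (exp 2 * (C * (l + v))) + d * (Err + exp 2 * R + t)"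
          by (simp add: algebra_simps)
        then show ?thesis using a small mlow b by linarith
      qed
      then have "exp (l - (ln l) ^ 3) * (exp 2 * (l + v)) \<le> (d * C) * (exp 2 * (l + v))"
        using elim(8) unfolding v_def[symmetric] E_def[symmetric] by (simp add: mult_ac)
      moreover have "exp 2 * (l + v) > 0" using elim(10) by (auto simp: v_def intro!: mult_pos_pos add_pos_nonneg)
      ultimately have "exp (l - (ln l) ^ 3) \<le> d * C" by (rule mult_right_le_imp_le)
      then have "exp (l - (ln l) ^ 3) / d \<le> C" using d1 by (simp add: field_simps)
      then show "exp (l - (ln l) ^ 3) / real (\<Prod>P)
        \<le> real (card {p. prime p \<and> real p \<le> exp (l + l powr (1/6)) \<and> [p = 1] (mod \<Prod>P)})"
        unfolding C_def d_def v_def exp_add .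
    qed
  qed
qed

section \<open>Residue classes occupied by the set\<close>

lemma pcompose_power_left:
  fixes f g :: "'a::comm_semiring_1 poly"
  shows "pcompose (f ^ n) g = pcompose f g ^ n"
  by (induction n) (simp_all add: pcompose_mult one_pCons pcompose_pCons)

lemma coeffs_vanish_pcompose_linear:
  fixes f :: "'a::idom poly"
  assumes "\<forall>i\<ge>N. coeff f i = 0"
  shows "\<forall>i\<ge>N. coeff (pcompose f [:b, 1:]) i = 0"
proof (cases "f = 0")
  case False
  then have "degree f < N"
    using assms by (metis leading_coeff_0_iff linorder_not_le)
  moreover have "degree (pcompose f [:b, 1:]) = degree f"
    by (simp add: degree_pcompose)
  ultimately show ?thesis by (auto intro: coeff_eq_0)
qed simp

lemma coeff_linear_poly_power_binomial:
  fixes u a :: "'a::comm_semiring_1"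
  shows "coeff ([:u, a:] ^ E) j = of_nat (E choose j) * a ^ j * u ^ (E - j)"
proof (induction E arbitrary: j)
  case 0
  then show ?case by (cases j) auto
next
  case (Suc E)
  have eq: "[:u, a:] ^ Suc E = smult u ([:u, a:] ^ E) + pCons 0 (smult a ([:u, a:] ^ E))"
    by (simp add: algebra_simps)
  show ?case
  proof (cases j)
    case 0
    then show ?thesis unfolding eq by (simp add: Suc)
  next
    case (Suc i)
    show ?thesis
    proof (cases "i < E")
      case True
      then have "E - i = Suc (E - Suc i)" by simp
      then show ?thesis unfolding eq Suc by (simp add: Suc.IH algebra_simps)
    next
      case False
      then show ?thesis unfolding eq Suc by (simp add: Suc.IH algebra_simps binomial_eq_0)
    qed
  qed
qed

text \<open>A nonzero polynomial over a field has at most as many zeros, with multiplicity, as its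
  degree. Everything stays over the integers, and the order of vanishing at \<open>b\<close> is read
  off the coefficients of \<open>f (x + b)\<close>, which remains correct when \<open>m\<close>
  exceeds the characteristic. The induction splits off \<open>(x - b) ^ m\<close>.\<close>

lemma int_poly_vanishing_mod_prime:
  fixes f :: "int poly" and p :: int
  assumes p: "prime p" and "finite B"
    and "\<And>b c. b \<in> B \<Longrightarrow> c \<in> B \<Longrightarrow> b \<noteq> c \<Longrightarrow> \<not> p dvd b - c"
    and "\<And>b j. b \<in> B \<Longrightarrow> j < m \<Longrightarrow> p dvd coeff (pcompose f [:b, 1:]) j"
    and "\<forall>i\<ge>m * card B. coeff f i = 0"
  shows "[:p:] dvd f"
  using assms(2-)
proof (induction B arbitrary: f rule: finite_induct)
  case empty
  then have "f = 0" by (auto simp: poly_eq_iff)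
  then show ?case by simp
next
  case (insert b B)
  define F where "F = pcompose f [:b, 1:]"
  define h where "h = poly_shift m F"
  define g where "g = pcompose h [:-b, 1:]"
  define cut where "cut = pcompose (poly_cutoff m F) [:-b, 1:]"
  have Fz: "\<forall>i\<ge>m * card (insert b B). coeff F i = 0"
    unfolding F_def by (rule coeffs_vanish_pcompose_linear) fact
  have split: "F = poly_cutoff m F + monom 1 m * h"
    by (rule poly_eqI) (auto simp: h_def coeff_poly_cutoff coeff_poly_shift coeff_monom_mult)
  have id: "pcompose [:b, 1:] [:-b, 1:] = [:0, 1 :: int:]"
    by (simp add: pcompose_pCons)
  have "f = pcompose F [:-b, 1:]"
    unfolding F_def by (simp add: pcompose_assoc id flip: pcompose_assoc)
  also have "\<dots> = cut + [:-b, 1:] ^ m * g"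
    unfolding cut_def g_def by (subst split)
      (simp add: pcompose_add pcompose_mult monom_altdef pcompose_power_left pcompose_pCons pcompose_power_left)
  finally have f: "f = cut + [:-b, 1:] ^ m * g" .
  have "[:p:] dvd poly_cutoff m F"
    using insert.prems(2)[of b] by (auto simp: const_poly_dvd_iff coeff_poly_cutoff F_def)
  then obtain u where u: "poly_cutoff m F = [:p:] * u" by (elim dvdE)
  have cut: "[:p:] dvd cut"
    unfolding cut_def u by (subst pcompose_mult) (simp add: pcompose_pCons const_poly_dvd_iff)
  have "\<forall>i\<ge>m * card B. coeff h i = 0"
  proof (intro allI impI)
    fix i assume "m * card B \<le> i"
    then have "m * card (insert b B) \<le> i + m"
      using insert.hyps by simp
    then show "coeff h i = 0" using Fz by (simp add: h_def coeff_poly_shift add.commute)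
  qed
  then have gz: "\<forall>i\<ge>m * card B. coeff g i = 0"
    unfolding g_def by (rule coeffs_vanish_pcompose_linear)
  have "[:p:] dvd g"
  proof (rule insert.IH)
    fix c j assume c: "c \<in> B" and "j < m"
    define G where "G = pcompose g [:c, 1:]"
    define \<beta> where "\<beta> = c - b"
    have nb: "\<not> p dvd \<beta>" unfolding \<beta>_def using insert c by auto
    from cut obtain v where v: "cut = [:p:] * v" by (elim dvdE)
    have "pcompose f [:c, 1:] = [:p:] * pcompose v [:c, 1:] + [:\<beta>, 1:] ^ m * G"
      unfolding f v G_def \<beta>_def
      by (simp add: pcompose_add pcompose_mult pcompose_smult pcompose_pCons pcompose_power_left)
    then have dv: "p dvd coeff ([:\<beta>, 1:] ^ m * G) i" if "i < m" for i
      using insert.prems(2)[of c i] c that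
      by (simp add: dvd_add_right_iff)
    from \<open>j < m\<close> show "p dvd coeff G j"
    proof (induction j rule: less_induct)
      \<comment> \<open>The constant coefficient \<open>\<beta> ^ m\<close> is a unit modulo
        \<open>p\<close>, so the coefficients of \<open>G\<close> are seen to vanish one after the
        other, as in a division of power series.\<close>
      case (less j)
      have "coeff ([:\<beta>, 1:] ^ m * G) j
          = (\<Sum>i\<le>j. coeff ([:\<beta>, 1:] ^ m) i * coeff G (j - i))"
        by (simp add: coeff_mult)
      also have "\<dots> = coeff ([:\<beta>, 1:] ^ m) 0 * coeff G j
          + (\<Sum>i\<in>{..j}-{0}. coeff ([:\<beta>, 1:] ^ m) i * coeff G (j - i))"
        by (subst sum.remove[of _ 0]) auto
      finally have e: "coeff ([:\<beta>, 1:] ^ m * G) j = \<beta> ^ m * coeff G j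
          + (\<Sum>i\<in>{..j}-{0}. coeff ([:\<beta>, 1:] ^ m) i * coeff G (j - i))"
        by (simp add: coeff_0_power)
      have "p dvd (\<Sum>i\<in>{..j}-{0}. coeff ([:\<beta>, 1:] ^ m) i * coeff G (j - i))"
        using less by (intro dvd_sum dvd_mult) auto
      then have "p dvd \<beta> ^ m * coeff G j"
        using dv[OF less.prems] unfolding e by (simp add: dvd_add_left_iff)
      then show ?case using p nb by (auto simp: prime_dvd_mult_iff dest: prime_dvd_power)
    qed
  qed (use insert gz in auto)
  then show ?case unfolding f using cut by simp
qed

text \<open>\<open>c a\<close> is the value at \<open>0\<close> of the Lagrange basis polynomial for
  \<open>a\<close>, with inverses modulo \<open>p\<close> as denominators. The interpolation error
  vanishes on \<open>A\<close> and has degree below \<open>card A\<close>, so the previous lemma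
  with \<open>m = 1\<close> kills it.\<close>

lemma lagrange_functional_mod_prime:
  fixes p :: int and A :: "int set"
  assumes p: "prime p" and A: "finite A"
    and dist: "\<And>a b. a \<in> A \<Longrightarrow> b \<in> A \<Longrightarrow> a \<noteq> b \<Longrightarrow> \<not> p dvd a - b"
  obtains c :: "int \<Rightarrow> int"
  where "\<And>F. \<forall>i\<ge>card A. coeff F i = 0 \<Longrightarrow> [(\<Sum>a\<in>A. c a * poly F a) = poly F 0] (mod p)"
proof -
  define iv where "iv x = (SOME y. [x * y = 1] (mod p))" for x :: int
  have iv: "[x * iv x = 1] (mod p)" if "\<not> p dvd x" for x
  proof -
    have "coprime x p" using p that by (simp add: coprime_commute prime_imp_coprime)
    then show ?thesis unfolding iv_def by (rule someI_ex[OF cong_solve_coprime_int])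
  qed
  define P where "P a = (\<Prod>l\<in>A - {a}. smult (iv (a - l)) [:-l, 1:])" for a
  define c where "c a = poly (P a) 0" for a
  have Pdeg: "coeff (P a) i = 0" if "a \<in> A" "i \<ge> card A" for a i
  proof -
    have "degree (P a) \<le> (\<Sum>l\<in>A - {a}. degree (smult (iv (a - l)) [:-l, 1:]))"
      unfolding P_def using degree_prod_sum_le[of "A - {a}" "\<lambda>l. smult (iv (a - l)) [:-l, 1:]"] A
      by (simp add: o_def)
    also have "\<dots> \<le> (\<Sum>l\<in>A - {a}. 1)" by (intro sum_mono) (simp add: degree_smult_eq)
    also have "\<dots> < card A" using that A card_Diff1_less[of A a] by simp
    finally show ?thesis using that by (intro coeff_eq_0) simp
  qed
  have "[(\<Sum>a\<in>A. c a * poly F a) = poly F 0] (mod p)" if F: "\<forall>i\<ge>card A. coeff F i = 0" for F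
  proof -
    define G where "G = (\<Sum>a\<in>A. smult (poly F a) (P a)) - F"
    have "[:p:] dvd G"
    proof (rule int_poly_vanishing_mod_prime[OF p A dist, where m = 1])
      fix b and j :: nat assume b: "b \<in> A" and "j < 1"
      then have [simp]: "j = 0" by simp
      have "coeff (pcompose G [:b, 1:]) j = poly G b"
        by (simp flip: poly_0_coeff_0 add: poly_pcompose)
      also have "\<dots> = (\<Sum>a\<in>A. poly F a * poly (P a) b) - poly F b"
        by (simp add: G_def poly_sum)
      also have "(\<Sum>a\<in>A. poly F a * poly (P a) b) = (\<Sum>a\<in>A. if a = b then poly F b * poly (P b) b else 0)"
      proof (intro sum.cong refl)
        fix a assume "a \<in> A"
        show "poly F a * poly (P a) b = (if a = b then poly F b * poly (P b) b else 0)"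
          using b A by (auto simp: P_def poly_prod)
      qed
      also have "\<dots> = poly F b * poly (P b) b" using b A by simp
      finally have e: "coeff (pcompose G [:b, 1:]) j = poly F b * (poly (P b) b - 1)"
        by (simp add: algebra_simps)
      have "poly (P b) b = (\<Prod>l\<in>A - {b}. (b - l) * iv (b - l))"
        by (simp add: P_def poly_prod algebra_simps)
      also have "[\<dots> = (\<Prod>l\<in>A - {b}. 1)] (mod p)"
        by (intro cong_prod iv dist) (use b in auto)
      finally have "p dvd poly (P b) b - 1" by (simp add: cong_iff_dvd_diff)
      then show "p dvd coeff (pcompose G [:b, 1:]) j" unfolding e by simp
    qed (use F Pdeg in \<open>auto simp: G_def coeff_sum\<close>)
    then have "p dvd poly G 0" by (auto elim!: dvdE)
    then show ?thesis
      by (simp add: G_def poly_sum c_def cong_iff_dvd_diff mult.commute)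
  qed
  then show ?thesis by (rule that)
qed

text \<open>
  Stepanov's method in the form of Hanson and Petridis: the auxiliary polynomial
  \<open>\<Sum>a. c a (a x + n)^(m - 1 + D) - n^(m - 1)\<close> has a zero of order at least \<open>m - 1\<close> at every
  element of \<open>B\<close>, because there the exponent \<open>D\<close> can be dropped and the Lagrange functional applies.
\<close>
lemma stepanov_product_shift_bound:
  fixes p n :: int and A B :: "int set"
  assumes p: "prime p" and A: "finite A" and B: "finite B"
    and distA: "\<And>a b. a \<in> A \<Longrightarrow> b \<in> A \<Longrightarrow> a \<noteq> b \<Longrightarrow> \<not> p dvd a - b"
    and distB: "\<And>a b. a \<in> B \<Longrightarrow> b \<in> B \<Longrightarrow> a \<noteq> b \<Longrightarrow> \<not> p dvd a - b"
    and nzA: "\<And>a. a \<in> A \<Longrightarrow> \<not> p dvd a" and n: "\<not> p dvd n"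
    and pow: "\<And>a b. a \<in> A \<Longrightarrow> b \<in> B \<Longrightarrow> [(a * b + n) ^ (D + 1) = a * b + n] (mod p)"
    and D: "D \<ge> 1" and m1: "card A \<ge> 1" and lt: "int (card A - 1 + D) < p"
  shows "(card A - 1) * card B \<le> card A - 1 + D"
proof (rule ccontr)
  define m where "m = card A"
  define E where "E = m - 1 + D"
  assume "\<not> ?thesis"
  then have big: "E < (m - 1) * card B" unfolding E_def m_def by simp
  have "\<exists>c. \<forall>F. (\<forall>i\<ge>m. coeff F i = 0) \<longrightarrow> [(\<Sum>a\<in>A. c a * poly F a) = poly F 0] (mod p)"
    unfolding m_def by (rule lagrange_functional_mod_prime[OF p A distA]) blast+
  then obtain c where c: "\<And>F. \<forall>i\<ge>m. coeff F i = 0 \<Longrightarrow> [(\<Sum>a\<in>A. c a * poly F a) = poly F 0] (mod p)"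
    by blast
  have c': "[(\<Sum>a\<in>A. c a * poly F a) = poly F 0] (mod p)" if "degree F < m" for F
    by (rule c) (use that in \<open>auto intro: coeff_eq_0\<close>)
  define f where "f = (\<Sum>a\<in>A. smult (c a) ([:n, a:] ^ E)) - [:n ^ (m - 1):]"
  have "[:p:] dvd f"
  proof (rule int_poly_vanishing_mod_prime[OF p B distB, where m = "m - 1"])
    fix b j assume b: "b \<in> B" and j: "j < m - 1"
    have "pcompose f [:b, 1:] = (\<Sum>a\<in>A. smult (c a) ([:a * b + n, a:] ^ E)) - [:n ^ (m - 1):]"
      unfolding f_def
      by (simp add: pcompose_diff pcompose_sum pcompose_smult pcompose_power_left pcompose_pCons algebra_simps)
    then have "coeff (pcompose f [:b, 1:]) j
       = (\<Sum>a\<in>A. c a * (of_nat (E choose j) * a ^ j * (a * b + n) ^ (E - j))) - (if j = 0 then n ^ (m - 1) else 0)"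
      by (simp add: coeff_sum coeff_linear_poly_power_binomial coeff_pCons split: nat.split)
    also have "[\<dots> = (\<Sum>a\<in>A. c a * (of_nat (E choose j) * a ^ j * (a * b + n) ^ (m - 1 - j))) - (if j = 0 then n ^ (m - 1) else 0)] (mod p)"
    proof (intro cong_diff cong_sum cong_mult cong_refl)
      fix a assume a: "a \<in> A"
      \<comment> \<open>The hypothesis \<open>pow\<close> has exponent \<open>D + 1\<close> so that
        it holds also when \<open>p\<close> divides \<open>a * b + n\<close>; the factor it requires
        is present because \<open>j < m - 1\<close>.\<close>
      have e1: "E - j = (m - 2 - j) + (D + 1)" and e2: "m - 1 - j = (m - 2 - j) + 1"
        using j by (auto simp: E_def)
      have "[(a * b + n) ^ (m - 2 - j) * (a * b + n) ^ (D + 1) = (a * b + n) ^ (m - 2 - j) * (a * b + n)] (mod p)"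
        using a b by (intro cong_mult cong_refl pow)
      then show "[(a * b + n) ^ (E - j) = (a * b + n) ^ (m - 1 - j)] (mod p)"
        unfolding e1 e2 power_add by simp
    qed
    also have "(\<Sum>a\<in>A. c a * (of_nat (E choose j) * a ^ j * (a * b + n) ^ (m - 1 - j)))
        = of_nat (E choose j) * (\<Sum>a\<in>A. c a * poly (monom 1 j * [:n, b:] ^ (m - 1 - j)) a)"
      by (simp add: sum_distrib_left poly_monom algebra_simps)
    also have "[of_nat (E choose j) * (\<Sum>a\<in>A. c a * poly (monom 1 j * [:n, b:] ^ (m - 1 - j)) a) - (if j = 0 then n ^ (m - 1) else 0)
        = of_nat (E choose j) * poly (monom 1 j * [:n, b:] ^ (m - 1 - j)) 0 - (if j = 0 then n ^ (m - 1) else 0)] (mod p)"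
    proof (intro cong_diff cong_mult cong_refl c')
      have "degree (monom 1 j * [:n, b:] ^ (m - 1 - j)) \<le> j + degree [:n, b:] * (m - 1 - j)"
        by (rule order_trans[OF degree_mult_le add_mono[OF degree_monom_le degree_power_le]])
      also have "\<dots> \<le> j + 1 * (m - 1 - j)" by (intro add_left_mono mult_right_mono) auto
      also have "\<dots> < m" using j by simp
      finally show "degree (monom 1 j * [:n, b:] ^ (m - 1 - j)) < m" .
    qed
    also have "of_nat (E choose j) * poly (monom 1 j * [:n, b:] ^ (m - 1 - j)) 0 - (if j = 0 then n ^ (m - 1) else 0) = 0"
      by (auto simp: poly_monom)
    finally show "p dvd coeff (pcompose f [:b, 1:]) j" by (simp add: cong_0_iff)
  next
    have "degree f \<le> E" unfolding f_def
    proof (intro degree_diff_le degree_sum_le A)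
      fix a assume "a \<in> A"
      have "degree (smult (c a) ([:n, a:] ^ E)) \<le> degree [:n, a:] * E"
        by (rule order_trans[OF degree_smult_le degree_power_le])
      also have "\<dots> \<le> 1 * E" by (intro mult_right_mono) auto
      finally show "degree (smult (c a) ([:n, a:] ^ E)) \<le> E" by simp
    qed auto
    then show "\<forall>i\<ge>(m - 1) * card B. coeff f i = 0" using big by (auto intro: coeff_eq_0)
  qed
  \<comment> \<open>The contradiction: \<open>f\<close> is zero modulo \<open>p\<close>, but none of
    the three factors of its coefficient at \<open>m\<close> is divisible by \<open>p\<close>. For
    the binomial coefficient this uses \<open>E < p\<close>, and \<open>D \<ge> 1\<close> gives
    \<open>m \<le> E\<close>.\<close>
  then have "p dvd coeff f m" by (simp add: const_poly_dvd_iff)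
  also have "coeff f m = of_nat (E choose m) * n ^ (E - m) * (\<Sum>a\<in>A. c a * a ^ m)"
    using m1 unfolding f_def m_def
    by (simp add: coeff_sum coeff_linear_poly_power_binomial coeff_pCons sum_distrib_left algebra_simps split: nat.split)
  finally have dv: "p dvd of_nat (E choose m) * n ^ (E - m) * (\<Sum>a\<in>A. c a * a ^ m)" .
  have "\<not> p dvd (\<Sum>a\<in>A. c a * a ^ m)"
  proof
    assume *: "p dvd (\<Sum>a\<in>A. c a * a ^ m)"
    \<comment> \<open>This polynomial has degree below \<open>m\<close> and agrees with
      \<open>x ^ m\<close> on \<open>A\<close>. So the functional evaluates the power sum as the
      value at \<open>0\<close>, up to sign the product of the elements of \<open>A\<close>.\<close>
    define F where "F = monom 1 m - (\<Prod>l\<in>A. [:-l, 1:])"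
    have "[(\<Sum>a\<in>A. c a * poly F a) = poly F 0] (mod p)"
    proof (rule c, intro allI impI)
      fix i assume i: "m \<le> i"
      have dg: "degree (\<Prod>l\<in>A. [:-l, 1:]) = m"
        unfolding m_def by (subst degree_prod_eq_sum_degree) auto
      have lc: "lead_coeff (\<Prod>l\<in>A. [:-l, 1::int:]) = 1"
        by (simp add: lead_coeff_prod)
      show "coeff F i = 0"
      proof (cases "i = m")
        case True then show ?thesis using lc dg by (simp add: F_def)
      next
        case False then show ?thesis using i dg by (simp add: F_def coeff_eq_0)
      qed
    qed
    moreover have "poly F a = a ^ m" if "a \<in> A" for a
      using that A by (auto simp: F_def poly_monom poly_prod)
    ultimately have "[(\<Sum>a\<in>A. c a * a ^ m) = poly F 0] (mod p)" by simp
    with * have "p dvd poly F 0" by (simp add: cong_dvd_iff)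
    moreover have "poly F 0 = - (\<Prod>l\<in>A. - l)"
      using m1 A by (simp add: F_def poly_monom poly_prod m_def)
    ultimately have "p dvd (\<Prod>l\<in>A. - l)" by simp
    then obtain l where "l \<in> A" "p dvd - l" using p A by (auto simp: prime_dvd_prod_iff)
    then show False using nzA by auto
  qed
  moreover have "\<not> p dvd n ^ (E - m)" using n p prime_dvd_power by blast
  moreover have "\<not> p dvd of_nat (E choose m)"
  proof
    assume "p dvd of_nat (E choose m)"
    then have "p dvd int (fact m * fact (E - m) * (E choose m))" by simp
    also have "fact m * fact (E - m) * (E choose m) = fact E"
      by (rule binomial_fact_lemma) (use D m1 in \<open>auto simp: E_def m_def\<close>)
    finally have "p dvd fact E" by simp
    define q where "q = nat p"
    have pq: "p = int q" using prime_ge_0_int[OF p] by (simp add: q_def)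
    have "prime q" using p unfolding pq by (rule prime_nat_int_transfer[THEN iffD1])
    moreover have "int q dvd int (fact E)" using \<open>p dvd fact E\<close> unfolding pq by simp
    then have "q dvd fact E" unfolding int_dvd_int_iff .
    ultimately have "q \<le> E" by (simp add: prime_dvd_fact_iff)
    then have "p \<le> int E" unfolding pq by simp
    then show False using lt unfolding E_def m_def by simp
  qed
  ultimately show False using dv prime_dvd_multD[OF p dv] prime_dvd_multD[OF p, of "of_nat (E choose m)"] by blast
qed


text \<open>A \<open>k\<close>-th power is \<open>0\<close> or has order dividing
  \<open>D = (p - 1) / gcd (p - 1) k\<close> modulo \<open>p\<close>. Since the property concerns
  distinct elements only, the nonzero classes are split into two disjoint sets of \<open>m\<close>
  each. Stepanov's bound becomes \<open>(m - 1)\<^sup>2 \<le> D\<close>, and at most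
  \<open>2 * m + 2 \<le> 4 + 2 * sqrt D \<le> 6 * sqrt D\<close> classes occur.\<close>

lemma card_residues_property_D:
  fixes p k n :: nat
  assumes p: "prime p" and g: "gcd (p - 1) k \<ge> 2" and k: "k > 0" and n: "\<not> p dvd n"
    and fin: "finite A" and A: "has_property_D k n A"
  shows "real (card ((\<lambda>a. a mod p) ` A)) \<le> 6 * sqrt (real p / real (gcd (p - 1) k))"
proof -
  define g where "g = gcd (p - 1) k"
  define D where "D = (p - 1) div g"
  define R where "R = (\<lambda>a. a mod p) ` A - {0}"
  define f where "f r = (SOME a. a \<in> A \<and> a mod p = r)" for r
  have p2: "p \<ge> 2" using p by (simp add: prime_ge_2_nat)
  have gle: "g \<le> p - 1" unfolding g_def using p2 by (intro gcd_le1_nat) auto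
  have g2: "g \<ge> 2" using assms unfolding g_def by simp
  have Dg: "D * g = p - 1" unfolding D_def g_def by simp
  have D1: "D \<ge> 1" using Dg gle g2 p2 by (cases D) auto
  have f: "f r \<in> A" "f r mod p = r" if "r \<in> R" for r
    using someI_ex[of "\<lambda>a. a \<in> A \<and> a mod p = r"] that unfolding R_def f_def by auto
  have finR: "finite R" unfolding R_def using fin by simp
  have Rsub: "R \<subseteq> {1..<p}" unfolding R_def using p2 by auto
  then have cR: "card R \<le> p - 1" using card_mono[of "{1..<p}" R] by simp
  define m where "m = card R div 2"
  obtain R1 where R1: "R1 \<subseteq> R" "card R1 = m"
    using obtain_subset_with_card_n[of m R] by (auto simp: m_def)
  have "card (R - R1) \<ge> m" using R1 finR finite_subset[OF R1(1) finR] by (simp add: card_Diff_subset m_def)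
  then obtain R2 where R2: "R2 \<subseteq> R - R1" "card R2 = m"
    using obtain_subset_with_card_n by metis
  define A1 B where "A1 = (\<lambda>r. int (f r)) ` R1" and "B = (\<lambda>r. int (f r)) ` R2"
  have finj: "\<not> int p dvd int (f r) - int (f s)" if "r \<in> R" "s \<in> R" "r \<noteq> s" for r s
  proof
    assume "int p dvd int (f r) - int (f s)"
    then have "[int (f r) = int (f s)] (mod int p)" by (simp add: cong_iff_dvd_diff)
    then have "[f r = f s] (mod p)" unfolding cong_int_iff .
    then show False using f(2)[OF that(1)] f(2)[OF that(2)] that(3)
      by (simp add: unique_euclidean_semiring_class.cong_def)
  qed
  have inj: "inj_on (\<lambda>r. int (f r)) R" using finj by (intro inj_onI) fastforce
  have cA1: "card A1 = m" unfolding A1_def using R1 inj by (subst card_image) (auto intro: inj_on_subset)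
  have cB: "card B = m" unfolding B_def using R2 inj by (subst card_image) (auto intro: inj_on_subset)
  have "(m - 1) ^ 2 \<le> D"
  proof (cases "m = 0")
    case False
    have "(card A1 - 1) * card B \<le> card A1 - 1 + D"
    proof (rule stepanov_product_shift_bound[where p = "int p" and n = "int n"])
      show "finite A1" "finite B" unfolding A1_def B_def using finR R1 R2 by (auto intro: finite_subset)
      show "\<not> int p dvd int n" using n by simp
      show "card A1 \<ge> 1" using False cA1 by simp
      \<comment> \<open>The assumption that the gcd is at least \<open>2\<close> enters here: it
        gives \<open>2 * D \<le> p - 1\<close>, so the degree \<open>m - 1 + D\<close> stays below
        \<open>p\<close>.\<close>
      have "2 * m \<le> p - 1" using cR unfolding m_def by linarith
      moreover have "2 * D \<le> p - 1" using Dg g2 using mult_le_mono2[OF g2, of D] by simp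
      ultimately show "int (card A1 - 1 + D) < int p" using cA1 p2 False by linarith
      fix a b
      { assume "a \<in> A1"
        then obtain r where r: "r \<in> R1" "a = int (f r)" unfolding A1_def by auto
        then have "f r mod p = r" "r \<noteq> 0" using f(2)[of r] R1(1) unfolding R_def by auto
        then have "\<not> p dvd f r" by auto
        then show "\<not> int p dvd a" unfolding r(2) int_dvd_int_iff . }
      { assume "a \<in> A1" "b \<in> A1" "a \<noteq> b"
        then show "\<not> int p dvd a - b" using finj R1(1) unfolding A1_def by blast }
      { assume "a \<in> B" "b \<in> B" "a \<noteq> b"
        then show "\<not> int p dvd a - b" using finj R2(1) unfolding B_def by blast }
      { assume "a \<in> A1" "b \<in> B"
        then obtain r s where rs: "r \<in> R1" "s \<in> R2" "a = int (f r)" "b = int (f s)"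
          unfolding A1_def B_def by blast
        have rR: "r \<in> R" "s \<in> R" "r \<noteq> s" using rs R1 R2 by auto
        have "f r \<noteq> f s" using f(2)[OF rR(1)] f(2)[OF rR(2)] rR(3) by auto
        then have "is_nth_power k (a * b + int n)"
          using A f(1)[OF rR(1)] f(1)[OF rR(2)] unfolding rs has_property_D_def by auto
        then obtain x where x: "a * b + int n = x ^ k" by (auto simp: is_nth_power_def)
        show "[(a * b + int n) ^ (D + 1) = a * b + int n] (mod int p)"
        proof (cases "int p dvd x")
          case True
          then have "int p dvd x ^ k" using k by (simp add: dvd_power dvd_trans)
          then have "[x ^ k = 0] (mod int p)" by (simp add: cong_0_iff)
          moreover have "[(x ^ k) ^ (D + 1) = 0] (mod int p)" using \<open>int p dvd x ^ k\<close> by (simp add: cong_0_iff)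
          ultimately show ?thesis unfolding x using cong_sym cong_trans by blast
        next
          case False
          define y where "y = nat (x mod int p)"
          have y: "int y = x mod int p" using p2 by (simp add: y_def)
          have xy: "[x = int y] (mod int p)" unfolding y by (simp add: unique_euclidean_semiring_class.cong_def)
          have "\<not> p dvd y" 
          proof
            assume "p dvd y"
            then have "int p dvd int y" by simp
            then show False using False unfolding y by (simp add: dvd_mod_iff)
          qed
          then have "[y ^ (p - 1) = 1] (mod p)" using p by (intro fermat_theorem) auto
          then have "[int y ^ (p - 1) = 1] (mod int p)" using cong_int_iff[of "y ^ (p - 1)" 1 p] by simp
          then have fe: "[x ^ (p - 1) = 1] (mod int p)" using cong_pow[OF xy] cong_trans by blast
          have "k * D = (p - 1) * (k div g)" 
          proof -
            have "k = k div g * g" unfolding g_def by simp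
            then have "k * D = k div g * (D * g)" by (metis mult.assoc mult.commute)
            then show ?thesis using Dg by (simp add: mult.commute)
          qed
          then have "(x ^ k) ^ D = (x ^ (p - 1)) ^ (k div g)" by (simp flip: power_mult)
          also have "[\<dots> = 1 ^ (k div g)] (mod int p)" by (intro cong_pow fe)
          finally have "[(x ^ k) ^ D = 1] (mod int p)" by simp
          then have "[x ^ k * (x ^ k) ^ D = x ^ k * 1] (mod int p)" by (intro cong_mult cong_refl)
          then show ?thesis unfolding x by simp
        qed }
    qed (use p D1 in auto)
    then have "(m - 1) * m \<le> m - 1 + D" using cA1 cB by simp
    then show ?thesis using False by (cases m) (auto simp: power2_eq_square)
  qed auto
  then have "real (m - 1) ^ 2 \<le> real D" by (metis of_nat_le_iff of_nat_power)
  then have "real (m - 1) \<le> sqrt (real D)" by (rule real_le_rsqrt)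
  then have m: "real m \<le> 1 + sqrt (real D)" by linarith
  have "(\<lambda>a. a mod p) ` A \<subseteq> insert 0 R" unfolding R_def by auto
  then have "card ((\<lambda>a. a mod p) ` A) \<le> card (insert 0 R)" using finR by (intro card_mono) auto
  also have "\<dots> \<le> 1 + card R" by (simp add: card_insert_le_m1 card_insert_if finR)
  also have "\<dots> \<le> 2 * m + 2" unfolding m_def by linarith
  finally have "real (card ((\<lambda>a. a mod p) ` A)) \<le> 2 * real m + 2" by linarith
  also have "\<dots> \<le> 4 + 2 * sqrt (real D)" using m by simp
  also have "\<dots> \<le> 6 * sqrt (real D)" using D1 by simp
  also have "real D \<le> real p / real g"

  proof -
    have "real D * real g = real (p - 1)" using Dg by (metis of_nat_mult)
    then show ?thesis using g2 by (simp add: field_simps)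
  qed
  finally show ?thesis unfolding g_def by simp
qed

section \<open>The larger sieve\<close>

lemma sum_ln_primes_dividing_le:
  fixes x :: nat
  assumes "finite P" "\<And>p. p \<in> P \<Longrightarrow> prime p \<and> p dvd x" "x > 0"
  shows "(\<Sum>p\<in>P. ln (real p)) \<le> ln (real x)"
proof -
  have "(\<Prod>p\<in>P. p) dvd x" using assms(1,2)
  proof (induction P rule: finite_induct)
    case (insert q P)
    have "coprime q (\<Prod>p\<in>P. p)"
      using insert by (intro prod_coprime_right) (auto intro: primes_coprime)
    then show ?case using insert by (auto intro: divides_mult)
  qed auto
  then have "(\<Prod>p\<in>P. p) \<le> x" using assms by (intro dvd_imp_le) auto
  moreover have pos: "0 < (\<Prod>p\<in>P. p)" using assms(2) by (intro prod_pos) (auto intro: prime_gt_0_nat)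
  ultimately have "ln (real (\<Prod>p\<in>P. p)) \<le> ln (real x)" by (meson ln_mono of_nat_0_less_iff of_nat_le_iff)
  moreover have "ln (real (\<Prod>p\<in>P. p)) = (\<Sum>p\<in>P. ln (real p))"
    using assms by (simp add: ln_prod prime_gt_0_nat)
  ultimately show ?thesis by simp
qed

text \<open>Pairs congruent modulo \<open>p\<close> are counted with weight \<open>ln p\<close>.
  Cauchy-Schwarz gives a lower bound for each \<open>p\<close>; in the other direction a pair
  \<open>a \<noteq> b\<close> contributes at most the logarithm of the difference, hence at most
  \<open>ln N\<close>. The form without division leaves the sign of the bracket open.\<close>

lemma gallagher_larger_sieve:
  fixes A P :: "nat set" and \<nu> :: "nat \<Rightarrow> real" and N :: nat
  assumes A: "finite A" "A \<noteq> {}" "A \<subseteq> {1..N}" and P: "finite P" "\<And>p. p \<in> P \<Longrightarrow> prime p"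
    and \<nu>: "\<And>p. p \<in> P \<Longrightarrow> real (card ((\<lambda>a. a mod p) ` A)) \<le> \<nu> p"
  shows "real (card A) * ((\<Sum>p\<in>P. ln (real p) / \<nu> p) - ln (real N)) \<le> (\<Sum>p\<in>P. ln (real p)) - ln (real N)"
proof -
  define s where "s = real (card A)"
  define e where "e p a b = (if a mod p = b mod p then 1 else 0 :: real)" for p a b :: nat
  have s: "s > 0" unfolding s_def using A by (simp add: card_gt_0_iff)
  have N: "N \<ge> 1" using A by auto
  have low: "s\<^sup>2 / \<nu> p \<le> (\<Sum>a\<in>A. \<Sum>b\<in>A. e p a b)" if p: "p \<in> P" for p
  proof -
    define R where "R = (\<lambda>a. a mod p) ` A"
    define h where "h r = (\<Sum>a\<in>A. if a mod p = r then 1 else 0 :: real)" for r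
    have R: "finite R" "R \<noteq> {}" using A by (auto simp: R_def)
    have \<nu>p: "real (card R) \<le> \<nu> p" using \<nu>[OF p] by (simp add: R_def)
    have "real (card R) > 0" using R by (simp add: card_gt_0_iff)
    then have \<nu>0: "\<nu> p > 0" using \<nu>p by linarith
    have "(\<Sum>r\<in>R. h r) = (\<Sum>a\<in>A. \<Sum>r\<in>R. if a mod p = r then 1 else 0)"
      unfolding h_def by (rule sum.swap)
    also have "\<dots> = (\<Sum>a\<in>A. 1)" using R by (intro sum.cong refl) (simp add: R_def)
    finally have sR: "(\<Sum>r\<in>R. h r) = s" by (simp add: s_def)
    have "(\<Sum>a\<in>A. \<Sum>b\<in>A. e p a b)
        = (\<Sum>a\<in>A. \<Sum>b\<in>A. \<Sum>r\<in>R. (if a mod p = r then 1 else 0) * (if b mod p = r then 1 else 0))"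
    proof (intro sum.cong refl)
      fix a b assume "a \<in> A" "b \<in> A"
      have "(\<Sum>r\<in>R. (if a mod p = r then 1 else 0) * (if b mod p = r then 1 else 0))
          = (\<Sum>r\<in>R. if a mod p = r then e p a b else 0)"
        by (intro sum.cong refl) (auto simp: e_def)
      also have "\<dots> = e p a b" using R \<open>a \<in> A\<close> by (simp add: R_def)
      finally show "e p a b = (\<Sum>r\<in>R. (if a mod p = r then 1 else 0) * (if b mod p = r then 1 else 0))" by simp
    qed
    also have "\<dots> = (\<Sum>r\<in>R. \<Sum>a\<in>A. \<Sum>b\<in>A. (if a mod p = r then 1 else 0) * (if b mod p = r then 1 else 0))"
      by (subst sum.swap[of _ _ A], subst sum.swap) (simp add: sum.swap[of _ R A])
    also have "\<dots> = (\<Sum>r\<in>R. (h r)\<^sup>2)"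
      by (simp add: h_def power2_eq_square sum_product)
    finally have eq: "(\<Sum>a\<in>A. \<Sum>b\<in>A. e p a b) = (\<Sum>r\<in>R. (h r)\<^sup>2)" .
    have "(\<Sum>r\<in>R. h r * 1)\<^sup>2 \<le> (\<Sum>r\<in>R. (h r)\<^sup>2) * (\<Sum>r\<in>R. 1\<^sup>2)"
      by (rule Cauchy_Schwarz_ineq_sum)
    then have "s\<^sup>2 \<le> (\<Sum>r\<in>R. (h r)\<^sup>2) * real (card R)" using sR by simp
    also have "\<dots> \<le> (\<Sum>r\<in>R. (h r)\<^sup>2) * \<nu> p" by (intro mult_left_mono \<nu>p sum_nonneg) auto
    finally show ?thesis unfolding eq using \<nu>0 by (simp add: pos_divide_le_eq)
  qed
  have lnp: "ln (real p) \<ge> 0" if "p \<in> P" for p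
    using P(2)[OF that] prime_ge_1_nat[of p] by simp
  have "s\<^sup>2 * (\<Sum>p\<in>P. ln (real p) / \<nu> p) = (\<Sum>p\<in>P. ln (real p) * (s\<^sup>2 / \<nu> p))"
    by (simp add: sum_distrib_left algebra_simps)
  also have "\<dots> \<le> (\<Sum>p\<in>P. ln (real p) * (\<Sum>a\<in>A. \<Sum>b\<in>A. e p a b))"
    by (intro sum_mono mult_left_mono low lnp)
  also have "\<dots> = (\<Sum>a\<in>A. \<Sum>b\<in>A. \<Sum>p\<in>P. ln (real p) * e p a b)"
    unfolding sum_distrib_left by (subst sum.swap, rule sum.cong[OF refl], rule sum.swap)
  also have "\<dots> \<le> (\<Sum>a\<in>A. \<Sum>b\<in>A. if a = b then (\<Sum>p\<in>P. ln (real p)) else ln (real N))"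
  proof (intro sum_mono)
    fix a b assume ab: "a \<in> A" "b \<in> A"
    show "(\<Sum>p\<in>P. ln (real p) * e p a b) \<le> (if a = b then (\<Sum>p\<in>P. ln (real p)) else ln (real N))"
    proof (cases "a = b")
      case False
      define x where "x = nat \<bar>int a - int b\<bar>"
      have "a \<le> N" "b \<le> N" using ab A(3) by auto
      then have x: "x > 0" "x \<le> N" using False unfolding x_def by linarith+
      have "(\<Sum>p\<in>P. ln (real p) * e p a b) = (\<Sum>p\<in>{p\<in>P. a mod p = b mod p}. ln (real p))"
        using P by (simp add: e_def sum.inter_filter if_distrib cong: if_cong)
      also have "\<dots> \<le> ln (real x)"
      proof (rule sum_ln_primes_dividing_le)
        fix p assume p: "p \<in> {p \<in> P. a mod p = b mod p}"
        then have "[int a = int b] (mod int p)" unfolding cong_int_iff by (simp add: unique_euclidean_semiring_class.cong_def)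
        then have "int p dvd int a - int b" by (simp add: cong_iff_dvd_diff)
        then have "int p dvd int x" unfolding x_def by simp
        then have "p dvd x" unfolding int_dvd_int_iff .
        then show "prime p \<and> p dvd x" using p P by auto
      qed (use P x in auto)
      also have "\<dots> \<le> ln (real N)" using x by simp
      finally show ?thesis using False by simp
    qed (simp add: e_def)
  qed
  also have "\<dots> = (\<Sum>a\<in>A. (\<Sum>p\<in>P. ln (real p)) + (s - 1) * ln (real N))"
  proof (intro sum.cong refl)
    fix a assume a: "a \<in> A"
    have "(\<Sum>b\<in>A. if a = b then (\<Sum>p\<in>P. ln (real p)) else ln (real N))
        = (\<Sum>p\<in>P. ln (real p)) + (\<Sum>b\<in>A-{a}. ln (real N))"
      using A a by (subst sum.remove[of _ a]) (auto intro!: sum.cong)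
    also have "(\<Sum>b\<in>A-{a}. ln (real N)) = (s - 1) * ln (real N)"
      using A a s by (simp add: s_def card_Diff_singleton of_nat_diff Suc_le_eq card_gt_0_iff)
    finally show "(\<Sum>b\<in>A. if a = b then (\<Sum>p\<in>P. ln (real p)) else ln (real N)) = (\<Sum>p\<in>P. ln (real p)) + (s - 1) * ln (real N)" .
  qed
  also have "\<dots> = s * ((\<Sum>p\<in>P. ln (real p)) + (s - 1) * ln (real N))" by (simp add: s_def)
  finally have "s * (s * (\<Sum>p\<in>P. ln (real p) / \<nu> p)) \<le> s * ((\<Sum>p\<in>P. ln (real p)) + (s - 1) * ln (real N))"
    by (simp add: power2_eq_square algebra_simps)
  then have "s * (\<Sum>p\<in>P. ln (real p) / \<nu> p) \<le> (\<Sum>p\<in>P. ln (real p)) + (s - 1) * ln (real N)"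
    using s by (rule mult_left_le_imp_le)
  then show ?thesis unfolding s_def[symmetric] by (simp add: algebra_simps)
qed

section \<open>Large elements\<close>

text \<open>Legendre's formula, with \<open>s / q ^ e\<close> replaced by
  \<open>s / 2 ^ e\<close>.\<close>

lemma multiplicity_fact_le:
  fixes q s :: nat
  assumes q: "prime q"
  shows "multiplicity q (fact s) \<le> s"
proof -
  have q2: "q \<ge> 2" using q by (rule prime_ge_2_nat)
  have pe: "prime_elem q" using q by simp
  have "multiplicity q (fact s) = multiplicity q (\<Prod>i\<in>{1..s}. i)" by (simp add: fact_prod)
  also have "\<dots> = (\<Sum>i\<in>{1..s}. multiplicity q i)"
    by (rule prime_elem_multiplicity_prod_distrib[OF pe]) auto
  also have "\<dots> = (\<Sum>i\<in>{1..s}. \<Sum>e\<in>{1..s}. if q ^ e dvd i then 1 else 0)"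
  proof (intro sum.cong refl)
    fix i assume i: "i \<in> {1..s}"
    have nu: "\<not> is_unit q" "i \<noteq> 0" using q2 i by auto
    have le: "multiplicity q i \<le> s"
    proof -
      have "q ^ multiplicity q i \<le> i" using nu by (intro dvd_imp_le multiplicity_dvd) auto
      moreover have "multiplicity q i < q ^ multiplicity q i" using q2 by (intro power_gt_expt) auto
      ultimately show ?thesis using i by simp
    qed
    have iff: "q ^ e dvd i \<longleftrightarrow> e \<le> multiplicity q i" for e
      by (rule power_dvd_iff_le_multiplicity[OF nu(2,1)])
    have "{e \<in> {1..s}. q ^ e dvd i} = {1..multiplicity q i}"
      unfolding iff using le by (auto intro: order_trans)
    then have "multiplicity q i = card {e \<in> {1..s}. q ^ e dvd i}" by simp
    also have "\<dots> = (\<Sum>e\<in>{e \<in> {1..s}. q ^ e dvd i}. 1)" by simp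
    also have "\<dots> = (\<Sum>e\<in>{1..s}. if q ^ e dvd i then 1 else 0)" by (intro sum.inter_filter) simp
    finally show "multiplicity q i = (\<Sum>e\<in>{1..s}. if q ^ e dvd i then 1 else 0)" .
  qed
  also have "\<dots> = (\<Sum>e\<in>{1..s}. \<Sum>i\<in>{1..s}. if q ^ e dvd i then 1 else 0)" by (rule sum.swap)
  also have "\<dots> = (\<Sum>e\<in>{1..s}. card {i \<in> {1..s}. q ^ e dvd i})"
  proof (intro sum.cong refl)
    fix e
    have "(\<Sum>i\<in>{1..s}. if q ^ e dvd i then 1 else 0) = (\<Sum>i\<in>{i\<in>{1..s}. q ^ e dvd i}. 1)"
      by (intro sum.inter_filter[symmetric]) simp
    then show "(\<Sum>i\<in>{1..s}. if q ^ e dvd i then 1 else 0) = card {i \<in> {1..s}. q ^ e dvd i}"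
      by (simp only: card_eq_sum)
  qed
  also have "\<dots> \<le> (\<Sum>e\<in>{1..s}. s div 2 ^ e)"
  proof (intro sum_mono)
    fix e assume "e \<in> {1..s}"
    have "card {i \<in> {1..s}. q ^ e dvd i} \<le> s div q ^ e" using q2 by (subst card_multiples_nat) auto
    also have "\<dots> \<le> s div 2 ^ e" using q2 by (intro div_le_mono2 power_mono) auto
    finally show "card {i \<in> {1..s}. q ^ e dvd i} \<le> s div 2 ^ e" .
  qed
  finally have "real (multiplicity q (fact s)) \<le> real (\<Sum>e\<in>{1..s}. s div 2 ^ e)" by (simp only: of_nat_le_iff)
  also have "\<dots> \<le> (\<Sum>e\<in>{1..s}. real s / 2 ^ e)"
    unfolding of_nat_sum 
  proof (intro sum_mono)
    fix e
    show "real (s div 2 ^ e) \<le> real s / 2 ^ e" using of_nat_div_le_of_nat[of s "2 ^ e", where ?'a = real] by simp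
  qed
  also have "(\<Sum>e\<in>{1..m}. real s / 2 ^ e) = real s - real s / 2 ^ m" for m
    by (induction m) (auto simp: field_simps)
  finally have "real (multiplicity q (fact s)) \<le> real s - real s / 2 ^ s" .
  also have "\<dots> \<le> real s" by simp
  finally show ?thesis by simp
qed

text \<open>Primes dividing \<open>k\<close> are absorbed by \<open>k ^ s\<close>. Modulo a power of
  any other prime, multiplication by the inverse of \<open>k\<close> turns the progression into
  \<open>s\<close> consecutive integers, whose product is divisible by
  \<open>fact s\<close>.\<close>

lemma fact_dvd_arith_progression:
  fixes k x :: int
  assumes nz: "k ^ s * (\<Prod>i<s. x + k * int i) \<noteq> 0"
  shows "fact s dvd k ^ s * (\<Prod>i<s. x + k * int i)"
proof (rule multiplicity_le_imp_dvd)
  fix p :: int assume p: "prime p"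
  obtain q where q: "p = int q" using prime_ge_0_int[OF p] nonneg_int_cases by blast
  have pq: "prime q" using p unfolding q by (rule prime_nat_int_transfer[THEN iffD1])
  define e where "e = multiplicity p (fact s)"
  define Pr where "Pr = (\<Prod>i<s. x + k * int i)"
  have nu: "\<not> is_unit p" using p by auto
  have pe: "p ^ e dvd fact s" unfolding e_def by (rule multiplicity_dvd)
  have "p ^ e dvd k ^ s * Pr"
    proof (cases "p dvd k")
      case True
      have "int q ^ e dvd int (fact s)" using pe by (simp add: q)
      then have "q ^ e dvd fact s" unfolding of_nat_power[symmetric] int_dvd_int_iff .
      then have "e \<le> multiplicity q (fact s)" using pq by (intro multiplicity_geI) auto
      then have "e \<le> s" using multiplicity_fact_le[OF pq, of s] by simp
      then have "p ^ e dvd p ^ s" by (rule le_imp_power_dvd)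
      also have "p ^ s dvd k ^ s" using True by (rule dvd_power_same)
      finally show ?thesis by simp
    next
      case npk: False
      have "coprime k (p ^ e)" using prime_imp_coprime[OF p npk] by (simp add: coprime_commute)
      then obtain y where y: "[k * y = 1] (mod p ^ e)" using cong_solve_coprime_int by blast
      have "[y ^ s * Pr = (\<Prod>i<s. x * y + int i)] (mod p ^ e)"
      proof -
        have "y ^ s * Pr = (\<Prod>i<s. y * (x + k * int i))" by (simp add: Pr_def prod.distrib)
        also have "[\<dots> = (\<Prod>i<s. x * y + int i)] (mod p ^ e)"
        proof (intro cong_prod)
          fix i
          have "[x * y + (k * y) * int i = x * y + 1 * int i] (mod p ^ e)"
            by (intro cong_add cong_mult cong_refl y)
          then show "[y * (x + k * int i) = x * y + int i] (mod p ^ e)" by (simp add: algebra_simps)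
        qed
        finally show ?thesis .
      qed
      moreover have "fact s dvd (\<Prod>i<s. x * y + int i)"
        using fact_dvd_pochhammer[of s "x * y"] by (simp add: pochhammer_prod atLeast0LessThan)
      then have "p ^ e dvd (\<Prod>i<s. x * y + int i)" using pe dvd_trans by blast
      ultimately have "p ^ e dvd y ^ s * Pr" by (simp add: cong_dvd_iff)
      moreover have "coprime (p ^ e) (y ^ s)"
      proof -
        have "coprime (k * y) (p ^ e)" using cong_imp_coprime[OF cong_sym[OF y]] by simp
        then show ?thesis by (auto simp: coprime_commute)
      qed
      ultimately have "p ^ e dvd Pr" by (simp add: coprime_dvd_mult_right_iff)
      then show ?thesis by simp
    qed
  then show "multiplicity p (fact s) \<le> multiplicity p (k ^ s * (\<Prod>i<s. x + k * int i))"
    using nz nu unfolding e_def Pr_def by (intro multiplicity_geI) auto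
qed auto

text \<open>Partial fractions of \<open>fact r / (x (x + 1) ... (x + r))\<close>. Pascal's rule
  reduces the sum for \<open>r + 1\<close> to those for \<open>r\<close> at \<open>x\<close> and at
  \<open>x + 1\<close>.\<close>

lemma partial_fraction_binomial:
  fixes x :: real
  assumes "\<And>i. i \<le> r \<Longrightarrow> x + real i \<noteq> 0"
  shows "(\<Sum>i\<le>r. (- 1) ^ i * real (r choose i) / (x + real i)) = fact r / (\<Prod>i\<le>r. x + real i)"
  using assms
proof (induction r arbitrary: x)
  case (Suc r)
  have nz: "x + real i \<noteq> 0" if "i \<le> Suc r" for i using Suc.prems that by auto
  have nz': "x + 1 + real i \<noteq> 0" if "i \<le> r" for i using nz[of "Suc i"] that by (simp add: add_ac)
  have "(\<Sum>i\<le>Suc r. (- 1) ^ i * real (Suc r choose i) / (x + real i))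
      = 1 / x + (\<Sum>i\<le>r. (- 1) ^ Suc i * real (Suc r choose Suc i) / (x + real (Suc i)))"
    by (subst sum.atMost_Suc_shift) simp
  also have "(\<Sum>i\<le>r. (- 1) ^ Suc i * real (Suc r choose Suc i) / (x + real (Suc i)))
     = (\<Sum>i\<le>r. (- 1) ^ Suc i * real (r choose Suc i) / (x + real (Suc i))) - (\<Sum>i\<le>r. (- 1) ^ i * real (r choose i) / (x + 1 + real i))"
    unfolding sum_subtractf[symmetric] by (intro sum.cong refl) (simp add: field_simps add_divide_distrib[symmetric])
  also have "1 / x + (\<dots>) = (\<Sum>i\<le>Suc r. (- 1) ^ i * real (r choose i) / (x + real i)) - (\<Sum>i\<le>r. (- 1) ^ i * real (r choose i) / (x + 1 + real i))"
    by (subst sum.atMost_Suc_shift) simp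
  also have "(\<Sum>i\<le>Suc r. (- 1) ^ i * real (r choose i) / (x + real i)) = (\<Sum>i\<le>r. (- 1) ^ i * real (r choose i) / (x + real i))"
    by simp
  also have "\<dots> = fact r / (\<Prod>i\<le>r. x + real i)" by (rule Suc.IH) (use nz in auto)
  also have "(\<Sum>i\<le>r. (- 1) ^ i * real (r choose i) / (x + 1 + real i)) = fact r / (\<Prod>i\<le>r. x + 1 + real i)"
    by (rule Suc.IH) (use nz' in auto)
  also have "fact r / (\<Prod>i\<le>r. x + real i) - fact r / (\<Prod>i\<le>r. x + 1 + real i) = fact (Suc r) / (\<Prod>i\<le>Suc r. x + real i)"
  proof -
    define A where "A = (\<Prod>i\<le>Suc r. x + real i)"
    have A1: "A = (\<Prod>i\<le>r. x + real i) * (x + real (Suc r))" by (simp add: A_def)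
    have A2: "A = x * (\<Prod>i\<le>r. x + 1 + real i)"
      unfolding A_def by (subst prod.atMost_Suc_shift) (simp add: add_ac)
    have An: "A \<noteq> 0" unfolding A_def prod_zero_iff[OF finite_atMost] using nz by blast
    have "fact r / (\<Prod>i\<le>r. x + real i) = fact r * (x + real (Suc r)) / A"
      using An unfolding A1 by auto
    moreover have "fact r / (\<Prod>i\<le>r. x + 1 + real i) = fact r * x / A"
      using An unfolding A2 by auto
    ultimately show ?thesis unfolding A_def[symmetric] by (simp add: diff_divide_distrib[symmetric] algebra_simps)
  qed
  finally show ?case .
qed simp


section \<open>Pade approximation of a k-th root\<close>

text \<open>Together with \<open>qpr\<close> and the middle factor \<open>x\<close> this describes
  the products of shifts of \<open>x\<close> in both directions that come out of partial fractions;
  see \<open>mixed_prod_eq\<close>.\<close>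

definition ppr :: "real \<Rightarrow> nat \<Rightarrow> real" where "ppr x t = (\<Prod>i\<in>{1..t}. x + real i)"
definition qpr :: "real \<Rightarrow> nat \<Rightarrow> real" where "qpr x t = (\<Prod>i\<in>{1..t}. x - real i)"

lemma ppr_Suc: "ppr x (Suc t) = ppr x t * (x + real (Suc t))"
  and qpr_Suc: "qpr x (Suc t) = qpr x t * (x - real (Suc t))"
  by (simp_all add: ppr_def qpr_def)

lemma mixed_prod_eq:
  assumes "j \<le> r"
  shows "(\<Prod>i\<le>r. x + real j - real i) = x * ppr x j * qpr x (r - j)"
  using assms
proof (induction r)
  case 0
  then show ?case by (simp add: ppr_def qpr_def)
next
  case (Suc r)
  show ?case
  proof (cases "j = Suc r")
    case True
    have "(\<Prod>i\<le>Suc r. x + real j - real i) = (\<Prod>i\<le>Suc r. x + real (Suc r - i))"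
      using True by (intro prod.cong) (auto simp: of_nat_diff)
    also have "\<dots> = (\<Prod>i\<le>Suc r. x + real i)"
      by (subst prod.nat_diff_reindex[symmetric, of _ "Suc (Suc r)", unfolded lessThan_Suc_atMost]) simp
    also have "\<dots> = x * ppr x (Suc r)"
    proof -
      have "{..Suc r} = insert 0 {1..Suc r}" by auto
      then show ?thesis by (simp only: ppr_def) (subst prod.insert, auto)
    qed
    finally show ?thesis using True by (simp add: qpr_def)
  next
    case False
    then have j: "j \<le> r" "Suc r - j = Suc (r - j)" using Suc.prems by auto
    then have "(\<Prod>i\<le>Suc r. x + real j - real i) = x * ppr x j * qpr x (r - j) * (x + real j - real (Suc r))"
      using Suc.IH by simp
    also have "x + real j - real (Suc r) = x - real (Suc (r - j))" using j by (simp add: of_nat_diff)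
    finally show ?thesis unfolding j(2) qpr_Suc by simp
  qed
qed

lemma ppr_qpr_nonzero:
  assumes "0 < x" "x < 1"
  shows "ppr x t > 0" "qpr x t \<noteq> 0"
  using assms unfolding ppr_def qpr_def by (auto intro!: prod_pos add_pos_nonneg)

text \<open>
  The coefficients of the Pade approximants of \<open>w powr (1 / k)\<close> at \<open>w = 1\<close>;
  the factor \<open>k ^ (2 * r) / fact r\<close> makes them integers.
\<close>

definition pade_coeff :: "nat \<Rightarrow> nat \<Rightarrow> nat \<Rightarrow> real" where
  "pade_coeff k r t = real k ^ (2 * r) * real (r choose t) / fact r *
     (ppr (1 / real k) r / ppr (1 / real k) t) * (qpr (1 / real k) r / qpr (1 / real k) (r - t))"

lemma ppr_quotient:
  assumes "0 < x" "x < 1" "t \<le> r"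
  shows "ppr x r / ppr x t = (\<Prod>i<r - t. x + real (t + 1 + i))"
  using assms(3)
proof (induction r)
  case (Suc r)
  show ?case
  proof (cases "t = Suc r")
    case True
    then show ?thesis using ppr_qpr_nonzero[OF assms(1,2), of t] by simp
  next
    case False
    then have t: "t \<le> r" "Suc r - t = Suc (r - t)" using Suc.prems by auto
    have "ppr x (Suc r) / ppr x t = ppr x r / ppr x t * (x + real (Suc r))" by (simp add: ppr_Suc)
    also have "\<dots> = (\<Prod>i<r - t. x + real (t + 1 + i)) * (x + real (t + 1 + (r - t)))" using Suc.IH t by simp
    finally show ?thesis unfolding t(2) by simp
  qed
qed (use ppr_qpr_nonzero[OF assms(1,2), of t] in simp)

lemma qpr_quotient:
  assumes "0 < x" "x < 1" "t \<le> r"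
  shows "qpr x r / qpr x (r - t) = (\<Prod>i<t. x - real (r - i))"
  using assms(3)
proof (induction t)
  case 0
  then show ?case using ppr_qpr_nonzero[OF assms(1,2), of r] by simp
next
  case (Suc t)
  have e: "r - t = Suc (r - Suc t)" using Suc.prems by simp
  have q: "qpr x (r - t) = qpr x (r - Suc t) * (x - real (r - t))" unfolding e qpr_Suc ..
  have "qpr x (r - t) \<noteq> 0" using ppr_qpr_nonzero[OF assms(1,2)] by auto
  then have "x - real (r - t) \<noteq> 0" unfolding q by auto
  then have "qpr x r / qpr x (r - Suc t) = qpr x r / qpr x (r - t) * (x - real (r - t))"
    unfolding q by simp
  then show ?case using Suc by simp
qed

text \<open>The binomial coefficient splits \<open>fact r\<close> between the two quotients, and the
  powers of \<open>k\<close> are shared accordingly. After clearing denominators each quotient is a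
  product over an arithmetic progression of difference \<open>k\<close>, to which
  \<open>fact_dvd_arith_progression\<close> applies.\<close>

lemma pade_coeff_int:
  assumes k: "k \<ge> 2" and t: "t \<le> r"
  shows "pade_coeff k r t \<in> \<int>"
proof -
  define x where "x = 1 / real k"
  have x: "0 < x" "x < 1" using k by (auto simp: x_def)
  have kx: "real k * x = 1" using k by (simp add: x_def)
  have int1: "real k ^ (2 * (r - t)) * (ppr x r / ppr x t) / fact (r - t) \<in> \<int>"
  proof -
    define Z where "Z = int k ^ (r - t) * (\<Prod>i<r - t. (1 + int k * int (t + 1)) + int k * int i)"
    have pp: "(\<Prod>i<r - t. (1 + int k * int (t + 1)) + int k * int i) > 0"
      by (intro prod_pos ballI add_pos_nonneg mult_nonneg_nonneg) auto
    have "int k ^ (r - t) * (\<Prod>i<r - t. (1 + int k * int (t + 1)) + int k * int i) > 0"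
      using k by (intro mult_pos_pos pp) simp
    then have "fact (r - t) dvd Z" unfolding Z_def by (intro fact_dvd_arith_progression) linarith
    then obtain c where c: "Z = fact (r - t) * c" by (elim dvdE)
    have "real k ^ (2 * (r - t)) * (ppr x r / ppr x t) = real k ^ (r - t) * (\<Prod>i<r - t. real k * (x + real (t + 1 + i)))"
      unfolding ppr_quotient[OF x t] by (simp add: prod.distrib power_add mult_2)
    also have "\<dots> = of_int Z"
      unfolding Z_def using kx by (simp add: algebra_simps)
    also have "\<dots> = fact (r - t) * of_int c" unfolding c by simp
    finally show ?thesis by simp
  qed
  have int2: "real k ^ (2 * t) * (qpr x r / qpr x (r - t)) / fact t \<in> \<int>"
  proof -
    define Z where "Z = int k ^ t * (\<Prod>i<t. (1 - int k * int r) + int k * int i)"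
    have ne: "(1 - int k * int r) + int k * int i \<noteq> 0" for i
    proof
      assume "(1 - int k * int r) + int k * int i = 0"
      then have "1 = int k * (int r - int i)" by (simp add: algebra_simps)
      then have "int k dvd 1" by (metis dvd_triv_left)
      then show False using k by simp
    qed
    then have "fact t dvd Z" unfolding Z_def using k by (intro fact_dvd_arith_progression) auto
    then obtain c where c: "Z = fact t * c" by (elim dvdE)
    have "real k ^ (2 * t) * (qpr x r / qpr x (r - t)) = real k ^ t * (\<Prod>i<t. real k * (x - real (r - i)))"
      unfolding qpr_quotient[OF x t] by (simp add: prod.distrib power_add mult_2)
    also have "\<dots> = of_int Z"
      unfolding Z_def of_int_mult of_int_power of_int_prod
    proof (intro arg_cong2[where f = "(*)"] prod.cong refl)
      fix i assume "i \<in> {..<t}"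
      then have "real (r - i) = real r - real i" using t by (simp add: of_nat_diff)
      then show "real k * (x - real (r - i)) = of_int (1 - int k * int r + int k * int i)"
        using kx by (simp add: algebra_simps)
    qed simp
    also have "\<dots> = fact t * of_int c" unfolding c by simp
    finally show ?thesis by simp
  qed
  have eq: "pade_coeff k r t = (real k ^ (2 * (r - t)) * (ppr x r / ppr x t) / fact (r - t)) * (real k ^ (2 * t) * (qpr x r / qpr x (r - t)) / fact t)"
  proof -
    have "real (r choose t) = fact r / (fact t * fact (r - t))" by (rule binomial_fact[OF t])
    moreover have "2 * r = 2 * (r - t) + 2 * t" using t by simp
    then have "real k ^ (2 * r) = real k ^ (2 * (r - t)) * real k ^ (2 * t)" by (metis power_add)
    ultimately show ?thesis unfolding pade_coeff_def x_def[symmetric] by (simp add: mult_ac)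
  qed
  show ?thesis unfolding eq by (rule Ints_mult[OF int1 int2])
qed

text \<open>Replacing \<open>x\<close> by \<open>1\<close> in the rising product and by
  \<open>0\<close> in the falling one turns the quotients into factorials, so the coefficient is at
  most \<open>k ^ (2 * r)\<close> times two binomial coefficients.\<close>

lemma pade_coeff_bound:
  assumes k: "k \<ge> 2" and t: "t \<le> r"
  shows "\<bar>pade_coeff k r t\<bar> \<le> 2 * (4 * real k ^ 2) ^ r"
proof -
  define x where "x = 1 / real k"
  have x: "0 < x" "x < 1" using k by (auto simp: x_def)
  have b1: "\<bar>ppr x r / ppr x t\<bar> \<le> fact (Suc r) / fact (Suc t)"
  proof -
    have "fact (Suc r) / fact (Suc t) = (\<Prod>i<r - t. real (t + 2 + i))"
      using t
    proof (induction r)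
      case (Suc r)
      show ?case
      proof (cases "t = Suc r")
        case False
        then have t: "t \<le> r" "Suc r - t = Suc (r - t)" using Suc.prems by auto
        then have "fact (Suc (Suc r)) / fact (Suc t) = real (r + 2) * (fact (Suc r) / fact (Suc t) :: real)" by simp
        also have "\<dots> = real (r + 2) * (\<Prod>i<r - t. real (t + 2 + i))" using Suc.IH t by simp
        finally show ?thesis using t by (simp add: mult.commute add_ac)
      qed simp
    qed simp
    moreover have "\<bar>ppr x r / ppr x t\<bar> \<le> (\<Prod>i<r - t. real (t + 2 + i))"
      unfolding ppr_quotient[OF x t] abs_prod using x by (intro prod_mono) auto
    ultimately show ?thesis by simp
  qed
  have b2: "\<bar>qpr x r / qpr x (r - t)\<bar> \<le> fact r / fact (r - t)"
  proof -
    have "fact r / fact (r - t) = (\<Prod>i<t. real (r - i))"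
      using t
    proof (induction t)
      case (Suc t)
      have e: "r - t = Suc (r - Suc t)" using Suc.prems by simp
      have "fact r / fact (r - Suc t) = real (r - t) * (fact r / fact (r - t) :: real)" unfolding e by simp
      then show ?case using Suc by (simp add: mult.commute)
    qed simp
    moreover have "\<bar>qpr x r / qpr x (r - t)\<bar> \<le> (\<Prod>i<t. real (r - i))"
      unfolding qpr_quotient[OF x t] abs_prod
    proof (intro prod_mono conjI)
      fix i assume "i \<in> {..<t}"
      then have "real (r - i) \<ge> 1" using t by simp
      then show "\<bar>x - real (r - i)\<bar> \<le> real (r - i)" using x by simp
    qed simp
    ultimately show ?thesis by simp
  qed
  have "\<bar>pade_coeff k r t\<bar> = real k ^ (2 * r) * real (r choose t) / fact r * \<bar>ppr x r / ppr x t\<bar> * \<bar>qpr x r / qpr x (r - t)\<bar>"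
    unfolding pade_coeff_def x_def[symmetric] by (simp add: abs_mult)
  also have "\<dots> \<le> real k ^ (2 * r) * real (r choose t) / fact r * (fact (Suc r) / fact (Suc t)) * (fact r / fact (r - t))"
    using b1 b2 by (intro mult_mono) auto
  also have "\<dots> = real k ^ (2 * r) * real (r choose t) * real (Suc r choose Suc t)"
  proof -
    have "real (Suc r choose Suc t) = fact (Suc r) / (fact (Suc t) * fact (r - t))"
      using binomial_fact[of "Suc t" "Suc r", where ?'a = real] t unfolding diff_Suc_Suc by blast
    then show ?thesis by (simp del: fact_Suc binomial_Suc_Suc)
  qed
  also have "\<dots> \<le> real k ^ (2 * r) * 2 ^ r * 2 ^ Suc r"
  proof (intro mult_mono)
    show "real (r choose t) \<le> 2 ^ r" using binomial_le_pow2[of r t] by (metis of_nat_le_iff of_nat_numeral of_nat_power)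
    show "real (Suc r choose Suc t) \<le> 2 ^ Suc r" using binomial_le_pow2[of "Suc r" "Suc t"] by (metis of_nat_le_iff of_nat_numeral of_nat_power)
  qed auto
  also have "\<dots> = 2 * (4 * real k ^ 2) ^ r"
  proof -
    have "(4::real) ^ r = 2 ^ r * 2 ^ r" by (simp add: power_mult_distrib[symmetric])
    then show ?thesis by (simp add: power_mult power_mult_distrib)
  qed
  finally show ?thesis .
qed

text \<open>The ratio of consecutive values is \<open>1 - x\<^sup>2 / (r + 1)\<^sup>2\<close>,
  between \<open>1 / 2\<close> and \<open>1\<close>. The expression is the part of the normalizing
  factor \<open>\<kappa>\<close> below that does not involve powers of \<open>k\<close>.\<close>

lemma pade_normalizer_bounds:
  assumes x: "0 < x" "x \<le> 1 / 2"
  shows "\<bar>x * ppr x r * qpr x r\<bar> / (fact r)\<^sup>2 \<le> x" "x / 2 ^ r \<le> \<bar>x * ppr x r * qpr x r\<bar> / (fact r)\<^sup>2"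
proof -
  define f where "f r = \<bar>x * ppr x r * qpr x r\<bar> / (fact r)\<^sup>2" for r :: nat
  have f0: "f 0 = x" using x by (simp add: f_def ppr_def qpr_def)
  have fS: "1 / 2 * f r \<le> f (Suc r)" "f (Suc r) \<le> f r" for r
  proof -
    define a where "a = real (Suc r)"
    have a: "a \<ge> 1" by (simp add: a_def)
    have fn: "f r \<ge> 0" by (simp add: f_def)
    have "f (Suc r) = f r * (\<bar>x + a\<bar> * \<bar>x - a\<bar> / a\<^sup>2)"
      unfolding f_def ppr_Suc qpr_Suc a_def[symmetric] fact_Suc power_mult_distrib
      by (simp add: abs_mult a_def[symmetric] mult_ac)
    also have "\<bar>x + a\<bar> * \<bar>x - a\<bar> / a\<^sup>2 = 1 - x\<^sup>2 / a\<^sup>2"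
      using a x by (simp add: field_simps power2_eq_square)
    finally have e: "f (Suc r) = f r * (1 - x\<^sup>2 / a\<^sup>2)" .
    have "x\<^sup>2 \<le> 1 / 2" using x power_mono[of x "1/2" 2] by (simp add: power2_eq_square)
    moreover have "x\<^sup>2 / a\<^sup>2 \<le> x\<^sup>2 / 1" using a by (intro divide_left_mono) auto
    ultimately have "1 / 2 \<le> 1 - x\<^sup>2 / a\<^sup>2" unfolding div_by_1 by linarith
    then have "f r * (1 / 2) \<le> f r * (1 - x\<^sup>2 / a\<^sup>2)" using fn by (rule mult_left_mono)
    then show "1 / 2 * f r \<le> f (Suc r)" unfolding e by simp
    have "f r * (1 - x\<^sup>2 / a\<^sup>2) \<le> f r * 1" using fn by (intro mult_left_mono) auto
    then show "f (Suc r) \<le> f r" unfolding e by simp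
  qed
  have "f r \<le> x \<and> x / 2 ^ r \<le> f r"
  proof (induction r)
    case (Suc r)
    then show ?case using fS[of r] by auto
  qed (simp add: f0)
  then show "\<bar>x * ppr x r * qpr x r\<bar> / (fact r)\<^sup>2 \<le> x" "x / 2 ^ r \<le> \<bar>x * ppr x r * qpr x r\<bar> / (fact r)\<^sup>2"
    unfolding f_def by auto
qed


text \<open>Up to the factor \<open>\<kappa>\<close>, \<open>D\<close> is the integral of
  \<open>s powr (x - 1 - r) * ((w - s) * (s - 1)) ^ r\<close> from \<open>1\<close> to
  \<open>w\<close>, with \<open>x = 1 / k\<close>. The integrand is nonnegative, so \<open>D\<close>
  can be bounded from below as well; the lower bound later excludes that the approximation
  vanishes.\<close>

lemma pade_approximation:
  fixes k r :: nat and w \<delta> :: real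
  assumes k: "k \<ge> 2" and r: "r \<ge> 1" and \<delta>: "0 < \<delta>" "\<delta> \<le> 1" and w: "w = 1 + \<delta>"
  defines "D \<equiv> w powr (1 / real k) * (\<Sum>j\<le>r. (- 1) ^ (r - j) * pade_coeff k r j * w ^ j)
     - (\<Sum>i\<le>r. (- 1) ^ i * pade_coeff k r (r - i) * w ^ i)"
  shows "\<delta> / 6 * (\<delta>\<^sup>2 / 9) ^ r \<le> \<bar>D\<bar>" "\<bar>D\<bar> \<le> \<delta> * ((real k)\<^sup>2 * \<delta>\<^sup>2 / 4) ^ r"
proof -
  define x where "x = 1 / real k"
  have x: "0 < x" "x < 1" "x \<le> 1 / 2" using k by (auto simp: x_def field_simps)
  have nz: "x + real j - real i \<noteq> 0" for i j :: nat
  proof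
    assume "x + real j - real i = 0"
    then have "x = of_int (int i - int j)" by simp
    then have "0 < int i - int j" "int i - int j < 1" using x(1,2) by linarith+
    then show False by linarith
  qed
  have w1: "w > 1" "w \<le> 2" using \<delta> w by auto
  define cf where "cf i j = (- 1) ^ (r - i) * real (r choose i) * ((- 1) ^ (r - j) * real (r choose j)) * w ^ i" for i j
  \<comment> \<open>The termwise primitive of \<open>G\<close> after expanding both binomials; no
    exponent vanishes as \<open>0 < x < 1\<close>. At \<open>s = w\<close> all powers combine to
    \<open>w powr x * w ^ j\<close>, and at \<open>s = 1\<close> a polynomial in \<open>w\<close> is
    left.\<close>
  define F where "F s = (\<Sum>i\<le>r. \<Sum>j\<le>r. cf i j * (s powr (x + real j - real i) / (x + real j - real i)))" for s
  define G where "G s = s powr (x - 1 - real r) * ((w - s) * (s - 1)) ^ r" for s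
  have dF: "(F has_real_derivative G s) (at s)" if s: "s > 0" for s
  proof -
    have 1: "((\<lambda>s. s powr (x + real j - real i) / (x + real j - real i)) has_real_derivative s powr (x + real j - real i - 1)) (at s)" for i j
      by (rule DERIV_cong[OF DERIV_cdivide[OF has_real_derivative_powr[OF s]]]) (use nz[of j i] in simp)
    have "(F has_real_derivative (\<Sum>i\<le>r. \<Sum>j\<le>r. cf i j * s powr (x + real j - real i - 1))) (at s)"
      unfolding F_def by (intro DERIV_sum DERIV_cmult 1)
    also have "(\<Sum>i\<le>r. \<Sum>j\<le>r. cf i j * s powr (x + real j - real i - 1))
       = (\<Sum>i\<le>r. \<Sum>j\<le>r. s powr (x - 1 - real r) * ((real (r choose i) * w ^ i * (- s) ^ (r - i)) * (real (r choose j) * s ^ j * (- 1) ^ (r - j))))"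
    proof (intro sum.cong refl)
      fix i j assume ij: "i \<in> {..r}" "j \<in> {..r}"
      have "x + real j - real i - 1 = (x - 1 - real r) + (real (r - i) + real j)" using ij by (simp add: of_nat_diff)
      then have "s powr (x + real j - real i - 1) = s powr (x - 1 - real r) * (s ^ (r - i) * s ^ j)"
        using s by (simp only: powr_add powr_realpow)
      moreover have "(- s) ^ (r - i) = (- 1) ^ (r - i) * s ^ (r - i)" by (rule power_minus)
      ultimately show "cf i j * s powr (x + real j - real i - 1)
        = s powr (x - 1 - real r) * ((real (r choose i) * w ^ i * (- s) ^ (r - i)) * (real (r choose j) * s ^ j * (- 1) ^ (r - j)))"
        unfolding cf_def by (simp add: mult_ac)
    qed
    also have "\<dots> = s powr (x - 1 - real r) * (\<Sum>i\<le>r. \<Sum>j\<le>r. (real (r choose i) * w ^ i * (- s) ^ (r - i)) * (real (r choose j) * s ^ j * (- 1) ^ (r - j)))"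
      by (simp only: sum_distrib_left)
    also have "\<dots> = s powr (x - 1 - real r) * ((\<Sum>i\<le>r. real (r choose i) * w ^ i * (- s) ^ (r - i)) * (\<Sum>j\<le>r. real (r choose j) * s ^ j * (- 1) ^ (r - j)))"
      by (simp only: sum_product)
    also have "(\<Sum>i\<le>r. real (r choose i) * w ^ i * (- s) ^ (r - i)) = (w + - s) ^ r" by (rule binomial_ring[symmetric])
    also have "(\<Sum>j\<le>r. real (r choose j) * s ^ j * (- 1) ^ (r - j)) = (s + - 1) ^ r" by (rule binomial_ring[symmetric])
    finally show ?thesis unfolding G_def by (simp add: power_mult_distrib)
  qed
  define \<kappa> where "\<kappa> = real k ^ (2 * r) * (x * ppr x r * qpr x r / (fact r)\<^sup>2)"
  define mid where "mid j = x * ppr x j * qpr x (r - j)" for j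
  have midnz: "mid j \<noteq> 0" for j using ppr_qpr_nonzero[OF x(1,2)] x(1) unfolding mid_def by (simp add: less_imp_neq[symmetric])
  have pc: "\<kappa> * (real (r choose j) * (fact r / mid j)) = pade_coeff k r j" for j
    using x(1) ppr_qpr_nonzero(1)[OF x(1,2), of j] ppr_qpr_nonzero(2)[OF x(1,2), of "r - j"]
    unfolding \<kappa>_def mid_def pade_coeff_def x_def[symmetric] by (simp add: field_simps power2_eq_square)
  have sgn: "(- 1 :: real) ^ (r - i) = (- 1) ^ r * (- 1) ^ i" if "i \<le> r" for i
  proof -
    have "(- 1 :: real) ^ r = (- 1) ^ (r - i) * (- 1) ^ i" using that by (simp add: power_add[symmetric])
    moreover have "(- 1 :: real) ^ i * (- 1) ^ i = 1" by (simp add: power_mult_distrib[symmetric])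
    ultimately show ?thesis by (simp add: mult.assoc)
  qed
  have PF1: "(\<Sum>i\<le>r. (- 1) ^ (r - i) * real (r choose i) / (x + real j - real i)) = fact r / mid j" if j: "j \<le> r" for j
  proof -
    have "(\<Sum>i\<le>r. (- 1) ^ i * real (r choose i) / (- (x + real j) + real i)) = fact r / (\<Prod>i\<le>r. - (x + real j) + real i)"
    proof (rule partial_fraction_binomial)
      show "- (x + real j) + real i \<noteq> 0" for i using nz[of j i] by linarith
    qed
    also have "(\<Prod>i\<le>r. - (x + real j) + real i) = (\<Prod>i\<le>r. (- 1) * (x + real j - real i))" by (intro prod.cong) auto
    also have "\<dots> = (- 1) ^ Suc r * mid j" unfolding prod.distrib mixed_prod_eq[OF j] mid_def by simp
    finally have e: "(\<Sum>i\<le>r. (- 1) ^ i * real (r choose i) / (- (x + real j) + real i)) = fact r / ((- 1) ^ Suc r * mid j)" .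
    have "(\<Sum>i\<le>r. (- 1) ^ (r - i) * real (r choose i) / (x + real j - real i))
       = (\<Sum>i\<le>r. (- 1) ^ Suc r * ((- 1) ^ i * real (r choose i) / (- (x + real j) + real i)))"
    proof (intro sum.cong refl)
      fix i assume "i \<in> {..r}"
      then have "(- 1 :: real) ^ (r - i) = (- 1) ^ r * (- 1) ^ i" by (intro sgn) simp
      moreover have "- (x + real j) + real i = - (x + real j - real i)" by simp
      ultimately show "(- 1) ^ (r - i) * real (r choose i) / (x + real j - real i) = (- 1) ^ Suc r * ((- 1) ^ i * real (r choose i) / (- (x + real j) + real i))"
        by (simp only: divide_minus_right power_Suc) simp
    qed
    also have "\<dots> = (- 1) ^ Suc r * (fact r / ((- 1) ^ Suc r * mid j))" unfolding sum_distrib_left[symmetric] e ..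
    also have "\<dots> = fact r / mid j" by simp
    finally show ?thesis .
  qed
  have PF2: "(\<Sum>j\<le>r. (- 1) ^ (r - j) * real (r choose j) / (x + real j - real i)) = (- 1) ^ r * (fact r / mid (r - i))" if i: "i \<le> r" for i
  proof -
    have "(\<Sum>j\<le>r. (- 1) ^ j * real (r choose j) / ((x - real i) + real j)) = fact r / (\<Prod>j\<le>r. (x - real i) + real j)"
    proof (rule partial_fraction_binomial)
      show "(x - real i) + real j \<noteq> 0" for j using nz[of j i] by linarith
    qed
    also have "(\<Prod>j\<le>r. (x - real i) + real j) = (\<Prod>j\<le>r. (x - real i) + real (r - j))"
      by (subst prod.nat_diff_reindex[symmetric, of _ "Suc r", unfolded lessThan_Suc_atMost]) simp
    also have "\<dots> = (\<Prod>j\<le>r. x + real (r - i) - real j)" using i by (intro prod.cong) (auto simp: of_nat_diff)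
    also have "\<dots> = mid (r - i)" unfolding mid_def by (rule mixed_prod_eq) simp
    finally have e: "(\<Sum>j\<le>r. (- 1) ^ j * real (r choose j) / ((x - real i) + real j)) = fact r / mid (r - i)" .
    have "(\<Sum>j\<le>r. (- 1) ^ (r - j) * real (r choose j) / (x + real j - real i))
      = (\<Sum>j\<le>r. (- 1) ^ r * ((- 1) ^ j * real (r choose j) / ((x - real i) + real j)))"
    proof (intro sum.cong refl)
      fix j assume "j \<in> {..r}"
      then have "(- 1 :: real) ^ (r - j) = (- 1) ^ r * (- 1) ^ j" by (intro sgn) simp
      moreover have "x + real j - real i = (x - real i) + real j" by simp
      ultimately show "(- 1) ^ (r - j) * real (r choose j) / (x + real j - real i) = (- 1) ^ r * ((- 1) ^ j * real (r choose j) / ((x - real i) + real j))"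
        by (simp only: mult.assoc times_divide_eq_right)
    qed
    then show ?thesis unfolding sum_distrib_left[symmetric] e .
  qed
  have Fw: "\<kappa> * F w = w powr x * (\<Sum>j\<le>r. (- 1) ^ (r - j) * pade_coeff k r j * w ^ j)"
  proof -
    have "F w = (\<Sum>j\<le>r. \<Sum>i\<le>r. cf i j * (w powr (x + real j - real i) / (x + real j - real i)))"
      unfolding F_def by (rule sum.swap)
    also have "\<dots> = (\<Sum>j\<le>r. \<Sum>i\<le>r. (w powr x * w ^ j * ((- 1) ^ (r - j) * real (r choose j))) * ((- 1) ^ (r - i) * real (r choose i) / (x + real j - real i)))"
    proof (intro sum.cong refl)
      fix i j :: nat
      have "w ^ i * w powr (x + real j - real i) = w powr x * w ^ j"
        using w1 by (simp add: powr_realpow[symmetric] powr_add[symmetric])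
      then have "cf i j * (w powr (x + real j - real i) / (x + real j - real i))
         = (- 1) ^ (r - i) * real (r choose i) * ((- 1) ^ (r - j) * real (r choose j)) * (w powr x * w ^ j) / (x + real j - real i)"
      proof -
        assume e: "w ^ i * w powr (x + real j - real i) = w powr x * w ^ j"
        have "a * b * c * (p / d) = a * b * (c * p) / d" for a b c p d :: real by simp
        then show ?thesis unfolding cf_def e[symmetric] .
      qed
      then show "cf i j * (w powr (x + real j - real i) / (x + real j - real i))
        = (w powr x * w ^ j * ((- 1) ^ (r - j) * real (r choose j))) * ((- 1) ^ (r - i) * real (r choose i) / (x + real j - real i))"
        by (simp add: mult_ac)
    qed
    also have "\<dots> = (\<Sum>j\<le>r. (w powr x * w ^ j * ((- 1) ^ (r - j) * real (r choose j))) * (fact r / mid j))"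
      unfolding sum_distrib_left[symmetric] by (intro sum.cong refl) (simp add: PF1)
    finally have "\<kappa> * F w = (\<Sum>j\<le>r. \<kappa> * ((w powr x * w ^ j * ((- 1) ^ (r - j) * real (r choose j))) * (fact r / mid j)))"
      by (simp add: sum_distrib_left)
    also have "\<dots> = (\<Sum>j\<le>r. w powr x * ((- 1) ^ (r - j) * pade_coeff k r j * w ^ j))"
      unfolding pc[symmetric] by (intro sum.cong refl) (simp only: mult_ac)
    finally show ?thesis by (simp add: sum_distrib_left)
  qed
  have F1: "\<kappa> * F 1 = (\<Sum>i\<le>r. (- 1) ^ i * pade_coeff k r (r - i) * w ^ i)"
  proof -
    have "F 1 = (\<Sum>i\<le>r. \<Sum>j\<le>r. (w ^ i * ((- 1) ^ (r - i) * real (r choose i))) * ((- 1) ^ (r - j) * real (r choose j) / (x + real j - real i)))"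
      unfolding F_def cf_def by (intro sum.cong refl) (simp add: mult_ac)
    also have "\<dots> = (\<Sum>i\<le>r. (w ^ i * ((- 1) ^ (r - i) * real (r choose i))) * ((- 1) ^ r * (fact r / mid (r - i))))"
      unfolding sum_distrib_left[symmetric] by (intro sum.cong refl) (simp add: PF2)
    finally have "\<kappa> * F 1 = (\<Sum>i\<le>r. \<kappa> * ((w ^ i * ((- 1) ^ (r - i) * real (r choose i))) * ((- 1) ^ r * (fact r / mid (r - i)))))"
      by (simp add: sum_distrib_left)
    also have "\<dots> = (\<Sum>i\<le>r. (- 1) ^ i * pade_coeff k r (r - i) * w ^ i)"
    proof (intro sum.cong refl)
      fix i assume "i \<in> {..r}"
      then have i: "i \<le> r" by simp
      have s: "(- 1 :: real) ^ (r - i) * (- 1) ^ r = (- 1) ^ i"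
      proof -
        have "(- 1 :: real) ^ r * (- 1) ^ r = 1" by (simp add: power_mult_distrib[symmetric])
        moreover have "(- 1 :: real) ^ (r - i) * (- 1) ^ r = (- 1) ^ i * ((- 1) ^ r * (- 1) ^ r)"
          unfolding sgn[OF i] by (simp only: mult_ac)
        ultimately show ?thesis by simp
      qed
      have c: "real (r choose i) = real (r choose (r - i))" using binomial_symmetric[OF i] by simp
      have "\<kappa> * ((w ^ i * ((- 1) ^ (r - i) * real (r choose i))) * ((- 1) ^ r * (fact r / mid (r - i))))
        = ((- 1) ^ (r - i) * (- 1) ^ r) * (\<kappa> * (real (r choose (r - i)) * (fact r / mid (r - i)))) * w ^ i"
        unfolding c by (simp only: mult_ac)
      then show "\<kappa> * ((w ^ i * ((- 1) ^ (r - i) * real (r choose i))) * ((- 1) ^ r * (fact r / mid (r - i))))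
        = (- 1) ^ i * pade_coeff k r (r - i) * w ^ i"
        unfolding s pc .
    qed
    finally show ?thesis .
  qed
  have D: "D = \<kappa> * (F w - F 1)" unfolding D_def right_diff_distrib Fw F1 x_def[symmetric] ..
  have kap: "1 \<le> \<bar>\<kappa>\<bar>" "\<bar>\<kappa>\<bar> \<le> real k ^ (2 * r)"
  proof -
    have a: "\<bar>\<kappa>\<bar> = real k ^ (2 * r) * (\<bar>x * ppr x r * qpr x r\<bar> / (fact r)\<^sup>2)"
      unfolding \<kappa>_def by (simp add: abs_mult)
    have "\<bar>x * ppr x r * qpr x r\<bar> / (fact r)\<^sup>2 \<le> 1" using pade_normalizer_bounds(1)[OF x(1,3), of r] x by linarith
    then have "real k ^ (2 * r) * (\<bar>x * ppr x r * qpr x r\<bar> / (fact r)\<^sup>2) \<le> real k ^ (2 * r) * 1" by (rule mult_left_mono) simp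
    then show "\<bar>\<kappa>\<bar> \<le> real k ^ (2 * r)" unfolding a by simp
    have "real k ^ (2 * r) * (x / 2 ^ r) \<le> \<bar>\<kappa>\<bar>"
      unfolding a using pade_normalizer_bounds(2)[OF x(1,3), of r] by (rule mult_left_mono) simp
    moreover have "real k ^ (2 * r) * (x / 2 ^ r) = ((real k)\<^sup>2 / 2) ^ r * x"
      by (simp add: power_mult power_divide)
    moreover have "1 \<le> ((real k)\<^sup>2 / 2) ^ r * x"
    proof -
      have k2: "real k \<le> (real k)\<^sup>2 / 2" using k by (simp add: power2_eq_square)
      have "((real k)\<^sup>2 / 2) ^ 1 \<le> ((real k)\<^sup>2 / 2) ^ r" using k2 k r by (intro power_increasing) auto
      then have "real k * x \<le> ((real k)\<^sup>2 / 2) ^ r * x" using k2 x by (intro mult_right_mono) auto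
      then show ?thesis using k by (simp add: x_def)
    qed
    ultimately show "1 \<le> \<bar>\<kappa>\<bar>" by linarith
  qed
  have Gnn: "G s \<ge> 0" if "1 \<le> s" "s \<le> w" for s
    unfolding G_def using that by (intro mult_nonneg_nonneg zero_le_power) auto
  have mono: "F s \<le> F t" if "1 \<le> s" "s \<le> t" "t \<le> w" for s t
    by (rule DERIV_nonneg_imp_nondecreasing[OF that(2)]) (use that dF Gnn in \<open>force intro!: exI\<close>)
  have up: "F w - F 1 \<le> \<delta> * (\<delta>\<^sup>2 / 4) ^ r"
  proof -
    obtain z where z: "1 < z" "z < w" "F w - F 1 = (w - 1) * G z"
      using MVT2[of 1 w F G] dF w1 by auto
    have "(w - z) * (z - 1) \<le> \<delta>\<^sup>2 / 4"
    proof -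
      have "0 \<le> ((w - z) - (z - 1))\<^sup>2" by simp
      then have "4 * ((w - z) * (z - 1)) \<le> (w - 1)\<^sup>2" by (simp add: power2_eq_square algebra_simps)
      then show ?thesis unfolding w by simp
    qed
    then have "((w - z) * (z - 1)) ^ r \<le> (\<delta>\<^sup>2 / 4) ^ r" using z by (intro power_mono) auto
    moreover have "z powr (x - 1 - real r) \<le> z powr 0" using z x by (intro powr_mono) auto
    ultimately have "G z \<le> 1 * (\<delta>\<^sup>2 / 4) ^ r" unfolding G_def using z by (intro mult_mono) auto
    then show ?thesis unfolding z(3) using \<delta> unfolding w by (simp add: mult_left_mono)
  qed
  have low: "\<delta> / 6 * (\<delta>\<^sup>2 / 9) ^ r \<le> F w - F 1"
  proof -
    \<comment> \<open>On the middle third of the interval \<open>(w - z) * (z - 1)\<close> is at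
      least \<open>2 * \<delta>\<^sup>2 / 9\<close>, and the power of \<open>z \<le> 2\<close> is at
      least \<open>1 / 2 ^ (r + 1)\<close>. The length \<open>\<delta> / 3\<close> of this third
      completes the bound.\<close>
    define s where "s = 1 + \<delta> / 3"
    define t where "t = 1 + 2 * \<delta> / 3"
    have st: "1 < s" "s < t" "t < w" using \<delta> by (auto simp: s_def t_def w)
    obtain z where z: "s < z" "z < t" "F t - F s = (t - s) * G z"
      using MVT2[of s t F G] dF st by auto
    have "\<delta> / 3 * (2 * \<delta> / 3) \<le> (w - z) * (z - 1)"
    proof -
      have "(w - z) * (z - 1) - \<delta> / 3 * (2 * \<delta> / 3) = (z - s) * (t - z)"
        unfolding s_def t_def w by (simp add: field_simps)
      moreover have "(z - s) * (t - z) \<ge> 0" using z by simp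
      ultimately show ?thesis by linarith
    qed
    then have a: "(\<delta> / 3 * (2 * \<delta> / 3)) ^ r \<le> ((w - z) * (z - 1)) ^ r" using \<delta> by (intro power_mono) auto
    have z12: "1 < z" "z \<le> 2" using z st w1 by auto
    have b: "1 / 2 ^ Suc r \<le> z powr (x - 1 - real r)"
    proof -
      have "1 / 2 ^ Suc r = 2 powr (- real (Suc r))" by (simp only: powr_minus powr_realpow zero_less_numeral divide_inverse mult_1)
      also have "\<dots> \<le> z powr (- real (Suc r))" using z12 by (intro powr_mono2') auto
      also have "\<dots> \<le> z powr (x - 1 - real r)" using z12 x by (intro powr_mono) auto
      finally show ?thesis .
    qed
    have "1 / 2 ^ Suc r * (\<delta> / 3 * (2 * \<delta> / 3)) ^ r \<le> G z"
      unfolding G_def using a b \<delta> by (intro mult_mono) auto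
    moreover have "1 / 2 ^ Suc r * (\<delta> / 3 * (2 * \<delta> / 3)) ^ r = 1 / 2 * (\<delta>\<^sup>2 / 9) ^ r"
    proof -
      have e: "\<delta> / 3 * (2 * \<delta> / 3) = 2 * (\<delta>\<^sup>2 / 9)" by (simp add: power2_eq_square)
      show ?thesis unfolding e power_mult_distrib by simp
    qed
    ultimately have "\<delta> / 3 * (1 / 2 * (\<delta>\<^sup>2 / 9) ^ r) \<le> \<delta> / 3 * G z" using \<delta> by (intro mult_left_mono) auto
    also have "\<dots> = F t - F s" using z(3) unfolding s_def t_def by simp
    also have "\<dots> \<le> F w - F 1" using mono[of 1 s] mono[of t w] st by auto
    finally show ?thesis by simp
  qed
  have F0: "F w - F 1 \<ge> 0" using mono[of 1 w] w1 by simp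
  have aD: "\<bar>D\<bar> = \<bar>\<kappa>\<bar> * (F w - F 1)" unfolding D abs_mult using F0 by simp
  have "1 * (F w - F 1) \<le> \<bar>D\<bar>" unfolding aD by (rule mult_right_mono[OF kap(1) F0])
  then have "F w - F 1 \<le> \<bar>D\<bar>" by (simp only: mult_1)
  then show "\<delta> / 6 * (\<delta>\<^sup>2 / 9) ^ r \<le> \<bar>D\<bar>" by (rule order_trans[OF low])
  have "\<bar>D\<bar> \<le> real k ^ (2 * r) * (\<delta> * (\<delta>\<^sup>2 / 4) ^ r)"
    unfolding aD using kap up F0 by (intro mult_mono) auto
  also have "\<dots> = \<delta> * ((real k)\<^sup>2 * \<delta>\<^sup>2 / 4) ^ r"
    by (simp add: power_mult power_mult_distrib power_divide)
  finally show "\<bar>D\<bar> \<le> \<delta> * ((real k)\<^sup>2 * \<delta>\<^sup>2 / 4) ^ r" .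
qed


section \<open>Gaps between elements above n\<close>

lemma nat_nth_power_of_int:
  assumes "is_nth_power k (int m)"
  obtains x :: nat where "m = x ^ k"
proof -
  obtain y where y: "int m = y ^ k" using assms by (auto simp: is_nth_power_def)
  have "int m = \<bar>y\<bar> ^ k" using y by (metis abs_of_nat power_abs)
  also have "\<dots> = int (nat \<bar>y\<bar> ^ k)" by simp
  finally have "m = nat \<bar>y\<bar> ^ k" by (simp only: of_nat_eq_iff)
  then show ?thesis by (rule that)
qed

text \<open>\<open>(a b + n) (c d + n)\<close> exceeds \<open>(a c + n) (b d + n)\<close> by
  \<open>n (d - a) (c - b) > 0\<close>. Both products are \<open>k\<close>-th powers, so the
  difference is at least \<open>y ^ (k - 1)\<close>. This forces
  \<open>b ^ (k - 2) \<le> d\<^sup>2\<close>, and \<open>k \<ge> 42\<close> gives the exponent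
  \<open>20\<close>.\<close>

lemma gap_principle:
  fixes a b c d n k :: nat
  assumes ord: "0 < n" "n \<le> a" "a < b" "b < c" "c < d" and k: "k \<ge> 42"
    and pw: "a * b + n = p1 ^ k" "c * d + n = p2 ^ k" "a * c + n = p3 ^ k" "b * d + n = p4 ^ k"
  shows "b ^ 20 \<le> d"
proof -
  define x y where "x = p1 * p2" and "y = p3 * p4"
  have xk: "x ^ k = (a * b + n) * (c * d + n)" and yk: "y ^ k = (a * c + n) * (b * d + n)"
    unfolding x_def y_def by (simp_all only: power_mult_distrib pw)
  have "int ((a * b + n) * (c * d + n)) = int ((a * c + n) * (b * d + n)) + int n * (int d - int a) * (int c - int b)"
    by (simp add: algebra_simps)
  also have "int n * (int d - int a) * (int c - int b) = int (n * (d - a) * (c - b))" using ord by (simp add: of_nat_diff)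
  finally have diff: "x ^ k = y ^ k + n * (d - a) * (c - b)"
    unfolding xk yk by (simp only: of_nat_add[symmetric] of_nat_eq_iff)
  have "y ^ k < x ^ k" unfolding diff using ord by simp
  then have "y < x" by (rule power_less_imp_less_base) simp
  then have "(y + 1) ^ k \<le> x ^ k" by (intro power_mono) auto
  moreover have "y ^ k + y ^ (k - 1) \<le> (y + 1) ^ k"
  proof -
    obtain m where m: "k = Suc m" using k by (cases k) auto
    have "y ^ m \<le> (y + 1) ^ m" by (intro power_mono) auto
    then have "(y + 1) * y ^ m \<le> (y + 1) * (y + 1) ^ m" by (intro mult_left_mono) auto
    then show ?thesis unfolding m by simp
  qed
  ultimately have "y ^ (k - 1) \<le> n * (d - a) * (c - b)" unfolding diff by linarith
  also have "\<dots> \<le> n * d * c" by (intro mult_mono) auto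
  finally have "(y ^ (k - 1)) ^ k \<le> (n * d * c) ^ k" by (rule power_mono) simp
  moreover have "(a * b * (c * d)) ^ (k - 1) \<le> (y ^ (k - 1)) ^ k"
  proof -
    have "a * b * (c * d) \<le> y ^ k" unfolding yk by (simp add: algebra_simps)
    then have "(a * b * (c * d)) ^ (k - 1) \<le> (y ^ k) ^ (k - 1)" by (intro power_mono) auto
    then show ?thesis by (simp add: power_mult[symmetric] mult.commute)
  qed
  ultimately have 1: "(a * b) ^ (k - 1) * (c * d) ^ (k - 1) \<le> n ^ k * (c * d) ^ k"
    by (simp add: power_mult_distrib mult_ac)
  have k1: "k = Suc (k - 1)" using k by simp
  have "(c * d) ^ k = (c * d) * (c * d) ^ (k - 1)" by (subst k1) simp
  with 1 have "(a * b) ^ (k - 1) * (c * d) ^ (k - 1) \<le> (n ^ k * (c * d)) * (c * d) ^ (k - 1)"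
    by (simp only: mult.assoc)
  moreover have "(c * d) ^ (k - 1) > 0" using ord by simp
  ultimately have "(a * b) ^ (k - 1) \<le> n ^ k * (c * d)" by (simp only: mult_le_cancel2)
  also have "\<dots> \<le> a ^ k * (d * d)" using ord by (intro mult_mono power_mono) auto
  finally have "a ^ (k - 1) * b ^ (k - 1) \<le> a ^ (k - 1) * (a * (d * d))"
    unfolding power_mult_distrib by (subst (asm) (3) k1) (simp add: mult_ac)
  then have "b ^ (k - 1) \<le> a * (d * d)" using ord by (simp add: mult_le_cancel1)
  also have "\<dots> \<le> b * (d * d)" using ord by (intro mult_right_mono) auto
  finally have "b * b ^ (k - 2) \<le> b * (d * d)"
    using k by (simp add: power_Suc[symmetric] Suc_diff_Suc numeral_2_eq_2 del: power_Suc)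
  then have "b ^ (k - 2) \<le> d * d" using ord by (simp add: mult_le_cancel1)
  moreover have "b ^ 40 \<le> b ^ (k - 2)" using ord k by (intro power_increasing) auto
  ultimately have "(b ^ 20) ^ 2 \<le> d ^ 2" by (simp add: power2_eq_square flip: power_add)
  then show ?thesis by (rule power2_le_imp_le) simp
qed

text \<open>The number \<open>w = b (a C + n) / (a (b C + n))\<close> is rational and close to
  \<open>1\<close>, and the roots \<open>X / Y\<close> formed from the four powers satisfy
  \<open>(X / Y) ^ k = w (1 - \<epsilon>)\<close> with \<open>\<epsilon> \<le> 1 / c\<close>. So
  \<open>X / Y\<close> approximates the \<open>k\<close>-th root of \<open>w\<close> within
  \<open>2 / c\<close>, although \<open>Y\<close> is at most \<open>c\<close> to the power
  \<open>1 / 21\<close>.\<close>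

lemma no_very_large_fourth:
  fixes a b C c n k :: nat
  assumes ord: "0 < n" "n \<le> a" "a < b" "b ^ 20 \<le> C" "C ^ 20 \<le> c" and k: "k \<ge> 42" "k \<le> n"
    and pw: "a * C + n = x0 ^ k" "b * C + n = y0 ^ k" "a * c + n = x1 ^ k" "b * c + n = y1 ^ k"
  shows False
proof -
  have b2: "b \<ge> 2" "b \<ge> 42" using ord k by linarith+
  define B L M where "B = ln (real b)" and "L = ln (real C)" and "M = ln (real c)"
  have C0: "C > 0" using ord b2 by (metis gr0I le_zero_eq power_not_zero not_numeral_le_zero)
  have c0: "c > 0" using ord C0 by (metis gr0I le_zero_eq power_not_zero)
  have B2: "ln 2 \<le> B" unfolding B_def using b2 by (intro ln_mono) auto
  have l2: "ln 2 > (2 / 3 - 1 / 100 :: real)" using ln2_ge_two_thirds by linarith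
  have LB: "20 * B \<le> L"
  proof -
    have "real b ^ 20 \<le> real C" using ord(4) by (metis of_nat_le_iff of_nat_power)
    then have "ln (real b ^ 20) \<le> L" unfolding L_def using b2 by (intro ln_mono) auto
    then show ?thesis using b2 by (simp add: B_def ln_realpow)
  qed
  have LM: "20 * L \<le> M"
  proof -
    have "real C ^ 20 \<le> real c" using ord(5) by (metis of_nat_le_iff of_nat_power)
    then have "ln (real C ^ 20) \<le> M" unfolding M_def using C0 by (intro ln_mono) auto
    then show ?thesis using C0 by (simp add: L_def ln_realpow)
  qed
  have pos: "B > 0" "L > 0" "M > 250" using B2 l2 LB LM by linarith+
  have eb: "real b = exp B" and eC: "real C = exp L" and ec: "real c = exp M"
    using b2 C0 c0 by (auto simp: B_def L_def M_def)
  have e2: "2 \<le> exp B" using b2 by (simp flip: eb)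
  define s where "s = a * (b * C + n)"
  define W where "W = b * (a * C + n)"
  define w where "w = real W / real s"
  define \<delta> where "\<delta> = real (n * (b - a)) / real s"
  have a0: "a > 0" using ord by linarith
  have s0: "s > 0" unfolding s_def using a0 ord by simp
  have sC: "real C \<le> real s"
  proof -
    have "1 * (1 * C + 0) \<le> s" unfolding s_def using a0 b2 by (intro mult_mono add_mono) auto
    then show ?thesis by simp
  qed
  have s_le: "real s \<le> 2 * real b ^ 2 * real C"
  proof -
    have "b * C + n \<le> b * C + b * C" using ord C0 by (intro add_left_mono) (metis One_nat_def Suc_leI le_trans less_imp_le mult.right_neutral mult_le_mono2)
    then have "s \<le> b * (b * C + b * C)" unfolding s_def using ord by (intro mult_mono) auto
    then have "real s \<le> real (b * (b * C + b * C))" by (simp only: of_nat_le_iff)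
    then show ?thesis by (simp add: power2_eq_square algebra_simps)
  qed
  have Ws: "W = s + n * (b - a)"
  proof -
    have "int W = int s + int n * (int b - int a)" unfolding W_def s_def by (simp add: algebra_simps)
    also have "int n * (int b - int a) = int (n * (b - a))" using ord by (simp add: of_nat_diff)
    finally show ?thesis by (simp only: of_nat_add[symmetric] of_nat_eq_iff)
  qed
  have w_eq: "w = 1 + \<delta>" unfolding w_def \<delta>_def Ws using s0 by (simp add: add_divide_distrib)
  have nb: "n * (b - a) \<le> b ^ 2" unfolding power2_eq_square using ord by (intro mult_mono) auto
  have d_low: "1 / real s \<le> \<delta>" unfolding \<delta>_def using ord by (intro divide_right_mono) (auto simp: Suc_le_eq simp flip: of_nat_mult)
  have d_up: "\<delta> \<le> real b ^ 2 / real s" unfolding \<delta>_def using nb by (intro divide_right_mono) (metis of_nat_le_iff of_nat_power, simp)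
  have bC: "real b ^ 2 \<le> real C"
  proof -
    have "b ^ 2 \<le> b ^ 20" using b2 by (intro power_increasing) auto
    then have "b ^ 2 \<le> C" using ord(4) by linarith
    then show ?thesis by (metis of_nat_le_iff of_nat_power)
  qed
  have d1: "0 < \<delta>" "\<delta> \<le> 1"
  proof -
    show "0 < \<delta>" using d_low s0 by (meson divide_pos_pos less_le_trans of_nat_0_less_iff zero_less_one)
    have "real b ^ 2 / real s \<le> 1" using bC sC s0 by (subst divide_le_eq_1_pos) auto
    then show "\<delta> \<le> 1" using d_up by linarith
  qed
  have w1: "1 < w" "w \<le> 2" using d1 w_eq by auto
  define \<theta> where "\<theta> = w powr (1 / real k)"
  have \<theta>0: "\<theta> > 0" using w1 by (simp add: \<theta>_def)
  have \<theta>k: "\<theta> ^ k = w" unfolding \<theta>_def using w1 k by (simp add: powr_realpow[symmetric] powr_powr)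
  have \<theta>2: "\<theta> \<le> 2"
  proof -
    have "\<theta> \<le> w powr 1" unfolding \<theta>_def using w1 k by (intro powr_mono) auto
    then show ?thesis using w1 by simp
  qed
  define X Y where "X = y1 * x0" and "Y = x1 * y0"
  have x1p: "x1 > 0" "y0 > 0" "y1 > 0" "x0 > 0" using pw ord k by (metis add_gr_0 gr0I power_0_left less_irrefl not_numeral_le_zero)+
  have Y0: "Y > 0" unfolding Y_def using x1p by simp
  define \<xi> where "\<xi> = real X / real Y"
  define \<epsilon> where "\<epsilon> = real (n * (b - a)) / real (b * (a * c + n))"
  have \<xi>k: "\<xi> ^ k = w * (1 - \<epsilon>)"
  proof -
    have "real X ^ k = real (b * c + n) * real (a * C + n)" unfolding X_def pw by (simp add: power_mult_distrib)
    moreover have "real Y ^ k = real (a * c + n) * real (b * C + n)" unfolding Y_def pw by (simp add: power_mult_distrib)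
    ultimately have 1: "\<xi> ^ k = real (b * c + n) * real (a * C + n) / (real (a * c + n) * real (b * C + n))"
      unfolding \<xi>_def by (simp add: power_divide)
    have e: "real (n * (b - a)) = real n * (real b - real a)" using ord by (simp add: of_nat_diff)
    have 2: "1 - \<epsilon> = real a * real (b * c + n) / (real b * real (a * c + n))"
    proof -
      have "0 < b" "0 < a * c + n" using b2 ord k by auto
      then have den: "real b * real (a * c + n) > 0" by (simp only: zero_less_mult_iff of_nat_0_less_iff simp_thms)
      have "1 - \<epsilon> = (real b * real (a * c + n) - real n * (real b - real a)) / (real b * real (a * c + n))"
        unfolding \<epsilon>_def e of_nat_mult[of b] using den by (simp only: diff_divide_distrib divide_self less_numeral_extra)
      also have "real b * real (a * c + n) - real n * (real b - real a) = real a * real (b * c + n)"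
        by (simp add: algebra_simps)
      finally show ?thesis .
    qed
    have cancel: "P * R / (Q * S) = (u * R / (v * S)) * (v * P / (u * Q))" if "u \<noteq> 0" "v \<noteq> 0" for P Q R S u v :: real
      using that by (cases "Q = 0 \<or> S = 0") (auto simp: field_simps)
    have ab: "real b \<noteq> 0" "real a \<noteq> 0" using a0 b2 by auto
    show ?thesis unfolding 1 2 w_def W_def s_def of_nat_mult[of b] of_nat_mult[of a] by (rule cancel[OF ab])
  qed
  have \<epsilon>: "0 < \<epsilon>" "\<epsilon> \<le> 1 / real c"
  proof -
    have "n * (b - a) > 0" "b * (a * c + n) > 0" using ord b2 k by simp_all
    then have pos: "real (n * (b - a)) > 0" "real (b * (a * c + n)) > 0" by (simp_all only: of_nat_0_less_iff)
    show "0 < \<epsilon>" unfolding \<epsilon>_def by (rule divide_pos_pos[OF pos])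
    have "n * (b - a) * c \<le> b * (a * c + n)"
    proof -
      have "n * (b - a) * c \<le> a * b * c" using ord by (intro mult_mono) auto
      also have "\<dots> \<le> b * (a * c + n)" by (simp add: algebra_simps)
      finally show ?thesis .
    qed
    then have "real (n * (b - a) * c) \<le> real (b * (a * c + n))" by (simp only: of_nat_le_iff)
    then show "\<epsilon> \<le> 1 / real c" unfolding \<epsilon>_def
      using c0 pos by (simp only: pos_divide_le_eq pos_le_divide_eq of_nat_mult times_divide_eq_left mult_1 of_nat_0_less_iff)
  qed
  have c1: "real c > 1" unfolding ec using pos by simp
  have \<epsilon>1: "\<epsilon> < 1" using \<epsilon>(2) c1 by (smt (verit) divide_less_eq_1_pos)
  have \<xi>0: "\<xi> > 0" unfolding \<xi>_def X_def using x1p Y0 by simp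
  have appr: "0 < \<theta> - \<xi>" "\<theta> - \<xi> \<le> 2 / real c"
  proof -
    define \<rho> where "\<rho> = \<xi> / \<theta>"
    have \<rho>0: "\<rho> > 0" using \<xi>0 \<theta>0 by (simp add: \<rho>_def)
    have \<rho>k: "\<rho> ^ k = 1 - \<epsilon>" unfolding \<rho>_def power_divide \<xi>k \<theta>k using w1 by simp
    have \<rho>1: "\<rho> < 1"
    proof (rule ccontr)
      assume "\<not> \<rho> < 1"
      then have "1 \<le> \<rho> ^ k" by (intro one_le_power) simp
      then show False unfolding \<rho>k using \<epsilon> by simp
    qed
    have "\<rho> ^ k \<le> \<rho> ^ 1" using \<rho>0 \<rho>1 k by (intro power_decreasing) auto
    then have \<rho>low: "1 - \<epsilon> \<le> \<rho>" unfolding \<rho>k by simp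
    have e: "\<theta> - \<xi> = \<theta> * (1 - \<rho>)" using \<theta>0 by (simp add: \<rho>_def field_simps)
    show "0 < \<theta> - \<xi>" unfolding e using \<theta>0 \<rho>1 by simp
    have "\<theta> * (1 - \<rho>) \<le> 2 * (1 / real c)" using \<theta>2 \<theta>0 \<rho>low \<rho>1 \<epsilon> by (intro mult_mono) auto
    then show "\<theta> - \<xi> \<le> 2 / real c" unfolding e by simp
  qed
  have lnY: "ln (real Y) \<le> M / 21"
  proof -
    have "real Y ^ k = real ((a * c + n) * (b * C + n))" unfolding Y_def pw by (simp add: power_mult_distrib)
    also have "(a * c + n) * (b * C + n) \<le> c * c"
    proof -
      have "a * c + n \<le> b * c + b * c" using ord c0 by (intro add_mono) (auto intro: order_trans[of n b] simp: Suc_le_eq)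
      also have "\<dots> = 2 * (b * c)" by simp
      also have "\<dots> \<le> b * (b * c)" using b2 by (intro mult_right_mono) auto
      also have "\<dots> = b ^ 2 * c" by (simp add: power2_eq_square)
      finally have 1: "a * c + n \<le> b ^ 2 * c" .
      have "b * C + n \<le> b * C + b * C" using ord C0 by (intro add_mono) (auto intro: order_trans[of n b] simp: Suc_le_eq)
      also have "\<dots> = 2 * (b * C)" by simp
      also have "\<dots> \<le> b * (b * C)" using b2 by (intro mult_right_mono) auto
      also have "\<dots> = b ^ 2 * C" by (simp add: power2_eq_square)
      finally have 2: "b * C + n \<le> b ^ 2 * C" .
      have "(a * c + n) * (b * C + n) \<le> (b ^ 2 * c) * (b ^ 2 * C)" using 1 2 by (rule mult_mono) auto
      also have "\<dots> = b ^ 4 * C * c" by (simp add: power2_eq_square power4_eq_xxxx)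
      also have "\<dots> \<le> C * C * c"
      proof -
        have "b ^ 4 \<le> b ^ 20" using b2 by (intro power_increasing) auto
        then show ?thesis using ord(4) by (intro mult_right_mono) auto
      qed
      also have "\<dots> \<le> c * c"
      proof -
        have "C ^ 2 \<le> C ^ 20" using C0 by (intro power_increasing) auto
        then show ?thesis using ord(5) by (intro mult_right_mono) (auto simp: power2_eq_square)
      qed
      finally show ?thesis .
    qed
    finally have "real Y ^ k \<le> real (c * c)" by simp
    then have "ln (real Y ^ k) \<le> ln (real (c * c))" using Y0 by (intro ln_mono) auto
    then have "real k * ln (real Y) \<le> 2 * M" using Y0 c0 by (simp add: ln_realpow ln_mult M_def)
    moreover have "42 * ln (real Y) \<le> real k * ln (real Y)" using Y0 k by (intro mult_right_mono) auto
    ultimately show ?thesis by simp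
  qed
  \<comment> \<open>Chosen so that \<open>C ^ r\<close> lies between \<open>c\<close> to the powers
    \<open>1 / 10\<close> and \<open>3 / 20\<close>; the rounding costs one \<open>L\<close>, which
    is at most \<open>M / 20\<close>.\<close>
  define r where "r = nat \<lceil>M / (10 * L)\<rceil>"
  have rL: "M / 10 \<le> real r * L" "real r * L \<le> M * (3 / 20)"
  proof -
    have r1: "M / (10 * L) \<le> real r" unfolding r_def by (rule real_nat_ceiling_ge)
    then show "M / 10 \<le> real r * L" using pos by (simp add: field_simps)
    have "real r \<le> M / (10 * L) + 1" unfolding r_def using pos by (simp add: of_nat_nat ceiling_le_iff)
    then have "real r * L \<le> (M / (10 * L) + 1) * L" using pos by (intro mult_right_mono) auto
    also have "\<dots> = M / 10 + L" using pos by (simp add: field_simps)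
    finally show "real r * L \<le> M * (3 / 20)" using LM by linarith
  qed
  have r1: "r \<ge> 1" using rL(1) pos by (cases r) auto
  define V where "V = (\<Sum>j\<le>r. (- 1) ^ (r - j) * pade_coeff k r j * w ^ j)"
  define U where "U = (\<Sum>i\<le>r. (- 1) ^ i * pade_coeff k r (r - i) * w ^ i)"
  define D where "D = \<theta> * V - U"
  have Dlow: "\<delta> / 6 * (\<delta>\<^sup>2 / 9) ^ r \<le> \<bar>D\<bar>" and Dup: "\<bar>D\<bar> \<le> \<delta> * ((real k)\<^sup>2 * \<delta>\<^sup>2 / 4) ^ r"
    using pade_approximation[of k r \<delta> w] k r1 d1 w_eq unfolding D_def V_def U_def \<theta>_def by auto
  have k2: "k \<ge> 2" using k by simp
  have sw: "real s ^ r * w ^ j = real (W ^ j * s ^ (r - j))" if "j \<le> r" for j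
  proof -
    have "real s ^ r = real s ^ j * real s ^ (r - j)" using that by (simp add: power_add[symmetric])
    then show ?thesis using s0 by (simp add: w_def power_divide)
  qed
  have Vint: "real s ^ r * V \<in> \<int>"
  proof -
    have "real s ^ r * V = (\<Sum>j\<le>r. (- 1) ^ (r - j) * pade_coeff k r j * real (W ^ j * s ^ (r - j)))"
      unfolding V_def sum_distrib_left by (intro sum.cong refl, subst sw[symmetric], simp, simp only: mult_ac)
    also have "\<dots> \<in> \<int>" by (intro Ints_sum Ints_mult pade_coeff_int[OF k2] Ints_power) auto
    finally show ?thesis .
  qed
  have Uint: "real s ^ r * U \<in> \<int>"
  proof -
    have "real s ^ r * U = (\<Sum>i\<le>r. (- 1) ^ i * pade_coeff k r (r - i) * real (W ^ i * s ^ (r - i)))"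
      unfolding U_def sum_distrib_left by (intro sum.cong refl, subst sw[symmetric], simp, simp only: mult_ac)
    also have "\<dots> \<in> \<int>" by (intro Ints_sum Ints_mult pade_coeff_int[OF k2] Ints_power) auto
    finally show ?thesis .
  qed
  have lnk: "real k \<le> exp B" using k ord by (simp flip: eb)
  have s_exp: "real s \<le> exp (3 * B + L)"
  proof -
    have "real s \<le> 2 * exp B ^ 2 * exp L" using s_le by (simp only: eb eC)
    also have "\<dots> \<le> exp B * exp B ^ 2 * exp L" using e2 by (intro mult_right_mono) auto
    also have "\<dots> = exp (3 * B + L)" by (simp add: power2_eq_square exp_add[symmetric])
    finally show ?thesis .
  qed
  have Vb: "\<bar>real s ^ r * V\<bar> \<le> 2 * exp (M * (3 / 20) * (29 / 20))"
  proof -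
    have "\<bar>V\<bar> \<le> (\<Sum>j\<le>r. 2 * (4 * (real k)\<^sup>2) ^ r * 2 ^ r)"
      unfolding V_def
    proof (rule order_trans[OF sum_abs sum_mono])
      fix j assume j: "j \<in> {..r}"
      have "w ^ j \<le> 2 ^ j" using w1 by (intro power_mono) auto
      also have "(2::real) ^ j \<le> 2 ^ r" using j by (intro power_increasing) auto
      finally have wj: "w ^ j \<le> 2 ^ r" .
      have "\<bar>(- 1) ^ (r - j) * pade_coeff k r j * w ^ j\<bar> = \<bar>pade_coeff k r j\<bar> * w ^ j"
        using w1 by (simp add: abs_mult power_abs)
      also have "\<dots> \<le> 2 * (4 * (real k)\<^sup>2) ^ r * 2 ^ r"
        using pade_coeff_bound[OF k2, of j r] j wj w1 by (intro mult_mono) auto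
      finally show "\<bar>(- 1) ^ (r - j) * pade_coeff k r j * w ^ j\<bar> \<le> 2 * (4 * (real k)\<^sup>2) ^ r * 2 ^ r" .
    qed
    also have "\<dots> = real (r + 1) * (2 * (4 * (real k)\<^sup>2) ^ r * 2 ^ r)" by simp
    also have "\<dots> \<le> 2 ^ r * (2 * (4 * (real k)\<^sup>2) ^ r * 2 ^ r)"
    proof (intro mult_right_mono)
      have "r + 1 \<le> 2 ^ r" using less_exp[of r] by (simp only: Suc_eq_plus1[symmetric] Suc_le_eq)
      then show "real (r + 1) \<le> 2 ^ r" by (metis of_nat_le_iff of_nat_numeral of_nat_power)
    qed auto
    also have "\<dots> = 2 * (16 * (real k)\<^sup>2) ^ r"
    proof -
      have "(16::real) ^ r = 4 ^ r * (2 ^ r * 2 ^ r)" by (simp add: power_mult_distrib[symmetric])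
      then show ?thesis by (simp add: power_mult_distrib)
    qed
    finally have Vr: "\<bar>V\<bar> \<le> 2 * (16 * (real k)\<^sup>2) ^ r" .
    have base: "real s * (16 * (real k)\<^sup>2) \<le> exp (L * (29 / 20))"
    proof -
      have "real s * (16 * (real k)\<^sup>2) \<le> exp (3 * B + L) * (exp B ^ 4 * exp B ^ 2)"
      proof (intro mult_mono s_exp)
        show "16 \<le> exp B ^ 4" using power_mono[OF e2, of 4] by simp
        show "(real k)\<^sup>2 \<le> exp B ^ 2" using lnk by (intro power_mono) auto
      qed auto
      also have "\<dots> = exp (9 * B + L)" by (simp add: exp_of_nat_mult[symmetric] exp_add[symmetric])
      also have "\<dots> \<le> exp (L * (29 / 20))" using LB by simp
      finally show ?thesis .
    qed
    have "\<bar>real s ^ r * V\<bar> = real s ^ r * \<bar>V\<bar>" by (simp add: abs_mult)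
    also have "\<dots> \<le> real s ^ r * (2 * (16 * (real k)\<^sup>2) ^ r)" using Vr by (intro mult_left_mono) auto
    also have "\<dots> = 2 * (real s * (16 * (real k)\<^sup>2)) ^ r" by (simp add: power_mult_distrib)
    also have "\<dots> \<le> 2 * exp (L * (29 / 20)) ^ r" using base by (intro mult_left_mono power_mono) auto
    also have "\<dots> = 2 * exp (real r * L * (29 / 20))" by (simp add: exp_of_nat_mult[symmetric] mult_ac)
    also have "\<dots> \<le> 2 * exp (M * (3 / 20) * (29 / 20))" using rL(2) by (simp add: mult_ac)
    finally show ?thesis .
  qed
  have Rup: "real s ^ r * \<bar>D\<bar> \<le> exp (- (M * (7 / 100)))"
  proof -
    have base: "real s * ((real k)\<^sup>2 * \<delta>\<^sup>2 / 4) \<le> exp (- (L * (7 / 10)))"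
    proof -
      have "real s * ((real k)\<^sup>2 * \<delta>\<^sup>2 / 4) \<le> real s * ((real k)\<^sup>2 * \<delta>\<^sup>2)" by (intro mult_left_mono) auto
      also have "\<dots> \<le> real s * (exp B ^ 2 * (real b ^ 2 / real s)\<^sup>2)"
        using lnk d1 d_up by (intro mult_left_mono mult_mono power_mono) auto
      also have "\<dots> = exp B ^ 6 / real s"
        using s0 unfolding eb by (simp add: power2_eq_square field_simps eval_nat_numeral)
      also have "\<dots> \<le> exp B ^ 6 / exp L" using sC unfolding eC by (intro divide_left_mono) (auto simp: s0)
      also have "\<dots> = exp (6 * B - L)" by (simp add: exp_diff exp_of_nat_mult[symmetric])
      also have "\<dots> \<le> exp (- (L * (7 / 10)))" using LB by simp
      finally show ?thesis .
    qed
    have "real s ^ r * \<bar>D\<bar> \<le> real s ^ r * (1 * ((real k)\<^sup>2 * \<delta>\<^sup>2 / 4) ^ r)"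
    proof (intro mult_left_mono)
      have "\<delta> * ((real k)\<^sup>2 * \<delta>\<^sup>2 / 4) ^ r \<le> 1 * ((real k)\<^sup>2 * \<delta>\<^sup>2 / 4) ^ r" using d1 by (intro mult_right_mono) auto
      then show "\<bar>D\<bar> \<le> 1 * ((real k)\<^sup>2 * \<delta>\<^sup>2 / 4) ^ r" using Dup by linarith
    qed simp
    also have "\<dots> = (real s * ((real k)\<^sup>2 * \<delta>\<^sup>2 / 4)) ^ r" by (simp only: power_mult_distrib mult_1)
    also have "\<dots> \<le> exp (- (L * (7 / 10))) ^ r" using base by (intro power_mono) auto
    also have "\<dots> = exp (- (real r * L * (7 / 10)))" by (simp add: exp_of_nat_mult[symmetric] mult_ac)
    also have "\<dots> \<le> exp (- (M * (7 / 100)))" using rL(1) by (simp add: mult_ac)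
    finally show ?thesis .
  qed
  have Rlow: "exp (- (M * (27 / 100))) \<le> real s ^ r * \<bar>D\<bar>"
  proof -
    have s9: "9 * real s \<le> exp (L * (27 / 20))"
    proof -
      have "9 * real s \<le> exp B ^ 4 * exp (3 * B + L)"
      proof (intro mult_mono s_exp)
        show "9 \<le> exp B ^ 4" using power_mono[OF e2, of 4] by simp
      qed auto
      also have "\<dots> = exp (7 * B + L)" by (simp add: exp_of_nat_mult[symmetric] exp_add[symmetric])
      also have "\<dots> \<le> exp (L * (27 / 20))" using LB by simp
      finally show ?thesis .
    qed
    have r1L: "real (Suc r) * L \<le> M * (1 / 5)" using rL(2) LM by (simp add: algebra_simps)
    have "real (Suc r) * L * (27 / 20) \<le> M * (1 / 5) * (27 / 20)" using r1L by (rule mult_right_mono) simp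
    also have "\<dots> = M * (27 / 100)" by simp
    finally have "exp (- (M * (27 / 100))) \<le> exp (- (real (Suc r) * L * (27 / 20)))"
      by (simp only: exp_le_cancel_iff neg_le_iff_le)
    also have "\<dots> = 1 / exp (L * (27 / 20)) ^ Suc r"
    proof -
      have "exp (L * (27 / 20)) ^ Suc r = exp (real (Suc r) * (L * (27 / 20)))" by (rule exp_of_nat_mult[symmetric])
      then show ?thesis by (simp only: exp_minus inverse_eq_divide mult.assoc)
    qed
    also have "\<dots> \<le> 1 / (9 * real s) ^ Suc r" using s9 s0 by (intro divide_left_mono power_mono) auto
    also have "\<dots> = 1 / (9 * real s) * (1 / (9 * real s)) ^ r" by (simp add: power_one_over)
    also have "\<dots> \<le> (1 / real s) / 6 * (real s * ((1 / real s)\<^sup>2 / 9)) ^ r"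
    proof (intro mult_mono)
      show "1 / (9 * real s) \<le> 1 / real s / 6" using s0 by (simp add: field_simps)
      have "real s * ((1 / real s)\<^sup>2 / 9) = 1 / (9 * real s)" using s0 by (simp add: power2_eq_square field_simps)
      then show "(1 / (9 * real s)) ^ r \<le> (real s * ((1 / real s)\<^sup>2 / 9)) ^ r" by (simp only: order_refl)
    qed (use s0 in auto)
    also have "\<dots> = real s ^ r * ((1 / real s) / 6 * ((1 / real s)\<^sup>2 / 9) ^ r)" by (simp only: power_mult_distrib mult_ac)
    also have "\<dots> \<le> real s ^ r * (\<delta> / 6 * (\<delta>\<^sup>2 / 9) ^ r)"
      using d_low d1 s0 by (intro mult_left_mono mult_mono power_mono divide_right_mono) auto
    also have "\<dots> \<le> real s ^ r * \<bar>D\<bar>" using Dlow by (intro mult_left_mono) auto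
    finally show ?thesis .
  qed
  \<comment> \<open>An integer. If it is \<open>0\<close>, then
    \<open>s ^ r * \<bar>D\<bar>\<close>, at least \<open>c\<close> to the power
    \<open>- 27 / 100\<close>, equals \<open>E1\<close>, at most \<open>4\<close> times
    \<open>c\<close> to the power \<open>87 / 400 - 1\<close>. Otherwise it is at least
    \<open>1\<close> in absolute value, but \<open>1 / 21 - 7 / 100 < 0\<close> makes it small. In
    both cases \<open>M > 250\<close> gives the contradiction.\<close>
  define \<Delta> where "\<Delta> = real s ^ r * V * real X - real s ^ r * U * real Y"
  have \<Delta>int: "\<Delta> \<in> \<int>" unfolding \<Delta>_def by (intro Ints_diff Ints_mult[OF Vint] Ints_mult[OF Uint] Ints_of_nat)
  have \<Delta>eq: "\<Delta> = real Y * (real s ^ r * D - real s ^ r * V * (\<theta> - \<xi>))"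
  proof -
    have "real X = real Y * \<xi>" using Y0 by (simp add: \<xi>_def)
    then show ?thesis unfolding \<Delta>_def D_def by (simp add: algebra_simps)
  qed
  define E1 where "E1 = \<bar>real s ^ r * V * (\<theta> - \<xi>)\<bar>"
  have E1: "E1 \<le> 4 * exp (M * (3 / 20) * (29 / 20) - M)"
  proof -
    have "E1 = \<bar>real s ^ r * V\<bar> * (\<theta> - \<xi>)" using appr unfolding E1_def abs_mult by simp
    also have "\<dots> \<le> 2 * exp (M * (3 / 20) * (29 / 20)) * (2 / real c)"
      using Vb appr by (intro mult_mono) auto
    also have "\<dots> = 4 * exp (M * (3 / 20) * (29 / 20) - M)" unfolding ec exp_diff by simp
    finally show ?thesis .
  qed
  have exp_small: "exp (- x) \<le> 1 / (1 + x)" if "x \<ge> 0" for x :: real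
    using exp_ge_add_one_self[of x] that by (simp add: exp_minus divide_inverse le_imp_inverse_le)
  show False
  proof (cases "\<Delta> = 0")
    case True
    then have "real s ^ r * D = real s ^ r * V * (\<theta> - \<xi>)" unfolding \<Delta>eq using Y0 by simp
    moreover have "\<bar>real s ^ r * D\<bar> = real s ^ r * \<bar>D\<bar>" by (simp add: abs_mult)
    ultimately have "real s ^ r * \<bar>D\<bar> = E1" unfolding E1_def by (simp only:)
    then have "exp (- (M * (27 / 100))) \<le> 4 * exp (M * (3 / 20) * (29 / 20) - M)" using Rlow E1 by linarith
    then have "exp (- (M * (27 / 100))) * exp (M * (27 / 100)) \<le> 4 * exp (M * (3 / 20) * (29 / 20) - M) * exp (M * (27 / 100))"
      by (intro mult_right_mono) auto
    moreover have "exp (- (M * (27 / 100))) * exp (M * (27 / 100)) = 1" unfolding exp_add[symmetric] by simp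
    moreover have "exp (M * (3 / 20) * (29 / 20) - M) * exp (M * (27 / 100)) = exp (- (M * (205 / 400)))"
    proof -
      have "M * (3 / 20) * (29 / 20) - M + M * (27 / 100) = - (M * (205 / 400))" by (simp add: field_simps)
      then show ?thesis unfolding exp_add[symmetric] by (simp only:)
    qed
    ultimately have "1 \<le> 4 * exp (- (M * (205 / 400)))" by (simp only: mult.assoc)
    moreover have "exp (- (M * (205 / 400))) \<le> 1 / (1 + M * (205 / 400))" using pos by (intro exp_small) simp
    moreover have "1 / (1 + M * (205 / 400)) < 1 / 4" using pos by (simp add: field_simps)
    ultimately show False by linarith
  next
    case False
    have eY: "real Y \<le> exp (M / 21)" using lnY Y0 by (metis exp_le_cancel_iff exp_ln of_nat_0_less_iff)
    have "1 \<le> \<bar>\<Delta>\<bar>" using \<Delta>int False by (auto elim!: Ints_cases)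
    also have "\<dots> = real Y * \<bar>real s ^ r * D - real s ^ r * V * (\<theta> - \<xi>)\<bar>" unfolding \<Delta>eq abs_mult by simp
    also have "\<dots> \<le> real Y * (real s ^ r * \<bar>D\<bar> + E1)"
    proof (intro mult_left_mono)
      have "\<bar>real s ^ r * D\<bar> = real s ^ r * \<bar>D\<bar>" by (simp add: abs_mult)
      then show "\<bar>real s ^ r * D - real s ^ r * V * (\<theta> - \<xi>)\<bar> \<le> real s ^ r * \<bar>D\<bar> + E1"
        unfolding E1_def using abs_triangle_ineq4[of "real s ^ r * D" "real s ^ r * V * (\<theta> - \<xi>)"] by linarith
    qed simp
    also have "\<dots> \<le> exp (M / 21) * (exp (- (M * (7 / 100))) + 4 * exp (M * (3 / 20) * (29 / 20) - M))"
      using eY Rup E1 by (intro mult_mono add_mono) (auto simp: E1_def)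
    also have "\<dots> = exp (- (M * (47 / 2100))) + 4 * exp (- (M * (7 / 10) + M * (293 / 8400)))"
    proof -
      have "M / 21 + - (M * (7 / 100)) = - (M * (47 / 2100))"
        "M / 21 + (M * (3 / 20) * (29 / 20) - M) = - (M * (7 / 10) + M * (293 / 8400))" by (simp_all add: field_simps)
      then show ?thesis
        unfolding distrib_left mult.left_commute[of "exp (M / 21)" 4] exp_add[symmetric] by (simp only:)
    qed
    also have "\<dots> \<le> 1 / (1 + M * (47 / 2100)) + 4 * (1 / (1 + (M * (7 / 10) + M * (293 / 8400))))"
      using pos by (intro add_mono mult_left_mono exp_small) auto
    also have "\<dots> < 1 / 2 + 1 / 2"
    proof (rule add_strict_mono)
      show "1 / (1 + M * (47 / 2100)) < 1 / 2" using pos by (simp add: field_simps)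
      show "4 * (1 / (1 + (M * (7 / 10) + M * (293 / 8400)))) < 1 / 2" using pos by (simp add: field_simps)
    qed
    finally show False by simp
  qed
qed

text \<open>Among six elements \<open>e ! 0 < ... < e ! 5\<close> the gap principle applies to the
  first four and to the last four. This gives two successive gaps from \<open>e ! 1\<close> over
  \<open>e ! 3\<close> to \<open>e ! 5\<close>, and \<open>e ! 0\<close> supplies the smallest
  element of the configuration just excluded.\<close>

lemma card_large_elements_le:
  assumes A: "has_property_D k n A" and k: "k \<ge> 42" "k \<le> n"
  shows "finite {a \<in> A. a \<ge> n} \<and> card {a \<in> A. a \<ge> n} \<le> 5"
proof (rule ccontr)
  define S where "S = {a \<in> A. a \<ge> n}"
  assume neg: "\<not> (finite {a \<in> A. a \<ge> n} \<and> card {a \<in> A. a \<ge> n} \<le> 5)"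
  then have "\<exists>T. T \<subseteq> S \<and> finite T \<and> card T = 6"
  proof (cases "finite S")
    case True
    then have "6 \<le> card S" using neg unfolding S_def[symmetric] by simp
    then show ?thesis using obtain_subset_with_card_n by (metis True finite_subset)
  next
    case False
    then show ?thesis using infinite_arbitrarily_large by blast
  qed
  then obtain T where T: "T \<subseteq> S" "finite T" "card T = 6" by blast
  define e where "e = sorted_list_of_set T"
  have e: "sorted_wrt (<) e" "set e = T" "length e = 6"
    unfolding e_def using T by (auto simp: strict_sorted_iff)
  have lt: "e ! i < e ! j" if "i < j" "j < 6" for i j
    using e(1,3) that by (simp add: sorted_wrt_iff_nth_less)
  have mem: "e ! i \<in> A" "n \<le> e ! i" if "i < 6" for i
    using e(2,3) T(1) nth_mem[of i e] that unfolding S_def by auto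
  have pw: "\<exists>x. e ! i * e ! j + n = x ^ k" if "i < j" "j < 6" for i j
  proof -
    have "is_nth_power k (int (e ! i) * int (e ! j) + int n)"
      using A mem[of i] mem[of j] lt[OF that] that unfolding has_property_D_def by auto
    then have "is_nth_power k (int (e ! i * e ! j + n))" by simp
    then show ?thesis by (rule nat_nth_power_of_int) blast
  qed
  have n0: "n > 0" using k by simp
  obtain p01 p23 p02 p13 where q1: "e ! 0 * e ! 1 + n = p01 ^ k" "e ! 2 * e ! 3 + n = p23 ^ k" "e ! 0 * e ! 2 + n = p02 ^ k" "e ! 1 * e ! 3 + n = p13 ^ k"
    using pw[of 0 1] pw[of 2 3] pw[of 0 2] pw[of 1 3] by auto
  have g1: "(e ! 1) ^ 20 \<le> e ! 3"
    by (rule gap_principle[OF n0 _ _ _ _ k(1) q1]) (use mem[of 0] lt[of 0 1] lt[of 1 2] lt[of 2 3] in auto)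
  obtain p23' p45 p24 p35 where q2: "e ! 2 * e ! 3 + n = p23' ^ k" "e ! 4 * e ! 5 + n = p45 ^ k" "e ! 2 * e ! 4 + n = p24 ^ k" "e ! 3 * e ! 5 + n = p35 ^ k"
    using pw[of 2 3] pw[of 4 5] pw[of 2 4] pw[of 3 5] by auto
  have g2: "(e ! 3) ^ 20 \<le> e ! 5"
    by (rule gap_principle[OF n0 _ _ _ _ k(1) q2]) (use mem[of 2] lt[of 2 3] lt[of 3 4] lt[of 4 5] in auto)
  obtain p03 p05 p15 where q3: "e ! 0 * e ! 3 + n = p03 ^ k" "e ! 0 * e ! 5 + n = p05 ^ k" "e ! 1 * e ! 5 + n = p15 ^ k"
    using pw[of 0 3] pw[of 0 5] pw[of 1 5] by auto
  show False
    by (rule no_very_large_fourth[OF n0 _ _ g1 g2 k q3(1) q1(4) q3(2,3)]) (use mem[of 0] lt[of 0 1] in auto)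
qed

section \<open>The choice of the exponent\<close>

lemma finite_primes_le: "finite {p::nat. Q p \<and> real p \<le> X}"
  by (rule finite_subset[of _ "{..nat \<lfloor>X\<rfloor>}"]) (auto simp: le_nat_floor)

text \<open>Chebyshev's bound again: powers of bases up to \<open>sqrt Y\<close> are negligible, and
  \<open>ln 4 > 1\<close> leaves the margin. The restriction to primes above \<open>sqrt Y\<close>
  pins each \<open>ln q\<close> between \<open>ln Y / 2\<close> and \<open>ln Y\<close>.\<close>

lemma eventually_many_primes_above_sqrt:
  "eventually (\<lambda>Y::real. Y / (2 * ln Y) \<le> real (card {p::nat. (prime p \<and> sqrt Y < real p) \<and> real p \<le> Y})) at_top"
proof -
  have "eventually (\<lambda>Y::real. Y / 2 + sqrt Y * (2 * ln Y + 1) * ln Y + ln Y \<le> (Y / 2 - 1) * (4 / 3)) at_top"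
    by real_asymp
  moreover have "eventually (\<lambda>Y::real. Y > 4) at_top" by (rule eventually_gt_at_top)
  ultimately show ?thesis
  proof eventually_elim
    case (elim Y)
    define N where "N = nat \<lfloor>Y / 2\<rfloor>"
    have N1: "N \<ge> 1" and N2: "2 * real N \<le> Y" and N3: "real N \<ge> Y / 2 - 1"
      unfolding N_def using elim by linarith+
    have lnY: "ln Y > 0" using elim by simp
    have ln2N: "ln (real (2 * N)) \<le> ln Y" using N1 N2 by (intro ln_mono) auto
    define R where "R = {p::nat. (prime p \<and> sqrt Y < real p) \<and> real p \<le> Y}"
    define R' where "R' = R \<inter> {1..2 * N}"
    have fR: "finite R" unfolding R_def by (rule finite_primes_le)
    define B where "B = {2..nat \<lfloor>sqrt Y\<rfloor>}"
    have cB: "real (card B) \<le> sqrt Y"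
    proof -
      have "card B \<le> nat \<lfloor>sqrt Y\<rfloor>" unfolding B_def by simp
      then have "real (card B) \<le> real (nat \<lfloor>sqrt Y\<rfloor>)" by (simp only: of_nat_le_iff)
      also have "\<dots> \<le> sqrt Y" using elim by (intro of_nat_floor) simp
      finally show ?thesis .
    qed
    define U where "U = {d \<in> {1..2 * N}. \<exists>b\<in>B. \<exists>k. d = b ^ k}"
    have cU: "real (card U) \<le> sqrt Y * (2 * ln Y + 1)"
    proof -
      have "real (card U) \<le> real (card B) * (2 * ln (real (2 * N)) + 1)"
        unfolding U_def using N1 by (intro card_powers_le) (auto simp: B_def)
      also have "\<dots> \<le> sqrt Y * (2 * ln Y + 1)"
        using N1 cB ln2N elim by (intro mult_mono add_mono mult_left_mono) (auto intro!: add_nonneg_nonneg)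
      finally show ?thesis .
    qed
    have "(Y / 2 - 1) * (4 / 3) \<le> real N * ln 4"
    proof (intro mult_mono N3)
      have "ln (4::real) = 2 * ln 2" using ln_realpow[of 2 2] by simp
      then show "4 / 3 \<le> ln (4::real)" using ln2_ge_two_thirds by simp
    qed auto
    also have "real N * ln 4 - ln (2 * real N) \<le> (\<Sum>n\<in>{1..2 * N}. mangoldt n)"
      by (rule psi_lower_bound) (use N1 in auto)
    then have "real N * ln 4 \<le> (\<Sum>n\<in>{1..2 * N}. mangoldt n) + ln Y" using ln2N by simp
    also have "(\<Sum>n\<in>{1..2 * N}. mangoldt n) = (\<Sum>n\<in>R' \<union> U. mangoldt n :: real)"
    proof (rule sum.mono_neutral_right)
      show "R' \<union> U \<subseteq> {1..2 * N}" by (auto simp: R'_def U_def)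
      show "\<forall>n\<in>{1..2 * N} - (R' \<union> U). mangoldt n = (0::real)"
      proof (rule ballI)
        fix n assume "n \<in> {1..2 * N} - (R' \<union> U)"
        then have n: "n \<in> {1..2 * N}" "n \<notin> R'" "n \<notin> U" by auto
        show "mangoldt n = (0::real)"
        proof (rule ccontr)
          assume "mangoldt n \<noteq> (0::real)"
          then have "primepow n" by (auto simp: mangoldt_def split: if_splits)
          then obtain q k where qk: "prime q" "k > 0" "n = q ^ k" by (auto simp: primepow_def)
          have q2: "q \<ge> 2" using qk(1) by (rule prime_ge_2_nat)
          have "q \<notin> B" using n(1,3) qk(3) by (auto simp: U_def)
          then have "\<not> q \<le> nat \<lfloor>sqrt Y\<rfloor>" using q2 by (simp add: B_def)
          then have qY: "sqrt Y < real q" using le_nat_floor[of q "sqrt Y"] by linarith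
          have nY: "real n \<le> Y" using n(1) N2 by auto
          have "k = 1"
          proof (rule ccontr)
            assume "k \<noteq> 1"
            then have "q ^ 2 \<le> q ^ k" using qk(2) q2 by (intro power_increasing) auto
            then have "real (q ^ 2) \<le> real n" unfolding qk(3) by (simp only: of_nat_le_iff)
            moreover have "sqrt Y ^ 2 < real q ^ 2" using qY elim by (intro power_strict_mono) auto
            moreover have "sqrt Y ^ 2 = Y" using elim by simp
            moreover have "real (q ^ 2) = real q ^ 2" by simp
            ultimately show False using nY by linarith
          qed
          then have "n \<in> R'" using n(1) qk qY nY by (auto simp: R'_def R_def)
          then show False using n(2) by simp
        qed
      qed
    qed auto
    also have "\<dots> \<le> real (card (R' \<union> U)) * ln (real (2 * N))"
      by (rule sum_mangoldt_le_card) (use N1 in \<open>auto simp: R'_def U_def\<close>)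
    also have "\<dots> \<le> (real (card R) + sqrt Y * (2 * ln Y + 1)) * ln Y"
    proof (intro mult_mono ln2N)
      have "card (R' \<union> U) \<le> card R' + card U" by (rule card_Un_le)
      moreover have "card R' \<le> card R" unfolding R'_def using fR by (intro card_mono) auto
      ultimately show "real (card (R' \<union> U)) \<le> real (card R) + sqrt Y * (2 * ln Y + 1)" using cU by linarith
    qed (use lnY N1 elim in \<open>auto intro!: add_nonneg_nonneg\<close>)
    also have "\<dots> = real (card R) * ln Y + sqrt Y * (2 * ln Y + 1) * ln Y" by (simp only: distrib_right)
    finally have "Y / 2 \<le> real (card R) * ln Y" using elim by linarith
    then have "Y / (2 * ln Y) \<le> real (card R)" using lnY by (simp add: field_simps)
    then show ?case unfolding R_def .
  qed
qed

section \<open>The average of the square root of the gcd\<close>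

lemma prod_primes_dvd:
  assumes "finite T" "\<And>q. q \<in> T \<Longrightarrow> prime (q::nat) \<and> q dvd m"
  shows "\<Prod>T dvd m"
  using assms
proof (induction T rule: finite_induct)
  case (insert q T)
  have "coprime q (\<Prod>T)"
    using insert by (intro prod_coprime_right) (metis insertCI primes_coprime)
  then show ?case using insert by (simp add: divides_mult)
qed simp

text \<open>Over all subsets of the primes dividing \<open>m\<close> the products of
  \<open>sqrt q - 1\<close> add up to the product of \<open>(sqrt q - 1) + 1\<close>, the square
  root of the gcd. The sum here keeps the subsets with \<open>J\<close> elements.\<close>

lemma sum_prod_le_sqrt_gcd:
  assumes P: "finite P" "\<And>q. q \<in> P \<Longrightarrow> prime (q::nat)"
  shows "(\<Sum>S | S \<subseteq> P \<and> card S = J \<and> \<Prod>S dvd m. \<Prod>q\<in>S. (sqrt (real q) - 1)) \<le> sqrt (real (gcd m (\<Prod>P)))"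
proof -
  define T where "T = {q \<in> P. q dvd m}"
  have fT: "finite T" using P by (simp add: T_def)
  have q1: "sqrt (real q) \<ge> 1" if "q \<in> P" for q using P(2)[OF that] prime_ge_1_nat[of q] by simp
  have "(\<Sum>S | S \<subseteq> P \<and> card S = J \<and> \<Prod>S dvd m. \<Prod>q\<in>S. (sqrt (real q) - 1)) \<le> (\<Sum>S\<in>Pow T. \<Prod>q\<in>S. (sqrt (real q) - 1))"
  proof (rule sum_mono2)
    show "{S. S \<subseteq> P \<and> card S = J \<and> \<Prod>S dvd m} \<subseteq> Pow T"
    proof safe
      fix S q assume S: "S \<subseteq> P" "\<Prod>S dvd m" "q \<in> S"
      have "q dvd \<Prod>S" using S P(1) by (intro dvd_prodI) (auto intro: finite_subset)
      then show "q \<in> T" using S by (auto simp: T_def intro: dvd_trans)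
    qed
    show "0 \<le> (\<Prod>q\<in>S. (sqrt (real q) - 1))" if "S \<in> Pow T - {S. S \<subseteq> P \<and> card S = J \<and> \<Prod>S dvd m}" for S
      using that q1 by (intro prod_nonneg) (auto simp: T_def)
  qed (use fT in auto)
  also have "\<dots> = (\<Prod>q\<in>T. (sqrt (real q) - 1) + 1)" by (subst prod_add[OF fT]) simp
  also have "\<dots> = sqrt (real (\<Prod>T))" using fT by (induction T rule: finite_induct) (simp_all add: real_sqrt_mult)
  also have "\<Prod>T dvd gcd m (\<Prod>P)"
    using fT P by (intro gcd_greatest prod_primes_dvd prod_dvd_prod_subset) (auto simp: T_def)
  then have "\<Prod>T \<le> gcd m (\<Prod>P)"
  proof (rule dvd_imp_le)
    have "\<Prod>P > 0" using P by (intro prod_pos) (auto intro: prime_gt_0_nat)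
    then show "gcd m (\<Prod>P) > 0" by simp
  qed
  then have "sqrt (real (\<Prod>T)) \<le> sqrt (real (gcd m (\<Prod>P)))" by (simp only: real_sqrt_le_iff of_nat_le_iff)
  finally show ?thesis .
qed

text \<open>Averaging over the primes \<open>p\<close> instead of bounding pointwise: on average over \<open>p\<close> a large
  divisor of \<open>k\<close> divides \<open>p - 1\<close>.\<close>

lemma sum_sqrt_gcd_ge:
  fixes Q :: "nat set"
  assumes P: "finite P" "\<And>q. q \<in> P \<Longrightarrow> prime q \<and> 4 \<le> real q \<and> real q \<le> Y"
    and Q: "finite Q" "\<And>p. p \<in> Q \<Longrightarrow> prime p"
    and J: "1 \<le> J" "J \<le> card P" and E: "E \<ge> 0"
    and dist: "\<And>S. S \<subseteq> P \<Longrightarrow> card S = J \<Longrightarrow> E / real (\<Prod>S) \<le> real (card {p \<in> Q. [p = 1] (mod \<Prod>S)})"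
  shows "E * (real (card P) / (2 * real J * sqrt Y)) ^ J
    \<le> (\<Sum>p | p \<in> Q \<and> gcd (p - 1) (\<Prod>P) \<ge> 2. sqrt (real (gcd (p - 1) (\<Prod>P))))"
proof -
  define D where "D = {S. S \<subseteq> P \<and> card S = J}"
  define Q2 where "Q2 = {p \<in> Q. gcd (p - 1) (\<Prod>P) \<ge> 2}"
  define wt where "wt S = (\<Prod>q\<in>S. (sqrt (real q) - 1))" for S :: "nat set"
  have fD: "finite D" unfolding D_def using P(1) by simp
  have cD: "card D = card P choose J" unfolding D_def using P(1) by (rule n_subsets)
  have Y0: "Y > 0"
  proof -
    have "P \<noteq> {}" using J by auto
    then obtain q where "q \<in> P" by blast
    then show ?thesis using P(2)[of q] by linarith
  qed
  have wtpos: "wt S \<ge> 0" if "S \<subseteq> P" for S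
    unfolding wt_def using that P(2) by (intro prod_nonneg) (force simp: real_le_rsqrt)
  have cong_iff: "[p = 1] (mod d) \<longleftrightarrow> d dvd p - 1" if "prime p" for p d :: nat
    using prime_ge_1_nat[OF that] by (metis cong_altdef_nat)
  have S2: "\<Prod>S \<ge> 2" if "S \<in> D" for S
  proof -
    have "S \<noteq> {}" using that J by (auto simp: D_def)
    then obtain q where q: "q \<in> S" by blast
    have fS: "finite S" using that P(1) by (auto simp: D_def intro: finite_subset)
    have "q dvd \<Prod>S" using fS q by (intro dvd_prodI) auto
    moreover have "\<Prod>S > 0" using that P by (intro prod_pos) (auto simp: D_def intro!: prime_gt_0_nat)
    ultimately have "q \<le> \<Prod>S" by (rule dvd_imp_le)
    moreover have "q \<ge> 2" using q that P(2)[of q] by (auto simp: D_def intro!: prime_ge_2_nat)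
    ultimately show ?thesis by linarith
  qed
  \<comment> \<open>\<open>q \<ge> 4\<close> gives \<open>sqrt q - 1 \<ge> sqrt q / 2\<close>, so
    each prime of \<open>S\<close> contributes at least \<open>1 / (2 * sqrt Y)\<close>.\<close>
  have wt_ge: "(1 / (2 * sqrt Y)) ^ J \<le> wt S * (1 / real (\<Prod>S))" if "S \<in> D" for S
  proof -
    have fS: "finite S" using that P(1) by (auto simp: D_def intro: finite_subset)
    have "(1 / (2 * sqrt Y)) ^ J = (\<Prod>q\<in>S. 1 / (2 * sqrt Y))" using that by (simp add: D_def)
    also have "\<dots> \<le> (\<Prod>q\<in>S. (sqrt (real q) - 1) / real q)"
    proof (rule prod_mono, safe)
      fix q assume "q \<in> S"
      then have q: "4 \<le> real q" "real q \<le> Y" using that P(2)[of q] by (auto simp: D_def)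
      have s: "2 \<le> sqrt (real q)" using q by (simp add: real_le_rsqrt)
      show "0 \<le> 1 / (2 * sqrt Y)" using Y0 by simp
      have "1 / (2 * sqrt Y) \<le> 1 / (2 * sqrt (real q))" using q by (intro divide_left_mono) auto
      also have "\<dots> = (sqrt (real q) / 2) / real q"
      proof -
        have "1 / (2 * s) = (s / 2) / (s * s)" if "s > 0" for s :: real using that by (simp add: field_simps)
        from this[of "sqrt (real q)"] show ?thesis using s by (simp only: real_sqrt_mult_self abs_of_nat)
      qed
      also have "\<dots> \<le> (sqrt (real q) - 1) / real q" using s by (intro divide_right_mono) auto
      finally show "1 / (2 * sqrt Y) \<le> (sqrt (real q) - 1) / real q" .
    qed
    also have "\<dots> = wt S * (1 / real (\<Prod>S))" unfolding wt_def by (simp add: prod_dividef)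
    finally show ?thesis .
  qed
  have J0: "real J > 0" using J by simp
  have "E * (real (card P) / (2 * real J * sqrt Y)) ^ J = E * ((real (card P) / real J) ^ J * (1 / (2 * sqrt Y)) ^ J)"
    by (simp add: power_mult_distrib[symmetric] mult_ac)
  also have "\<dots> \<le> E * (real (card D) * (1 / (2 * sqrt Y)) ^ J)"
  proof (intro mult_left_mono mult_right_mono E)
    show "(real (card P) / real J) ^ J \<le> real (card D)" unfolding cD using binomial_ge_n_over_k_pow_k[OF J(2), where 'a=real] by simp
  qed (use Y0 in auto)
  also have "\<dots> = (\<Sum>S\<in>D. E * (1 / (2 * sqrt Y)) ^ J)" by simp
  also have "\<dots> \<le> (\<Sum>S\<in>D. wt S * real (card {p \<in> Q. [p = 1] (mod \<Prod>S)}))"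
  proof (rule sum_mono)
    fix S assume S: "S \<in> D"
    have "E * (1 / (2 * sqrt Y)) ^ J \<le> E * (wt S * (1 / real (\<Prod>S)))" using wt_ge[OF S] E by (rule mult_left_mono)
    also have "\<dots> = wt S * (E / real (\<Prod>S))" by simp
    also have "\<dots> \<le> wt S * real (card {p \<in> Q. [p = 1] (mod \<Prod>S)})"
      using S by (intro mult_left_mono dist wtpos) (auto simp: D_def)
    finally show "E * (1 / (2 * sqrt Y)) ^ J \<le> wt S * real (card {p \<in> Q. [p = 1] (mod \<Prod>S)})" .
  qed
  also have "\<dots> = (\<Sum>S\<in>D. \<Sum>p\<in>Q2. if \<Prod>S dvd p - 1 then wt S else 0)"
  proof (intro sum.cong refl)
    fix S assume S: "S \<in> D"
    \<comment> \<open>Because \<open>J \<ge> 1\<close>, the modulus is at least \<open>2\<close>, so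
      every prime counted for \<open>S\<close> already has gcd at least \<open>2\<close>.\<close>
    have "{p \<in> Q. [p = 1] (mod \<Prod>S)} = {p \<in> Q2. \<Prod>S dvd p - 1}"
    proof (intro equalityI subsetI)
      fix p assume "p \<in> {p \<in> Q. [p = 1] (mod \<Prod>S)}"
      then have p: "p \<in> Q" "\<Prod>S dvd p - 1" using cong_iff Q(2) by auto
      have "\<Prod>S dvd \<Prod>P" using S P(1) by (intro prod_dvd_prod_subset) (auto simp: D_def)
      then have "\<Prod>S dvd gcd (p - 1) (\<Prod>P)" using p(2) by simp
      moreover have "\<Prod>P > 0" using P by (intro prod_pos) (auto intro!: prime_gt_0_nat)
      then have "gcd (p - 1) (\<Prod>P) > 0" by (simp only: gcd_pos_nat, simp)
      ultimately have "\<Prod>S \<le> gcd (p - 1) (\<Prod>P)" by (rule dvd_imp_le)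
      with S2[OF S] have "2 \<le> gcd (p - 1) (\<Prod>P)" by (rule order_trans)
      then show "p \<in> {p \<in> Q2. \<Prod>S dvd p - 1}" using p unfolding Q2_def by blast
    next
      fix p assume "p \<in> {p \<in> Q2. \<Prod>S dvd p - 1}"
      then show "p \<in> {p \<in> Q. [p = 1] (mod \<Prod>S)}" using cong_iff Q(2) by (auto simp: Q2_def)
    qed
    then have "wt S * real (card {p \<in> Q. [p = 1] (mod \<Prod>S)}) = (\<Sum>p\<in>{p \<in> Q2. \<Prod>S dvd p - 1}. wt S)" by simp
    also have "\<dots> = (\<Sum>p\<in>Q2. if \<Prod>S dvd p - 1 then wt S else 0)" using Q(1) by (intro sum.inter_filter) (simp add: Q2_def)
    finally show "wt S * real (card {p \<in> Q. [p = 1] (mod \<Prod>S)}) = (\<Sum>p\<in>Q2. if \<Prod>S dvd p - 1 then wt S else 0)" .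
  qed
  also have "\<dots> = (\<Sum>p\<in>Q2. \<Sum>S\<in>D. if \<Prod>S dvd p - 1 then wt S else 0)" by (rule sum.swap)
  also have "\<dots> \<le> (\<Sum>p\<in>Q2. sqrt (real (gcd (p - 1) (\<Prod>P))))"
  proof (rule sum_mono)
    fix p
    have "(\<Sum>S\<in>D. if \<Prod>S dvd p - 1 then wt S else 0) = (\<Sum>S\<in>{S \<in> D. \<Prod>S dvd p - 1}. wt S)"
      by (rule sum.inter_filter[OF fD, symmetric])
    also have "{S \<in> D. \<Prod>S dvd p - 1} = {S. S \<subseteq> P \<and> card S = J \<and> \<Prod>S dvd p - 1}" by (auto simp: D_def)
    also have "(\<Sum>S\<in>{S. S \<subseteq> P \<and> card S = J \<and> \<Prod>S dvd p - 1}. wt S) \<le> sqrt (real (gcd (p - 1) (\<Prod>P)))"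
      unfolding wt_def by (rule sum_prod_le_sqrt_gcd) (use P in auto)
    finally show "(\<Sum>S\<in>D. if \<Prod>S dvd p - 1 then wt S else 0) \<le> sqrt (real (gcd (p - 1) (\<Prod>P)))" .
  qed
  finally show ?thesis unfolding Q2_def .
qed

lemma card_small_elements_le:
  assumes A: "has_property_D k n A" "A \<subseteq> {1..n}" and n: "n \<ge> 2" and k: "k > 0" and X: "X \<ge> 2"
    and W: "(\<Sum>p | p \<in> {p::nat. prime p \<and> real p \<le> X} \<and> gcd (p - 1) k \<ge> 2. sqrt (real (gcd (p - 1) k)))
      \<ge> 24 * sqrt X * ln (real n) + 2 * sqrt (real k) * ln (real n)"
  shows "real (card A) * ln (real n) \<le> X * ln X"
proof (cases "A = {}")
  case True
  then show ?thesis using X by simp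
next
  case False
  have fA: "finite A" using A(2) by (rule finite_subset) simp
  define Q where "Q = {p. p \<in> {p::nat. prime p \<and> real p \<le> X} \<and> gcd (p - 1) k \<ge> 2}"
  have fQ: "finite Q" by (rule finite_subset[OF _ finite_primes_le[of prime X]]) (auto simp: Q_def)
  define P where "P = {p \<in> Q. \<not> p dvd n}"
  define R where "R = {p \<in> Q. p dvd n}"
  have fP: "finite P" "finite R" using fQ by (auto simp: P_def R_def)
  have lnn: "ln (real n) > 0" using n by simp
  define \<nu> where "\<nu> p = 6 * sqrt (real p / real (gcd (p - 1) k))" for p :: nat
  have gs: "real (card A) * ((\<Sum>p\<in>P. ln (real p) / \<nu> p) - ln (real n)) \<le> (\<Sum>p\<in>P. ln (real p)) - ln (real n)"
    unfolding \<nu>_def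
  proof (rule gallagher_larger_sieve[OF fA False A(2) fP(1)])
    fix p assume "p \<in> P"
    then show "prime p" "real (card ((\<lambda>a. a mod p) ` A)) \<le> 6 * sqrt (real p / real (gcd (p - 1) k))"
      using card_residues_property_D[of p k n A] fA A(1) k by (auto simp: P_def Q_def)
  qed
  have X0: "sqrt X > 0" using X by simp
  have Rsum: "(\<Sum>p\<in>R. sqrt (real (gcd (p - 1) k))) \<le> 2 * sqrt (real k) * ln (real n)"
  proof -
    have "(\<Sum>p\<in>R. sqrt (real (gcd (p - 1) k))) \<le> (\<Sum>p\<in>R. sqrt (real k))"
      using k by (intro sum_mono) (simp add: dvd_imp_le)
    also have "\<dots> = real (card R) * sqrt (real k)" by simp
    also have "real (card R) \<le> 2 * ln (real n)"
    proof -
      have "real (card R) * (1 / 2) = (\<Sum>p\<in>R. 1 / 2)" by simp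
      also have "\<dots> \<le> (\<Sum>p\<in>R. ln (real p))"
      proof (rule sum_mono)
        fix p assume "p \<in> R"
        then have "real p \<ge> 2" using prime_ge_2_nat[of p] by (auto simp: R_def Q_def)
        then have "ln 2 \<le> ln (real p)" by (intro ln_mono) auto
        then show "1 / 2 \<le> ln (real p)" using ln2_ge_two_thirds by simp
      qed
      also have "\<dots> \<le> ln (real n)" by (rule sum_ln_primes_dividing_le) (use fP n in \<open>auto simp: R_def Q_def\<close>)
      finally show ?thesis by simp
    qed
    then have "real (card R) * sqrt (real k) \<le> 2 * ln (real n) * sqrt (real k)" by (rule mult_right_mono) simp
    finally show ?thesis by (simp add: mult_ac)
  qed
  have "(\<Sum>p\<in>Q. sqrt (real (gcd (p - 1) k))) = (\<Sum>p\<in>P. sqrt (real (gcd (p - 1) k))) + (\<Sum>p\<in>R. sqrt (real (gcd (p - 1) k)))"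
  proof -
    have "Q = P \<union> R" "P \<inter> R = {}" by (auto simp: P_def R_def)
    then show ?thesis using fP by (simp add: sum.union_disjoint)
  qed
  then have Psum: "24 * sqrt X * ln (real n) \<le> (\<Sum>p\<in>P. sqrt (real (gcd (p - 1) k)))"
    using W Rsum unfolding Q_def[symmetric] by linarith
  have "2 * ln (real n) = (24 * sqrt X * ln (real n)) * (1 / (12 * sqrt X))" using X0 by (simp add: field_simps)
  also have "\<dots> \<le> (\<Sum>p\<in>P. sqrt (real (gcd (p - 1) k))) * (1 / (12 * sqrt X))" using Psum X0 by (intro mult_right_mono) auto
  also have "\<dots> = (\<Sum>p\<in>P. sqrt (real (gcd (p - 1) k)) * (1 / (12 * sqrt X)))" by (rule sum_distrib_right)
  also have "\<dots> \<le> (\<Sum>p\<in>P. ln (real p) / \<nu> p)"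
  proof (rule sum_mono)
    fix p assume "p \<in> P"
    then have p: "prime p" "real p \<le> X" "gcd (p - 1) k \<ge> 2" by (auto simp: P_def Q_def)
    have p2: "real p \<ge> 2" using prime_ge_2_nat[OF p(1)] by simp
    have "ln 2 \<le> ln (real p)" using p2 by (intro ln_mono) auto
    then have lp: "1 / 2 \<le> ln (real p)" using ln2_ge_two_thirds by simp
    define g where "g = sqrt (real (gcd (p - 1) k))"
    have "gcd (p - 1) k > 0" using p(3) by linarith
    then have g: "g > 0" unfolding g_def by (simp only: real_sqrt_gt_0_iff of_nat_0_less_iff)
    have "g * (1 / (12 * sqrt X)) \<le> g * (1 / (12 * sqrt (real p)))"
      using p p2 g by (intro mult_left_mono divide_left_mono) auto
    also have "\<dots> = (1 / 2) * (g / (6 * sqrt (real p)))" by simp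
    also have "\<dots> \<le> ln (real p) * (g / (6 * sqrt (real p)))" using lp g by (intro mult_right_mono) auto
    also have "\<dots> = ln (real p) / \<nu> p" unfolding \<nu>_def g_def[symmetric] real_sqrt_divide using g by (simp add: g_def[symmetric])
    finally show "sqrt (real (gcd (p - 1) k)) * (1 / (12 * sqrt X)) \<le> ln (real p) / \<nu> p" unfolding g_def .
  qed
  finally have "real (card A) * ln (real n) \<le> real (card A) * ((\<Sum>p\<in>P. ln (real p) / \<nu> p) - ln (real n))"
    by (intro mult_left_mono) auto
  also have "\<dots> \<le> (\<Sum>p\<in>P. ln (real p))" using gs lnn by linarith
  also have "\<dots> \<le> (\<Sum>p\<in>P. ln X)"
  proof (rule sum_mono)
    fix p assume "p \<in> P"
    then have "real p > 0" "real p \<le> X" using prime_gt_0_nat[of p] by (auto simp: P_def Q_def)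
    then show "ln (real p) \<le> ln X" by (intro ln_mono) auto
  qed
  also have "\<dots> = real (card P) * ln X" by simp
  also have "\<dots> \<le> X * ln X"
  proof (rule mult_right_mono)
    have "P \<subseteq> {1..nat \<lfloor>X\<rfloor>}" using prime_ge_1_nat by (auto simp: P_def Q_def le_nat_floor)
    then have "card P \<le> nat \<lfloor>X\<rfloor>" using card_mono[of "{1..nat \<lfloor>X\<rfloor>}" P] by simp
    then have "real (card P) \<le> real (nat \<lfloor>X\<rfloor>)" by (simp only: of_nat_le_iff)
    also have "\<dots> \<le> X" using X by (intro of_nat_floor) simp
    finally show "real (card P) \<le> X" .
  qed (use X in simp)
  finally show ?thesis .
qed

section \<open>The exponent and the final bound\<close>

text \<open>The weights sum to about \<open>exp (l + j)\<close>, and the sieve needs this to exceed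
  \<open>sqrt X * ln n\<close>, about \<open>exp (l / 2 + x)\<close>. With
  \<open>l = 2 x - j\<close> there is \<open>j / 2\<close> to spare for lower-order terms, and the
  sieve bound \<open>X * ln X / ln n\<close> is at most \<open>exp (x - j / 2)\<close>.\<close>

lemma eventually_good_exponent:
  "eventually (\<lambda>x::real. \<exists>k::nat. k \<ge> 2 \<and> sqrt x / 16 \<le> ln (real k) \<and> ln (real k) \<le> sqrt x / 4 \<and>
     (\<forall>n A. ln (real n) = exp x \<longrightarrow> has_property_D k n A \<longrightarrow>
        finite A \<and> real (card A) \<le> 2 * exp (x - x powr (1 / 4) / (64 * ln x)))) at_top"
proof -
  \<comment> \<open>The \<open>32\<close> ensures \<open>N / (2 * J * sqrt Y) \<ge> 3\<close>, which
    exceeds \<open>exp 1\<close>.\<close>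
  define j where "j = (\<lambda>x::real. x powr (1 / 4) / (32 * ln x))"
  define l where "l = (\<lambda>x::real. 2 * x - j x)"
  define h where "h = (\<lambda>x::real. l x + l x powr (1 / 6))"
  have lim: "filterlim l at_top at_top" unfolding l_def j_def by real_asymp
  have limY: "filterlim (\<lambda>x::real. sqrt x) at_top at_top" by real_asymp
  note ev1 = eventually_compose_filterlim[OF eventually_many_primes lim]
  note ev2 = eventually_compose_filterlim[OF eventually_many_primes_above_sqrt limY]
  have a1: "eventually (\<lambda>x. ln 48 + h x / 2 + x \<le> l x - (ln (l x)) ^ 3 + (j x - 1)) at_top"
    unfolding h_def l_def j_def by real_asymp
  have a2: "eventually (\<lambda>x. ln 4 + sqrt x / 8 + x \<le> l x - (ln (l x)) ^ 3 + (j x - 1)) at_top"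
    unfolding h_def l_def j_def by real_asymp
  have a3: "eventually (\<lambda>x. h x + ln (h x) \<le> 2 * x - j x / 2) at_top"
    unfolding h_def l_def j_def by real_asymp
  have a4: "eventually (\<lambda>x. j x * ln (sqrt x) \<le> l x powr (1 / 4)) at_top"
  proof -
    have "eventually (\<lambda>x. x \<le> l x) at_top" unfolding l_def j_def by real_asymp
    moreover have "eventually (\<lambda>x::real. x > 1) at_top" by (rule eventually_gt_at_top)
    ultimately show ?thesis
    proof eventually_elim
      case (elim x)
      have "j x * ln (sqrt x) = x powr (1 / 4) / 64" using elim by (simp add: j_def ln_sqrt)
      also have "\<dots> \<le> x powr (1 / 4)" by simp
      also have "\<dots> \<le> l x powr (1 / 4)" using elim by (intro powr_mono2) auto
      finally show ?case .
    qed
  qed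
  have a5: "eventually (\<lambda>x. 1 \<le> j x) at_top" unfolding j_def by real_asymp
  have a6: "eventually (\<lambda>x::real. sqrt x / (8 * ln (sqrt x)) \<le> sqrt x / (4 * ln (sqrt x)) - 1) at_top" by real_asymp
  have a6': "eventually (\<lambda>x::real. sqrt x / (4 * ln (sqrt x)) + 1 \<le> sqrt x / (2 * ln (sqrt x))) at_top" by real_asymp
  have a7: "eventually (\<lambda>x. 3 * (2 * j x * sqrt (sqrt x)) \<le> sqrt x / (8 * ln (sqrt x))) at_top"
    unfolding j_def by real_asymp
  have a8: "eventually (\<lambda>x::real. 42 \<le> sqrt (sqrt x)) at_top" by real_asymp
  have a9: "eventually (\<lambda>x::real. sqrt x / 4 \<le> exp x) at_top" by real_asymp
  have a10: "eventually (\<lambda>x. 5 \<le> exp (x - j x / 2)) at_top" unfolding j_def by real_asymp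
  have a11: "eventually (\<lambda>x. 1 \<le> h x) at_top" unfolding h_def l_def j_def by real_asymp
  show ?thesis
    using ev1 ev2 a1 a2 a3 a4 a5 a6 a6' a7 a8 a9 a10 a11
  proof eventually_elim
    case (elim x)
    note el = elim(3-)
    define Y where "Y = sqrt x"
    define X where "X = exp (h x)"
    have sY: "sqrt Y \<ge> 42" using el(9) by (simp add: Y_def)
    have Y42: "Y \<ge> 42"
    proof -
      have "42 * 1 \<le> sqrt Y * sqrt Y" using sY by (intro mult_mono) linarith+
      moreover have "Y \<ge> 0" using sY by (metis dual_order.trans real_sqrt_ge_0_iff zero_le_numeral)
      ultimately show ?thesis by simp
    qed
    have lnY: "ln Y > 0" using Y42 by simp
    \<comment> \<open>\<open>N\<close> primes up to \<open>Y\<close> keep \<open>ln k\<close> at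
      most \<open>Y / 4\<close>; lying above \<open>sqrt Y\<close>, they also keep it at least
      \<open>Y / 16\<close>.\<close>
    define N where "N = nat \<lfloor>Y / (4 * ln Y)\<rfloor>"
    have N: "real N \<le> Y / (4 * ln Y)" "Y / (8 * ln Y) \<le> real N"
    proof -
      have "Y / (4 * ln Y) \<ge> 0" using Y42 lnY by simp
      then show "real N \<le> Y / (4 * ln Y)" unfolding N_def by (rule of_nat_floor)
      show "Y / (8 * ln Y) \<le> real N" using el(6) unfolding N_def Y_def by linarith
    qed
    define J where "J = nat \<lfloor>j x\<rfloor>"
    have J: "real J \<le> j x" "j x - 1 \<le> real J" "J \<ge> 1" unfolding J_def using el(5) by linarith+
    have JN: "3 * (2 * real J * sqrt Y) \<le> real N"
    proof -
      have "3 * (2 * real J * sqrt Y) \<le> 3 * (2 * j x * sqrt Y)" using J(1) Y42 by (intro mult_left_mono mult_right_mono) auto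
      also have "\<dots> \<le> real N" using el(8) N(2) unfolding Y_def by linarith
      finally show ?thesis .
    qed
    have JN': "J \<le> N"
    proof -
      have "real J * 1 \<le> real J * (6 * sqrt Y)" using sY by (intro mult_left_mono) (linarith, simp)
      then have "real J \<le> real N" using JN by linarith
      then show ?thesis by simp
    qed
    \<comment> \<open>The exceptional prime depends on \<open>x\<close> alone, so it can be removed
      before \<open>k\<close> is formed. The margin \<open>N + 1 \<le> card R\<close> allows for its
      removal.\<close>
    obtain q0 where q0: "\<And>P. finite P \<Longrightarrow> (\<forall>p\<in>P. prime p) \<Longrightarrow> q0 \<notin> P \<Longrightarrow> real (\<Prod>P) \<le> exp (l x powr (1 / 4)) \<Longrightarrow>
        exp (l x - (ln (l x)) ^ 3) / real (\<Prod>P) \<le> real (card {p. prime p \<and> real p \<le> exp (l x + l x powr (1 / 6)) \<and> [p = 1] (mod \<Prod>P)})"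
      using elim(1) by blast
    define R where "R = {p::nat. (prime p \<and> sqrt Y < real p) \<and> real p \<le> Y}"
    have fR: "finite R" unfolding R_def by (rule finite_primes_le)
    have "real N + 1 \<le> real (card R)" using elim(2) el(7) N(1) unfolding R_def Y_def by linarith
    then have "N + 1 \<le> card R" by linarith
    then have "N \<le> card (R - {q0})" using card_Diff1_le[of R q0] fR by (auto simp: card_Diff_singleton_if)
    then obtain P where P: "P \<subseteq> R - {q0}" "card P = N" "finite P" by (rule obtain_subset_with_card_n)
    have Pp: "prime q" "sqrt Y < real q" "real q \<le> Y" if "q \<in> P" for q using P(1) that by (auto simp: R_def)
    define k where "k = \<Prod>P"
    have k0: "k > 0" unfolding k_def using Pp by (intro prod_pos) (auto intro: prime_gt_0_nat)
    have k42: "k \<ge> 42"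
    proof -
      have "P \<noteq> {}" using P(2) JN' J(3) by auto
      then obtain q where q: "q \<in> P" by blast
      then have "q dvd k" unfolding k_def using P(3) by (intro dvd_prodI) auto
      then have "q \<le> k" using k0 by (rule dvd_imp_le)
      moreover have "real q \<ge> 42" using Pp(2)[OF q] sY by linarith
      ultimately show ?thesis by linarith
    qed
    have lnk: "ln (real k) = (\<Sum>q\<in>P. ln (real q))"
      unfolding k_def of_nat_prod using P(3) Pp(1) by (subst ln_prod) (auto intro: prime_gt_0_nat)
    have lnq: "ln Y / 2 \<le> ln (real q)" "ln (real q) \<le> ln Y" if "q \<in> P" for q
    proof -
      have "ln Y / 2 = ln (sqrt Y)" using Y42 by (simp add: ln_sqrt)
      also have "\<dots> \<le> ln (real q)" using Pp(2)[OF that] Y42 by (intro ln_mono) auto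
      finally show "ln Y / 2 \<le> ln (real q)" .
      show "ln (real q) \<le> ln Y" using Pp(1,3)[OF that] by (intro ln_mono) (auto intro: prime_gt_0_nat)
    qed
    have lnk_le: "ln (real k) \<le> Y / 4"
    proof -
      have "ln (real k) \<le> (\<Sum>q\<in>P. ln Y)" unfolding lnk by (intro sum_mono lnq)
      also have "\<dots> = real N * ln Y" using P(2) by simp
      also have "\<dots> \<le> Y / (4 * ln Y) * ln Y" using N(1) lnY by (intro mult_right_mono) auto
      also have "\<dots> = Y / 4" using lnY by simp
      finally show ?thesis .
    qed
    have lnk_ge: "Y / 16 \<le> ln (real k)"
    proof -
      have "Y / 16 = Y / (8 * ln Y) * (ln Y / 2)" using lnY by simp
      also have "\<dots> \<le> real N * (ln Y / 2)" using N(2) lnY by (intro mult_right_mono) auto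
      also have "\<dots> = (\<Sum>q\<in>P. ln Y / 2)" using P(2) by simp
      also have "\<dots> \<le> ln (real k)" unfolding lnk by (intro sum_mono lnq)
      finally show ?thesis .
    qed
    define E where "E = exp (l x - (ln (l x)) ^ 3)"
    define Q where "Q = {p::nat. prime p \<and> real p \<le> X}"
    have "E * (real (card P) / (2 * real J * sqrt Y)) ^ J
      \<le> (\<Sum>p | p \<in> Q \<and> gcd (p - 1) (\<Prod>P) \<ge> 2. sqrt (real (gcd (p - 1) (\<Prod>P))))"
    proof (rule sum_sqrt_gcd_ge)
      show "prime q \<and> 4 \<le> real q \<and> real q \<le> Y" if "q \<in> P" for q using Pp[OF that] sY by auto
      show "finite Q" unfolding Q_def by (rule finite_primes_le)
      show "prime p" if "p \<in> Q" for p using that by (simp add: Q_def)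
      show "J \<le> card P" using JN' P(2) by simp
      show "E \<ge> 0" by (simp add: E_def)
      fix S assume S: "S \<subseteq> P" "card S = J"
      have fS: "finite S" using S(1) P(3) by (rule finite_subset)
      have "real (\<Prod>S) = (\<Prod>q\<in>S. real q)" by simp
      also have "\<dots> \<le> (\<Prod>q\<in>S. Y)" using S(1) Pp(3) by (intro prod_mono) auto
      also have "\<dots> = Y ^ J" using S(2) by simp
      also have "\<dots> = exp (real J * ln Y)" using Y42 by (simp add: exp_of_nat_mult)
      also have "\<dots> \<le> exp (j x * ln Y)" using J(1) lnY by simp
      also have "\<dots> \<le> exp (l x powr (1 / 4))" using el(4) unfolding Y_def by simp
      finally have "real (\<Prod>S) \<le> exp (l x powr (1 / 4))" .
      then have "exp (l x - (ln (l x)) ^ 3) / real (\<Prod>S) \<le> real (card {p. prime p \<and> real p \<le> exp (l x + l x powr (1 / 6)) \<and> [p = 1] (mod \<Prod>S)})"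
        using fS S(1) P(1) Pp(1) by (intro q0) auto
      also have "{p. prime p \<and> real p \<le> exp (l x + l x powr (1 / 6)) \<and> [p = 1] (mod \<Prod>S)} = {p \<in> Q. [p = 1] (mod \<Prod>S)}"
        by (auto simp: Q_def X_def h_def)
      finally show "E / real (\<Prod>S) \<le> real (card {p \<in> Q. [p = 1] (mod \<Prod>S)})" unfolding E_def .
    qed (use P(3) J(3) in auto)
    moreover have "exp (l x - (ln (l x)) ^ 3 + (j x - 1)) \<le> E * (real (card P) / (2 * real J * sqrt Y)) ^ J"
    proof -
      have "exp (j x - 1) \<le> exp (real J)" using J(2) by simp
      also have "\<dots> = exp 1 ^ J" by (simp add: exp_of_nat_mult[symmetric])
      also have "\<dots> \<le> (real (card P) / (2 * real J * sqrt Y)) ^ J"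
      proof (rule power_mono)
        have "3 \<le> real N / (2 * real J * sqrt Y)" using JN J(3) Y42 by (subst pos_le_divide_eq) auto
        then show "exp 1 \<le> real (card P) / (2 * real J * sqrt Y)" using exp_le P(2) by simp
      qed simp
      finally show ?thesis unfolding E_def exp_add by (intro mult_left_mono) auto
    qed
    ultimately have W: "exp (l x - (ln (l x)) ^ 3 + (j x - 1)) \<le> (\<Sum>p | p \<in> Q \<and> gcd (p - 1) k \<ge> 2. sqrt (real (gcd (p - 1) k)))"
      unfolding k_def by linarith
    have "finite A \<and> real (card A) \<le> 2 * exp (x - x powr (1 / 4) / (64 * ln x))"
      if n: "ln (real n) = exp x" and A: "has_property_D k n A" for n A
    proof -
      have n2: "n \<ge> 2"
      proof (rule ccontr)
        assume "\<not> n \<ge> 2"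
        then have "n = 0 \<or> n = 1" by linarith
        then show False using n by auto
      qed
      have kn: "k \<le> n"
      proof -
        have "ln (real k) \<le> ln (real n)" using lnk_le el(10) n unfolding Y_def by linarith
        then have "real k \<le> real n" using k0 n2 by simp
        then show ?thesis by simp
      qed
      define A0 where "A0 = {a \<in> A. a < n}"
      define A1 where "A1 = {a \<in> A. a \<ge> n}"
      have A1: "finite A1" "card A1 \<le> 5" using card_large_elements_le[OF A k42 kn] by (auto simp: A1_def)
      have A0: "has_property_D k n A0" "A0 \<subseteq> {1..n}" using A by (auto simp: has_property_D_def A0_def Suc_le_eq)
      have fA0: "finite A0" using A0(2) by (rule finite_subset) simp
      have sX: "sqrt X = exp (h x / 2)"
        unfolding X_def by (rule real_sqrt_unique) (simp_all add: power2_eq_square exp_add[symmetric])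
      have "48 * sqrt X * exp x = exp (ln 48 + h x / 2 + x)" unfolding sX exp_add by simp
      also have "\<dots> \<le> exp (l x - (ln (l x)) ^ 3 + (j x - 1))" using el(1) by (simp only: exp_le_cancel_iff)
      finally have W1: "48 * sqrt X * exp x \<le> exp (l x - (ln (l x)) ^ 3 + (j x - 1))" .
      have "sqrt (real k) \<le> exp (Y / 8)"
      proof (rule real_le_lsqrt)
        have "real k = exp (ln (real k))" using k0 by simp
        also have "\<dots> \<le> exp (Y / 4)" using lnk_le by simp
        also have "\<dots> = exp (Y / 8) ^ 2" by (simp add: power2_eq_square exp_add[symmetric])
        finally show "real k \<le> exp (Y / 8) ^ 2" .
      qed simp
      then have "4 * sqrt (real k) * exp x \<le> 4 * exp (Y / 8) * exp x" by (intro mult_right_mono mult_left_mono) auto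
      also have "\<dots> = exp (ln 4 + Y / 8 + x)" unfolding exp_add by simp
      also have "\<dots> \<le> exp (l x - (ln (l x)) ^ 3 + (j x - 1))" using el(2) unfolding Y_def by (simp only: exp_le_cancel_iff)
      finally have W2: "4 * sqrt (real k) * exp x \<le> exp (l x - (ln (l x)) ^ 3 + (j x - 1))" .
      have "24 * sqrt X * ln (real n) + 2 * sqrt (real k) * ln (real n)
          \<le> (\<Sum>p | p \<in> {p::nat. prime p \<and> real p \<le> X} \<and> gcd (p - 1) k \<ge> 2. sqrt (real (gcd (p - 1) k)))"
        using W1 W2 W unfolding n Q_def by linarith
      moreover have "X \<ge> 2" unfolding X_def using exp_ge_add_one_self[of "h x"] el(12) by linarith
      ultimately have "real (card A0) * exp x \<le> X * ln X"
        using card_small_elements_le[OF A0 n2 k0] unfolding n by blast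
      also have "\<dots> = exp (h x + ln (h x))" unfolding X_def exp_add using el(12) by simp
      also have "\<dots> \<le> exp (2 * x - j x / 2)" using el(3) by (simp only: exp_le_cancel_iff)
      also have "2 * x - j x / 2 = (x - j x / 2) + x" by simp
      also have "exp \<dots> = exp (x - j x / 2) * exp x" by (rule exp_add)
      finally have c0: "real (card A0) \<le> exp (x - j x / 2)" by simp
      have "A = A0 \<union> A1" by (auto simp: A0_def A1_def)
      then have "finite A" "card A \<le> card A0 + card A1" using fA0 A1 by (auto simp: card_Un_le)
      moreover have "j x / 2 = x powr (1 / 4) / (64 * ln x)" by (simp add: j_def)
      ultimately show ?thesis using c0 A1(2) el(11) by simp
    qed
    then show ?case using k42 lnk_le lnk_ge unfolding Y_def by (intro exI[of _ k]) auto
  qed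
qed

theorem theorem1p2:
  shows "\<exists>(c::real) > 0. \<exists>k :: nat \<Rightarrow> nat.
    (\<forall>n. k n \<ge> 2) \<and>
    (\<lambda>n. ln (real (k n))) \<in> \<Theta>(\<lambda>n. sqrt (ln (ln (real n)))) \<and>
    (\<exists>(C::real) > 0. \<forall>\<^sub>F n in sequentially.
       ereal_of_enat (M (k n) n) \<le>
         ereal (C * (exp (- (c * ln (ln (real n)) powr (1/4) / ln (ln (ln (real n)))))
                     * ln (real n))))"
proof -
  define good where "good x k \<longleftrightarrow> k \<ge> 2 \<and> sqrt x / 16 \<le> ln (real k) \<and> ln (real k) \<le> sqrt x / 4 \<and>
     (\<forall>n A. ln (real n) = exp x \<longrightarrow> has_property_D k n A \<longrightarrow>
        finite A \<and> real (card A) \<le> 2 * exp (x - x powr (1 / 4) / (64 * ln x)))" for x :: real and k :: nat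
  \<comment> \<open>The default \<open>2\<close> covers the finitely many \<open>n\<close> without a
    good exponent, among them those for which the iterated logarithm has only a conventional
    value.\<close>
  define k where "k n = (if \<exists>k. good (ln (ln (real n))) k then SOME k. good (ln (ln (real n))) k else 2)" for n :: nat
  have k_good: "good (ln (ln (real n))) (k n)" if "\<exists>k. good (ln (ln (real n))) k" for n
    unfolding k_def using that by (simp add: someI_ex)
  have lim: "filterlim (\<lambda>n. ln (ln (real n))) at_top sequentially" by real_asymp
  have ev: "eventually (\<lambda>n. good (ln (ln (real n))) (k n)) sequentially"
    using eventually_compose_filterlim[OF eventually_good_exponent lim]
    by eventually_elim (rule k_good, simp add: good_def)
  have k2: "k n \<ge> 2" for n
  proof (cases "\<exists>k. good (ln (ln (real n))) k")
    case True
    then show ?thesis using k_good[of n] by (simp add: good_def)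
  qed (simp add: k_def)
  have pos: "eventually (\<lambda>n. ln (ln (real n)) > 0) sequentially" by real_asymp
  have pos2: "eventually (\<lambda>n. ln (real n) > 0) sequentially" by real_asymp
  have theta: "(\<lambda>n. ln (real (k n))) \<in> \<Theta>(\<lambda>n. sqrt (ln (ln (real n))))"
  proof (rule bigthetaI)
    show "(\<lambda>n. ln (real (k n))) \<in> O(\<lambda>n. sqrt (ln (ln (real n))))"
      by (rule bigoI[of _ "1 / 4"], use ev pos in eventually_elim) (use k2 in \<open>auto simp: good_def abs_if\<close>)
    show "(\<lambda>n. ln (real (k n))) \<in> \<Omega>(\<lambda>n. sqrt (ln (ln (real n))))"
      by (rule landau_omega.bigI[of "1 / 16"], simp, use ev pos in eventually_elim) (auto simp: good_def abs_if)
  qed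
  have bound: "eventually (\<lambda>n. ereal_of_enat (M (k n) n) \<le>
         ereal (2 * (exp (- (1 / 64 * ln (ln (real n)) powr (1/4) / ln (ln (ln (real n)))))
                     * ln (real n)))) sequentially"
    using ev pos2
  proof eventually_elim
    case (elim n)
    define x where "x = ln (ln (real n))"
    have ex: "exp x = ln (real n)" using elim(2) by (simp add: x_def)
    define r where "r = 2 * exp (x - x powr (1 / 4) / (64 * ln x))"
    have r: "r = 2 * (exp (- (1 / 64 * x powr (1/4) / ln x)) * ln (real n))"
      unfolding r_def ex[symmetric] exp_add[symmetric] by simp
    \<comment> \<open>The supremum is taken in \<open>enat\<close>. A bound by the integer part of
      \<open>r\<close> holds for each set, finiteness being part of \<open>good\<close>, and so
      passes to the supremum.\<close>
    have "M (k n) n \<le> enat (nat \<lfloor>r\<rfloor>)"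
      unfolding M_def
    proof (rule SUP_least)
      fix A assume "A \<in> {A. has_property_D (k n) n A}"
      then have A: "finite A" "real (card A) \<le> r"
        using elim(1) ex unfolding good_def x_def[symmetric] r_def by auto
      then show "set_size A \<le> enat (nat \<lfloor>r\<rfloor>)" by (simp add: set_size_def le_nat_floor)
    qed
    then have "ereal_of_enat (M (k n) n) \<le> ereal_of_enat (enat (nat \<lfloor>r\<rfloor>))" by (simp only: ereal_of_enat_le_iff)
    also have "\<dots> \<le> ereal r"
      using of_nat_floor[of r] by (simp add: r_def)
    finally show ?case unfolding r x_def .
  qed
  show ?thesis
    by (rule exI[of _ "1 / 64"], intro conjI, simp, rule exI[of _ k], intro conjI allI k2 theta, rule exI[of _ 2], intro conjI, simp, rule bound)
qed

end
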